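(* Let $r\ge 0$ and let $f,g:A\to B$ be two morphisms of derived $A_\infty$-algebras, with corresponding coalgebra morphisms $F,G:\overline TSA\to\overline TSB$ in $\underline{bgMod_R}$. Then $h:A\to P_r(B)$ being an $r$-homotopy from $f$ to $g$ (that is, a morphism of derived $A_\infty$-algebras $A\to P_r(B)$ with $\partial^-_B\circ h=f$ and $\partial^+_B\circ h=g$) is equivalent to the following two conditions on $K:=c(\pi,H):\overline TSA\to\overline TSB$, where $H:\overline TSA\to\overline TSP_r(B)$ is the coalgebra morphism in $\underline{bgMod_R}$ corresponding to $h$: (i) $K\in\underline{bgMod_R}(\overline TSA,\overline TSB)_r^{r-1}$ is a $(G,F)$-coderivation, i.e. $c(G\widehat\otimes K+K\widehat\otimes F,\underline\Delta)=c(\underline\Delta,K)$; explicitly, for all $i\ge0$, $\bigl(\sum_j(-1)^jG_j\otimes K_{i-j}+\sum_jK_j\otimes F_{i-j}\bigr)\Delta=\Delta K_i$; (ii) $(-1)^rc(d^B,K)+c(K,d^A)=\mathbb S^r(G-F)$.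
   Context: $R$ is a commutative ring with unit. Bigraded modules $A=\{A_i^j\}$ are $(\mathbb Z,\mathbb Z)$-bigraded $R$-modules; a map of bidegree $(p,q)$ sends $A_i^j$ to $A_{i+p}^{j+q}$; the total degree of bidegree $(i,j)$ is $|\cdot|=j-i$; $\langle(x_1,x_2),(y_1,y_2)\rangle=x_1y_1+x_2y_2$; Koszul rule $(f\otimes g)(a\otimes c)=(-1)^{\langle g,a\rangle}f(a)\otimes g(c)$. Derived $A_\infty$-algebras: bigraded modules $A$ with maps $m_{ij}:A^{\otimes j}\to A$, $i\ge0,j\ge1$, of bidegree $(-i,2-i-j)$ such that for all $u\ge0,v\ge1$, $\sum_{u=i+p,\ v=j+q-1,\ j=1+s+t}(-1)^{sq+t+pj}m_{ij}(1^{\otimes s}\otimes m_{pq}\otimes1^{\otimes t})=0$. Morphisms $f:A\to B$: families $f_{ij}:A^{\otimes j}\to B$, $i\ge0,j\ge1$, of bidegree $(-i,1-i-j)$ with, for all $u\ge0,v\ge1$, $$\sum_{u=i+p,\ v=j+q-1,\ j=1+s+t}(-1)^{sq+t+pj}f_{ij}(1^{\otimes s}\otimes m^A_{pq}\otimes1^{\otimes t})=\sum_{u=i+p_1+\cdots+p_j,\ v=q_1+\cdots+q_j}(-1)^{\sigma}m^B_{ij}(f_{p_1q_1}\otimes\cdots\otimes f_{p_jq_j}),$$ $\sigma=u+\sum_{t=1}^j\bigl((p_t+q_t)(j+t)+q_t\sum_{w=t+1}^j(p_w+q_w)\bigr)$. The $r$-path $P_r(B)$ of $(B,m_{ij})$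 is the derived $A_\infty$-algebra $P_r(B)_i^j=B_i^j\oplus B_{i+r}^{j+r-1}\oplus B_i^j$ with $M_{r1}(x,y,z)=(m_{r1}x,-x-m_{r1}y+z,m_{r1}z)$, $M_{i1}(x,y,z)=(m_{i1}x,(-1)^{i+r+1}m_{i1}y,m_{i1}z)$ for $i\ne r$, and for $j\ge2$, $M_{ij}=\mathrm{diag}(m_{ij},(-1)^{rj+i+j}m_{ij},m_{ij})\circ t_j$, where $t_n:P_r(B)^{\otimes n}\to P_r(B^{\otimes n})$ is $$t_n\bigl(\textstyle\bigotimes_k(x_k,y_k,z_k)\bigr)=\bigl(x_1\otimes\cdots\otimes x_n,\ \sum_{1\le j\le n}\overline x_1\otimes\cdots\otimes\overline x_{j-1}\otimes y_j\otimes z_{j+1}\otimes\cdots\otimes z_n,\ z_1\otimes\cdots\otimes z_n\bigr),$$ $\overline x=(-1)^{rx_1+(1-r)x_2}x$ for $x$ of bidegree $(x_1,x_2)$. The projections $\partial^-_B,\partial_B^0,\partial_B^+:P_r(B)\to B$ are $(x,y,z)\mapsto x,y,z$ respectively, of bidegrees $(0,0),(r,r-1),(0,0)$. The equations $\partial^-_B\circ h=f$, $\partial^+_B\circ h=g$ mean $\partial^-_Bh_{ij}=f_{ij}$, $\partial^+_Bh_{ij}=g_{ij}$ for all $i,j$. $\underline{bgMod_R}$ is the enriched category of bigraded modules in which $\underline{bgMod_R}(A,B)_u^v$ is the set of sequences $f=(f_0,f_1,\dots)$ with $f_i:A\to B$ of bidegree $(u-i,v-i)$, $|f|=v-u$,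 and composition is $c(f,g)_m=\sum_{i+j=m}(-1)^{i|g|}f_ig_j$. The symbol $\widehat\otimes$ is the enriched tensor product of morphisms; in the cases needed here, $(G\widehat\otimes K)_i=\sum_j(-1)^jG_j\otimes K_{i-j}$, $(K\widehat\otimes F)_i=\sum_jK_j\otimes F_{i-j}$ and $(F\widehat\otimes F)_i=\sum_jF_j\otimes F_{i-j}$. The shift is $(\mathbb S^rf)_n=f_{n-r}$ for $n\ge r$ and $0$ for $n<r$. Suspension: $S(A)_i^j=A_i^{j+1}$, and $\sigma_A:SA\to A$ is the induced isomorphism of bidegree $(0,1)$. For $f:A^{\otimes k}\to B$ of bidegree $(u,v)$, $\Psi_k(f):=(-1)^{v+k-1}\sigma_B^{-1}f\sigma_A^{\otimes k}:(SA)^{\otimes k}\to SB$. $\overline TV=\bigoplus_{n\ge1}V^{\otimes n}$ is the reduced tensor coalgebra with deconcatenation comultiplication $\Delta$, and $\underline\Delta=(\Delta,0,0,\dots)$. $d^A=(d_i^A)_{i\ge0}\in\underline{bgMod_R}(\overline TSA,\overline TSA)_0^1$ is the square-zero coderivation encoding the structure of $A$: $d_i^A=\sum_{s,j,t}1^{\otimes s}\otimes\Psi_j(m^A_{ij})\otimes1^{\otimes t}$; similarly $d^B$. A family $f=(f_{ij})$ of maps $f_{ij}:A^{\otimes j}\to B$ of bidegree $(-i,1-i-j)$ corresponds to the coalgebra morphism $F=(F_p)_{p\ge0}\in\underline{bgMod_R}(\overline TSA,\overline TSB)_0^0$ (i.e. $c(F\widehat\otimes F,\underline\Delta)=c(\underline\Delta,F)$)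 for which the component $(SA)^{\otimes q}\to(SB)^{\otimes l}$ of $F_p$ is $\sum_{p_1+\cdots+p_l=p,\ q_1+\cdots+q_l=q}\Psi_{q_1}(f_{p_1q_1})\otimes\cdots\otimes\Psi_{q_l}(f_{p_lq_l})$; likewise $G$ from $g$ and $H$ from $h=(h_{ij})$, $h_{ij}:A^{\otimes j}\to P_r(B)$. $\pi\in\underline{bgMod_R}(\overline TSP_r(B),\overline TSB)$ is the strict element (only the index-$0$ term is nonzero) $\sum_{s,t\ge0}\pi_L^{\otimes s}\otimes\pi_M\otimes\pi_R^{\otimes t}$, where $\pi_L=\sigma^{-1}\partial_B^-\sigma$, $\pi_M=(-1)^{r-1}\sigma^{-1}\partial_B^0\sigma$ and $\pi_R=\sigma^{-1}\partial_B^+\sigma$ are the maps $SP_r(B)\to SB$ corresponding to $\partial_B^-,\partial_B^0,\partial_B^+$.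
   Formalization: Condition (i) is proved with F and G exchanged, c(F⊗̂K+K⊗̂G,Δ)=c(Δ,K), as the printed (G,F) form fails for K=c(π,H); and ∂⁻h=f, ∂⁺h=g is assumed of the family h throughout, since (i) and (ii) do not determine the end points of h. *)

theory Defs
  imports "HOL-Algebra.Module" "HOL-Algebra.AbelCoset" "HOL-Library.Product_Plus"
begin

section \<open>Bigraded modules and homogeneous maps\<close>

type_synonym bideg = "int \<times> int"

text \<open>\<open>V (i, j)\<close> is the component with lower index \<open>i\<close> and upper index \<open>j\<close>.\<close>

type_synonym ('r, 'a) bgmod = "bideg \<Rightarrow> ('r, 'a) module"

definition bgmodule :: "'r ring \<Rightarrow> ('r, 'a) bgmod \<Rightarrow> bool" where
  "bgmodule R V \<longleftrightarrow> (\<forall>d. module R (V d))"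

definition bipair :: "bideg \<Rightarrow> bideg \<Rightarrow> int" where
  "bipair x y = fst x * fst y + snd x * snd y"

definition tdeg :: "bideg \<Rightarrow> int" where
  "tdeg d = snd d - fst d"

definition sg :: "('r, 'a) module \<Rightarrow> int \<Rightarrow> 'a \<Rightarrow> 'a" where
  "sg M k x = (if even k then x else \<ominus>\<^bsub>M\<^esub> x)"

definition linear_maps :: "'r ring \<Rightarrow> ('r, 'a) module \<Rightarrow> ('r, 'b) module \<Rightarrow> ('a \<Rightarrow> 'b) set" where
  "linear_maps R M N = {f \<in> carrier M \<rightarrow> carrier N.
     (\<forall>x\<in>carrier M. \<forall>y\<in>carrier M. f (x \<oplus>\<^bsub>M\<^esub> y) = f x \<oplus>\<^bsub>N\<^esub> f y) \<and>
     (\<forall>c\<in>carrier R. \<forall>x\<in>carrier M. f (c \<odot>\<^bsub>M\<^esub> x) = c \<odot>\<^bsub>N\<^esub> f x)}"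

text \<open>A homogeneous map carries its bidegree; \<open>bgapp f d\<close> is the component of \<open>f\<close> on the
  summand of bidegree \<open>d\<close>, with values in bidegree \<open>d + bdeg f\<close>.\<close>

record ('a, 'b) bgmap =
  bdeg :: bideg
  bgapp :: "bideg \<Rightarrow> 'a \<Rightarrow> 'b"

definition bghom :: "'r ring \<Rightarrow> ('r, 'a) bgmod \<Rightarrow> ('r, 'b) bgmod \<Rightarrow> bideg \<Rightarrow> ('a, 'b) bgmap set" where
  "bghom R V W e = {f. bdeg f = e \<and> (\<forall>d. bgapp f d \<in> linear_maps R (V d) (W (d + e)))}"

definition bg_eq :: "('r, 'a) bgmod \<Rightarrow> ('a, 'b) bgmap \<Rightarrow> ('a, 'b) bgmap \<Rightarrow> bool" where
  "bg_eq V f g \<longleftrightarrow> bdeg f = bdeg g \<and> (\<forall>d. \<forall>x\<in>carrier (V d). bgapp f d x = bgapp g d x)"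

definition bgid :: "('a, 'a) bgmap" where
  "bgid = \<lparr>bdeg = 0, bgapp = (\<lambda>d x. x)\<rparr>"

definition bgzero :: "('r, 'b) bgmod \<Rightarrow> bideg \<Rightarrow> ('a, 'b) bgmap" where
  "bgzero W e = \<lparr>bdeg = e, bgapp = (\<lambda>d x. \<zero>\<^bsub>W (d + e)\<^esub>)\<rparr>"

definition bgcomp :: "('b, 'c) bgmap \<Rightarrow> ('a, 'b) bgmap \<Rightarrow> ('a, 'c) bgmap" where
  "bgcomp g f = \<lparr>bdeg = bdeg g + bdeg f, bgapp = (\<lambda>d x. bgapp g (d + bdeg f) (bgapp f d x))\<rparr>"

definition bgsgn :: "('r, 'b) bgmod \<Rightarrow> int \<Rightarrow> ('a, 'b) bgmap \<Rightarrow> ('a, 'b) bgmap" where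
  "bgsgn W k f = \<lparr>bdeg = bdeg f, bgapp = (\<lambda>d x. sg (W (d + bdeg f)) k (bgapp f d x))\<rparr>"

definition bgadd :: "('r, 'b) bgmod \<Rightarrow> ('a, 'b) bgmap \<Rightarrow> ('a, 'b) bgmap \<Rightarrow> ('a, 'b) bgmap" where
  "bgadd W f g =
     \<lparr>bdeg = bdeg f, bgapp = (\<lambda>d x. bgapp f d x \<oplus>\<^bsub>W (d + bdeg f)\<^esub> bgapp g d x)\<rparr>"

text \<open>The sum of the maps \<open>(-1)^(k s) f s\<close>, all of bidegree \<open>e\<close>, over a finite set \<open>S\<close>.\<close>

definition bgsum :: "('r, 'b) bgmod \<Rightarrow> bideg \<Rightarrow> ('s \<Rightarrow> int) \<Rightarrow> ('s \<Rightarrow> ('a, 'b) bgmap) \<Rightarrow> 's set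
    \<Rightarrow> ('a, 'b) bgmap" where
  "bgsum W e k f S =
     \<lparr>bdeg = e, bgapp = (\<lambda>d x. finsum (W (d + e)) (\<lambda>s. sg (W (d + e)) (k s) (bgapp (f s) d x)) S)\<rparr>"

section \<open>Tensor powers\<close>

definition free_mod :: "'r ring \<Rightarrow> 'w set \<Rightarrow> ('r, 'w \<Rightarrow> 'r) module" where
  "free_mod R W =
     \<lparr>carrier = {x. (\<forall>w. x w \<in> carrier R) \<and> finite {w. x w \<noteq> \<zero>\<^bsub>R\<^esub>} \<and> (\<forall>w. w \<notin> W \<longrightarrow> x w = \<zero>\<^bsub>R\<^esub>)},
      mult = undefined, one = undefined, zero = (\<lambda>w. \<zero>\<^bsub>R\<^esub>),
      add = (\<lambda>x y w. x w \<oplus>\<^bsub>R\<^esub> y w), smult = (\<lambda>c x w. c \<otimes>\<^bsub>R\<^esub> x w)\<rparr>"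

definition basis_vec :: "'r ring \<Rightarrow> 'w \<Rightarrow> 'w \<Rightarrow> 'r" where
  "basis_vec R w = (\<lambda>v. if v = w then \<one>\<^bsub>R\<^esub> else \<zero>\<^bsub>R\<^esub>)"

definition submod_span :: "'r ring \<Rightarrow> ('r, 'a) module \<Rightarrow> 'a set \<Rightarrow> 'a set" where
  "submod_span R M S = \<Inter>{N. submodule N R M \<and> S \<subseteq> N}"

definition quot_mod :: "('r, 'a) module \<Rightarrow> 'a set \<Rightarrow> ('r, 'a set) module" where
  "quot_mod M N =
     \<lparr>carrier = a_rcosets\<^bsub>M\<^esub> N, mult = undefined, one = undefined, zero = N,
      add = (\<lambda>X Y. X <+>\<^bsub>M\<^esub> Y), smult = (\<lambda>c X. \<Union>x\<in>X. N +>\<^bsub>M\<^esub> (c \<odot>\<^bsub>M\<^esub> x))\<rparr>"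

text \<open>\<open>V\<^sup>\<otimes>\<^sup>n\<close> in bidegree \<open>d\<close> is the free module on the words of \<open>n\<close> homogeneous elements of
  total bidegree \<open>d\<close>, each letter labelled with its bidegree, modulo multilinearity.\<close>

type_synonym 'a word = "(bideg \<times> 'a) list"
type_synonym ('r, 'a) tens = "('a word \<Rightarrow> 'r) set"

definition wdeg :: "'a word \<Rightarrow> bideg" where
  "wdeg w = sum_list (map fst w)"

definition words :: "('r, 'a) bgmod \<Rightarrow> nat \<Rightarrow> bideg \<Rightarrow> 'a word set" where
  "words V n d = {w. length w = n \<and> wdeg w = d \<and> (\<forall>(e, a)\<in>set w. a \<in> carrier (V e))}"

definition multilin_rels :: "'r ring \<Rightarrow> ('r, 'a) bgmod \<Rightarrow> nat \<Rightarrow> bideg \<Rightarrow> ('a word \<Rightarrow> 'r) set" where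
  "multilin_rels R V n d = (let M = free_mod R (words V n d) in
     {basis_vec R (u @ (e, a \<oplus>\<^bsub>V e\<^esub> b) # v)
        \<ominus>\<^bsub>M\<^esub> (basis_vec R (u @ (e, a) # v) \<oplus>\<^bsub>M\<^esub> basis_vec R (u @ (e, b) # v)) | u e a b v.
        u @ (e, a) # v \<in> words V n d \<and> b \<in> carrier (V e)} \<union>
     {basis_vec R (u @ (e, c \<odot>\<^bsub>V e\<^esub> a) # v) \<ominus>\<^bsub>M\<^esub> (c \<odot>\<^bsub>M\<^esub> basis_vec R (u @ (e, a) # v)) | u e a c v.
        u @ (e, a) # v \<in> words V n d \<and> c \<in> carrier R})"

definition tpow_ker :: "'r ring \<Rightarrow> ('r, 'a) bgmod \<Rightarrow> nat \<Rightarrow> bideg \<Rightarrow> ('a word \<Rightarrow> 'r) set" where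
  "tpow_ker R V n d = submod_span R (free_mod R (words V n d)) (multilin_rels R V n d)"

definition tpow :: "'r ring \<Rightarrow> ('r, 'a) bgmod \<Rightarrow> nat \<Rightarrow> ('r, ('r, 'a) tens) bgmod" where
  "tpow R V n = (\<lambda>d. quot_mod (free_mod R (words V n d)) (tpow_ker R V n d))"

definition tens :: "'r ring \<Rightarrow> ('r, 'a) bgmod \<Rightarrow> 'a word \<Rightarrow> ('r, 'a) tens" where
  "tens R V w = tpow_ker R V (length w) (wdeg w)
     +>\<^bsub>free_mod R (words V (length w) (wdeg w))\<^esub> basis_vec R w"

text \<open>For multilinear \<open>\<phi>\<close> this is the linear map on the tensor power with values \<open>\<phi> w\<close> on the
  elementary tensors \<open>tens R V w\<close>; it is then independent of the representative chosen.\<close>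

definition tlift :: "'r ring \<Rightarrow> ('r, 'c) module \<Rightarrow> ('a word \<Rightarrow> 'c) \<Rightarrow> ('r, 'a) tens \<Rightarrow> 'c" where
  "tlift R M \<phi> X = (let x = (SOME x. x \<in> X) in
     finsum M (\<lambda>w. x w \<odot>\<^bsub>M\<^esub> \<phi> w) {w. x w \<noteq> \<zero>\<^bsub>R\<^esub>})"

text \<open>A map on \<open>V\<close>, regarded as a map on \<open>V\<^sup>\<otimes>\<^sup>1\<close>.\<close>

definition unary :: "'r ring \<Rightarrow> ('r, 'b) bgmod \<Rightarrow> ('a, 'b) bgmap \<Rightarrow> (('r, 'a) tens, 'b) bgmap" where
  "unary R W f = \<lparr>bdeg = bdeg f, bgapp = (\<lambda>d. tlift R (W (d + bdeg f))
     (\<lambda>w. bgapp f (fst (hd w)) (snd (hd w))))\<rparr>"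

fun blocks :: "nat list \<Rightarrow> 'x list \<Rightarrow> 'x list list" where
  "blocks [] w = []"
| "blocks (q # qs) w = take q w # blocks qs (drop q w)"

text \<open>For a list of pairs \<open>(q\<^sub>k, f\<^sub>k)\<close> with \<open>f\<^sub>k : V\<^sup>\<otimes>\<^sup>q\<^sup>k \<rightarrow> W\<close>, the map
  \<open>f\<^sub>1 \<otimes> \<dots> \<otimes> f\<^sub>l : V\<^sup>\<otimes>\<^sup>q \<rightarrow> W\<^sup>\<otimes>\<^sup>l\<close>, \<open>q\<close> being the sum of the \<open>q\<^sub>k\<close>. By the Koszul rule each
  \<open>f\<^sub>k\<close> moves past the arguments of all \<open>f\<^sub>j\<close> with \<open>j < k\<close>.\<close>

definition btens_sign :: "(nat \<times> (('r, 'a) tens, 'b) bgmap) list \<Rightarrow> 'a word \<Rightarrow> int" where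
  "btens_sign fs w =
     (\<Sum>k<length fs. \<Sum>j<k. bipair (bdeg (snd (fs ! k))) (wdeg (blocks (map fst fs) w ! j)))"

definition btens_word :: "'r ring \<Rightarrow> ('r, 'a) bgmod \<Rightarrow> (nat \<times> (('r, 'a) tens, 'b) bgmap) list
    \<Rightarrow> 'a word \<Rightarrow> 'b word" where
  "btens_word R V fs w =
     map2 (\<lambda>(q, f) b. (wdeg b + bdeg f, bgapp f (wdeg b) (tens R V b))) fs (blocks (map fst fs) w)"

definition btens :: "'r ring \<Rightarrow> ('r, 'a) bgmod \<Rightarrow> ('r, 'b) bgmod \<Rightarrow>
    (nat \<times> (('r, 'a) tens, 'b) bgmap) list \<Rightarrow> (('r, 'a) tens, ('r, 'b) tens) bgmap" where
  "btens R V W fs = (let e = sum_list (map (\<lambda>(q, f). bdeg f) fs) in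
     \<lparr>bdeg = e, bgapp = (\<lambda>d. let M = tpow R W (length fs) (d + e) in
        tlift R M (\<lambda>w. sg M (btens_sign fs w) (tens R W (btens_word R V fs w))))\<rparr>)"

definition tmaps :: "'r ring \<Rightarrow> ('r, 'a) bgmod \<Rightarrow> ('r, 'b) bgmod \<Rightarrow> ('a, 'b) bgmap list \<Rightarrow>
    (('r, 'a) tens, ('r, 'b) tens) bgmap" where
  "tmaps R V W fs = btens R V W (map (\<lambda>f. (1, unary R W f)) fs)"

text \<open>\<open>1\<^sup>\<otimes>\<^sup>s \<otimes> f \<otimes> 1\<^sup>\<otimes>\<^sup>t\<close> for \<open>f : V\<^sup>\<otimes>\<^sup>q \<rightarrow> V\<close>.\<close>

definition insert_op :: "'r ring \<Rightarrow> ('r, 'a) bgmod \<Rightarrow> nat \<Rightarrow> nat \<Rightarrow> (('r, 'a) tens, 'a) bgmap \<Rightarrow> nat \<Rightarrow>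
    (('r, 'a) tens, ('r, 'a) tens) bgmap" where
  "insert_op R V s q f t =
     btens R V V (replicate s (1, unary R V bgid) @ (q, f) # replicate t (1, unary R V bgid))"

section \<open>Derived A-infinity algebras and their morphisms\<close>

type_synonym ('r, 'a, 'b) opfam = "nat \<Rightarrow> nat \<Rightarrow> (('r, 'a) tens, 'b) bgmap"

definition insertion_sum :: "'r ring \<Rightarrow> ('r, 'a) bgmod \<Rightarrow> ('r, 'b) bgmod \<Rightarrow> bideg \<Rightarrow>
    ('r, 'a, 'b) opfam \<Rightarrow> ('r, 'a, 'a) opfam \<Rightarrow> nat \<Rightarrow> nat \<Rightarrow> (('r, 'a) tens, 'b) bgmap" where
  "insertion_sum R A B e f m u v =
     bgsum B e (\<lambda>(i, p, j, q, s, t). int (s * q + t + p * j))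
       (\<lambda>(i, p, j, q, s, t). bgcomp (f i j) (insert_op R A s q (m p q) t))
       {(i, p, j, q, s, t). u = i + p \<and> v + 1 = j + q \<and> j = 1 + s + t \<and> 1 \<le> q}"

definition derived_Ainf :: "'r ring \<Rightarrow> ('r, 'a) bgmod \<Rightarrow> ('r, 'a, 'a) opfam \<Rightarrow> bool" where
  "derived_Ainf R A m \<longleftrightarrow> bgmodule R A \<and>
     (\<forall>i j. 1 \<le> j \<longrightarrow> m i j \<in> bghom R (tpow R A j) A (- int i, 2 - int i - int j)) \<and>
     (\<forall>u v. 1 \<le> v \<longrightarrow>
        bg_eq (tpow R A v) (insertion_sum R A A (- int u, 3 - int u - int v) m m u v)
          (bgzero A (- int u, 3 - int u - int v)))"

definition morphism_sign :: "nat \<Rightarrow> nat \<Rightarrow> nat list \<Rightarrow> nat list \<Rightarrow> nat" where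
  "morphism_sign u j ps qs = u + (\<Sum>t=1..j. (ps ! (t - 1) + qs ! (t - 1)) * (j + t)
     + qs ! (t - 1) * (\<Sum>w=t+1..j. ps ! (w - 1) + qs ! (w - 1)))"

definition block_sum :: "'r ring \<Rightarrow> ('r, 'a) bgmod \<Rightarrow> ('r, 'b) bgmod \<Rightarrow> bideg \<Rightarrow>
    ('r, 'b, 'b) opfam \<Rightarrow> ('r, 'a, 'b) opfam \<Rightarrow> nat \<Rightarrow> nat \<Rightarrow> (('r, 'a) tens, 'b) bgmap" where
  "block_sum R A B e m f u v =
     bgsum B e (\<lambda>(i, j, ps, qs). int (morphism_sign u j ps qs))
       (\<lambda>(i, j, ps, qs). bgcomp (m i j) (btens R A B (map2 (\<lambda>p q. (q, f p q)) ps qs)))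
       {(i, j, ps, qs). 1 \<le> j \<and> length ps = j \<and> length qs = j \<and> (\<forall>q\<in>set qs. 1 \<le> q) \<and>
          u = i + sum_list ps \<and> v = sum_list qs}"

definition map_family :: "'r ring \<Rightarrow> ('r, 'a) bgmod \<Rightarrow> ('r, 'b) bgmod \<Rightarrow> ('r, 'a, 'b) opfam \<Rightarrow> bool" where
  "map_family R A B f \<longleftrightarrow>
     (\<forall>i j. 1 \<le> j \<longrightarrow> f i j \<in> bghom R (tpow R A j) B (- int i, 1 - int i - int j))"

definition dAinf_morphism :: "'r ring \<Rightarrow> ('r, 'a) bgmod \<Rightarrow> ('r, 'a, 'a) opfam \<Rightarrow>
    ('r, 'b) bgmod \<Rightarrow> ('r, 'b, 'b) opfam \<Rightarrow> ('r, 'a, 'b) opfam \<Rightarrow> bool" where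
  "dAinf_morphism R A mA B mB f \<longleftrightarrow> map_family R A B f \<and>
     (\<forall>u v. 1 \<le> v \<longrightarrow>
        bg_eq (tpow R A v) (insertion_sum R A B (- int u, 2 - int u - int v) f mA u v)
          (block_sum R A B (- int u, 2 - int u - int v) mB f u v))"

section \<open>The path object and homotopies\<close>

definition triple_sum :: "('r, 'a) module \<Rightarrow> ('r, 'b) module \<Rightarrow> ('r, 'c) module \<Rightarrow>
    ('r, 'a \<times> 'b \<times> 'c) module" where
  "triple_sum L M N =
     \<lparr>carrier = carrier L \<times> carrier M \<times> carrier N, mult = undefined, one = undefined,
      zero = (\<zero>\<^bsub>L\<^esub>, \<zero>\<^bsub>M\<^esub>, \<zero>\<^bsub>N\<^esub>),
      add = (\<lambda>(x, y, z) (x', y', z'). (x \<oplus>\<^bsub>L\<^esub> x', y \<oplus>\<^bsub>M\<^esub> y', z \<oplus>\<^bsub>N\<^esub> z')),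
      smult = (\<lambda>c (x, y, z). (c \<odot>\<^bsub>L\<^esub> x, c \<odot>\<^bsub>M\<^esub> y, c \<odot>\<^bsub>N\<^esub> z))\<rparr>"

definition rshift :: "nat \<Rightarrow> bideg" where
  "rshift r = (int r, int r - 1)"

definition path :: "nat \<Rightarrow> ('r, 'b) bgmod \<Rightarrow> ('r, 'b \<times> 'b \<times> 'b) bgmod" where
  "path r B = (\<lambda>d. triple_sum (B d) (B (d + rshift r)) (B d))"

text \<open>The map \<open>t\<^sub>n\<close>, from the \<open>n\<close>-th tensor power of the path object of \<open>B\<close> to the path object
  of the \<open>n\<close>-th tensor power of \<open>B\<close>.\<close>

definition path_t :: "'r ring \<Rightarrow> nat \<Rightarrow> ('r, 'b) bgmod \<Rightarrow> nat \<Rightarrow>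
    (('r, 'b \<times> 'b \<times> 'b) tens, ('r, 'b) tens \<times> ('r, 'b) tens \<times> ('r, 'b) tens) bgmap" where
  "path_t R r B n = \<lparr>bdeg = 0, bgapp = (\<lambda>d. tlift R (path r (tpow R B n) d)
     (\<lambda>w. (tens R B (map (\<lambda>(e, x, y, z). (e, x)) w),
           finsum (tpow R B n (d + rshift r))
             (\<lambda>j. tens R B
                (map (\<lambda>(e, x, y, z). (e, sg (B e) (int r * fst e + (1 - int r) * snd e) x)) (take j w)
                 @ (case w ! j of (e, x, y, z) \<Rightarrow> (e + rshift r, y))
                 # map (\<lambda>(e, x, y, z). (e, z)) (drop (Suc j) w)))
             {..<n},
           tens R B (map (\<lambda>(e, x, y, z). (e, z)) w))))\<rparr>"

definition path_diag :: "nat \<Rightarrow> ('a, 'b) bgmap \<Rightarrow> ('a, 'b) bgmap \<Rightarrow> ('a, 'b) bgmap \<Rightarrow>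
    ('a \<times> 'a \<times> 'a, 'b \<times> 'b \<times> 'b) bgmap" where
  "path_diag r f g h = \<lparr>bdeg = bdeg f,
     bgapp = (\<lambda>d (x, y, z). (bgapp f d x, bgapp g (d + rshift r) y, bgapp h d z))\<rparr>"

definition path_op1 :: "'r ring \<Rightarrow> nat \<Rightarrow> ('r, 'b) bgmod \<Rightarrow> ('r, 'b, 'b) opfam \<Rightarrow> nat \<Rightarrow>
    ('b \<times> 'b \<times> 'b, 'b \<times> 'b \<times> 'b) bgmap" where
  "path_op1 R r B m i = (let m1 = (\<lambda>d x. bgapp (m i 1) d (tens R B [(d, x)])) in
     \<lparr>bdeg = (- int i, 1 - int i),
      bgapp = (\<lambda>d (x, y, z).
        (m1 d x,
         if i = r then (\<ominus>\<^bsub>B d\<^esub> x \<ominus>\<^bsub>B d\<^esub> m1 (d + rshift r) y) \<oplus>\<^bsub>B d\<^esub> z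
         else sg (B (d + rshift r + (- int i, 1 - int i))) (int (i + r + 1)) (m1 (d + rshift r) y),
         m1 d z))\<rparr>)"

definition path_op :: "'r ring \<Rightarrow> nat \<Rightarrow> ('r, 'b) bgmod \<Rightarrow> ('r, 'b, 'b) opfam \<Rightarrow>
    ('r, 'b \<times> 'b \<times> 'b, 'b \<times> 'b \<times> 'b) opfam" where
  "path_op R r B m i j =
     (if j = 1 then unary R (path r B) (path_op1 R r B m i)
      else bgcomp (path_diag r (m i j) (bgsgn B (int (r * j + i + j)) (m i j)) (m i j))
             (path_t R r B j))"

definition end_minus :: "('b \<times> 'b \<times> 'b, 'b) bgmap" where
  "end_minus = \<lparr>bdeg = 0, bgapp = (\<lambda>d (x, y, z). x)\<rparr>"

definition end_zero :: "nat \<Rightarrow> ('b \<times> 'b \<times> 'b, 'b) bgmap" where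
  "end_zero r = \<lparr>bdeg = rshift r, bgapp = (\<lambda>d (x, y, z). y)\<rparr>"

definition end_plus :: "('b \<times> 'b \<times> 'b, 'b) bgmap" where
  "end_plus = \<lparr>bdeg = 0, bgapp = (\<lambda>d (x, y, z). z)\<rparr>"

definition has_endpoints :: "'r ring \<Rightarrow> ('r, 'a) bgmod \<Rightarrow> ('r, 'a, 'b) opfam \<Rightarrow> ('r, 'a, 'b) opfam \<Rightarrow>
    ('r, 'a, 'b \<times> 'b \<times> 'b) opfam \<Rightarrow> bool" where
  "has_endpoints R A f g h \<longleftrightarrow>
     (\<forall>i j. 1 \<le> j \<longrightarrow> bg_eq (tpow R A j) (bgcomp end_minus (h i j)) (f i j) \<and>
                      bg_eq (tpow R A j) (bgcomp end_plus (h i j)) (g i j))"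

definition r_homotopy :: "'r ring \<Rightarrow> nat \<Rightarrow> ('r, 'a) bgmod \<Rightarrow> ('r, 'a, 'a) opfam \<Rightarrow>
    ('r, 'b) bgmod \<Rightarrow> ('r, 'b, 'b) opfam \<Rightarrow> ('r, 'a, 'b) opfam \<Rightarrow> ('r, 'a, 'b) opfam \<Rightarrow>
    ('r, 'a, 'b \<times> 'b \<times> 'b) opfam \<Rightarrow> bool" where
  "r_homotopy R r A mA B mB f g h \<longleftrightarrow>
     dAinf_morphism R A mA (path r B) (path_op R r B mB) h \<and> has_endpoints R A f g h"

section \<open>The enriched category of bigraded modules\<close>

type_synonym ('a, 'b) eseq = "nat \<Rightarrow> ('a, 'b) bgmap"

definition ehom :: "'r ring \<Rightarrow> ('r, 'a) bgmod \<Rightarrow> ('r, 'b) bgmod \<Rightarrow> int \<Rightarrow> int \<Rightarrow> ('a, 'b) eseq set" where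
  "ehom R V W u v = {f. \<forall>i. f i \<in> bghom R V W (u - int i, v - int i)}"

text \<open>The bidegree \<open>(u, v)\<close> of a sequence is that of its term of index \<open>0\<close>.\<close>

definition edeg :: "('a, 'b) eseq \<Rightarrow> bideg" where
  "edeg f = bdeg (f 0)"

definition eq_seq :: "('r, 'a) bgmod \<Rightarrow> ('a, 'b) eseq \<Rightarrow> ('a, 'b) eseq \<Rightarrow> bool" where
  "eq_seq V f g \<longleftrightarrow> (\<forall>i. bg_eq V (f i) (g i))"

definition ecomp :: "('r, 'c) bgmod \<Rightarrow> ('b, 'c) eseq \<Rightarrow> ('a, 'b) eseq \<Rightarrow> ('a, 'c) eseq" where
  "ecomp W f g m = bgsum W (edeg f + edeg g - (int m, int m)) (\<lambda>i. int i * tdeg (edeg g))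
     (\<lambda>i. bgcomp (f i) (g (m - i))) {..m}"

text \<open>The enriched tensor product of \<open>f\<close> and \<open>g\<close>; its sign \<open>(-1)^(j |g|)\<close> is trivial for
  \<open>|g| = 0\<close>.\<close>

definition etens :: "'r ring \<Rightarrow> ('r, 'a) bgmod \<Rightarrow> ('r, 'b) bgmod \<Rightarrow> ('a, 'b) eseq \<Rightarrow> ('a, 'b) eseq \<Rightarrow>
    (('r, 'a) tens, ('r, 'b) tens) eseq" where
  "etens R V W f g m = bgsum (tpow R W 2) (edeg f + edeg g - (int m, int m))
     (\<lambda>j. int j * tdeg (edeg g)) (\<lambda>j. tmaps R V W [f j, g (m - j)]) {..m}"

definition eadd :: "('r, 'b) bgmod \<Rightarrow> ('a, 'b) eseq \<Rightarrow> ('a, 'b) eseq \<Rightarrow> ('a, 'b) eseq" where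
  "eadd W f g i = bgadd W (f i) (g i)"

definition esgn :: "('r, 'b) bgmod \<Rightarrow> int \<Rightarrow> ('a, 'b) eseq \<Rightarrow> ('a, 'b) eseq" where
  "esgn W k f i = bgsgn W k (f i)"

definition eshift :: "('r, 'b) bgmod \<Rightarrow> nat \<Rightarrow> ('a, 'b) eseq \<Rightarrow> ('a, 'b) eseq" where
  "eshift W r f n =
     (if r \<le> n then f (n - r) else bgzero W (edeg f + (int r - int n, int r - int n)))"

definition strict :: "('r, 'b) bgmod \<Rightarrow> ('a, 'b) bgmap \<Rightarrow> ('a, 'b) eseq" where
  "strict W f n = (if n = 0 then f else bgzero W (bdeg f - (int n, int n)))"

section \<open>Suspension and reduced tensor coalgebras\<close>

text \<open>An element of \<open>susp V d\<close> is an element of \<open>V (d + (0, 1))\<close>, so the suspension isomorphism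
  is the identity on underlying elements.\<close>

definition susp :: "('r, 'a) bgmod \<Rightarrow> ('r, 'a) bgmod" where
  "susp V = (\<lambda>d. V (d + (0, 1)))"

definition desusp_map :: "('a, 'a) bgmap" where
  "desusp_map = \<lparr>bdeg = (0, 1), bgapp = (\<lambda>d x. x)\<rparr>"

definition susp_map :: "('a, 'a) bgmap" where
  "susp_map = \<lparr>bdeg = (0, -1), bgapp = (\<lambda>d x. x)\<rparr>"

text \<open>In \<open>Psi\<close>, the map \<open>desusp_map\<close> is \<open>\<sigma>\<close> and \<open>susp_map\<close> is its inverse.\<close>

definition Psi :: "'r ring \<Rightarrow> ('r, 'a) bgmod \<Rightarrow> ('r, 'b) bgmod \<Rightarrow> nat \<Rightarrow> (('r, 'a) tens, 'b) bgmap \<Rightarrow>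
    (('r, 'a) tens, 'b) bgmap" where
  "Psi R V W k f = bgsgn (susp W) (snd (bdeg f) + int k - 1)
     (bgcomp susp_map (bgcomp f (tmaps R (susp V) V (replicate k desusp_map))))"

definition direct_sum :: "'i set \<Rightarrow> ('i \<Rightarrow> ('r, 'a) module) \<Rightarrow> ('r, 'i \<Rightarrow> 'a) module" where
  "direct_sum I M =
     \<lparr>carrier = {x \<in> Pi\<^sub>E I (\<lambda>i. carrier (M i)). finite {i \<in> I. x i \<noteq> \<zero>\<^bsub>M i\<^esub>}},
      mult = undefined, one = undefined, zero = (\<lambda>i\<in>I. \<zero>\<^bsub>M i\<^esub>),
      add = (\<lambda>x y. \<lambda>i\<in>I. x i \<oplus>\<^bsub>M i\<^esub> y i), smult = (\<lambda>c x. \<lambda>i\<in>I. c \<odot>\<^bsub>M i\<^esub> x i)\<rparr>"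

type_synonym ('r, 'a) tcoalg = "nat \<Rightarrow> ('r, 'a) tens"

definition Tbar :: "'r ring \<Rightarrow> ('r, 'a) bgmod \<Rightarrow> ('r, ('r, 'a) tcoalg) bgmod" where
  "Tbar R V = (\<lambda>d. direct_sum {1..} (\<lambda>n. tpow R V n d))"

definition Tincl :: "'r ring \<Rightarrow> ('r, 'a) bgmod \<Rightarrow> 'a word \<Rightarrow> ('r, 'a) tcoalg" where
  "Tincl R V w =
     (\<lambda>n\<in>{1..}. if n = length w then tens R V w else \<zero>\<^bsub>tpow R V n (wdeg w)\<^esub>)"

text \<open>The map out of the direct sum with restriction \<open>\<phi> n\<close> to the \<open>n\<close>-th tensor power.\<close>

definition from_T :: "'r ring \<Rightarrow> ('r, 'a) bgmod \<Rightarrow> ('r, 'c) bgmod \<Rightarrow> bideg \<Rightarrow>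
    (nat \<Rightarrow> bideg \<Rightarrow> ('r, 'a) tens \<Rightarrow> 'c) \<Rightarrow> (('r, 'a) tcoalg, 'c) bgmap" where
  "from_T R V W e \<phi> = \<lparr>bdeg = e, bgapp = (\<lambda>d x. finsum (W (d + e)) (\<lambda>n. \<phi> n d (x n))
     {n. 1 \<le> n \<and> x n \<noteq> \<zero>\<^bsub>tpow R V n d\<^esub>})\<rparr>"

text \<open>The map with components \<open>\<phi> q l\<close> from the \<open>q\<close>-th to the \<open>l\<close>-th tensor power; for each \<open>q\<close>
  only finitely many of them may be nonzero.\<close>

definition T_matrix :: "'r ring \<Rightarrow> ('r, 'a) bgmod \<Rightarrow> ('r, 'b) bgmod \<Rightarrow> bideg \<Rightarrow>
    (nat \<Rightarrow> nat \<Rightarrow> (('r, 'a) tens, ('r, 'b) tens) bgmap) \<Rightarrow>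
    (('r, 'a) tcoalg, ('r, 'b) tcoalg) bgmap" where
  "T_matrix R V W e \<phi> = from_T R V (Tbar R W) e (\<lambda>q d X. \<lambda>l\<in>{1..}. bgapp (\<phi> q l) d X)"

text \<open>Here \<open>Tbar R V \<otimes> Tbar R V\<close> is the second tensor power of the bigraded module \<open>Tbar R V\<close>.\<close>

definition deconc :: "'r ring \<Rightarrow> ('r, 'a) bgmod \<Rightarrow>
    (('r, 'a) tcoalg, ('r, ('r, 'a) tcoalg) tens) bgmap" where
  "deconc R V = from_T R V (tpow R (Tbar R V) 2) 0 (\<lambda>n d. tlift R (tpow R (Tbar R V) 2 d)
     (\<lambda>w. finsum (tpow R (Tbar R V) 2 d)
        (\<lambda>k. tens R (Tbar R V)
           [(wdeg (take k w), Tincl R V (take k w)), (wdeg (drop k w), Tincl R V (drop k w))])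
        {1..<n}))"

definition codiff :: "'r ring \<Rightarrow> ('r, 'a) bgmod \<Rightarrow> ('r, 'a, 'a) opfam \<Rightarrow>
    (('r, 'a) tcoalg, ('r, 'a) tcoalg) eseq" where
  "codiff R A m i = T_matrix R (susp A) (susp A) (- int i, 1 - int i)
     (\<lambda>q l. bgsum (tpow R (susp A) l) (- int i, 1 - int i) (\<lambda>_. 0)
        (\<lambda>(s, j, t). insert_op R (susp A) s j (Psi R A A j (m i j)) t)
        {(s, j, t). s + 1 + t = l \<and> s + j + t = q \<and> 1 \<le> j})"

definition coalg_map :: "'r ring \<Rightarrow> ('r, 'a) bgmod \<Rightarrow> ('r, 'b) bgmod \<Rightarrow> ('r, 'a, 'b) opfam \<Rightarrow>
    (('r, 'a) tcoalg, ('r, 'b) tcoalg) eseq" where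
  "coalg_map R A B f p = T_matrix R (susp A) (susp B) (- int p, - int p)
     (\<lambda>q l. bgsum (tpow R (susp B) l) (- int p, - int p) (\<lambda>_. 0)
        (\<lambda>(ps, qs). btens R (susp A) (susp B) (map2 (\<lambda>p q. (q, Psi R A B q (f p q))) ps qs))
        {(ps, qs). length ps = l \<and> length qs = l \<and> sum_list ps = p \<and> sum_list qs = q \<and>
           (\<forall>q\<in>set qs. 1 \<le> q)})"

definition path_pi :: "'r ring \<Rightarrow> nat \<Rightarrow> ('r, 'b) bgmod \<Rightarrow>
    (('r, 'b \<times> 'b \<times> 'b) tcoalg, ('r, 'b) tcoalg) eseq" where
  "path_pi R r B = (let
       pL = bgcomp susp_map (bgcomp end_minus desusp_map);
       pM = bgsgn (susp B) (int r - 1) (bgcomp susp_map (bgcomp (end_zero r) desusp_map));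
       pR = bgcomp susp_map (bgcomp end_plus desusp_map)
     in strict (Tbar R (susp B)) (T_matrix R (susp (path r B)) (susp B) (rshift r)
          (\<lambda>q l. bgsum (tpow R (susp B) l) (rshift r) (\<lambda>_. 0)
             (\<lambda>(s, t). tmaps R (susp (path r B)) (susp B) (replicate s pL @ pM # replicate t pR))
             {(s, t). s + 1 + t = l \<and> l = q})))"

text \<open>\<open>K\<close> is a coderivation of bidegree \<open>(u, v)\<close> with respect to the coalgebra morphism \<open>X\<close> on
  the left and \<open>Y\<close> on the right: \<open>c(X \<otimes> K + K \<otimes> Y, \<Delta>) = c(\<Delta>, K)\<close>.\<close>

definition coderivation :: "'r ring \<Rightarrow> ('r, 'a) bgmod \<Rightarrow> ('r, 'b) bgmod \<Rightarrow>
    (('r, 'a) tcoalg, ('r, 'b) tcoalg) eseq \<Rightarrow> (('r, 'a) tcoalg, ('r, 'b) tcoalg) eseq \<Rightarrow>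
    int \<Rightarrow> int \<Rightarrow> (('r, 'a) tcoalg, ('r, 'b) tcoalg) eseq \<Rightarrow> bool" where
  "coderivation R V W X Y u v K \<longleftrightarrow>
     K \<in> ehom R (Tbar R V) (Tbar R W) u v \<and>
     (let T2 = tpow R (Tbar R W) 2 in
      eq_seq (Tbar R V)
        (ecomp T2 (eadd T2 (etens R (Tbar R V) (Tbar R W) X K) (etens R (Tbar R V) (Tbar R W) K Y))
           (strict (tpow R (Tbar R V) 2) (deconc R V)))
        (ecomp T2 (strict T2 (deconc R W)) K))"

end

(* Operators on the reduced tensor coalgebras are represented by formal integral combinations of
   words of homogeneous elements, on which composition, the enriched tensor product and
   deconcatenation can be computed with signs but without quotients. On this formal level F, G and
   K are sums over decompositions of a word into consecutive blocks, and they are compatible with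
   deconcatenation by construction; this gives condition (i) for every family h with the
   prescribed endpoints. The defect (-1)^r d^B K + K d^A - S^r (G - F) is again compatible with
   deconcatenation, as f and g are morphisms, so a word of length at least two in its values is
   controlled by the values on shorter words, and the defect vanishes as soon as its one-letter
   components do. These components are, up to a global sign, the middle component of the morphism
   equation for h, and the two outer components are the equations for f and g. *)

theory Submission imports Defs "HOL-Library.Poly_Mapping" "HOL-Algebra.Free_Abelian_Groups"
begin

text \<open>Formal words satisfy no linear relations: neither multilinearity nor the morphism
  equations hold for them. Equality to zero is therefore replaced by membership in a two-sided ideal
  of the concatenation algebra, the sums that evaluate to zero in every tensor power, and words are
  restricted to those with letters in the right carriers. Being an ideal is what lets an induction
  on word length run: in each term obtained by cutting a word, one of the two concatenated factors
  already lies in it. Suspension is confined to signs. It affects a whole morphism equation by one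
  sign depending on the word alone, and the comparison is a parity identity proved one block at a
  time. The factor (-1)^(r-1) in pi_M is the sign that suspension gives to a map of bidegree (r,
  r-1), so the marked letter of K is the suspension of the middle component of h. The sign
  (-1)^(rj+i+j) in M_ij is what that parity count leaves over, and the summand z - x of M_r1 is the
  origin of the shifted difference of G and F.\<close>

declare split_paired_All [simp del] split_paired_Ex [simp del]

abbreviation "fkeys == Poly_Mapping.keys"
abbreviation "fext == frag_extend"
abbreviation "lmaps == linear_maps"
abbreviation "zr M == \<zero>\<^bsub>M\<^esub>"

section \<open>Linear algebra behind the definitions: quotients, tensor powers, direct sums\<close>

subsection \<open>Signs and linear maps\<close>

lemma module_abgrp: "module R M ==> abelian_group M" by (simp add: module_def)

lemma module_abmon: "module R M ==> abelian_monoid M" by (simp add: module_def abelian_group_def)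

lemma sg_closed: "module R M ==> x \<in> carrier M ==> sg M k x \<in> carrier M" by (simp add: sg_def module_def abelian_group.a_inv_closed)

lemma sg_zero: "module R M ==> sg M k (zr M) = (zr M)"
 unfolding sg_def a_inv_def by (metis module_abgrp abelian_group.a_group group.is_monoid monoid.inv_one monoid.select_convs(2))

lemma sg_add:
 assumes "module R M" "x \<in> carrier M" "y \<in> carrier M"
 shows "sg M k (x \<oplus>\<^bsub>M\<^esub> y) = sg M k x \<oplus>\<^bsub>M\<^esub> sg M k y"
proof -
 interpret abelian_group M using assms(1) by (rule module_abgrp)
 show ?thesis using assms(2,3) by (simp add: sg_def minus_add)
qed

lemma sg_smult:
 assumes "module R M" "x \<in> carrier M" "c \<in> carrier R"
 shows "sg M k (c \<odot>\<^bsub>M\<^esub> x) = c \<odot>\<^bsub>M\<^esub> sg M k x"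
proof -
 interpret module R M by fact
 show ?thesis using assms(2,3) by (simp add: sg_def smult_r_minus)
qed

lemma sg_sg:
 assumes "module R M" "x \<in> carrier M"
 shows "sg M k (sg M l x) = sg M (k + l) x"
proof -
 interpret abelian_group M using assms(1) by (rule module_abgrp)
 show ?thesis using assms(2) by (auto simp: sg_def minus_minus)
qed

lemma sg_cong: "even (k - l) ==> sg M k x = sg M l x" by (auto simp: sg_def)

lemma lin_closed: "f \<in> lmaps R M N ==> x \<in> carrier M ==> f x \<in> carrier N" by (auto simp: linear_maps_def)

lemma lin_add: "f \<in> lmaps R M N ==> x \<in> carrier M ==> y \<in> carrier M ==>
  f (x \<oplus>\<^bsub>M\<^esub> y) = f x \<oplus>\<^bsub>N\<^esub> f y"
 by (auto simp: linear_maps_def)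

lemma lin_smult: "f \<in> lmaps R M N ==> c \<in> carrier R ==> x \<in> carrier M ==>
  f (c \<odot>\<^bsub>M\<^esub> x) = c \<odot>\<^bsub>N\<^esub> f x"
 by (auto simp: linear_maps_def)

text \<open>\<open>linear_maps\<close> asks for additivity and homogeneity only; zero is preserved
  because it is a multiple of itself by the zero scalar.\<close>

lemma lin_zero:
 assumes "f \<in> lmaps R M N" "module R M" "module R N"
 shows "f (zr M) = (zr N)"
proof -
 interpret M: module R M by fact
 interpret N: module R N by fact
 have "f ((zr R) \<odot>\<^bsub>M\<^esub> (zr M)) = (zr R) \<odot>\<^bsub>N\<^esub> f (zr M)"
  by (rule lin_smult[OF assms(1)]) auto
 thus ?thesis using lin_closed[OF assms(1), of "zr M"] by simp
qed

lemma lin_minus: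
 assumes "f \<in> lmaps R M N" "module R M" "module R N" "x \<in> carrier M"
 shows "f (\<ominus>\<^bsub>M\<^esub> x) = \<ominus>\<^bsub>N\<^esub> f x"
proof -
 interpret M: module R M by fact
 interpret N: module R N by fact
 have fx: "f x \<in> carrier N" using assms by (blast intro: lin_closed)
 have "f (\<ominus>\<^bsub>M\<^esub> x) = f ((\<ominus>\<^bsub>R\<^esub> \<one>\<^bsub>R\<^esub>) \<odot>\<^bsub>M\<^esub> x)"
  using assms(4) by (simp add: M.smult_l_minus)
 also have "\<dots> = (\<ominus>\<^bsub>R\<^esub> \<one>\<^bsub>R\<^esub>) \<odot>\<^bsub>N\<^esub> f x" using assms by (intro lin_smult) auto
 also have "\<dots> = \<ominus>\<^bsub>N\<^esub> f x" using fx by (simp add: N.smult_l_minus)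
 finally show ?thesis .
qed

lemma lin_sg:
 assumes "f \<in> lmaps R M N" "module R M" "module R N" "x \<in> carrier M"
 shows "f (sg M k x) = sg N k (f x)"
 using lin_minus[OF assms] by (simp add: sg_def)

text \<open>Over an infinite index set both sides are zero, the default value of
  \<open>finsum\<close>, so one statement covers all index sets.\<close>

lemma lin_finsum:
 assumes f: "f \<in> lmaps R M N" and M: "module R M" and N: "module R N" and "g \<in> S \<rightarrow> carrier M"
 shows "f (finsum M g S) = finsum N (%s. f (g s)) S"
proof -
 interpret M: module R M by fact
 interpret N: module R N by fact
 show ?thesis using \<open>g \<in> S \<rightarrow> carrier M\<close>
 proof (induct S rule: infinite_finite_induct)
  case (infinite A)
  then show ?case by (simp add: finsum_def finprod_def lin_zero[OF f M N])
 next
  case empty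
  then show ?case by (simp add: lin_zero[OF f M N])
 next
  case (insert x F)
  hence "(%s. f (g s)) \<in> F \<rightarrow> carrier N" "f (g x) \<in> carrier N" using lin_closed[OF f] by auto
  with insert show ?case by (simp add: lin_add[OF f] Pi_def)
 qed
qed

lemma lin_comp: "f \<in> lmaps R M N ==> g \<in> lmaps R N P ==> (%x. g (f x)) \<in> lmaps R M P"
 by (auto simp: linear_maps_def Pi_def)

lemma lin_id: "(%x. x) \<in> lmaps R M M" by (auto simp: linear_maps_def)

lemma lin_sg_map:
 assumes "f \<in> lmaps R M N" "module R N"
 shows "(%x. sg N k (f x)) \<in> lmaps R M N"
 using assms sg_add[OF assms(2)] sg_closed[OF assms(2)] sg_smult[OF assms(2)] by (auto simp: linear_maps_def Pi_def)

lemma lin_zero_map: "module R N ==> (%x. (zr N)) \<in> lmaps R M N"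
proof -
 assume "module R N"
 then interpret N: module R N .
 show ?thesis by (auto simp: linear_maps_def)
qed

lemma lin_add_map:
 assumes f: "f \<in> lmaps R M N" and g: "g \<in> lmaps R M N" and N: "module R N"
 shows "(%x. f x \<oplus>\<^bsub>N\<^esub> g x) \<in> lmaps R M N"
proof -
 interpret N: module R N by fact
 show ?thesis using lin_closed[OF f] lin_closed[OF g] lin_add[OF f] lin_add[OF g] lin_smult[OF f] lin_smult[OF g]
  by (auto simp: linear_maps_def N.smult_r_distr N.a_ac)
qed

lemma lin_cong:
 assumes "f \<in> lmaps R M N" "module R M" "!!x. x \<in> carrier M ==> g x = f x"
 shows "g \<in> lmaps R M N"
proof -
 interpret M: module R M by fact
 show ?thesis using assms by (auto simp: linear_maps_def)
qed

lemma lin_finsum_map: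
 assumes f: "!!s. s \<in> S ==> f s \<in> lmaps R M N" and M: "module R M" and N: "module R N"
 shows "(%x. finsum N (%s. f s x) S) \<in> lmaps R M N"
proof -
 interpret N: module R N by fact
 show ?thesis using f
 proof (induct S rule: infinite_finite_induct)
  case (infinite A)
  then show ?case using lin_zero_map[OF N] by (simp add: finsum_def finprod_def)
 next
  case empty
  then show ?case using lin_zero_map[OF N] by simp
 next
  case (insert s F)
  have 1: "(%x. f s x \<oplus>\<^bsub>N\<^esub> finsum N (%s. f s x) F) \<in> lmaps R M N"
   using insert by (intro lin_add_map N) auto
  have 2: "finsum N (%s. f s x) (insert s F) = f s x \<oplus>\<^bsub>N\<^esub> finsum N (%s. f s x) F" if "x \<in> carrier M" for x
   using insert.hyps insert.prems[THEN lin_closed] that by (intro N.finsum_insert) auto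
  show ?case by (rule lin_cong[OF 1 M 2])
 qed
qed

subsection \<open>Free modules and quotients\<close>

lemma free_mod_simps: "(zr (free_mod R W)) = (%w. (zr R))"
 "x \<oplus>\<^bsub>free_mod R W\<^esub> y = (%w. x w \<oplus>\<^bsub>R\<^esub> y w)"
 "c \<odot>\<^bsub>free_mod R W\<^esub> x = (%w. c \<otimes>\<^bsub>R\<^esub> x w)"
 "x \<in> carrier (free_mod R W) \<longleftrightarrow>
  (\<forall>w. x w \<in> carrier R) \<and> finite {w. x w ~= (zr R)} \<and> (\<forall>w. w \<notin> W --> x w = (zr R))"
 by (auto simp: free_mod_def)

lemma free_mod_module:
 assumes "cring R" shows "module R (free_mod R W)"
proof -
 interpret cring R by fact
 have fin: "finite {w. x w \<oplus>\<^bsub>R\<^esub> y w ~= (zr R)}"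
  if "finite {w. x w ~= (zr R)}" "finite {w. y w ~= (zr R)}" for x y :: "'b => 'a"
  by (rule finite_subset[OF _ finite_UnI[OF that]]) auto
 have inv: "\<exists>y\<in>carrier (free_mod R W). y \<oplus>\<^bsub>free_mod R W\<^esub> x = (zr (free_mod R W))"
  if "x \<in> carrier (free_mod R W)" for x
 proof (rule bexI[where x = "%w. \<ominus>\<^bsub>R\<^esub> x w"])
  have "finite {w. \<ominus>\<^bsub>R\<^esub> x w ~= (zr R)}"
   using that by (auto simp: free_mod_simps intro: rev_finite_subset[of "{w. x w ~= (zr R)}"])
  then show "(%w. \<ominus>\<^bsub>R\<^esub> x w) \<in> carrier (free_mod R W)" using that by (auto simp: free_mod_simps)
 qed (use that in \<open>auto simp: free_mod_simps l_neg\<close>)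
 show ?thesis
 proof (rule moduleI[OF assms])
  show "abelian_group (free_mod R W)" by (rule abelian_groupI) (use inv in \<open>auto simp: free_mod_simps fin a_ac fun_eq_iff\<close>)
  show "a \<odot>\<^bsub>free_mod R W\<^esub> x \<in> carrier (free_mod R W)" if "a \<in> carrier R" "x \<in> carrier (free_mod R W)" for a x
  proof -
   have "finite {w. a \<otimes>\<^bsub>R\<^esub> x w ~= (zr R)}"
    using that by (auto simp: free_mod_simps intro: rev_finite_subset[of "{w. x w ~= (zr R)}"])
   then show ?thesis using that by (auto simp: free_mod_simps)
  qed
 qed (auto simp: free_mod_simps l_distr r_distr m_assoc fun_eq_iff)
qed

lemma basis_vec_closed:
 assumes "cring R" "w \<in> W" shows "basis_vec R w \<in> carrier (free_mod R W)"
proof -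
 interpret cring R by fact
 have "finite {v. (if v = w then \<one>\<^bsub>R\<^esub> else (zr R)) ~= (zr R)}" by (rule finite_subset[of _ "{w}"]) auto
 then show ?thesis using assms(2) by (auto simp: free_mod_simps basis_vec_def)
qed

text \<open>Induction on a finite set containing the support: one basis vector is split off by
  resetting its coefficient to zero.\<close>

lemma free_mod_induct:
 assumes "cring R" and x: "x \<in> carrier (free_mod R W)" and z: "P (zr (free_mod R W))"
  and step: "!!x c w. x \<in> carrier (free_mod R W) ==> c \<in> carrier R ==> w \<in> W ==> P x ==>
   P (x \<oplus>\<^bsub>free_mod R W\<^esub> c \<odot>\<^bsub>free_mod R W\<^esub> basis_vec R w)"
 shows "P x"
proof -
 interpret cring R by fact
 have "\<forall>x. x \<in> carrier (free_mod R W) --> {w. x w ~= (zr R)} \<subseteq> F --> P x" if "finite F" for F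
  using that
 proof (induct F)
  case empty
  then show ?case using z by (auto simp: free_mod_simps)
 next
  case (insert w F)
  show ?case
  proof (intro allI impI)
   fix x assume x: "x \<in> carrier (free_mod R W)" and sub: "{w. x w ~= (zr R)} \<subseteq> insert w F"
   show "P x"
   proof (cases "x w = (zr R)")
    case True
    then show ?thesis using insert x sub by blast
   next
    case False
    let ?y = "x(w := (zr R))"
    have y: "?y \<in> carrier (free_mod R W)"
     using x by (auto simp: free_mod_simps intro: rev_finite_subset[of "{w. x w ~= (zr R)}"])
    have "{v. ?y v ~= (zr R)} \<subseteq> F" using sub by auto
    then have "P ?y" using insert.hyps(3) y by blast
    moreover have "x = ?y \<oplus>\<^bsub>free_mod R W\<^esub> x w \<odot>\<^bsub>free_mod R W\<^esub> basis_vec R w"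
     using x by (auto simp: free_mod_simps basis_vec_def fun_eq_iff)
    ultimately show ?thesis using step[OF y, of "x w" w] x False by (auto simp: free_mod_simps)
   qed
  qed
 qed
 then show ?thesis using x by (auto simp: free_mod_simps)
qed

text \<open>The finite sum in the body of \<open>tlift\<close>, taken apart from the choice of a
  representative made there.\<close>

definition free_lift :: "'r ring => ('r, 'c) module => ('w => 'c) => ('w => 'r) => 'c" where
 "free_lift R M \<phi> x = finsum M (%w. x w \<odot>\<^bsub>M\<^esub> \<phi> w) {w. x w ~= (zr R)}"

text \<open>The index set of the sum is the support and changes with the argument; linearity is read
  off after enlarging all supports to a common finite set, on which the extra terms are
  zero.\<close>

lemma free_lift_linear:
 assumes M: "module R M" and \<phi>: "\<phi> \<in> W \<rightarrow> carrier M"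
 shows "free_lift R M \<phi> \<in> lmaps R (free_mod R W) M"
proof -
 interpret module R M by fact
 have eq: "free_lift R M \<phi> x = finsum M (%w. x w \<odot>\<^bsub>M\<^esub> \<phi> w) F"
  if "x \<in> carrier (free_mod R W)" "finite F" "{w. x w ~= (zr R)} \<subseteq> F" "F \<subseteq> W" for x F
  unfolding free_lift_def by (rule M.add.finprod_mono_neutral_cong_left) (use that \<phi> in \<open>auto simp: free_mod_simps Pi_def\<close>)
 have car: "(%w. x w \<odot>\<^bsub>M\<^esub> \<phi> w) \<in> F \<rightarrow> carrier M"
  if "x \<in> carrier (free_mod R W)" "F \<subseteq> W" for x F
  using that \<phi> by (auto simp: free_mod_simps Pi_def)
 interpret FM: module R "free_mod R W" by (rule free_mod_module) (rule R.is_cring)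
 show ?thesis unfolding linear_maps_def
 proof (intro CollectI conjI ballI)
  show "free_lift R M \<phi> \<in> carrier (free_mod R W) \<rightarrow> carrier M"
  proof
   fix x assume x: "x \<in> carrier (free_mod R W)"
   show "free_lift R M \<phi> x \<in> carrier M" unfolding free_lift_def using x by (intro M.finsum_closed car[OF x]) (auto simp: free_mod_simps)
  qed
  fix x assume x: "x \<in> carrier (free_mod R W)"
  let ?S = "{w. x w ~= (zr R)}"
  have S: "finite ?S" "?S \<subseteq> W" using x by (auto simp: free_mod_simps)
  {
   fix y assume y: "y \<in> carrier (free_mod R W)"
   let ?T = "{w. y w ~= (zr R)}"
   have T: "finite ?T" "?T \<subseteq> W" using y by (auto simp: free_mod_simps)
   have xy: "x \<oplus>\<^bsub>free_mod R W\<^esub> y \<in> carrier (free_mod R W)" using x y by simp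
   have "free_lift R M \<phi> (x \<oplus>\<^bsub>free_mod R W\<^esub> y)
     = finsum M (%w. (x \<oplus>\<^bsub>free_mod R W\<^esub> y) w \<odot>\<^bsub>M\<^esub> \<phi> w) (?S \<union> ?T)"
    using S T xy by (intro eq) (auto simp: free_mod_simps)
   also have "\<dots> = finsum M (%w. x w \<odot>\<^bsub>M\<^esub> \<phi> w \<oplus>\<^bsub>M\<^esub> y w \<odot>\<^bsub>M\<^esub> \<phi> w) (?S \<union> ?T)"
   proof (rule M.finsum_cong'[OF refl])
    fix w assume w: "w \<in> ?S \<union> ?T"
    then have pw: "\<phi> w \<in> carrier M" using S T \<phi> by blast
    have "x w \<in> carrier R" "y w \<in> carrier R" using x y by (simp_all add: free_mod_simps)
    then show "(x \<oplus>\<^bsub>free_mod R W\<^esub> y) w \<odot>\<^bsub>M\<^esub> \<phi> w = x w \<odot>\<^bsub>M\<^esub> \<phi> w \<oplus>\<^bsub>M\<^esub> y w \<odot>\<^bsub>M\<^esub> \<phi> w"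
     using pw by (simp add: free_mod_simps(2) smult_l_distr)
   qed (use car[OF x, of "?S \<union> ?T"] car[OF y, of "?S \<union> ?T"] S T in \<open>simp add: Pi_def\<close>)
   also have "\<dots> = finsum M (%w. x w \<odot>\<^bsub>M\<^esub> \<phi> w) (?S \<union> ?T) \<oplus>\<^bsub>M\<^esub> finsum M (%w. y w \<odot>\<^bsub>M\<^esub> \<phi> w) (?S \<union> ?T)"
    using S T by (intro M.finsum_addf car x y) auto
   also have "\<dots> = free_lift R M \<phi> x \<oplus>\<^bsub>M\<^esub> free_lift R M \<phi> y"
    using eq[OF x, of "?S \<union> ?T"] eq[OF y, of "?S \<union> ?T"] S T by simp
   finally show "free_lift R M \<phi> (x \<oplus>\<^bsub>free_mod R W\<^esub> y) = free_lift R M \<phi> x \<oplus>\<^bsub>M\<^esub> free_lift R M \<phi> y" .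
  }
  fix c assume c: "c \<in> carrier R"
  have cx: "c \<odot>\<^bsub>free_mod R W\<^esub> x \<in> carrier (free_mod R W)" using x c by simp
  have "free_lift R M \<phi> (c \<odot>\<^bsub>free_mod R W\<^esub> x) = finsum M (%w. (c \<odot>\<^bsub>free_mod R W\<^esub> x) w \<odot>\<^bsub>M\<^esub> \<phi> w) ?S"
   using S cx c by (intro eq) (auto simp: free_mod_simps)
  also have "\<dots> = finsum M (%w. c \<odot>\<^bsub>M\<^esub> (x w \<odot>\<^bsub>M\<^esub> \<phi> w)) ?S"
  proof (rule M.finsum_cong'[OF refl])
   fix w assume w: "w \<in> ?S"
   then have pw: "\<phi> w \<in> carrier M" using S \<phi> by blast
   have "x w \<in> carrier R" using x by (simp add: free_mod_simps)
   then show "(c \<odot>\<^bsub>free_mod R W\<^esub> x) w \<odot>\<^bsub>M\<^esub> \<phi> w = c \<odot>\<^bsub>M\<^esub> (x w \<odot>\<^bsub>M\<^esub> \<phi> w)"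
    using pw c by (simp add: free_mod_simps(3) smult_assoc1)
  qed (use car[OF x, of ?S] S c in \<open>simp add: Pi_def\<close>)
  also have "\<dots> = c \<odot>\<^bsub>M\<^esub> finsum M (%w. x w \<odot>\<^bsub>M\<^esub> \<phi> w) ?S"
   using S c by (intro finsum_smult_ldistr[symmetric] car x) auto
  finally show "free_lift R M \<phi> (c \<odot>\<^bsub>free_mod R W\<^esub> x) = c \<odot>\<^bsub>M\<^esub> free_lift R M \<phi> x"
   by (simp add: free_lift_def)
 qed
qed

lemma free_lift_basis:
 assumes M: "module R M" and "\<phi> w \<in> carrier M"
 shows "free_lift R M \<phi> (basis_vec R w) = \<phi> w"
proof -
 interpret module R M by fact
 \<comment> \<open>In the zero ring \<open>basis_vec\<close> has empty support and its image is an
   empty sum; the value of \<phi> is then zero as well.\<close>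
 have one_zero: "\<phi> w = (zr M)" if "\<one>\<^bsub>R\<^esub> = (zr R)"
  using smult_one[OF assms(2)] assms(2) that by simp
 have "free_lift R M \<phi> (basis_vec R w) = finsum M (%v. basis_vec R w v \<odot>\<^bsub>M\<^esub> \<phi> v) {w}" unfolding free_lift_def
  by (rule M.add.finprod_mono_neutral_cong_left) (use assms one_zero in \<open>auto simp: basis_vec_def\<close>)
 then show ?thesis using assms by (simp add: basis_vec_def)
qed

text \<open>Since S lies in the carrier, the carrier is one of the intersected submodules, which
  keeps the intersection inside M.\<close>

lemma submod_span_submodule:
 assumes "module R M" "S \<subseteq> carrier M"
 shows "submodule (submod_span R M S) R M"
proof -
 interpret module R M by fact
 have ne: "submodule (carrier M) R M" by (rule carrier_is_submodule)
 have z: "(zr M) \<in> N" if "submodule N R M" for N using subgroup.one_closed[OF submodule.axioms(1)[OF that]] by simp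
 show ?thesis unfolding submod_span_def
 proof (rule submoduleI)
  show "\<Inter>{N. submodule N R M \<and> S \<subseteq> N} \<subseteq> carrier M" using ne assms(2) by blast
  show "(zr M) \<in> \<Inter>{N. submodule N R M \<and> S \<subseteq> N}" using z by blast
  show "\<ominus>\<^bsub>M\<^esub> a \<in> \<Inter>{N. submodule N R M \<and> S \<subseteq> N}" if "a \<in> \<Inter>{N. submodule N R M \<and> S \<subseteq> N}" for a
   using that by (simp add: submoduleE(3))
  show "a \<oplus>\<^bsub>M\<^esub> b \<in> \<Inter>{N. submodule N R M \<and> S \<subseteq> N}"
   if "a \<in> \<Inter>{N. submodule N R M \<and> S \<subseteq> N}" "b \<in> \<Inter>{N. submodule N R M \<and> S \<subseteq> N}" for a b
   using that by (simp add: submoduleE(5))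
  show "c \<odot>\<^bsub>M\<^esub> a \<in> \<Inter>{N. submodule N R M \<and> S \<subseteq> N}"
   if "c \<in> carrier R" "a \<in> \<Inter>{N. submodule N R M \<and> S \<subseteq> N}" for a c
   using that by (simp add: submoduleE(4))
 qed
qed

lemma submod_span_incl: "S \<subseteq> submod_span R M S" by (auto simp: submod_span_def)

lemma lin_kernel_submodule:
 assumes "f \<in> lmaps R M N" "module R M" "module R N"
 shows "submodule {x \<in> carrier M. f x = (zr N)} R M"
proof -
 interpret M: module R M by fact
 interpret N: module R N by fact
 show ?thesis by (rule M.submoduleI) (use assms in \<open>auto simp: lin_zero lin_minus lin_add lin_smult\<close>)
qed

lemma submod_span_kernel:
 assumes "f \<in> lmaps R M N" "module R M" "module R N" "S \<subseteq> carrier M"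
  and "!!x. x \<in> S ==> f x = (zr N)" "x \<in> submod_span R M S"
 shows "f x = (zr N)"
 using lin_kernel_submodule[OF assms(1-3)] assms(4-6) unfolding submod_span_def by blast

context
 fixes R :: "'r ring" and M :: "('r, 'a) module" and N
 assumes M: "module R M" and N: "submodule N R M"
begin

interpretation M: module R M by (rule M)

lemma quot_subgroup: "abelian_subgroup N M"
proof -
 have "subgroup N (add_monoid M)" using N by (rule submodule.axioms(1))
 then show ?thesis by (intro abelian_subgroupI3 additive_subgroup.intro M.abelian_group_axioms)
qed

interpretation N: abelian_subgroup N M by (rule quot_subgroup)

lemma quot_add: "x \<in> carrier M ==> y \<in> carrier M ==>
  (N +>\<^bsub>M\<^esub> x) \<oplus>\<^bsub>quot_mod M N\<^esub> (N +>\<^bsub>M\<^esub> y) = N +>\<^bsub>M\<^esub> (x \<oplus>\<^bsub>M\<^esub> y)"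
 by (simp add: quot_mod_def N.a_rcos_sum)

lemma coset_mem: "x \<in> carrier M ==> y \<in> N +>\<^bsub>M\<^esub> x \<longleftrightarrow> (\<exists>n\<in>N. y = n \<oplus>\<^bsub>M\<^esub> x)"
 by (auto simp: a_r_coset_def')

lemma coset_eqI: "x \<in> carrier M ==> n \<in> N ==> N +>\<^bsub>M\<^esub> (n \<oplus>\<^bsub>M\<^esub> x) = N +>\<^bsub>M\<^esub> x"
 by (rule N.a_repr_independence'[symmetric]) (auto simp: coset_mem)

text \<open>\<open>quot_mod\<close> defines the scalar action by a union over all representatives. N
  is stable under scalars, so the united cosets coincide and the union is a single coset.\<close>

lemma quot_smult:
 assumes "x \<in> carrier M" "c \<in> carrier R"
 shows "c \<odot>\<^bsub>quot_mod M N\<^esub> (N +>\<^bsub>M\<^esub> x) = N +>\<^bsub>M\<^esub> (c \<odot>\<^bsub>M\<^esub> x)"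
proof -
 have "N +>\<^bsub>M\<^esub> (c \<odot>\<^bsub>M\<^esub> y) = N +>\<^bsub>M\<^esub> (c \<odot>\<^bsub>M\<^esub> x)" if y: "y \<in> N +>\<^bsub>M\<^esub> x" for y
 proof -
  obtain n where n: "n \<in> N" "y = n \<oplus>\<^bsub>M\<^esub> x" using y assms by (auto simp: coset_mem)
  have nc: "n \<in> carrier M" using n N.a_subset by auto
  have "c \<odot>\<^bsub>M\<^esub> n \<in> N" using n assms N by (simp add: submodule.smult_closed)
  then show ?thesis using n nc assms by (simp add: M.smult_r_distr coset_eqI)
 qed
 then have eq: "\<forall>y\<in>N +>\<^bsub>M\<^esub> x. N +>\<^bsub>M\<^esub> (c \<odot>\<^bsub>M\<^esub> y) = N +>\<^bsub>M\<^esub> (c \<odot>\<^bsub>M\<^esub> x)" by blast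
 have ne: "x \<in> N +>\<^bsub>M\<^esub> x" using assms(1) by (rule N.a_rcos_self)
 have "(\<Union>y\<in>N +>\<^bsub>M\<^esub> x. N +>\<^bsub>M\<^esub> (c \<odot>\<^bsub>M\<^esub> y)) = N +>\<^bsub>M\<^esub> (c \<odot>\<^bsub>M\<^esub> x)"
  by (rule UN_constant_eq[OF ne eq])
 then show ?thesis unfolding quot_mod_def by (simp only: module.simps partial_object.simps)
qed

lemma quot_carrier: "carrier (quot_mod M N) = (%x. N +>\<^bsub>M\<^esub> x) ` carrier M" by (auto simp: quot_mod_def A_RCOSETS_def')

lemma quot_zero: "(zr (quot_mod M N)) = N +>\<^bsub>M\<^esub> (zr M)" using N.a_subset by (simp add: quot_mod_def)

lemma quot_module: "module R (quot_mod M N)"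
proof (rule moduleI[OF M.R.is_cring])
 have inv: "\<exists>y\<in>carrier (quot_mod M N). y \<oplus>\<^bsub>quot_mod M N\<^esub> x = (zr (quot_mod M N))"
  if x: "x \<in> carrier (quot_mod M N)" for x
 proof -
  obtain x' where x': "x' \<in> carrier M" "x = N +>\<^bsub>M\<^esub> x'" using x by (auto simp: quot_carrier)
  then show ?thesis
   by (intro bexI[where x = "N +>\<^bsub>M\<^esub> (\<ominus>\<^bsub>M\<^esub> x')"]) (auto simp: quot_add quot_zero quot_carrier M.l_neg)
 qed
 show "abelian_group (quot_mod M N)" by (rule abelian_groupI) (use inv in \<open>auto simp: quot_carrier quot_add quot_zero M.a_ac\<close>)
qed (auto simp: quot_carrier quot_add quot_smult M.smult_l_distr M.smult_r_distr M.smult_assoc1)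

lemma quot_proj_linear: "(%x. N +>\<^bsub>M\<^esub> x) \<in> lmaps R M (quot_mod M N)"
 by (auto simp: linear_maps_def quot_carrier quot_add quot_smult)

lemma quot_rel: "x \<in> N ==> N +>\<^bsub>M\<^esub> x = (zr (quot_mod M N))" using N.a_rcos_const by (simp add: quot_mod_def)

end

subsection \<open>Tensor powers\<close>


lemma bgD: "bgmodule R V ==> module R (V d)" by (simp add: bgmodule_def)

text \<open>Generation is phrased through arbitrary submodules because it is applied to equalizers
  of linear maps and to preimages of submodules, without computing a span.\<close>

definition spans :: "'r ring => ('r, 'a) module => 'a set => bool" where
 "spans R M B \<longleftrightarrow> (\<forall>N. submodule N R M --> B \<subseteq> N --> carrier M \<subseteq> N)"

lemma spans_lin_eq:
 assumes B: "spans R M B" "B \<subseteq> carrier M" and M: "module R M" and N: "module R N"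
  and f: "f \<in> lmaps R M N" and g: "g \<in> lmaps R M N" and "!!b. b \<in> B ==> f b = g b"
  and "x \<in> carrier M"
 shows "f x = g x"
proof -
 interpret M: module R M by (rule M)
 interpret N: module R N by (rule N)
 have "submodule {x \<in> carrier M. f x = g x} R M" by (rule M.submoduleI)
   (use lin_zero[OF f M N] lin_zero[OF g M N] lin_minus[OF f M N] lin_minus[OF g M N]
    lin_add[OF f] lin_add[OF g] lin_smult[OF f] lin_smult[OF g] in auto)
 then have "carrier M \<subseteq> {x \<in> carrier M. f x = g x}" using assms unfolding spans_def by blast
 then show ?thesis using assms(8) by blast
qed

lemma lin_preimage_submodule:
 assumes f: "f \<in> lmaps R M N" and M: "module R M" and N: "module R N" and S: "submodule S R N"
 shows "submodule {x \<in> carrier M. f x \<in> S} R M"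
proof -
 interpret M: module R M by (rule M)
 interpret N: module R N by (rule N)
 have z: "(zr N) \<in> S" using subgroup.one_closed[OF submodule.axioms(1)[OF S]] by simp
 show ?thesis by (rule M.submoduleI) (use z lin_zero[OF f M N] lin_minus[OF f M N] lin_add[OF f] lin_smult[OF f] N.submoduleE[OF S] in auto)
qed

text \<open>The two identities are those encoded by \<open>multilin_rels\<close>: the bidegree label
  of the varying letter stays fixed.\<close>

definition multilinear :: "'r ring => ('r, 'a) bgmod => nat => bideg => ('r, 'c) module => ('a word => 'c) => bool" where
 "multilinear R V n d M \<phi> \<longleftrightarrow> (\<forall>w\<in>words V n d. \<phi> w \<in> carrier M) \<and>
  (\<forall>u e a b v. u @ (e, a) # v \<in> words V n d --> b \<in> carrier (V e) -->
    \<phi> (u @ (e, a \<oplus>\<^bsub>V e\<^esub> b) # v) = \<phi> (u @ (e, a) # v) \<oplus>\<^bsub>M\<^esub> \<phi> (u @ (e, b) # v)) \<and>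
  (\<forall>u e a c v. u @ (e, a) # v \<in> words V n d --> c \<in> carrier R -->
    \<phi> (u @ (e, c \<odot>\<^bsub>V e\<^esub> a) # v) = c \<odot>\<^bsub>M\<^esub> \<phi> (u @ (e, a) # v))"

lemma multilinearI:
 assumes "!!w. w \<in> words V n d ==> \<phi> w \<in> carrier M"
  and "!!u e a b v. u @ (e, a) # v \<in> words V n d ==> b \<in> carrier (V e) ==>
    \<phi> (u @ (e, a \<oplus>\<^bsub>V e\<^esub> b) # v) = \<phi> (u @ (e, a) # v) \<oplus>\<^bsub>M\<^esub> \<phi> (u @ (e, b) # v)"
  and "!!u e a c v. u @ (e, a) # v \<in> words V n d ==> c \<in> carrier R ==>
    \<phi> (u @ (e, c \<odot>\<^bsub>V e\<^esub> a) # v) = c \<odot>\<^bsub>M\<^esub> \<phi> (u @ (e, a) # v)"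
 shows "multilinear R V n d M \<phi>"
 using assms unfolding multilinear_def by blast

lemma multilinearD:
 assumes "multilinear R V n d M \<phi>"
 shows "w \<in> words V n d ==> \<phi> w \<in> carrier M" and "u @ (e, a) # v \<in> words V n d ==> b \<in> carrier (V e) ==>
    \<phi> (u @ (e, a \<oplus>\<^bsub>V e\<^esub> b) # v) = \<phi> (u @ (e, a) # v) \<oplus>\<^bsub>M\<^esub> \<phi> (u @ (e, b) # v)"
  and "u @ (e, a) # v \<in> words V n d ==> c \<in> carrier R ==>
    \<phi> (u @ (e, c \<odot>\<^bsub>V e\<^esub> a) # v) = c \<odot>\<^bsub>M\<^esub> \<phi> (u @ (e, a) # v)"
 using assms unfolding multilinear_def by blast+

lemma wdeg_simps [simp]: "wdeg [] = 0" "wdeg (x # w) = fst x + wdeg w" "wdeg (u @ v) = wdeg u + wdeg v" by (auto simp: wdeg_def)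

definition valid :: "('r, 'a) bgmod => 'a word => bool" where
 "valid V w \<longleftrightarrow> (\<forall>x\<in>set w. snd x \<in> carrier (V (fst x)))"

lemma valid_simps [simp]: "valid V []" "valid V (x # w) \<longleftrightarrow> snd x \<in> carrier (V (fst x)) \<and> valid V w"
 "valid V (u @ v) \<longleftrightarrow> valid V u \<and> valid V v"
 by (auto simp: valid_def)

lemma valid_take_drop [simp]: "valid V w ==> valid V (take n w)" "valid V w ==> valid V (drop n w)"
 by (auto simp: valid_def dest: in_set_takeD in_set_dropD)

lemma words_iff: "w \<in> words V n d \<longleftrightarrow> length w = n \<and> wdeg w = d \<and> valid V w"
 by (auto simp: words_def valid_def case_prod_beta)

locale bgmods =
 fixes R :: "'r ring"
 assumes R: "cring R"
begin

lemma rels_closed: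
 assumes "bgmodule R V"
 shows "multilin_rels R V n d \<subseteq> carrier (free_mod R (words V n d))"
proof -
 interpret F: module R "free_mod R (words V n d)" by (rule free_mod_module[OF R])
 have V: "module R (V e)" for e using assms by (simp add: bgmodule_def)
 have add: "u @ (e, a \<oplus>\<^bsub>V e\<^esub> b) # v \<in> words V n d \<and> u @ (e, b) # v \<in> words V n d"
  if "u @ (e, a) # v \<in> words V n d" "b \<in> carrier (V e)" for u e a b v
  using that abelian_monoid.a_closed[OF module_abmon[OF V]] by (auto simp: words_iff)
 have smult: "u @ (e, c \<odot>\<^bsub>V e\<^esub> a) # v \<in> words V n d" if "u @ (e, a) # v \<in> words V n d" "c \<in> carrier R" for u e a c v
  using that module.smult_closed[OF V] by (auto simp: words_iff)
 show ?thesis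
 proof
  fix y assume "y \<in> multilin_rels R V n d"
  then consider u e a b v where "u @ (e, a) # v \<in> words V n d" "b \<in> carrier (V e)"
    "y = basis_vec R (u @ (e, a \<oplus>\<^bsub>V e\<^esub> b) # v) \<ominus>\<^bsub>free_mod R (words V n d)\<^esub>
     (basis_vec R (u @ (e, a) # v) \<oplus>\<^bsub>free_mod R (words V n d)\<^esub> basis_vec R (u @ (e, b) # v))"
   | u e a c v where "u @ (e, a) # v \<in> words V n d" "c \<in> carrier R"
    "y = basis_vec R (u @ (e, c \<odot>\<^bsub>V e\<^esub> a) # v) \<ominus>\<^bsub>free_mod R (words V n d)\<^esub>
     c \<odot>\<^bsub>free_mod R (words V n d)\<^esub> basis_vec R (u @ (e, a) # v)"
   unfolding multilin_rels_def Let_def by blast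
  then show "y \<in> carrier (free_mod R (words V n d))"
  proof cases
   case 1
   with add[OF 1(1,2)] show ?thesis by (simp add: basis_vec_closed[OF R])
  next
   case 2
   with smult[OF 2(1,2)] show ?thesis by (simp add: basis_vec_closed[OF R])
  qed
 qed
qed

lemma ker_submodule: "bgmodule R V ==> submodule (tpow_ker R V n d) R (free_mod R (words V n d))"
 unfolding tpow_ker_def by (rule submod_span_submodule[OF free_mod_module[OF R] rels_closed])

lemma tpow_mod: "bgmodule R V ==> module R (tpow R V n d)" unfolding tpow_def by (rule quot_module[OF free_mod_module[OF R] ker_submodule])

lemma tpow_bgmodule: "bgmodule R V ==> bgmodule R (tpow R V n)" by (simp add: bgmodule_def tpow_mod)

lemma tens_eq: "w \<in> words V n d ==> tens R V w = tpow_ker R V n d +>\<^bsub>free_mod R (words V n d)\<^esub> basis_vec R w"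
 by (auto simp: tens_def words_iff)

lemma tens_cl:
 assumes "bgmodule R V" "w \<in> words V n d"
 shows "tens R V w \<in> carrier (tpow R V n d)"
 using assms by (simp add: tens_eq tpow_def quot_carrier[OF free_mod_module[OF R] ker_submodule] basis_vec_closed[OF R])

lemma tens_multilinear:
 assumes V: "bgmodule R V"
 shows "multilinear R V n d (tpow R V n d) (tens R V)"
proof -
 let ?F = "free_mod R (words V n d)" and ?N = "tpow_ker R V n d"
 interpret F: module R ?F by (rule free_mod_module[OF R])
 interpret T: module R "tpow R V n d" by (rule tpow_mod[OF V])
 have Ve: "module R (V e)" for e using assms by (simp add: bgmodule_def)
 have p: "(%x. ?N +>\<^bsub>?F\<^esub> x) \<in> lmaps R ?F (tpow R V n d)"
  unfolding tpow_def by (rule quot_proj_linear[OF F.module_axioms ker_submodule[OF V]])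
 have rel: "?N +>\<^bsub>?F\<^esub> x = ?N +>\<^bsub>?F\<^esub> y"
  if "x \<ominus>\<^bsub>?F\<^esub> y \<in> multilin_rels R V n d" "x \<in> carrier ?F" "y \<in> carrier ?F" for x y
 proof -
  have "x \<ominus>\<^bsub>?F\<^esub> y \<in> ?N" unfolding tpow_ker_def by (rule subsetD[OF submod_span_incl that(1)])
  then have "?N +>\<^bsub>?F\<^esub> (x \<ominus>\<^bsub>?F\<^esub> y) = (zr (tpow R V n d))"
   unfolding tpow_def by (intro quot_rel[OF F.module_axioms ker_submodule[OF V]])
  then have "(?N +>\<^bsub>?F\<^esub> x) \<ominus>\<^bsub>tpow R V n d\<^esub> (?N +>\<^bsub>?F\<^esub> y) = (zr (tpow R V n d))"
   using that by (simp add: a_minus_def lin_add[OF p] lin_minus[OF p F.module_axioms T.module_axioms])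
  then have "\<ominus>\<^bsub>tpow R V n d\<^esub> (\<ominus>\<^bsub>tpow R V n d\<^esub> (?N +>\<^bsub>?F\<^esub> y)) = ?N +>\<^bsub>?F\<^esub> x"
   using that lin_closed[OF p] by (intro T.minus_equality) (simp_all add: a_minus_def)
  then show ?thesis using that lin_closed[OF p] by simp
 qed
 show ?thesis
 proof (rule multilinearI)
  show "w \<in> words V n d ==> tens R V w \<in> carrier (tpow R V n d)" for w by (rule tens_cl[OF V])
 next
  fix u e a b v assume w: "u @ (e, a) # v \<in> words V n d" and b: "b \<in> carrier (V e)"
  have w2: "u @ (e, a \<oplus>\<^bsub>V e\<^esub> b) # v \<in> words V n d" "u @ (e, b) # v \<in> words V n d"
   using w b abelian_monoid.a_closed[OF module_abmon[OF Ve]] by (auto simp: words_iff)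
  show "tens R V (u @ (e, a \<oplus>\<^bsub>V e\<^esub> b) # v)
    = tens R V (u @ (e, a) # v) \<oplus>\<^bsub>tpow R V n d\<^esub> tens R V (u @ (e, b) # v)"
  proof -
   have "basis_vec R (u @ (e, a \<oplus>\<^bsub>V e\<^esub> b) # v) \<ominus>\<^bsub>?F\<^esub>
     (basis_vec R (u @ (e, a) # v) \<oplus>\<^bsub>?F\<^esub> basis_vec R (u @ (e, b) # v)) \<in> multilin_rels R V n d"
    unfolding multilin_rels_def Let_def using w b by blast
   from rel[OF this] show ?thesis unfolding tens_eq[OF w] tens_eq[OF w2(1)] tens_eq[OF w2(2)]
    using basis_vec_closed[OF R w] basis_vec_closed[OF R w2(1)] basis_vec_closed[OF R w2(2)] by (simp add: lin_add[OF p])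
  qed
 next
  fix u e a c v assume w: "u @ (e, a) # v \<in> words V n d" and c: "c \<in> carrier R"
  have w2: "u @ (e, c \<odot>\<^bsub>V e\<^esub> a) # v \<in> words V n d" using w c module.smult_closed[OF Ve] by (auto simp: words_iff)
  show "tens R V (u @ (e, c \<odot>\<^bsub>V e\<^esub> a) # v) = c \<odot>\<^bsub>tpow R V n d\<^esub> tens R V (u @ (e, a) # v)"
  proof -
   have "basis_vec R (u @ (e, c \<odot>\<^bsub>V e\<^esub> a) # v) \<ominus>\<^bsub>?F\<^esub>
     c \<odot>\<^bsub>?F\<^esub> basis_vec R (u @ (e, a) # v) \<in> multilin_rels R V n d"
    unfolding multilin_rels_def Let_def using w c by blast
   from rel[OF this] show ?thesis unfolding tens_eq[OF w] tens_eq[OF w2] using basis_vec_closed[OF R w] basis_vec_closed[OF R w2] c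
    by (simp add: lin_smult[OF p])
  qed
 qed
qed

text \<open>\<open>tlift\<close> evaluates an arbitrary representative. Two representatives differ
  by an element of the span of the relations, and the linear extension of a multilinear \<phi> kills
  that span.\<close>

lemma tlift_coset:
 assumes V: "bgmodule R V" and M: "module R M" and \<phi>: "multilinear R V n d M \<phi>" and x: "x \<in> carrier (free_mod R (words V n d))"
 shows "tlift R M \<phi> (tpow_ker R V n d +>\<^bsub>free_mod R (words V n d)\<^esub> x) = free_lift R M \<phi> x"
proof -
 let ?F = "free_mod R (words V n d)" and ?N = "tpow_ker R V n d"
 interpret F: module R ?F by (rule free_mod_module[OF R])
 interpret M: module R M by (rule M)
 have Ve: "module R (V e)" for e using assms by (simp add: bgmodule_def)
 have L: "free_lift R M \<phi> \<in> lmaps R ?F M" using \<phi> by (intro free_lift_linear[OF M]) (auto simp: multilinear_def)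
 note lin = lin_add[OF L] lin_smult[OF L] lin_minus[OF L F.module_axioms M]
 have b: "free_lift R M \<phi> (basis_vec R w) = \<phi> w" "\<phi> w \<in> carrier M" if "w \<in> words V n d" for w
  using that \<phi> by (auto simp: multilinear_def intro: free_lift_basis[OF M])
 have zero: "free_lift R M \<phi> y = (zr M)" if "y \<in> multilin_rels R V n d" for y
  using that unfolding multilin_rels_def Let_def
 proof (elim UnE CollectE exE conjE)
  fix u e a b v assume w: "u @ (e, a) # v \<in> words V n d" and b': "b \<in> carrier (V e)"
   and y: "y = basis_vec R (u @ (e, a \<oplus>\<^bsub>V e\<^esub> b) # v) \<ominus>\<^bsub>?F\<^esub>
    (basis_vec R (u @ (e, a) # v) \<oplus>\<^bsub>?F\<^esub> basis_vec R (u @ (e, b) # v))"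
  have w2: "u @ (e, a \<oplus>\<^bsub>V e\<^esub> b) # v \<in> words V n d" "u @ (e, b) # v \<in> words V n d"
   using w b' abelian_monoid.a_closed[OF module_abmon[OF Ve]] by (auto simp: words_iff)
  show "free_lift R M \<phi> y = (zr M)"
  proof -
   note cl = basis_vec_closed[OF R w] basis_vec_closed[OF R w2(1)] basis_vec_closed[OF R w2(2)]
   have "basis_vec R (u @ (e, a) # v) \<oplus>\<^bsub>?F\<^esub> basis_vec R (u @ (e, b) # v) \<in> carrier ?F" using cl by simp
   then show ?thesis using cl b[OF w] b[OF w2(1)] b[OF w2(2)] multilinearD(2)[OF \<phi> w b']
    by (simp add: y a_minus_def lin M.r_neg del: F.minus_add)
  qed
 next
  fix u e a c v assume w: "u @ (e, a) # v \<in> words V n d" and c: "c \<in> carrier R"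
   and y: "y = basis_vec R (u @ (e, c \<odot>\<^bsub>V e\<^esub> a) # v) \<ominus>\<^bsub>?F\<^esub> c \<odot>\<^bsub>?F\<^esub> basis_vec R (u @ (e, a) # v)"
  have w2: "u @ (e, c \<odot>\<^bsub>V e\<^esub> a) # v \<in> words V n d" using w c module.smult_closed[OF Ve] by (auto simp: words_iff)
  show "free_lift R M \<phi> y = (zr M)"
  proof -
   note cl = basis_vec_closed[OF R w] basis_vec_closed[OF R w2]
   have "c \<odot>\<^bsub>?F\<^esub> basis_vec R (u @ (e, a) # v) \<in> carrier ?F" using cl c by simp
   then show ?thesis using cl c b[OF w] b[OF w2] multilinearD(3)[OF \<phi> w c] by (simp add: y a_minus_def lin M.r_neg)
  qed
 qed
 have ker: "free_lift R M \<phi> y = (zr M)" "y \<in> carrier ?F" if "y \<in> ?N" for y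
  using submod_span_kernel[OF L F.module_axioms M rels_closed[OF V] zero, of y] that
   F.submoduleE(1)[OF ker_submodule[OF V]] unfolding tpow_ker_def by auto
 let ?y = "SOME y. y \<in> ?N +>\<^bsub>?F\<^esub> x"
 have "x \<in> ?N +>\<^bsub>?F\<^esub> x" by (rule abelian_subgroup.a_rcos_self[OF quot_subgroup[OF F.module_axioms ker_submodule[OF V]] x])
 then have "?y \<in> ?N +>\<^bsub>?F\<^esub> x" by (rule someI[where P = "%y. y \<in> ?N +>\<^bsub>?F\<^esub> x"])
 then obtain n' where n: "n' \<in> ?N" "?y = n' \<oplus>\<^bsub>?F\<^esub> x" using coset_mem[OF F.module_axioms ker_submodule[OF V] x] by blast
 have "tlift R M \<phi> (?N +>\<^bsub>?F\<^esub> x) = free_lift R M \<phi> ?y" by (simp add: tlift_def free_lift_def Let_def)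
 also have "\<dots> = free_lift R M \<phi> x" using ker[OF n(1)] x lin_closed[OF L] unfolding n(2) by (simp add: lin)
 finally show ?thesis .
qed

lemma tlift_tens:
 assumes "bgmodule R V" "module R M" "multilinear R V n d M \<phi>" "w \<in> words V n d"
 shows "tlift R M \<phi> (tens R V w) = \<phi> w"
 using assms tlift_coset[OF assms(1-3) basis_vec_closed[OF R assms(4)]] multilinearD(1)[OF assms(3,4)] by (simp add: tens_eq free_lift_basis)

lemma tlift_linear:
 assumes V: "bgmodule R V" and M: "module R M" and \<phi>: "multilinear R V n d M \<phi>"
 shows "tlift R M \<phi> \<in> lmaps R (tpow R V n d) M"
proof -
 let ?F = "free_mod R (words V n d)" and ?N = "tpow_ker R V n d"
 interpret F: module R ?F by (rule free_mod_module[OF R])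
 have L: "free_lift R M \<phi> \<in> lmaps R ?F M" using \<phi> by (intro free_lift_linear[OF M]) (auto simp: multilinear_def)
 note q = quot_carrier[OF F.module_axioms ker_submodule[OF V]]
  quot_add[OF F.module_axioms ker_submodule[OF V]] quot_smult[OF F.module_axioms ker_submodule[OF V]]
 show ?thesis using lin_closed[OF L] by (auto simp: linear_maps_def tpow_def q tlift_coset[OF V M \<phi>] lin_add[OF L] lin_smult[OF L])
qed

lemma tens_spans:
 assumes V: "bgmodule R V"
 shows "spans R (tpow R V n d) (tens R V ` words V n d)"
 unfolding spans_def
proof (intro allI impI)
 let ?F = "free_mod R (words V n d)" and ?N = "tpow_ker R V n d"
 interpret F: module R ?F by (rule free_mod_module[OF R])
 note q = quot_carrier[OF F.module_axioms ker_submodule[OF V]]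
  quot_add[OF F.module_axioms ker_submodule[OF V]] quot_smult[OF F.module_axioms ker_submodule[OF V]]
  quot_zero[OF F.module_axioms ker_submodule[OF V]]
 fix N assume N: "submodule N R (tpow R V n d)" and sub: "tens R V ` words V n d \<subseteq> N"
 interpret T: module R "tpow R V n d" by (rule tpow_mod[OF V])
 define P where "P x \<longleftrightarrow> x \<in> N" for x
 have z: "P (zr (tpow R V n d))" using subgroup.one_closed[OF submodule.axioms(1)[OF N]] by (simp add: P_def)
 have st: "\<forall>x c b. x \<in> carrier (tpow R V n d) --> c \<in> carrier R --> b \<in> tens R V ` words V n d -->
   P x --> P (x \<oplus>\<^bsub>tpow R V n d\<^esub> c \<odot>\<^bsub>tpow R V n d\<^esub> b)"
  using T.submoduleE(4,5)[OF N] sub unfolding P_def by blast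
 show "carrier (tpow R V n d) \<subseteq> N"
 proof
 fix X assume X: "X \<in> carrier (tpow R V n d)"
 obtain x where x: "x \<in> carrier ?F" "X = ?N +>\<^bsub>?F\<^esub> x" using X by (auto simp: tpow_def q)
 have "P (?N +>\<^bsub>?F\<^esub> x)" using x(1)
 proof (rule free_mod_induct[OF R, where P = "%x. P (?N +>\<^bsub>?F\<^esub> x)"])
  show "P (?N +>\<^bsub>?F\<^esub> (zr ?F))" using z by (simp add: tpow_def q)
  fix y c w assume y: "y \<in> carrier ?F" and c: "c \<in> carrier R" and w: "w \<in> words V n d" and Py: "P (?N +>\<^bsub>?F\<^esub> y)"
  have "P ((?N +>\<^bsub>?F\<^esub> y) \<oplus>\<^bsub>tpow R V n d\<^esub> c \<odot>\<^bsub>tpow R V n d\<^esub> tens R V w)"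
   using st y c w Py by (auto simp: tpow_def q)
  then show "P (?N +>\<^bsub>?F\<^esub> (y \<oplus>\<^bsub>?F\<^esub> c \<odot>\<^bsub>?F\<^esub> basis_vec R w))"
   using y c w basis_vec_closed[OF R w] by (simp add: tpow_def q tens_eq[OF w])
 qed
 then show "X \<in> N" using x by (simp add: P_def)
 qed
qed

lemma tpow_lin_eq:
 assumes V: "bgmodule R V" and N: "module R N" and "f \<in> lmaps R (tpow R V n d) N" "g \<in> lmaps R (tpow R V n d) N"
  and "!!w. w \<in> words V n d ==> f (tens R V w) = g (tens R V w)"
  and "x \<in> carrier (tpow R V n d)"
 shows "f x = g x"
 by (rule spans_lin_eq[OF tens_spans[OF V] _ tpow_mod[OF V] N assms(3,4) _ assms(6)]) (use tens_cl[OF V, of _ n d] assms(5) in auto)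

end

subsection \<open>Tensor products of maps\<close>

lemma bipair_simps [simp]: "bipair 0 y = 0" "bipair x 0 = 0" "bipair (x + x') y = bipair x y + bipair x' y"
 "bipair x (y + y') = bipair x y + bipair x y'" "bipair (- x) y = - bipair x y" "bipair x (- y) = - bipair x y"
 "bipair (x - x') y = bipair x y - bipair x' y" "bipair x (y - y') = bipair x y - bipair x y'"
 by (auto simp: bipair_def algebra_simps)

lemma length_blocks [simp]: "length (blocks qs w) = length qs" by (induct qs w rule: blocks.induct) auto

lemma btens_word_Nil [simp]: "btens_word R V [] w = []" by (simp add: btens_word_def)

lemma btens_word_Cons [simp]: "btens_word R V ((q, f) # fs) w =
  (wdeg (take q w) + bdeg f, bgapp f (wdeg (take q w)) (tens R V (take q w))) # btens_word R V fs (drop q w)"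
 by (simp add: btens_word_def)

lemma btens_sign_Nil [simp]: "btens_sign [] w = 0" by (simp add: btens_sign_def)

lemma bipair_sum_list: "bipair (sum_list (map f xs)) y = (\<Sum>k<length xs. bipair (f (xs ! k)) y)"
 by (induct xs) (auto simp: lessThan_Suc_eq_insert_0 sum.reindex zero_notin_Suc_image simp del: sum.lessThan_Suc)

text \<open>All later maps pass the first block, so the sum of their bidegrees pairs with its
  degree; the rest is the sign of the remaining factors.\<close>

lemma btens_sign_Cons [simp]: "btens_sign ((q, f) # fs) w =
  bipair (sum_list (map (%(q, f). bdeg f) fs)) (wdeg (take q w)) + btens_sign fs (drop q w)"
proof -
 have "btens_sign ((q, f) # fs) w =
   (\<Sum>k<length fs. \<Sum>j<Suc k. bipair (bdeg (snd (fs ! k))) (wdeg ((take q w # blocks (map fst fs) (drop q w)) ! j)))"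
  by (simp add: btens_sign_def sum.lessThan_Suc_shift del: sum.lessThan_Suc)
 also have "\<dots> = (\<Sum>k<length fs. bipair (bdeg (snd (fs ! k))) (wdeg (take q w))
   + (\<Sum>j<k. bipair (bdeg (snd (fs ! k))) (wdeg (blocks (map fst fs) (drop q w) ! j))))"
  by (intro sum.cong refl) (simp add: sum.lessThan_Suc_shift del: sum.lessThan_Suc)
 also have "\<dots> = (\<Sum>k<length fs. bipair (bdeg (snd (fs ! k))) (wdeg (take q w))) + btens_sign fs (drop q w)"
  by (simp add: sum.distrib btens_sign_def)
 finally show ?thesis by (simp add: bipair_sum_list case_prod_beta)
qed

text \<open>The target bidegree is the one stored in the map, so lists of factors of different
  bidegrees can be treated uniformly.\<close>

definition blin :: "'r ring => ('r, 'a) bgmod => ('r, 'b) bgmod => nat => (('r, 'a) tens, 'b) bgmap => bool" where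
 "blin R V W q f \<longleftrightarrow> (\<forall>d. bgapp f d \<in> lmaps R (tpow R V q d) (W (d + bdeg f)))"

lemma blinD: "blin R V W q f ==> bgapp f d \<in> lmaps R (tpow R V q d) (W (d + bdeg f))" by (simp add: blin_def)

lemma bghom_blin: "f \<in> bghom R (tpow R V q) W e ==> blin R V W q f" by (auto simp: blin_def bghom_def)

lemma words_replace:
 assumes "bgmodule R V" "u @ (e, a) # v \<in> words V n d"
 shows "b \<in> carrier (V e) ==> u @ (e, b) # v \<in> words V n d"
  and "b \<in> carrier (V e) ==> u @ (e, a \<oplus>\<^bsub>V e\<^esub> b) # v \<in> words V n d"
  and "c \<in> carrier R ==> u @ (e, c \<odot>\<^bsub>V e\<^esub> a) # v \<in> words V n d"
 using assms abelian_monoid.a_closed[OF module_abmon[OF bgD[OF assms(1)]]] module.smult_closed[OF bgD[OF assms(1)]] by (auto simp: words_iff)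

text \<open>A chosen letter is consumed by exactly one factor; the other output letters and, for a
  fixed bidegree of the letter, the Koszul sign do not see it. This reduces multilinearity of a
  tensor product of maps to linearity of one factor.\<close>

lemma btens_locate:
 assumes "sum_list (map fst fs) = length u + 1 + length v"
 shows "\<exists>fs1 q f fs2 u1 u2 v1 v2. fs = fs1 @ (q, f) # fs2 \<and> u = u1 @ u2 \<and> v = v1 @ v2 \<and>
  length u2 + 1 + length v1 = q \<and> length u1 = sum_list (map fst fs1) \<and>
  (\<forall>x. btens_word R V fs (u @ x # v) = btens_word R V fs1 u1 @
    (wdeg (u2 @ x # v1) + bdeg f, bgapp f (wdeg (u2 @ x # v1)) (tens R V (u2 @ x # v1))) # btens_word R V fs2 v2) \<and>
  (\<forall>x y. fst x = fst y --> btens_sign fs (u @ x # v) = btens_sign fs (u @ y # v))"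
 using assms
proof (induct fs arbitrary: u)
 case Nil
 then show ?case by simp
next
 case (Cons qf fs)
 obtain q f where qf: "qf = (q, f)" by (cases qf)
 show ?case
 proof (cases "length u < q")
  case True
  let ?v1 = "take (q - Suc (length u)) v" and ?v2 = "drop (q - Suc (length u)) v"
  have k: "q - length u = Suc (q - Suc (length u))" using True by simp
  have t: "take q (u @ x # v) = u @ x # ?v1" "drop q (u @ x # v) = ?v2" for x using True unfolding take_append drop_append k by simp_all
  have l: "length u + 1 + length ?v1 = q" using True Cons.prems qf by simp
  show ?thesis
  proof (rule exI[of _ "[]"], rule exI[of _ q], rule exI[of _ f], rule exI[of _ fs], rule exI[of _ "[]"],
     rule exI[of _ u], rule exI[of _ ?v1], rule exI[of _ ?v2], intro conjI allI impI)
   show "length u + 1 + length ?v1 = q" by (rule l)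
  qed (simp_all only: qf btens_word_Cons btens_sign_Cons btens_word_Nil t wdeg_simps append_Nil
    append_take_drop_id length_map list.size list.map sum_list.Nil)
 next
  case False
  then have t: "take q (u @ x # v) = take q u" "drop q (u @ x # v) = drop q u @ x # v" for x by simp_all
  have "sum_list (map fst fs) = length (drop q u) + 1 + length v" using False Cons.prems qf by simp
  from Cons.hyps[OF this] obtain fs1 q' f' fs2 u1 u2 v1 v2 where
   IH: "fs = fs1 @ (q', f') # fs2" "drop q u = u1 @ u2" "v = v1 @ v2" "length u2 + 1 + length v1 = q'"
   "length u1 = sum_list (map fst fs1)"
   and IH2: "\<forall>x. btens_word R V fs (drop q u @ x # v) = btens_word R V fs1 u1 @
    (wdeg (u2 @ x # v1) + bdeg f', bgapp f' (wdeg (u2 @ x # v1)) (tens R V (u2 @ x # v1))) # btens_word R V fs2 v2"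
   and IH3: "\<forall>x y. fst x = fst y --> btens_sign fs (drop q u @ x # v) = btens_sign fs (drop q u @ y # v)"
   by blast
  have u: "u = (take q u @ u1) @ u2" using IH(2) by (metis append.assoc append_take_drop_id)
  have tk: "take q (take q u @ u1) = take q u" "drop q (take q u @ u1) = u1" "length (take q u) = q" using False by simp_all
  let ?u1 = "take q u @ u1"
  have 1: "btens_word R V (qf # fs) (u @ x # v) = btens_word R V (qf # fs1) ?u1 @
    (wdeg (u2 @ x # v1) + bdeg f', bgapp f' (wdeg (u2 @ x # v1)) (tens R V (u2 @ x # v1))) # btens_word R V fs2 v2" for x
   unfolding qf btens_word_Cons t tk using IH2 by simp
  have 2: "btens_sign (qf # fs) (u @ x # v) = btens_sign (qf # fs) (u @ y # v)" if "fst x = fst y" for x y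
   unfolding qf btens_sign_Cons t IH3[rule_format, OF that] ..
  have 3: "length ?u1 = sum_list (map fst (qf # fs1))" using tk(3) IH(5) by (simp add: qf)
  have 4: "qf # fs = (qf # fs1) @ (q', f') # fs2" using IH(1) by simp
  show ?thesis by (rule exI[of _ "qf # fs1"], rule exI[of _ q'], rule exI[of _ f'], rule exI[of _ fs2],
     rule exI[of _ ?u1], rule exI[of _ u2], rule exI[of _ v1], rule exI[of _ v2])
    (intro conjI allI impI 1 2 3 4 u IH(3,4))
 qed
qed

context bgmods
begin

lemma btens_word_words:
 assumes V: "bgmodule R V" and fs: "!!q f. (q, f) \<in> set fs ==> blin R V W q f" and w: "w \<in> words V (sum_list (map fst fs)) d"
 shows "btens_word R V fs w \<in> words W (length fs) (d + sum_list (map (%(q, f). bdeg f) fs))"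
 using fs w
proof (induct fs arbitrary: w d)
 case Nil
 then show ?case by (auto simp: words_iff)
next
 case (Cons qf fs)
 obtain q f where qf: "qf = (q, f)" by (cases qf)
 have t: "take q w \<in> words V q (wdeg (take q w))" "drop q w \<in> words V (sum_list (map fst fs)) (wdeg (drop q w))"
  using Cons.prems(2) by (auto simp: words_iff qf)
 have d: "d = wdeg (take q w) + wdeg (drop q w)" using Cons.prems(2) by (metis append_take_drop_id wdeg_simps(3) words_iff)
 have "blin R V W q f" using Cons.prems(1)[of q f] qf by simp
 then have "bgapp f (wdeg (take q w)) (tens R V (take q w)) \<in> carrier (W (wdeg (take q w) + bdeg f))"
  using lin_closed[OF blinD tens_cl[OF V t(1)]] by blast
 moreover have "btens_word R V fs (drop q w) \<in> words W (length fs) (wdeg (drop q w) + sum_list (map (%(q, f). bdeg f) fs))"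
  using Cons.prems(1) by (intro Cons.hyps t) auto
 ultimately show ?case by (simp add: words_iff qf d add_ac)
qed

lemma btens_fun_multilinear:
 assumes V: "bgmodule R V" and W: "bgmodule R W" and fs: "!!q f. (q, f) \<in> set fs ==> blin R V W q f"
  and e: "e = sum_list (map (%(q, f). bdeg f) fs)" and M: "M = tpow R W (length fs) (d + e)"
 shows "multilinear R V (sum_list (map fst fs)) d M (%w. sg M (btens_sign fs w) (tens R W (btens_word R V fs w)))"
proof (rule multilinearI)
 have MM: "module R M" unfolding M by (rule tpow_mod[OF W])
 have cl: "tens R W (btens_word R V fs w) \<in> carrier M" if "w \<in> words V (sum_list (map fst fs)) d" for w
  unfolding M e by (rule tens_cl[OF W btens_word_words[OF V fs that]])
 show "sg M (btens_sign fs w) (tens R W (btens_word R V fs w)) \<in> carrier M" if "w \<in> words V (sum_list (map fst fs)) d" for w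
  using cl[OF that] by (rule sg_closed[OF MM])
 fix u e' a v assume w: "u @ (e', a) # v \<in> words V (sum_list (map fst fs)) d"
 have ul: "sum_list (map fst fs) = length u + 1 + length v" using w by (auto simp: words_iff)
 obtain fs1 q f fs2 u1 u2 v1 v2 where loc: "fs = fs1 @ (q, f) # fs2" "u = u1 @ u2" "v = v1 @ v2"
  "length u2 + 1 + length v1 = q" "length u1 = sum_list (map fst fs1)"
  and bw0: "\<forall>x. btens_word R V fs (u @ x # v) = btens_word R V fs1 u1 @
    (wdeg (u2 @ x # v1) + bdeg f, bgapp f (wdeg (u2 @ x # v1)) (tens R V (u2 @ x # v1))) # btens_word R V fs2 v2"
  and sgn0: "\<forall>x y. fst x = fst y --> btens_sign fs (u @ x # v) = btens_sign fs (u @ y # v)"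
  using btens_locate[OF ul, of R V] by blast
 note bw = bw0[rule_format] and sgn = sgn0[rule_format]
 let ?d = "wdeg u2 + e' + wdeg v1"
 have f: "bgapp f ?d \<in> lmaps R (tpow R V q ?d) (W (?d + bdeg f))" using fs[of q f] loc(1) by (auto intro: blinD)
 have wl: "u2 @ (e', a) # v1 \<in> words V q ?d" using w loc by (auto simp: words_iff add_ac)
 note rep = words_replace[OF V w] and repl = words_replace[OF V wl]
 have tl: "tens R V x \<in> carrier (tpow R V q ?d)" if "x \<in> words V q ?d" for x by (rule tens_cl[OF V that])
 have deg: "wdeg (u2 @ (e', x) # v1) = ?d" for x by (simp add: add_ac)
 have wW: "btens_word R V fs (u @ (e', a) # v) \<in> words W (length fs) (d + e)" using btens_word_words[OF V fs w] by (simp add: e)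
 note wW' = wW[unfolded bw deg]
 {
  fix b assume b: "b \<in> carrier (V e')"
  have fb: "bgapp f ?d (tens R V (u2 @ (e', b) # v1)) \<in> carrier (W (?d + bdeg f))" using lin_closed[OF f tl[OF repl(1)[OF b]]] .
  have 1: "bgapp f ?d (tens R V (u2 @ (e', a \<oplus>\<^bsub>V e'\<^esub> b) # v1)) =
    bgapp f ?d (tens R V (u2 @ (e', a) # v1)) \<oplus>\<^bsub>W (?d + bdeg f)\<^esub> bgapp f ?d (tens R V (u2 @ (e', b) # v1))"
   using lin_add[OF f tl[OF wl] tl[OF repl(1)[OF b]]] multilinearD(2)[OF tens_multilinear[OF V] wl b] by simp
  have 2: "tens R W (btens_word R V fs (u @ (e', a \<oplus>\<^bsub>V e'\<^esub> b) # v)) =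
    tens R W (btens_word R V fs (u @ (e', a) # v)) \<oplus>\<^bsub>M\<^esub> tens R W (btens_word R V fs (u @ (e', b) # v))"
   unfolding bw deg 1 M by (rule multilinearD(2)[OF tens_multilinear[OF W] wW' fb])
  show "sg M (btens_sign fs (u @ (e', a \<oplus>\<^bsub>V e'\<^esub> b) # v)) (tens R W (btens_word R V fs (u @ (e', a \<oplus>\<^bsub>V e'\<^esub> b) # v))) =
    sg M (btens_sign fs (u @ (e', a) # v)) (tens R W (btens_word R V fs (u @ (e', a) # v))) \<oplus>\<^bsub>M\<^esub>
    sg M (btens_sign fs (u @ (e', b) # v)) (tens R W (btens_word R V fs (u @ (e', b) # v)))"
   unfolding 2 sgn[of "(e', a \<oplus>\<^bsub>V e'\<^esub> b)" "(e', a)", simplified] sgn[of "(e', b)" "(e', a)", simplified]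
   by (rule sg_add[OF MM cl[OF w] cl[OF rep(1)[OF b]]])
 next
  fix c assume c: "c \<in> carrier R"
  have 1: "bgapp f ?d (tens R V (u2 @ (e', c \<odot>\<^bsub>V e'\<^esub> a) # v1)) =
    c \<odot>\<^bsub>W (?d + bdeg f)\<^esub> bgapp f ?d (tens R V (u2 @ (e', a) # v1))"
   using lin_smult[OF f c tl[OF wl]] multilinearD(3)[OF tens_multilinear[OF V] wl c] by simp
  have 2: "tens R W (btens_word R V fs (u @ (e', c \<odot>\<^bsub>V e'\<^esub> a) # v)) =
    c \<odot>\<^bsub>M\<^esub> tens R W (btens_word R V fs (u @ (e', a) # v))"
   unfolding bw deg 1 M by (rule multilinearD(3)[OF tens_multilinear[OF W] wW' c])
  show "sg M (btens_sign fs (u @ (e', c \<odot>\<^bsub>V e'\<^esub> a) # v)) (tens R W (btens_word R V fs (u @ (e', c \<odot>\<^bsub>V e'\<^esub> a) # v))) =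
    c \<odot>\<^bsub>M\<^esub> sg M (btens_sign fs (u @ (e', a) # v)) (tens R W (btens_word R V fs (u @ (e', a) # v)))"
   unfolding 2 sgn[of "(e', c \<odot>\<^bsub>V e'\<^esub> a)" "(e', a)", simplified] by (rule sg_smult[OF MM cl[OF w] c])
 }
qed

lemma bdeg_btens [simp]: "bdeg (btens R V W fs) = sum_list (map (%(q, f). bdeg f) fs)" by (simp add: btens_def Let_def)

lemma btens_linear:
 assumes V: "bgmodule R V" and W: "bgmodule R W" and fs: "!!q f. (q, f) \<in> set fs ==> blin R V W q f"
 shows "bgapp (btens R V W fs) d \<in> lmaps R (tpow R V (sum_list (map fst fs)) d) (tpow R W (length fs) (d + bdeg (btens R V W fs)))"
 using tlift_linear[OF V tpow_mod[OF W] btens_fun_multilinear[OF V W fs refl refl]] by (simp add: btens_def Let_def)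

lemma btens_tens:
 assumes V: "bgmodule R V" and W: "bgmodule R W" and fs: "!!q f. (q, f) \<in> set fs ==> blin R V W q f"
  and w: "w \<in> words V (sum_list (map fst fs)) d"
 shows "bgapp (btens R V W fs) d (tens R V w) =
  sg (tpow R W (length fs) (d + bdeg (btens R V W fs))) (btens_sign fs w) (tens R W (btens_word R V fs w))"
 using tlift_tens[OF V tpow_mod[OF W] btens_fun_multilinear[OF V W fs refl refl] w] by (simp add: btens_def Let_def)

lemma words_1: "w \<in> words V 1 d \<longleftrightarrow> (\<exists>x\<in>carrier (V d). w = [(d, x)])"
 unfolding words_iff by (auto simp: length_Suc_conv)

lemma unary_multilinear:
 assumes f: "bgapp f d \<in> lmaps R (V d) (W (d + bdeg f))"
 shows "multilinear R V 1 d (W (d + bdeg f)) (%w. bgapp f (fst (hd w)) (snd (hd w)))"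
proof (rule multilinearI)
 have E: "u = [] \<and> v = [] \<and> e = d \<and> a \<in> carrier (V d)" if "u @ (e, a) # v \<in> words V 1 d" for u e a v
  using that unfolding words_iff by auto
 show "bgapp f (fst (hd w)) (snd (hd w)) \<in> carrier (W (d + bdeg f))" if "w \<in> words V 1 d" for w
  using that lin_closed[OF f] unfolding words_1 by auto
 show "bgapp f (fst (hd (u @ (e, a \<oplus>\<^bsub>V e\<^esub> b) # v))) (snd (hd (u @ (e, a \<oplus>\<^bsub>V e\<^esub> b) # v))) =
  bgapp f (fst (hd (u @ (e, a) # v))) (snd (hd (u @ (e, a) # v))) \<oplus>\<^bsub>W (d + bdeg f)\<^esub>
  bgapp f (fst (hd (u @ (e, b) # v))) (snd (hd (u @ (e, b) # v)))"
  if "u @ (e, a) # v \<in> words V 1 d" "b \<in> carrier (V e)" for u e a b v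
  using E[OF that(1)] that(2) lin_add[OF f] by simp
 show "bgapp f (fst (hd (u @ (e, c \<odot>\<^bsub>V e\<^esub> a) # v))) (snd (hd (u @ (e, c \<odot>\<^bsub>V e\<^esub> a) # v))) =
  c \<odot>\<^bsub>W (d + bdeg f)\<^esub> bgapp f (fst (hd (u @ (e, a) # v))) (snd (hd (u @ (e, a) # v)))"
  if "u @ (e, a) # v \<in> words V 1 d" "c \<in> carrier R" for u e a c v
  using E[OF that(1)] that(2) lin_smult[OF f] by simp
qed

lemma bdeg_unary [simp]: "bdeg (unary R W f) = bdeg f" by (simp add: unary_def)

lemma unary_blin:
 assumes V: "bgmodule R V" and W: "bgmodule R W" and f: "!!d. bgapp f d \<in> lmaps R (V d) (W (d + bdeg f))"
 shows "blin R V W 1 (unary R W f)"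
 unfolding blin_def unary_def using tlift_linear[OF V bgD[OF W] unary_multilinear[of f _ V W, OF f]] by simp

lemma unary_tens:
 assumes V: "bgmodule R V" and W: "bgmodule R W"
  and f: "!!d. bgapp f d \<in> lmaps R (V d) (W (d + bdeg f))" and x: "x \<in> carrier (V d)"
 shows "bgapp (unary R W f) d (tens R V [(d, x)]) = bgapp f d x"
proof -
 have "[(d, x)] \<in> words V 1 d" using x unfolding words_1 by simp
 from tlift_tens[OF V bgD[OF W] unary_multilinear[of f d V W, OF f] this] show ?thesis by (simp add: unary_def)
qed

text \<open>Tensoring with u on the left and v on the right, as a map between tensor powers. It is
  needed to see that vanishing under evaluation survives concatenation.\<close>

definition surround :: "('r, 'a) bgmod => 'a word => nat => 'a word => bideg => ('r, 'a) tens => ('r, 'a) tens" where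
 "surround V u n v d = tlift R (tpow R V (length u + n + length v) (wdeg u + d + wdeg v)) (%w. tens R V (u @ w @ v))"

lemma surround_multilinear:
 assumes V: "bgmodule R V" and u: "valid V u" and v: "valid V v"
 shows "multilinear R V n d (tpow R V (length u + n + length v) (wdeg u + d + wdeg v)) (%w. tens R V (u @ w @ v))"
proof (rule multilinearI)
 let ?n = "length u + n + length v" and ?d = "wdeg u + d + wdeg v"
 note m = multilinearD[OF tens_multilinear[OF V, of ?n ?d]]
 have w: "u @ w @ v \<in> words V ?n ?d" if "w \<in> words V n d" for w using that u v by (auto simp: words_iff add_ac)
 show "tens R V (u @ w @ v) \<in> carrier (tpow R V ?n ?d)" if "w \<in> words V n d" for w by (rule m(1)[OF w[OF that]])
 show "tens R V (u @ (u' @ (e, a \<oplus>\<^bsub>V e\<^esub> b) # v') @ v) =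
   tens R V (u @ (u' @ (e, a) # v') @ v) \<oplus>\<^bsub>tpow R V ?n ?d\<^esub> tens R V (u @ (u' @ (e, b) # v') @ v)"
  if "u' @ (e, a) # v' \<in> words V n d" "b \<in> carrier (V e)" for u' e a b v'
  using m(2)[of "u @ u'" e a "v' @ v" b] w[OF that(1)] that(2) by simp
 show "tens R V (u @ (u' @ (e, c \<odot>\<^bsub>V e\<^esub> a) # v') @ v) =
   c \<odot>\<^bsub>tpow R V ?n ?d\<^esub> tens R V (u @ (u' @ (e, a) # v') @ v)"
  if "u' @ (e, a) # v' \<in> words V n d" "c \<in> carrier R" for u' e a c v'
  using m(3)[of "u @ u'" e a "v' @ v" c] w[OF that(1)] that(2) by simp
qed

lemmas surround_linear = tlift_linear[OF _ tpow_mod surround_multilinear, folded surround_def]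
lemmas surround_tens = tlift_tens[OF _ tpow_mod surround_multilinear, folded surround_def]

end

subsection \<open>Direct sums\<close>

lemma direct_sum_iff: "x \<in> carrier (direct_sum I M) \<longleftrightarrow>
  x \<in> extensional I \<and> (\<forall>i\<in>I. x i \<in> carrier (M i)) \<and> finite {i \<in> I. x i ~= (zr (M i))}"
 by (auto simp: direct_sum_def PiE_def)

lemma direct_sum_app: "i \<in> I ==> (x \<oplus>\<^bsub>direct_sum I M\<^esub> y) i = x i \<oplus>\<^bsub>M i\<^esub> y i"
 "i \<in> I ==> (c \<odot>\<^bsub>direct_sum I M\<^esub> x) i = c \<odot>\<^bsub>M i\<^esub> x i"
 "i \<in> I ==> (zr (direct_sum I M)) i = (zr (M i))"
 by (auto simp: direct_sum_def)

lemma direct_sum_ext: "x \<oplus>\<^bsub>direct_sum I M\<^esub> y \<in> extensional I" "c \<odot>\<^bsub>direct_sum I M\<^esub> x \<in> extensional I"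
 "(zr (direct_sum I M)) \<in> extensional I"
 by (auto simp: direct_sum_def)

lemma direct_sum_module:
 assumes R: "cring R" and M: "!!i. i \<in> I ==> module R (M i)"
 shows "module R (direct_sum I M)"
proof (rule moduleI[OF R])
 let ?D = "direct_sum I M"
 have ag: "abelian_group (M i)" if "i \<in> I" for i using M[OF that] by (rule module_abgrp)
 have am: "abelian_monoid (M i)" if "i \<in> I" for i using M[OF that] by (rule module_abmon)
 have mem: "x i \<in> carrier (M i)" if "x \<in> carrier ?D" "i \<in> I" for x i using that by (simp add: direct_sum_iff)
 have ext: "x = y" if "x \<in> carrier ?D" "y \<in> carrier ?D" "!!i. i \<in> I ==> x i = y i" for x y
  by (rule extensionalityI[of x I y]) (use that in \<open>simp_all add: direct_sum_iff\<close>)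
 have cl: "x \<oplus>\<^bsub>?D\<^esub> y \<in> carrier ?D" if x: "x \<in> carrier ?D" and y: "y \<in> carrier ?D" for x y unfolding direct_sum_iff
 proof (intro conjI ballI direct_sum_ext)
  show "(x \<oplus>\<^bsub>?D\<^esub> y) i \<in> carrier (M i)" if "i \<in> I" for i unfolding direct_sum_app(1)[OF that]
   by (rule abelian_monoid.a_closed[OF am[OF that] mem[OF x that] mem[OF y that]])
  have "{i \<in> I. (x \<oplus>\<^bsub>?D\<^esub> y) i ~= (zr (M i))} \<subseteq> {i \<in> I. x i ~= (zr (M i))} \<union> {i \<in> I. y i ~= (zr (M i))}"
   using abelian_monoid.l_zero[OF am abelian_monoid.zero_closed[OF am]] by (auto simp: direct_sum_app)
  then show "finite {i \<in> I. (x \<oplus>\<^bsub>?D\<^esub> y) i ~= (zr (M i))}"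
   by (rule finite_subset) (use x y in \<open>simp add: direct_sum_iff\<close>)
 qed
 have zc: "(zr ?D) \<in> carrier ?D" unfolding direct_sum_iff
  by (auto simp: direct_sum_app direct_sum_ext abelian_monoid.zero_closed[OF am] cong: conj_cong)
 have inv: "\<exists>y\<in>carrier ?D. y \<oplus>\<^bsub>?D\<^esub> x = (zr ?D)" if x: "x \<in> carrier ?D" for x
 proof (rule bexI[where x = "\<lambda>i\<in>I. \<ominus>\<^bsub>M i\<^esub> x i"])
  have "{i \<in> I. (\<lambda>i\<in>I. \<ominus>\<^bsub>M i\<^esub> x i) i ~= (zr (M i))} \<subseteq> {i \<in> I. x i ~= (zr (M i))}"
   using sg_zero[OF M, where k = 1] by (auto simp: sg_def)
  then have "finite {i \<in> I. (\<lambda>i\<in>I. \<ominus>\<^bsub>M i\<^esub> x i) i ~= (zr (M i))}"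
   by (rule finite_subset) (use x in \<open>simp add: direct_sum_iff\<close>)
  then show c: "(\<lambda>i\<in>I. \<ominus>\<^bsub>M i\<^esub> x i) \<in> carrier ?D" unfolding direct_sum_iff
   using mem[OF x] by (simp add: abelian_group.a_inv_closed[OF ag])
  show "(\<lambda>i\<in>I. \<ominus>\<^bsub>M i\<^esub> x i) \<oplus>\<^bsub>?D\<^esub> x = (zr ?D)"
   by (rule ext[OF cl[OF c x] zc]) (simp add: direct_sum_app abelian_group.l_neg[OF ag] mem[OF x])
 qed
 show "abelian_group ?D"
 proof (rule abelian_groupI[OF cl zc _ _ _ inv])
  fix x y z assume x: "x \<in> carrier ?D" and y: "y \<in> carrier ?D" and z: "z \<in> carrier ?D"
  show "x \<oplus>\<^bsub>?D\<^esub> y \<oplus>\<^bsub>?D\<^esub> z = x \<oplus>\<^bsub>?D\<^esub> (y \<oplus>\<^bsub>?D\<^esub> z)"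
   by (rule ext) (simp_all add: cl x y z direct_sum_app abelian_monoid.a_assoc[OF am] mem)
 next
  fix x y assume x: "x \<in> carrier ?D" and y: "y \<in> carrier ?D"
  show "x \<oplus>\<^bsub>?D\<^esub> y = y \<oplus>\<^bsub>?D\<^esub> x" using abelian_monoid.a_comm[OF am mem[OF x] mem[OF y]]
   by (intro ext[OF cl[OF x y] cl[OF y x]]) (simp add: direct_sum_app)
 next
  fix x assume x: "x \<in> carrier ?D"
  show "(zr ?D) \<oplus>\<^bsub>?D\<^esub> x = x"
   by (rule ext[OF cl[OF zc x] x]) (simp add: direct_sum_app abelian_monoid.l_zero[OF am] mem[OF x])
 qed
 show scl: "a \<odot>\<^bsub>?D\<^esub> x \<in> carrier ?D" if a: "a \<in> carrier R" and x: "x \<in> carrier ?D" for a x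
 proof -
  have "{i \<in> I. (a \<odot>\<^bsub>?D\<^esub> x) i ~= (zr (M i))} \<subseteq> {i \<in> I. x i ~= (zr (M i))}"
   using module.smult_r_null[OF M a] by (auto simp: direct_sum_app)
  then have "finite {i \<in> I. (a \<odot>\<^bsub>?D\<^esub> x) i ~= (zr (M i))}"
   by (rule finite_subset) (use x in \<open>simp add: direct_sum_iff\<close>)
  then show ?thesis unfolding direct_sum_iff using module.smult_closed[OF M a mem[OF x]] by (simp add: direct_sum_ext direct_sum_app)
 qed
 interpret R: cring R by (rule R)
 show "(a \<oplus>\<^bsub>R\<^esub> b) \<odot>\<^bsub>?D\<^esub> x = a \<odot>\<^bsub>?D\<^esub> x \<oplus>\<^bsub>?D\<^esub> b \<odot>\<^bsub>?D\<^esub> x"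
  if a: "a \<in> carrier R" and b: "b \<in> carrier R" and x: "x \<in> carrier ?D" for a b x
  by (rule ext) (simp_all add: cl scl a b x direct_sum_app module.smult_l_distr[OF M] mem)
 show "a \<odot>\<^bsub>?D\<^esub> (x \<oplus>\<^bsub>?D\<^esub> y) = a \<odot>\<^bsub>?D\<^esub> x \<oplus>\<^bsub>?D\<^esub> a \<odot>\<^bsub>?D\<^esub> y"
  if a: "a \<in> carrier R" and x: "x \<in> carrier ?D" and y: "y \<in> carrier ?D" for a x y
  by (rule ext) (simp_all add: cl scl a x y direct_sum_app module.smult_r_distr[OF M] mem)
 show "a \<otimes>\<^bsub>R\<^esub> b \<odot>\<^bsub>?D\<^esub> x = a \<odot>\<^bsub>?D\<^esub> (b \<odot>\<^bsub>?D\<^esub> x)"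
  if a: "a \<in> carrier R" and b: "b \<in> carrier R" and x: "x \<in> carrier ?D" for a b x
  by (rule ext) (simp_all add: cl scl a b x direct_sum_app module.smult_assoc1[OF M] mem)
 show "\<one>\<^bsub>R\<^esub> \<odot>\<^bsub>?D\<^esub> x = x" if x: "x \<in> carrier ?D" for x
  by (rule ext) (simp_all add: scl x direct_sum_app module.smult_one[OF M] mem)
qed

section \<open>The formal calculus of operators on words, with all signs\<close>

subsection \<open>Formal sums\<close>

text \<open>Formal counterpart of \<open>sg\<close>; evaluation turns one into the other.\<close>

definition fsg :: "int => 'a::ab_group_add => 'a" where "fsg k x = (if even k then x else - x)"

lemma fsg_0 [simp]: "fsg 0 x = x" by (simp add: fsg_def)
lemma fsg_zero [simp]: "fsg k 0 = 0" by (simp add: fsg_def)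
lemma fsg_add: "fsg k (x + y) = fsg k x + fsg k y" by (simp add: fsg_def)
lemma fsg_diff: "fsg k (x - y) = fsg k x - fsg k y" by (simp add: fsg_def)
lemma fsg_minus: "fsg k (- x) = - fsg k x" by (simp add: fsg_def)
lemma fsg_fsg [simp]: "fsg k (fsg l x) = fsg (k + l) x" by (auto simp: fsg_def)
lemma fsg_sum: "fsg k (sum f S) = (\<Sum>s\<in>S. fsg k (f s))" by (simp add: fsg_def sum_negf)
lemma fsg_cong: "even (k - l) ==> fsg k x = fsg l x" by (auto simp: fsg_def)

lemma frag_extend_fsg [simp]: "fext X (fsg k x) = fsg k (fext X x)" by (simp add: fsg_def frag_extend_minus)

lemma frag_extend_sum': "fext X (sum f S) = (\<Sum>s\<in>S. fext X (f s))"
 by (induct S rule: infinite_finite_induct) (auto simp: frag_extend_add)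

lemma frag_extend_assoc: "fext X (fext Y x) = fext (%b. fext X (Y b)) x"
 unfolding frag_extend_def[of Y] frag_extend_def[of "%b. fext X (Y b)"] by (simp add: frag_extend_sum' frag_extend_cmul)

lemma frag_extend_fun_add: "fext (%b. X b + Y b) x = fext X x + fext Y x"
 by (simp add: frag_extend_def frag_cmul_distrib2 sum.distrib)

lemma frag_extend_fun_sum: "fext (%b. \<Sum>s\<in>S. X s b) x = (\<Sum>s\<in>S. fext (X s) x)"
 by (induct S rule: infinite_finite_induct) (auto simp: frag_extend_fun_add frag_extend_def)

lemma frag_cmul_uminus: "frag_cmul c (- z) = - frag_cmul c z" by (rule poly_mapping_eqI) (simp del: minus_frag_cmul)

lemma frag_extend_fun_fsg: "fext (%b. fsg k (X b)) x = fsg k (fext X x)"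
 by (simp add: fsg_def frag_extend_def sum_negf frag_cmul_uminus del: minus_frag_cmul)

lemma frag_extend_fun_zero [simp]: "fext (%b. 0) x = 0" by (simp add: frag_extend_def)

lemma frag_extend_frag_of [simp]: "fext frag_of x = x" by (rule frag_expansion[symmetric])

text \<open>The tensor product of two free abelian groups, identified with the free abelian group on
  pairs of generators.\<close>

definition fpair :: "('x \<Rightarrow>\<^sub>0 int) => ('y \<Rightarrow>\<^sub>0 int) => ('x \<times> 'y \<Rightarrow>\<^sub>0 int)" where
 "fpair x y = fext (%u. fext (%v. frag_of (u, v)) y) x"

lemma fpair_of [simp]: "fpair (frag_of u) (frag_of v) = frag_of (u, v)" by (simp add: fpair_def)

lemma fpair_simps [simp]: "fpair 0 y = 0" "fpair x 0 = 0" "fpair (x + x') y = fpair x y + fpair x' y" "fpair x (y + y') = fpair x y + fpair x y'"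
 "fpair (fsg k x) y = fsg k (fpair x y)" "fpair x (fsg k y) = fsg k (fpair x y)"
 by (simp_all add: fpair_def frag_extend_add frag_extend_fun_add frag_extend_fun_fsg)

lemma fpair_diff: "fpair (x - x') y = fpair x y - fpair x' y" "fpair x (y - y') = fpair x y - fpair x y'"
proof -
 have "fpair (x + fsg 1 x') y = fpair x y + fsg 1 (fpair x' y)" "fpair x (y + fsg 1 y') = fpair x y + fsg 1 (fpair x y')" by simp_all
 then show "fpair (x - x') y = fpair x y - fpair x' y" "fpair x (y - y') = fpair x y - fpair x y'" by (simp_all add: fsg_def)
qed

lemma fpair_sum: "fpair (sum f S) y = (\<Sum>s\<in>S. fpair (f s) y)" "fpair x (sum g S) = (\<Sum>s\<in>S. fpair x (g s))"
 by (simp_all add: fpair_def frag_extend_sum' frag_extend_fun_sum)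

lemma frag_extend_fpair: "fext Z (fpair x y) = fext (%u. fext (%v. Z (u, v)) y) x"
 by (simp add: fpair_def frag_extend_assoc)

lemma fpair_frag_extend: "fpair (fext X x) (fext Y y) = fext (%u. fext (%v. fpair (X u) (Y v)) y) x"
proof -
 have 1: "fpair x (fext Y y) = fext (%v. fpair x (Y v)) y" for x
  unfolding frag_extend_def[of Y] frag_extend_def[of "%v. fpair x (Y v)"] fpair_sum by (intro sum.cong refl)
   (simp add: fpair_def frag_extend_cmul frag_extend_def[of _ x] frag_cmul_sum mult.commute)
 have 2: "fpair (fext X x) y = fext (%u. fpair (X u) y) x" for y unfolding fpair_def by (simp add: frag_extend_assoc)
 show ?thesis unfolding 2 by (simp only: 1)
qed

section \<open>Formal operators\<close>

text \<open>Formal counterpart of \<open>eseq\<close>: the natural number is the index of a sequence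
  in the enriched category.\<close>

type_synonym ('x, 'y) fop = "nat => 'x => ('y \<Rightarrow>\<^sub>0 int)"

definition dsh :: "nat => bideg" where "dsh n = (int n, int n)"

lemma dsh_simps [simp]: "dsh 0 = 0" "dsh (m + n) = dsh m + dsh n" by (simp_all add: dsh_def zero_prod_def)

lemma dsh_diff: "n \<le> m ==> dsh (m - n) = dsh m - dsh n" by (simp add: dsh_def of_nat_diff)

text \<open>k is the total degree of the inner operator Y, the only information on degrees that the
  sign of the enriched composition uses.\<close>

definition opcomp :: "int => ('y, 'z) fop => ('x, 'y) fop => ('x, 'z) fop" where
 "opcomp k X Y m b = (\<Sum>i\<le>m. fsg (int i * k) (fext (X i) (Y (m - i) b)))"

text \<open>e is the bidegree of Y, so its term of index m - j has bidegree
  \<open>e - dsh (m - j)\<close>. The exponent is the index sign of the enriched tensor product plus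
  the Koszul sign for moving that term past u.\<close>

definition ften :: "('x => bideg) => bideg => ('x, 'x') fop => ('y, 'y') fop => ('x \<times> 'y, 'x' \<times> 'y') fop" where
 "ften dg e X Y m = (%(u, v). \<Sum>j\<le>m. fsg (int j * tdeg e + bipair (e - dsh (m - j)) (dg u)) (fpair (X j u) (Y (m - j) v)))"

definition fid :: "('x, 'x) fop" where "fid p b = (if p = 0 then frag_of b else 0)"

definition fhom :: "('x => bideg) => ('y => bideg) => bideg => ('x, 'y) fop => bool" where
 "fhom dg dg' e X \<longleftrightarrow> (\<forall>p b. \<forall>c\<in>fkeys (X p b). dg' c = dg b + e - dsh p)"

lemma fhom_fid: "fhom dg dg 0 fid" by (auto simp: fhom_def fid_def)

lemma frag_extend_ften:
 assumes "!!c. c \<in> fkeys x ==> dg c = e'"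
 shows "fext (ften dg f X Y i) (fpair x y) =
  (\<Sum>j\<le>i. fsg (int j * tdeg f + bipair (f - dsh (i - j)) e') (fpair (fext (X j) x) (fext (Y (i - j)) y)))"
proof -
 have "fext (ften dg f X Y i) (fpair x y) = fext (%u. \<Sum>j\<le>i. fsg (int j * tdeg f + bipair (f - dsh (i - j)) (dg u))
    (fext (%v. fpair (X j u) (Y (i - j) v)) y)) x"
  by (simp add: frag_extend_fpair ften_def frag_extend_fun_sum frag_extend_fun_fsg)
 also have "\<dots> = fext (%u. \<Sum>j\<le>i. fsg (int j * tdeg f + bipair (f - dsh (i - j)) e')
    (fext (%v. fpair (X j u) (Y (i - j) v)) y)) x"
  by (rule frag_extend_eq) (simp add: assms)
 finally show ?thesis by (simp add: frag_extend_fun_sum frag_extend_fun_fsg fpair_frag_extend)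
qed

text \<open>Interchange of tensor product and composition. The Koszul signs of the single terms
  depend on the indices, but the index signs absorb this dependence, and one global sign is left:
  the pairing of the bidegree f of Y with the bidegree e' of X'. Homogeneity of X' determines the
  degree that Y has to pass.\<close>

lemma ften_opcomp:
 assumes X': "fhom dg dg' e' X'"
 shows "opcomp (tdeg (e' + f')) (ften dg' f X Y) (ften dg f' X' Y') m (u, v) =
  fsg (bipair f e') (ften dg (f + f') (opcomp (tdeg e') X X') (opcomp (tdeg f') Y Y') m (u, v))"
proof -
 define T where "T j a k b = fpair (fext (X j) (X' a u)) (fext (Y k) (Y' b v))" for j a k b
 define s1 where "s1 j a k b = int (j + k) * tdeg (e' + f') + (int a * tdeg f' + bipair (f' - dsh b) (dg u))
  + (int j * tdeg f + bipair (f - dsh k) (dg u + e' - dsh a))" for j a k b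
 define s2 where "s2 j a k b = bipair f e' + (int (j + a) * tdeg (f + f') + bipair (f + f' - dsh (k + b)) (dg u))
  + (int j * tdeg e' + int k * tdeg f')" for j a k b
 \<comment> \<open>The exponents \<open>s1\<close> before and \<open>s2\<close> after the
   interchange differ by an explicit even number.\<close>
 have par: "s1 j a k b - s2 j a k b = 2 * (int k * int a - int k * fst e' - int a * snd f)" for j a k b
  by (simp add: s1_def s2_def bipair_def tdeg_def dsh_def algebra_simps)
 have s12: "fsg (s1 j a k b) (T j a k b) = fsg (s2 j a k b) (T j a k b)" for j a k b by (rule fsg_cong) (simp add: par)
 have deg: "dg' c = dg u + e' - dsh a" if "c \<in> fkeys (X' a u)" for a c using X' that by (auto simp: fhom_def)
 have ext: "fext (ften dg' f X Y i) (fpair (X' a u) y) = (\<Sum>j\<le>i. fsg (int j * tdeg f + bipair (f - dsh (i - j)) (dg u + e' - dsh a))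
   (fpair (fext (X j) (X' a u)) (fext (Y (i - j)) y)))" for i a y
  by (rule frag_extend_ften) (rule deg)
 have "opcomp (tdeg (e' + f')) (ften dg' f X Y) (ften dg f' X' Y') m (u, v) =
  (\<Sum>i\<le>m. \<Sum>a\<le>m - i. \<Sum>j\<le>i. fsg (s1 j a (i - j) (m - i - a)) (T j a (i - j) (m - i - a)))"
  unfolding opcomp_def ften_def[of dg] prod.case frag_extend_sum' frag_extend_fsg ext fsg_sum fsg_fsg
  by (intro sum.cong refl) (simp add: s1_def T_def algebra_simps)
 also have "\<dots> = (\<Sum>(i, a, j)\<in>(SIGMA i:{..m}. SIGMA a:{..m - i}. {..i}). fsg (s1 j a (i - j) (m - i - a)) (T j a (i - j) (m - i - a)))"
  by (simp add: sum.Sigma)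
 \<comment> \<open>The new outer index n = j + a collects the two left factors, whereas i = j + k
   collected the two operators applied last.\<close>
 also have "\<dots> = (\<Sum>(n, j, k)\<in>(SIGMA n:{..m}. SIGMA j:{..n}. {..m - n}). fsg (s2 j (n - j) k (m - n - k)) (T j (n - j) k (m - n - k)))"
  by (rule sum.reindex_bij_witness[of _ "%(n, j, k). (j + k, n - j, j)" "%(i, a, j). (j + a, j, i - j)"])
   (auto simp: s12 diff_diff_add add.commute add.left_commute intro!: arg_cong2[where f = fsg])
 also have "\<dots> = (\<Sum>n\<le>m. \<Sum>j\<le>n. \<Sum>k\<le>m - n. fsg (s2 j (n - j) k (m - n - k)) (T j (n - j) k (m - n - k)))"
  by (simp add: sum.Sigma)
 also have "\<dots> = fsg (bipair f e') (ften dg (f + f') (opcomp (tdeg e') X X') (opcomp (tdeg f') Y Y') m (u, v))"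
  unfolding opcomp_def ften_def[of dg] prod.case fpair_sum fpair_simps fsg_sum fsg_fsg
  by (subst (2) sum.swap) (intro sum.cong refl, simp add: s2_def T_def algebra_simps)
 finally show ?thesis .
qed

lemma opcomp_fid_left [simp]: "opcomp k fid X = X"
proof (intro ext)
 fix m b
 have "opcomp k fid X m b = (\<Sum>i\<le>m. if i = 0 then X m b else 0)" unfolding opcomp_def fid_def by (rule sum.cong) auto
 then show "opcomp k fid X m b = X m b" by simp
qed

text \<open>The exponent is 0 because the identity has total degree 0. With the identity on the left
  any k is harmless, as only its term of index 0 survives.\<close>

lemma opcomp_fid_right [simp]: "opcomp 0 X fid = X"
proof (intro ext)
 fix m b
 have "opcomp 0 X fid m b = (\<Sum>i\<le>m. if i = m then X m b else 0)" unfolding opcomp_def fid_def by (rule sum.cong) auto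
 then show "opcomp 0 X fid m b = X m b" by simp
qed

lemma opcomp_add_left: "opcomp k (%m b. X m b + Y m b) Z m b = opcomp k X Z m b + opcomp k Y Z m b"
 by (simp add: opcomp_def frag_extend_fun_add fsg_add sum.distrib)

lemma opcomp_add_right: "opcomp k X (%m b. Y m b + Z m b) m b = opcomp k X Y m b + opcomp k X Z m b"
 by (simp add: opcomp_def frag_extend_add fsg_add sum.distrib)

lemma ften_linear: "ften dg e (%m b. X m b + X' m b) Y m uv = ften dg e X Y m uv + ften dg e X' Y m uv"
 "ften dg e (%m b. X m b - X' m b) Y m uv = ften dg e X Y m uv - ften dg e X' Y m uv"
 "ften dg e (%m b. fsg k (X m b)) Y m uv = fsg k (ften dg e X Y m uv)"
 "ften dg e X (%m b. Y m b + Y' m b) m uv = ften dg e X Y m uv + ften dg e X Y' m uv"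
 "ften dg e X (%m b. Y m b - Y' m b) m uv = ften dg e X Y m uv - ften dg e X Y' m uv"
 "ften dg e X (%m b. fsg k (Y m b)) m uv = fsg k (ften dg e X Y m uv)"
 by (simp_all add: ften_def case_prod_beta fpair_diff fsg_add fsg_diff sum.distrib sum_subtractf fsg_sum add.commute)

definition fshift :: "nat => ('x, 'y) fop => ('x, 'y) fop" where "fshift r X m b = (if r \<le> m then X (m - r) b else 0)"

lemma tdeg_simps [simp]: "tdeg 0 = 0" "tdeg (dsh n) = 0" "tdeg (a + b) = tdeg a + tdeg b" "tdeg (0, 1) = 1" "tdeg (rshift r) = -1"
 by (simp_all add: tdeg_def dsh_def rshift_def)

text \<open>Shifting raises the bidegree by \<open>dsh r\<close>, of total degree 0: the index sign
  stays trivial, and the Koszul signs agree after renaming the index.\<close>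

lemma ften_shift_right: "ften dg (dsh r) X (fshift r Y) m uv = fshift r (ften dg 0 X Y) m uv"
proof (cases uv)
 case (Pair u v)
 show ?thesis
 proof (cases "r \<le> m")
  case True
  have "(\<Sum>j\<le>m. fsg (bipair (dsh r - dsh (m - j)) (dg u)) (fpair (X j u) (fshift r Y (m - j) v))) =
    (\<Sum>j\<le>m - r. fsg (bipair (- dsh (m - r - j)) (dg u)) (fpair (X j u) (Y (m - r - j) v)))"
   using True by (intro sum.mono_neutral_cong_right) (auto simp: fshift_def dsh_diff add.commute diff_diff_add intro!: arg_cong2[where f = fsg])
  then show ?thesis using True by (simp add: ften_def fshift_def Pair)
 next
  case False
  then show ?thesis by (auto simp: ften_def fshift_def Pair intro!: sum.neutral)
 qed
qed

lemma ften_shift_left: "ften dg 0 (fshift r X) Y m uv = fshift r (ften dg 0 X Y) m uv"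
proof (cases uv)
 case (Pair u v)
 show ?thesis
 proof (cases "r \<le> m")
  case True
  have "(\<Sum>j\<le>m. fsg (bipair (- dsh (m - j)) (dg u)) (fpair (fshift r X j u) (Y (m - j) v))) =
    (\<Sum>j\<in>{r..m}. fsg (bipair (- dsh (m - j)) (dg u)) (fpair (X (j - r) u) (Y (m - j) v)))"
   using True by (intro sum.mono_neutral_cong_right) (auto simp: fshift_def)
  also have "\<dots> = (\<Sum>j\<le>m - r. fsg (bipair (- dsh (m - r - j)) (dg u)) (fpair (X j u) (Y (m - r - j) v)))"
   using True by (intro sum.reindex_bij_witness[of _ "%j. j + r" "%j. j - r"]) (auto simp: diff_diff_add add.commute)
  finally show ?thesis using True by (simp add: ften_def fshift_def Pair)
 next
  case False
  then show ?thesis by (auto simp: ften_def fshift_def Pair intro!: sum.neutral)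
 qed
qed

section \<open>Deconcatenation\<close>

text \<open>Cuts with an empty factor are included, so this is the counital comultiplication and not
  the reduced one. Cuts of a word into blocks then correspond to cuts of its pieces without
  exceptions at the ends.\<close>

definition fdec :: "'x list => ('x list \<times> 'x list \<Rightarrow>\<^sub>0 int)" where
 "fdec w = (\<Sum>n\<le>length w. frag_of (take n w, drop n w))"

definition dcompat :: "('x list, 'y list) fop => ('x list \<times> 'x list, 'y list \<times> 'y list) fop => bool" where
 "dcompat X T \<longleftrightarrow> (\<forall>m w. fext fdec (X m w) = fext (T m) (fdec w))"

lemma dcompat_opcomp:
 assumes X: "dcompat X S" and Y: "dcompat Y T"
 shows "dcompat (opcomp k X Y) (opcomp k S T)"
 unfolding dcompat_def
proof (intro allI)
 fix m w
 have "fext fdec (opcomp k X Y m w) = (\<Sum>i\<le>m. fsg (int i * k) (fext (%b. fext fdec (X i b)) (Y (m - i) w)))"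
  by (simp add: opcomp_def frag_extend_sum' frag_extend_assoc)
 also have "\<dots> = (\<Sum>i\<le>m. fsg (int i * k) (fext (S i) (fext fdec (Y (m - i) w))))"
  using X by (simp add: dcompat_def frag_extend_assoc)
 also have "\<dots> = fext (opcomp k S T m) (fdec w)"
  using Y by (simp add: dcompat_def opcomp_def[abs_def] frag_extend_assoc frag_extend_fun_sum frag_extend_fun_fsg)
 finally show "fext fdec (opcomp k X Y m w) = fext (opcomp k S T m) (fdec w)" .
qed

lemma frag_extend_fun_diff: "fext (%b. X b - Y b) x = fext X x - fext Y x"
 using frag_extend_fun_add[of X "%b. fsg 1 (Y b)" x] by (simp add: frag_extend_fun_fsg) (simp add: fsg_def)

lemma dcompat_add: "dcompat X S ==> dcompat Y T ==> dcompat (%m b. X m b + Y m b) (%m b. S m b + T m b)"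
 by (simp add: dcompat_def frag_extend_fun_add frag_extend_add)

lemma dcompat_diff: "dcompat X S ==> dcompat Y T ==> dcompat (%m b. X m b - Y m b) (%m b. S m b - T m b)"
 by (simp add: dcompat_def frag_extend_fun_diff frag_extend_diff)

lemma dcompat_fsg: "dcompat X S ==> dcompat (%m b. fsg k (X m b)) (%m b. fsg k (S m b))"
 by (simp add: dcompat_def frag_extend_fun_fsg)

lemma dcompat_shift: "dcompat X S ==> dcompat (fshift r X) (fshift r S)" by (auto simp: dcompat_def fshift_def[abs_def])

lemma dcompat_eq: "dcompat X S ==> (!!m u v. S m (u, v) = T m (u, v)) ==> dcompat X T"
proof -
 assume "dcompat X S" "!!m u v. S m (u, v) = T m (u, v)"
 moreover from this(2) have "S m = T m" for m by auto
 ultimately show ?thesis by (simp add: dcompat_def)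
qed

definition coalg_op :: "('x list => bideg) => ('x list, 'y list) fop => bool" where "coalg_op dg F \<longleftrightarrow> dcompat F (ften dg 0 F F)"

definition coder_op :: "('x list => bideg) => bideg => ('x list, 'y list) fop => ('x list, 'y list) fop => ('x list, 'y list) fop => bool" where
 "coder_op dg e F G K \<longleftrightarrow> dcompat K (%m b. ften dg e F K m b + ften dg 0 K G m b)"

text \<open>The arguments 0 and 1 of \<open>opcomp\<close> are the total degrees of F and of the
  codifferential.\<close>

definition commut :: "('x list, 'x list) fop => ('y list, 'y list) fop => ('x list, 'y list) fop => ('x list, 'y list) fop" where
 "commut dA dB F m b = opcomp 0 dB F m b - opcomp 1 F dA m b"

text \<open>The difference of the two sides of condition (ii); -1 is the total degree of K, whose
  bidegree is (r, r-1).\<close>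

definition hdefect :: "nat => ('x list, 'x list) fop => ('y list, 'y list) fop => ('x list, 'y list) fop =>
  ('x list, 'y list) fop => ('x list, 'y list) fop => ('x list, 'y list) fop" where
 "hdefect r dA dB F G K m b = fsg (int r) (opcomp (-1) dB K m b) + opcomp 1 K dA m b - (fshift r G m b - fshift r F m b)"

lemma bipair_rshift [simp]: "bipair (0, 1) (rshift r) = int r - 1" "bipair (rshift r) (0, 1) = int r - 1" by (simp_all add: bipair_def rshift_def)

lemma rshift_add: "rshift r + (0, 1) = dsh r" "(0, 1) + rshift r = dsh r" by (simp_all add: rshift_def dsh_def)

context
 fixes dgA :: "'x list => bideg" and dgB :: "'y list => bideg" and dA dB
 assumes dA: "coder_op dgA (0, 1) fid fid dA" and dB: "coder_op dgB (0, 1) fid fid dB" and dA_hom: "fhom dgA dgA (0, 1) dA"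
begin

text \<open>Interchange alone gives the Leibniz rule, for any coalgebra morphism F. Whether the
  commutator vanishes is thereby left to its one-letter components.\<close>

lemma commut_coder:
 assumes F: "coalg_op dgA F" and F_hom: "fhom dgA dgB 0 F"
 shows "coder_op dgA (0, 1) F F (commut dA dB F)"
proof -
 have 1: "dcompat (opcomp 0 dB F) (opcomp 0 (%m b. ften dgB (0, 1) fid dB m b + ften dgB 0 dB fid m b) (ften dgA 0 F F))"
  using dB F unfolding coder_op_def coalg_op_def by (intro dcompat_opcomp)
 have 2: "dcompat (opcomp 1 F dA) (opcomp 1 (ften dgA 0 F F) (%m b. ften dgA (0, 1) fid dA m b + ften dgA 0 dA fid m b))"
  using dA F unfolding coder_op_def coalg_op_def by (intro dcompat_opcomp)
 show ?thesis unfolding coder_op_def commut_def[abs_def]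
 proof (rule dcompat_eq[OF dcompat_diff[OF 1 2]])
  fix m u v
  note [simp] = ften_opcomp[OF F_hom, where f' = 0, simplified] ften_opcomp[OF dA_hom, where f' = 0, simplified]
   ften_opcomp[OF fhom_fid, where f' = "(0, 1)", simplified]
  show "opcomp 0 (%m b. ften dgB (0, 1) fid dB m b + ften dgB 0 dB fid m b) (ften dgA 0 F F) m (u, v) -
    opcomp 1 (ften dgA 0 F F) (%m b. ften dgA (0, 1) fid dA m b + ften dgA 0 dA fid m b) m (u, v) =
    ften dgA (0, 1) F (%m b. opcomp 0 dB F m b - opcomp 1 F dA m b) m (u, v) +
    ften dgA 0 (%m b. opcomp 0 dB F m b - opcomp 1 F dA m b) F m (u, v)"
   by (simp add: ften_linear opcomp_add_left opcomp_add_right)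
 qed
qed

text \<open>Interchange produces the Leibniz terms with F on the left and G on the right, and cross
  terms. As (0,1) and (r, r-1) pair to r - 1, the factor (-1)^r makes the cross terms assemble into
  commutators of F and of G with the codifferentials. The shifted part telescopes: G \<otimes> G - F
  \<otimes> F = F \<otimes> (G - F) + (G - F) \<otimes> G.\<close>

lemma hdefect_coder:
 assumes F: "coalg_op dgA F" and F_hom: "fhom dgA dgB 0 F" and G: "coalg_op dgA G"
  and K: "coder_op dgA (rshift r) F G K" and K_hom: "fhom dgA dgB (rshift r) K"
 shows "dcompat (hdefect r dA dB F G K) (%m b. ften dgA (dsh r) F (hdefect r dA dB F G K) m b + ften dgA 0 (hdefect r dA dB F G K) G m b
  + (fsg (int r) (ften dgA (rshift r) (commut dA dB F) K m b) - ften dgA (0, 1) K (commut dA dB G) m b))"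
proof -
 let ?TK = "%m b. ften dgA (rshift r) F K m b + ften dgA 0 K G m b"
 let ?TA = "%m b. ften dgA (0, 1) fid dA m b + ften dgA 0 dA fid m b"
 let ?TB = "%m b. ften dgB (0, 1) fid dB m b + ften dgB 0 dB fid m b"
 have 1: "dcompat (opcomp (-1) dB K) (opcomp (-1) ?TB ?TK)" using dB K unfolding coder_op_def coalg_op_def by (intro dcompat_opcomp)
 have 2: "dcompat (opcomp 1 K dA) (opcomp 1 ?TK ?TA)" using dA K unfolding coder_op_def coalg_op_def by (intro dcompat_opcomp)
 have 3: "dcompat (%m b. fshift r G m b - fshift r F m b) (%m b. fshift r (ften dgA 0 G G) m b - fshift r (ften dgA 0 F F) m b)"
  using F G unfolding coalg_op_def by (intro dcompat_diff dcompat_shift)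
 show ?thesis unfolding hdefect_def[abs_def]
 proof (rule dcompat_eq[OF dcompat_diff[OF dcompat_add[OF dcompat_fsg[OF 1] 2] 3]], goal_cases)
  case (1 m u v)
  note k = ften_opcomp[OF F_hom, where f' = "rshift r", simplified] ften_opcomp[OF K_hom, where f' = 0, simplified]
   ften_opcomp[OF dA_hom, where f' = 0, simplified] ften_opcomp[OF fhom_fid, where f' = "(0, 1)", simplified]
  have sh: "fshift r (ften dgA 0 F G) m (u, v) = ften dgA (dsh r) F (fshift r G) m (u, v)"
   "fshift r (ften dgA 0 F F) m (u, v) = ften dgA (dsh r) F (fshift r F) m (u, v)"
   "fshift r (ften dgA 0 F G) m (u, v) = ften dgA 0 (fshift r F) G m (u, v)"
   "fshift r (ften dgA 0 G G) m (u, v) = ften dgA 0 (fshift r G) G m (u, v)"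
   by (simp_all add: ften_shift_right ften_shift_left)
  have par: "fsg (int r + (int r - 1)) x = - x" "fsg (int r - 1) x = - fsg (int r) x"
   "fsg (2 * int r) x = x" for x :: "'z \<Rightarrow>\<^sub>0 int"
   by (auto simp: fsg_def)
  show ?case by (simp add: ften_linear opcomp_add_left opcomp_add_right k rshift_add commut_def[abs_def] fsg_add fsg_diff
     sh[symmetric] par fsg_minus)
 qed
qed

end

section \<open>Vanishing detected on one-letter components\<close>

section \<open>Reduction to single letters\<close>

definition fcat :: "('x list \<Rightarrow>\<^sub>0 int) => ('x list \<Rightarrow>\<^sub>0 int) => ('x list \<Rightarrow>\<^sub>0 int)" where
 "fcat x y = fext (%a. fext (%b. frag_of (a @ b)) y) x"

definition letters :: "('x list \<Rightarrow>\<^sub>0 int) => ('x list \<Rightarrow>\<^sub>0 int)" where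
 "letters = fext (%a. if length a = 1 then frag_of a else 0)"

lemma letters_0 [simp]: "letters 0 = 0" by (simp add: letters_def)

text \<open>A left inverse of deconcatenation on nonempty words: only the cut after the first letter
  is kept, and its two pieces are glued again.\<close>

definition cat1 :: "'x list \<times> 'x list => ('x list \<Rightarrow>\<^sub>0 int)" where
 "cat1 = (%(a, b). if length a = 1 then frag_of (a @ b) else 0)"

lemma cat1_fpair: "fext cat1 (fpair x y) = fcat (letters x) y"
proof -
 have "fext (%v. cat1 (u, v)) y =
   fext (%a. fext (%b. frag_of (a @ b)) y) (if length u = 1 then frag_of u else 0)" for u
  by (simp add: cat1_def)
 then show ?thesis by (simp add: fcat_def letters_def frag_extend_fpair frag_extend_assoc)
qed

lemma cat1_fdec:
 assumes "w ~= []" shows "fext cat1 (fdec w) = frag_of w"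
proof -
 have "fext cat1 (fdec w) = (\<Sum>n\<le>length w. if n = 1 then frag_of w else 0)" unfolding fdec_def frag_extend_sum'
  by (rule sum.cong) (auto simp: cat1_def min_def)
 moreover have "1 \<le> length w" using assms by (cases w) auto
 ultimately show ?thesis by simp
qed

definition fne :: "('x list, 'y list) fop => bool" where "fne X \<longleftrightarrow> (\<forall>m w. w ~= [] --> [] \<notin> fkeys (X m w))"

lemma fne_expand:
 assumes D: "dcompat D T" and ne: "fne D" and w: "w ~= []"
 shows "D m w = (\<Sum>n\<le>length w. fext cat1 (T m (take n w, drop n w)))"
proof -
 have "D m w = fext (%b. fext cat1 (fdec b)) (D m w)"
  using ne w by (subst frag_expansion, intro frag_extend_eq) (metis cat1_fdec fne_def)
 also have "\<dots> = fext cat1 (fext (T m) (fdec w))" using D by (simp add: dcompat_def flip: frag_extend_assoc)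
 finally show ?thesis by (simp add: frag_extend_assoc fdec_def frag_extend_sum')
qed

text \<open>N stands for "evaluates to zero". Keeping it abstract lets the induction run without
  reference to modules.\<close>

definition ideal :: "(('x list \<Rightarrow>\<^sub>0 int) => bool) => bool" where
 "ideal N \<longleftrightarrow> N 0 \<and> (\<forall>x y. N x --> N y --> N (x - y)) \<and> (\<forall>x y. N x --> N (fcat x y) \<and> N (fcat y x))"

lemma idealD:
 assumes "ideal N"
 shows "N 0" "N x ==> N y ==> N (x - y)" "N x ==> N (fcat x y)" "N x ==> N (fcat y x)" and "N x ==> N y ==> N (x + y)" "N x ==> N (fsg k x)"
proof -
 have m: "N (- x)" if "N x" for x using assms that unfolding ideal_def by (metis diff_0)
 show "N 0" "N x ==> N y ==> N (x - y)" "N x ==> N (fcat x y)" "N x ==> N (fcat y x)" using assms unfolding ideal_def by auto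
 show "N x ==> N y ==> N (x + y)" using assms m[of y] unfolding ideal_def by (metis diff_minus_eq_add)
 show "N x ==> N (fsg k x)" using m by (simp add: fsg_def)
qed

lemma ideal_sum:
 assumes "ideal N" "!!s. s \<in> S ==> N (f s)" shows "N (sum f S)"
 using assms(2) by (induct S rule: infinite_finite_induct) (auto intro: idealD[OF assms(1)])

lemma cat1_ften: "fext cat1 (ften dg e X Y m (u, v)) =
 (\<Sum>j\<le>m. fsg (int j * tdeg e + bipair (e - dsh (m - j)) (dg u)) (fcat (letters (X j u)) (Y (m - j) v)))"
 by (simp add: ften_def frag_extend_sum' cat1_fpair)

text \<open>Induction on the length of w. Regluing after the first output letter expresses D on w
  through the cuts of w. In F \<otimes> D an empty prefix gives nothing, since F of it has no
  one-letter part, and otherwise the remainder is shorter. In D \<otimes> G only the one-letter part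
  of D on a prefix matters; the hypothesis on letters covers every prefix, w itself
  included.\<close>

lemma null_from_letters:
 assumes N: "ideal N" and S: "!!u v. u @ v \<in> S ==> u \<in> S \<and> v \<in> S"
  and D: "dcompat D (%m b. ften dg e F D m b + ften dg 0 D G m b + Z m b)" and ne: "fne D"
  and D0: "!!m. D m [] = 0" and F0: "!!m. letters (F m []) = 0"
  and Z: "!!m u v. u @ v \<in> S ==> N (fext cat1 (Z m (u, v)))"
  and L: "!!m w. w \<in> S ==> w ~= [] ==> N (letters (D m w))"
 shows "w \<in> S ==> N (D m w)"
proof (induct "length w" arbitrary: w m rule: less_induct)
 case less
 show ?case
 proof (cases "w = []")
  case True
  then show ?thesis by (simp add: D0 idealD[OF N])
 next
  case False
  have "N (fext cat1 (ften dg e F D m (take n w, drop n w)))" if "n \<le> length w" for n unfolding cat1_ften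
  proof (intro ideal_sum[OF N] idealD(6)[OF N])
   fix j
   show "N (fcat (letters (F j (take n w))) (D (m - j) (drop n w)))"
   proof (cases "n = 0")
    case True
    then show ?thesis by (simp add: F0 fcat_def idealD[OF N])
   next
    case n: False
    have "drop n w \<in> S" using S[of "take n w" "drop n w"] less.prems by simp
    then have "N (D (m - j) (drop n w))" using less.hyps[of "drop n w"] n False by simp
    then show ?thesis by (rule idealD(4)[OF N])
   qed
  qed
  moreover have "N (fext cat1 (ften dg 0 D G m (take n w, drop n w)))" for n unfolding cat1_ften
  proof (intro ideal_sum[OF N] idealD(6)[OF N])
   fix j
   have "take n w \<in> S" using S[of "take n w" "drop n w"] less.prems by simp
   then have "N (letters (D j (take n w)))" using L[of "take n w" j] by (cases "take n w = []") (simp_all add: D0 idealD(1)[OF N] del: take_eq_Nil)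
   then show "N (fcat (letters (D j (take n w))) (G (m - j) (drop n w)))" by (rule idealD(3)[OF N])
  qed
  moreover have "N (fext cat1 (Z m (take n w, drop n w)))" for n using Z less.prems by simp
  ultimately show ?thesis unfolding fne_expand[OF D ne False] by (intro ideal_sum[OF N]) (simp add: frag_extend_add idealD(5)[OF N])
 qed
qed

lemma fne_opcomp: "fne X ==> fne Y ==> fne (opcomp k X Y)" unfolding fne_def opcomp_def
proof (intro allI impI notI)
 fix m w
 assume X: "\<forall>m w. w ~= [] --> [] \<notin> fkeys (X m w)" and Y: "\<forall>m w. w ~= [] --> [] \<notin> fkeys (Y m w)"
  and w: "w ~= []" and k: "[] \<in> fkeys (\<Sum>i\<le>m. fsg (int i * k) (fext (X i) (Y (m - i) w)))"
 obtain i where "[] \<in> fkeys (fsg (int i * k) (fext (X i) (Y (m - i) w)))" using subsetD[OF keys_sum k] by (rule UN_E)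
 then have k': "[] \<in> fkeys (fext (X i) (Y (m - i) w))" by (auto simp: fsg_def split: if_splits)
 obtain b where "b \<in> fkeys (Y (m - i) w)" "[] \<in> fkeys (X i b)" using subsetD[OF keys_frag_extend k'] by (rule UN_E)
 moreover from this(1) have "b ~= []" using Y w by blast
 ultimately show False using X by blast
qed

lemma fne_diff: "fne X ==> fne Y ==> fne (%m b. X m b - Y m b)" unfolding fne_def using keys_diff by fastforce

lemma fne_add: "fne X ==> fne Y ==> fne (%m b. X m b + Y m b)" unfolding fne_def using keys_add by fastforce

lemma fne_fsg: "fne X ==> fne (%m b. fsg k (X m b))" unfolding fne_def by (simp add: fsg_def)

lemma fne_shift: "fne X ==> fne (fshift r X)" unfolding fne_def fshift_def by simp

text \<open>The letter criterion is used twice. The commutator of G stands in the right factor of a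
  cross term, so it must vanish as a whole, which the criterion provides; for the commutator of F,
  in the left factor, the one-letter part suffices. The criterion then applies to the defect
  itself.\<close>

theorem hdefect_null:
 fixes dA :: "('x list, 'x list) fop" and dB :: "('y list, 'y list) fop"
 assumes N: "ideal N" and S: "!!u v. u @ v \<in> S ==> u \<in> S \<and> v \<in> S"
  and dA: "coder_op dgA (0, 1) fid fid dA" and dB: "coder_op dgB (0, 1) fid fid dB" and dA_hom: "fhom dgA dgA (0, 1) dA"
  and F: "coalg_op dgA F" and F_hom: "fhom dgA dgB 0 F" and G: "coalg_op dgA G" and G_hom: "fhom dgA dgB 0 G"
  and K: "coder_op dgA (rshift r) F G K" and K_hom: "fhom dgA dgB (rshift r) K"
  and ne: "fne dA" "fne dB" "fne F" "fne G" "fne K"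
  and nil: "!!m. dA m [] = 0" "!!m. dB m [] = 0" "!!m. F m [] = fid m []" "!!m. G m [] = fid m []" "!!m. K m [] = 0"
  and cF: "!!m w. w \<in> S ==> w ~= [] ==> N (letters (commut dA dB F m w))"
  and cG: "!!m w. w \<in> S ==> w ~= [] ==> N (letters (commut dA dB G m w))"
  and L: "!!m w. w \<in> S ==> w ~= [] ==> N (letters (hdefect r dA dB F G K m w))"
 shows "w \<in> S ==> N (hdefect r dA dB F G K m w)"
proof -
 have fid0: "letters (fid m []) = 0" for m by (simp add: fid_def letters_def)
 have comm_nil: "commut dA dB H m [] = 0" if "!!m. H m [] = fid m []" for H :: "('x list, 'y list) fop" and m
  using that by (simp add: commut_def opcomp_def nil fid_def) (intro sum.neutral, auto simp: fid_def nil)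
 have comm: "w \<in> S ==> N (commut dA dB H m w)" if "coalg_op dgA H" "fhom dgA dgB 0 H" "fne H" "!!m. H m [] = fid m []"
   "!!m w. w \<in> S ==> w ~= [] ==> N (letters (commut dA dB H m w))" for H w m
 proof (rule null_from_letters[OF N S, where Z = "%m b. 0"])
  show "dcompat (commut dA dB H) (%m b. ften dgA (0, 1) H (commut dA dB H) m b + ften dgA 0 (commut dA dB H) H m b + 0)"
   using commut_coder[OF dA dB dA_hom that(1,2)] by (simp add: coder_op_def)
  show "fne (commut dA dB H)" unfolding commut_def[abs_def] by (intro fne_diff fne_opcomp that ne)
 qed (use that comm_nil fid0 idealD[OF N] in auto)
 have defect_nil: "hdefect r dA dB F G K m [] = 0" for m by (simp add: hdefect_def opcomp_def nil fshift_def)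
 have cK: "N (fext cat1 (fsg (int r) (ften dgA (rshift r) (commut dA dB F) K m (u, v))
   - ften dgA (0, 1) K (commut dA dB G) m (u, v)))" if uv: "u @ v \<in> S" for m u v
 proof -
  have 1: "N (fext cat1 (ften dgA (rshift r) (commut dA dB F) K m (u, v)))" unfolding cat1_ften
  proof (intro ideal_sum[OF N] idealD(6)[OF N] idealD(3)[OF N])
   show "N (letters (commut dA dB F j u))" for j using cF S[OF uv] comm_nil[of F, OF nil(3)] by (cases "u = []") (simp_all add: idealD(1)[OF N])
  qed
  have 2: "N (fext cat1 (ften dgA (0, 1) K (commut dA dB G) m (u, v)))" unfolding cat1_ften using comm[OF G G_hom ne(4) nil(4) cG] S[OF uv]
   by (intro ideal_sum[OF N] idealD(6)[OF N] idealD(4)[OF N]) auto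
  show ?thesis using 1 2 by (simp add: frag_extend_diff idealD[OF N])
 qed
 show "w \<in> S ==> N (hdefect r dA dB F G K m w)"
 proof (rule null_from_letters[OF N S hdefect_coder[OF dA dB dA_hom F F_hom G K K_hom]])
  show "fne (hdefect r dA dB F G K)" unfolding hdefect_def[abs_def] by (intro fne_diff fne_add fne_fsg fne_shift fne_opcomp ne)
  show "letters (F m []) = 0" for m by (simp add: nil fid0)
 qed (use defect_nil L cK in auto)
qed

section \<open>Block formulas for coalgebra morphisms, coderivations and codifferentials\<close>

section \<open>Decompositions of words\<close>

text \<open>Indexes the summands of F_p on w: the blocks are the arguments of the maps Psi(f_{p_k
  q_k}), and the attached numbers are the indices p_k.\<close>

definition decs :: "nat => 'x list => (nat \<times> 'x list) list set" where
 "decs p w = {D. concat (map snd D) = w \<and> sum_list (map fst D) = p \<and> [] \<notin> set (map snd D)}"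

lemma finite_decs: "finite (decs p w)"
proof -
 have l: "length D \<le> length (concat (map snd D))" if "[] \<notin> set (map snd D)" for D :: "(nat \<times> 'a list) list" using that
 proof (induct D)
  case (Cons x D)
  then have "1 \<le> length (snd x)" by (cases "snd x") auto
  moreover have "length D \<le> length (concat (map snd D))" using Cons by simp
  ultimately show ?case by simp
 qed simp
 let ?B = "{b. set b \<subseteq> set w \<and> length b \<le> length w}"
 have "decs p w \<subseteq> {D. set D \<subseteq> {..p} \<times> ?B \<and> length D \<le> length w}"
 proof
  fix D assume D: "D \<in> decs p w"
  have "x \<in> {..p} \<times> ?B" if x: "x \<in> set D" for x
  proof -
   obtain D1 D2 where "D = D1 @ x # D2" using x by (auto simp: in_set_conv_decomp)
   then show ?thesis using D by (cases x) (auto simp: decs_def)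
  qed
  then show "D \<in> {D. set D \<subseteq> {..p} \<times> ?B \<and> length D \<le> length w}" using D l by (auto simp: decs_def)
 qed
 moreover have "finite ({..p} \<times> ?B)" by (simp add: finite_lists_length_le)
 ultimately show ?thesis using finite_subset[OF _ finite_lists_length_le] by blast
qed

lemma decs_Nil [simp]: "decs p [] = (if p = 0 then {[]} else {})"
proof -
 have "D = []" if "D \<in> decs p []" for D using that by (cases D) (auto simp: decs_def)
 then have "decs p [] \<subseteq> {[]}" by blast
 then show ?thesis by (auto simp: decs_def)
qed

text \<open>A decomposition with a cut between its blocks is the same as a cut of w, a splitting of
  p, and decompositions of both pieces; empty pieces occur on both sides.\<close>

lemma sum_decs_split: "(\<Sum>D\<in>decs p w. \<Sum>n\<le>length D. T (take n D) (drop n D)) =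
 (\<Sum>n\<le>length w. \<Sum>j\<le>p. \<Sum>D1\<in>decs j (take n w). \<Sum>D2\<in>decs (p - j) (drop n w). T D1 D2)"
proof -
 have "(\<Sum>D\<in>decs p w. \<Sum>n\<le>length D. T (take n D) (drop n D)) =
   (\<Sum>(D, n)\<in>(SIGMA D:decs p w. {..length D}). T (take n D) (drop n D))"
  by (simp add: sum.Sigma finite_decs)
 also have "\<dots> = (\<Sum>(n, j, D1, D2)\<in>(SIGMA n:{..length w}. SIGMA j:{..p}. SIGMA D1:decs j (take n w). decs (p - j) (drop n w)). T D1 D2)"
 proof (rule sum.reindex_bij_witness[of _ "%(n, j, D1, D2). (D1 @ D2, length D1)"
    "%(D, n). (length (concat (map snd (take n D))), sum_list (map fst (take n D)), take n D, drop n D)"])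
  fix a assume "a \<in> (SIGMA D:decs p w. {..length D})"
  then obtain D n where a: "a = (D, n)" "D \<in> decs p w" "n \<le> length D" by auto
  let ?u = "concat (map snd (take n D))" and ?v = "concat (map snd (drop n D))"
  have w: "w = ?u @ ?v" using a(2) by (simp add: decs_def flip: concat_append map_append)
  have p: "p = sum_list (map fst (take n D)) + sum_list (map fst (drop n D))" using a(2) by (simp add: decs_def flip: sum_list_append map_append)
  have t: "take (length ?u) w = ?u" "drop (length ?u) w = ?v" unfolding w by simp_all
  have l: "length ?u \<le> length w" unfolding w by simp
  show "(case a of (D, n) => (length (concat (map snd (take n D))), sum_list (map fst (take n D)), take n D, drop n D))
    \<in> (SIGMA n:{..length w}. SIGMA j:{..p}. SIGMA D1:decs j (take n w). decs (p - j) (drop n w))"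
   using l t p a(2) by (auto simp: a(1) decs_def dest: in_set_takeD in_set_dropD)
 qed (auto simp: decs_def image_Un del: imageE)
 finally show ?thesis by (simp add: sum.Sigma finite_decs finite_SigmaI)
qed

text \<open>Koszul exponent of a tensor product of maps of bidegrees \<open>- dsh p\<close>: every
  block is passed by all later maps.\<close>

fun dec_sign :: "(nat \<times> 'x word) list => int" where "dec_sign [] = 0"
| "dec_sign ((p, b) # D) = bipair (- dsh (sum_list (map fst D))) (wdeg b) + dec_sign D"

lemma dec_sign_append: "dec_sign (D @ E) = dec_sign D + dec_sign E + bipair (- dsh (sum_list (map fst E))) (wdeg (concat (map snd D)))"
 by (induct D rule: dec_sign.induct) auto

definition bword :: "(nat => 'x word => 'y) => (nat \<times> 'x word) list => 'y word" where
 "bword \<phi> D = map (%(p, b). (wdeg b - dsh p, \<phi> p b)) D"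

lemma bword_simps [simp]: "bword \<phi> [] = []" "length (bword \<phi> D) = length D"
 "bword \<phi> ((p, b) # D) = (wdeg b - dsh p, \<phi> p b) # bword \<phi> D"
 "bword \<phi> (D @ E) = bword \<phi> D @ bword \<phi> E"
 "take n (bword \<phi> D) = bword \<phi> (take n D)" "drop n (bword \<phi> D) = bword \<phi> (drop n D)"
 by (auto simp: bword_def take_map drop_map)

lemma wdeg_bword: "wdeg (bword \<phi> D) = wdeg (concat (map snd D)) - dsh (sum_list (map fst D))" by (induct D) auto



definition coalg_fop :: "(nat => 'x word => 'y) => ('x word, 'y word) fop" where
 "coalg_fop \<phi> p w = (\<Sum>D\<in>decs p w. fsg (dec_sign D) (frag_of (bword \<phi> D)))"

text \<open>The word that pi extracts from a word of triples when it marks position s: \<phi> gives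
  the letters to the left, \<kappa> the marked letter, \<gamma> those to the right.\<close>

definition mword :: "nat => (nat => 'x word => 'y) => (nat => 'x word => 'y) => (nat => 'x word => 'y) =>
  (nat \<times> 'x word) list => nat => 'y word" where
 "mword r \<phi> \<kappa> \<gamma> D s = bword \<phi> (take s D)
  @ (wdeg (snd (D ! s)) - dsh (fst (D ! s)) + rshift r, \<kappa> (fst (D ! s)) (snd (D ! s)))
  # bword \<gamma> (drop (Suc s) D)"

text \<open>The additional sign is that of a map of bidegree (r, r-1) passing the letters already
  produced on its left, as pi is applied after H.\<close>

definition coder_fop :: "nat => (nat => 'x word => 'y) => (nat => 'x word => 'y) => (nat => 'x word => 'y) => ('x word, 'y word) fop" where
 "coder_fop r \<phi> \<kappa> \<gamma> p w = (\<Sum>D\<in>decs p w. \<Sum>s<length D.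
  fsg (dec_sign D + bipair (rshift r) (wdeg (bword \<phi> (take s D)))) (frag_of (mword r \<phi> \<kappa> \<gamma> D s)))"

lemma coalg_fop_Nil [simp]: "coalg_fop \<phi> p [] = fid p []" by (simp add: coalg_fop_def fid_def)

lemma coder_fop_Nil [simp]: "coder_fop r \<phi> \<kappa> \<gamma> p [] = 0" by (simp add: coder_fop_def)

lemma take_marked: "s < length D ==> n \<le> length D ==> take n (mword r \<phi> \<kappa> \<gamma> D s) =
  (if n \<le> s then bword \<phi> (take n D) else mword r \<phi> \<kappa> \<gamma> (take n D) s)"
proof (cases "n \<le> s")
 case False
 then obtain k where "n = Suc (s + k)" by (metis not_less_eq_eq less_imp_Suc_add not_le)
 moreover assume "s < length D" "n \<le> length D"
 ultimately show ?thesis by (simp add: mword_def min_def drop_take)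
qed (simp add: mword_def min_def)

lemma drop_marked: "s < length D ==> n \<le> length D ==> drop n (mword r \<phi> \<kappa> \<gamma> D s) =
  (if n \<le> s then mword r \<phi> \<kappa> \<gamma> (drop n D) (s - n) else bword \<gamma> (drop n D))"
proof (cases "n \<le> s")
 case False
 then obtain k where "n = Suc (s + k)" by (metis not_less_eq_eq less_imp_Suc_add not_le)
 moreover assume "s < length D" "n \<le> length D"
 ultimately show ?thesis by (simp add: mword_def add.commute)
qed (simp add: mword_def drop_take Suc_diff_le)

lemma length_marked [simp]: "s < length D ==> length (mword r \<phi> \<kappa> \<gamma> D s) = length D" by (simp add: mword_def)

text \<open>For arbitrary letter functions: the Koszul exponent of a concatenated decomposition
  splits exactly as the exponent in \<open>ften\<close> requires.\<close>

lemma coalg_fop_coalg: "coalg_op wdeg (coalg_fop \<phi>)" unfolding coalg_op_def dcompat_def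
proof (intro allI)
 fix p w
 let ?T = "%D1 D2. fsg (dec_sign (D1 @ D2)) (frag_of (bword \<phi> D1, bword \<phi> D2))"
 have "fext fdec (coalg_fop \<phi> p w) = (\<Sum>D\<in>decs p w. \<Sum>n\<le>length D. ?T (take n D) (drop n D))"
  by (simp add: coalg_fop_def frag_extend_sum' fdec_def fsg_sum)
 also have "\<dots> = (\<Sum>n\<le>length w. \<Sum>j\<le>p. \<Sum>D1\<in>decs j (take n w). \<Sum>D2\<in>decs (p - j) (drop n w). ?T D1 D2)"
  by (rule sum_decs_split)
 also have "\<dots> = (\<Sum>n\<le>length w. \<Sum>j\<le>p. \<Sum>D1\<in>decs j (take n w). \<Sum>D2\<in>decs (p - j) (drop n w).
   fsg (bipair (- dsh (p - j)) (wdeg (take n w)) + (dec_sign D1 + dec_sign D2)) (frag_of (bword \<phi> D1, bword \<phi> D2)))"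
  by (intro sum.cong refl) (simp add: dec_sign_append decs_def add_ac)
 also have "\<dots> = fext (ften wdeg 0 (coalg_fop \<phi>) (coalg_fop \<phi>) p) (fdec w)"
 proof -
  have a: "fsg k (fpair (coalg_fop \<phi> j u) (coalg_fop \<phi> i v)) = (\<Sum>D1\<in>decs j u. \<Sum>D2\<in>decs i v.
    fsg (k + (dec_sign D1 + dec_sign D2)) (frag_of (bword \<phi> D1, bword \<phi> D2)))" for k i j u v
   by (simp add: coalg_fop_def fpair_sum fsg_sum add.commute) (subst sum.swap, simp add: add_ac)
  show ?thesis unfolding fdec_def frag_extend_sum' frag_extend_of ften_def prod.case a by simp
 qed
 finally show "fext fdec (coalg_fop \<phi> p w) = fext (ften wdeg 0 (coalg_fop \<phi>) (coalg_fop \<phi>) p) (fdec w)" .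
qed

text \<open>A cut behind the marked block contributes to K \<otimes> G, a cut in front of it to F
  \<otimes> K. In the second case the marked map also passes the outputs of the first piece, of
  weight j; the drop of their degree pairs with (r, r-1) to j(2r-1), which modulo 2 is the index
  sign of the enriched tensor product.\<close>

lemma coder_fop_coder: "coder_op wdeg (rshift r) (coalg_fop \<phi>) (coalg_fop \<gamma>) (coder_fop r \<phi> \<kappa> \<gamma>)"
 unfolding coder_op_def dcompat_def
proof (intro allI)
 fix p :: nat and w :: "'a word"
 let ?m = "mword r \<phi> \<kappa> \<gamma>"
 let ?s = "%D s. bipair (rshift r) (wdeg (bword \<phi> (take s D)))"
 let ?A = "%D1 D2. \<Sum>s<length D2. fsg (dec_sign (D1 @ D2) + ?s (D1 @ D2) (length D1 + s)) (frag_of (bword \<phi> D1, ?m D2 s))"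
 let ?B = "%D1 D2. \<Sum>s<length D1. fsg (dec_sign (D1 @ D2) + ?s D1 s) (frag_of (?m D1 s, bword \<gamma> D2))"
 have split: "(\<Sum>s<length D. fsg (dec_sign D + ?s D s) (frag_of (take n (?m D s), drop n (?m D s))))
   = ?A (take n D) (drop n D) + ?B (take n D) (drop n D)" if n: "n \<le> length D" for n D
 proof -
  let ?f = "%s. fsg (dec_sign D + ?s D s) (frag_of (take n (?m D s), drop n (?m D s)))"
  have "(\<Sum>s<length D. ?f s) = (\<Sum>s<n. ?f s) + (\<Sum>s=n..<length D. ?f s)"
   using sum.atLeastLessThan_concat[of 0 n "length D" ?f] n by (simp add: atLeast0LessThan)
  also have "(\<Sum>s<n. ?f s) = ?B (take n D) (drop n D)"
  proof (rule sum.cong)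
   fix s assume "s \<in> {..<length (take n D)}"
   then have "s < length D" "\<not> n \<le> s" "take s (take n D) = take s D" using n by auto
   then show "?f s = fsg (dec_sign (take n D @ drop n D) + ?s (take n D) s) (frag_of (?m (take n D) s, bword \<gamma> (drop n D)))"
    using n by (simp add: take_marked drop_marked)
  qed (use n in auto)
  also have "(\<Sum>s=n..<length D. ?f s) = ?A (take n D) (drop n D)"
   using n by (intro sum.reindex_bij_witness[of _ "%s. s + n" "%s. s - n"])
    (auto simp: take_marked drop_marked min_def add.commute)
  finally show ?thesis by (simp add: add.commute)
 qed
 have "fext fdec (coder_fop r \<phi> \<kappa> \<gamma> p w) = (\<Sum>D\<in>decs p w. \<Sum>s<length D. \<Sum>n\<le>length D.
    fsg (dec_sign D + ?s D s) (frag_of (take n (?m D s), drop n (?m D s))))"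
  by (simp add: coder_fop_def frag_extend_sum' fdec_def fsg_sum)
 also have "\<dots> = (\<Sum>D\<in>decs p w. \<Sum>n\<le>length D. ?A (take n D) (drop n D) + ?B (take n D) (drop n D))"
 proof (rule sum.cong[OF refl], goal_cases)
  case (1 D)
  show ?case by (subst sum.swap) (rule sum.cong[OF refl], rule split, simp)
 qed
 also have "\<dots> = (\<Sum>n\<le>length w. \<Sum>j\<le>p. \<Sum>D1\<in>decs j (take n w). \<Sum>D2\<in>decs (p - j) (drop n w). ?A D1 D2 + ?B D1 D2)"
  by (rule sum_decs_split)
 also have "\<dots> = (\<Sum>n\<le>length w. \<Sum>j\<le>p. \<Sum>D1\<in>decs j (take n w). \<Sum>D2\<in>decs (p - j) (drop n w).
   (\<Sum>s<length D2. fsg (- int j + bipair (rshift r - dsh (p - j)) (wdeg (take n w)) + (dec_sign D1 + (dec_sign D2 + ?s D2 s)))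
     (frag_of (bword \<phi> D1, ?m D2 s))) +
   (\<Sum>s<length D1. fsg (bipair (- dsh (p - j)) (wdeg (take n w)) + ((dec_sign D1 + ?s D1 s) + dec_sign D2))
     (frag_of (?m D1 s, bword \<gamma> D2))))"
 proof (intro sum.cong refl arg_cong2[where f = "(+)"] fsg_cong)
  fix n j D1 D2 s
  assume D: "D1 \<in> decs j (take n w)" "D2 \<in> decs (p - j) (drop n w)"
  have "bipair (rshift r) (dsh j) = int j * (2 * int r - 1)" by (simp add: bipair_def rshift_def dsh_def algebra_simps)
  then show "even (dec_sign (D1 @ D2) + ?s (D1 @ D2) (length D1 + s) -
    (- int j + bipair (rshift r - dsh (p - j)) (wdeg (take n w)) + (dec_sign D1 + (dec_sign D2 + ?s D2 s))))"
   using D by (simp add: dec_sign_append decs_def wdeg_bword algebra_simps)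
  show "even (dec_sign (D1 @ D2) + ?s D1 s - (bipair (- dsh (p - j)) (wdeg (take n w)) + (dec_sign D1 + ?s D1 s + dec_sign D2)))"
   using D by (simp add: dec_sign_append decs_def)
 qed
 also have "\<dots> = fext (%b. ften wdeg (rshift r) (coalg_fop \<phi>) (coder_fop r \<phi> \<kappa> \<gamma>) p b +
   ften wdeg 0 (coder_fop r \<phi> \<kappa> \<gamma>) (coalg_fop \<gamma>) p b) (fdec w)"
 proof -
  have a: "fsg k (fpair (coalg_fop \<phi> j u) (coder_fop r \<phi> \<kappa> \<gamma> i v)) = (\<Sum>D1\<in>decs j u. \<Sum>D2\<in>decs i v. \<Sum>s<length D2.
    fsg (k + (dec_sign D1 + (dec_sign D2 + ?s D2 s))) (frag_of (bword \<phi> D1, ?m D2 s)))" for k i j u v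
   unfolding coalg_fop_def fpair_sum(1) unfolding coder_fop_def fpair_sum(2) fsg_sum by (simp add: add_ac)
  have b: "fsg k (fpair (coder_fop r \<phi> \<kappa> \<gamma> j u) (coalg_fop \<gamma> i v)) = (\<Sum>D1\<in>decs j u. \<Sum>D2\<in>decs i v. \<Sum>s<length D1.
    fsg (k + ((dec_sign D1 + ?s D1 s) + dec_sign D2)) (frag_of (?m D1 s, bword \<gamma> D2)))" for k i j u v
   unfolding coder_fop_def fpair_sum(1) unfolding coalg_fop_def fpair_sum(2) fsg_sum by (rule sum.cong[OF refl], subst sum.swap) (simp add: add_ac)
  show ?thesis unfolding fdec_def frag_extend_sum' frag_extend_of ften_def prod.case a b by (simp add: sum.distrib)
 qed
 finally show "fext fdec (coder_fop r \<phi> \<kappa> \<gamma> p w) = fext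
   (%b. ften wdeg (rshift r) (coalg_fop \<phi>) (coder_fop r \<phi> \<kappa> \<gamma>) p b + ften wdeg 0 (coder_fop r \<phi> \<kappa> \<gamma>) (coalg_fop \<gamma>) p b) (fdec w)" .
qed

section \<open>Insertions\<close>

text \<open>Insertions into a word of length n: s letters stay in front and a letters are
  consumed.\<close>

definition insert_set :: "nat => (nat \<times> nat) set" where "insert_set n = {(s, a). 1 \<le> a \<and> s + a \<le> n}"

lemma finite_insert_set [simp]: "finite (insert_set n)" by (rule finite_subset[of _ "{..n} \<times> {..n}"]) (auto simp: insert_set_def)

definition iword :: "bideg => ('x word => 'x) => 'x word => nat => nat => 'x word" where
 "iword e \<delta> w s a = take s w @ (wdeg (take a (drop s w)) + e, \<delta> (take a (drop s w))) # drop (s + a) w"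

definition insert_fop :: "(nat => 'x word => 'x) => ('x word, 'x word) fop" where
 "insert_fop \<delta> i w = (\<Sum>(s, a)\<in>insert_set (length w). fsg (bipair ((0, 1) - dsh i) (wdeg (take s w)))
  (frag_of (iword ((0, 1) - dsh i) (\<delta> i) w s a)))"

lemma insert_fop_Nil [simp]: "insert_fop \<delta> i [] = 0"
proof -
 have "insert_set 0 = {}" by (auto simp: insert_set_def)
 then show ?thesis by (simp add: insert_fop_def)
qed

text \<open>No cut passes through the inserted letter: cuts in front of it give the terms with the
  identity on the left, cuts behind it those with the identity on the right.\<close>

lemma insert_fop_coder: "coder_op wdeg (0, 1) fid fid (insert_fop \<delta>)" unfolding coder_op_def dcompat_def
proof (intro allI)
 fix i :: nat and w :: "'a word"
 let ?e = "(0, 1) - dsh i" and ?l = "length w"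
 let ?iw = "iword ?e (\<delta> i)"
 have len: "length (?iw w s a) = Suc (?l - a)" if "(s, a) \<in> insert_set ?l" for s a using that by (auto simp: iword_def insert_set_def)
 have shift: "fsg (bipair ?e (wdeg (take n w)) + bipair ?e (wdeg (take (s - n) (drop n w)))) z =
   fsg (bipair ?e (wdeg (take s w))) z" if "n \<le> s" for n s z
 proof -
  have "take s w = take n w @ take (s - n) (drop n w)" using that by (metis le_add_diff_inverse take_add)
  then have "wdeg (take s w) = wdeg (take n w) + wdeg (take (s - n) (drop n w))" by simp
  then show ?thesis by (simp add: algebra_simps)
 qed
 have "fext fdec (insert_fop \<delta> i w) = (\<Sum>(s, a)\<in>insert_set ?l. \<Sum>n\<le>Suc (?l - a).
   fsg (bipair ?e (wdeg (take s w))) (frag_of (take n (?iw w s a), drop n (?iw w s a))))"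
  unfolding insert_fop_def frag_extend_sum' by (rule sum.cong) (auto simp: fdec_def fsg_sum len simp del: sum.atMost_Suc)
 also have "\<dots> = (\<Sum>(s, a)\<in>insert_set ?l. (\<Sum>n\<le>s. fsg (bipair ?e (wdeg (take s w))) (frag_of (take n w, ?iw (drop n w) (s - n) a)))
   + (\<Sum>n\<in>{s + a..?l}. fsg (bipair ?e (wdeg (take s w))) (frag_of (?iw (take n w) s a, drop n w))))"
 proof (rule sum.cong[OF refl], clarify)
  fix s a assume sa: "(s, a) \<in> insert_set ?l"
  let ?f = "%n. fsg (bipair ?e (wdeg (take s w))) (frag_of (take n (?iw w s a), drop n (?iw w s a)))"
  have "(\<Sum>n\<le>Suc (?l - a). ?f n) = (\<Sum>n\<in>{..s} \<union> {Suc s..Suc (?l - a)}. ?f n)"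
   using sa by (intro sum.cong) (auto simp: insert_set_def)
  also have "\<dots> = (\<Sum>n\<le>s. ?f n) + (\<Sum>n\<in>{Suc s..Suc (?l - a)}. ?f n)" by (rule sum.union_disjoint) auto
  also have "(\<Sum>n\<le>s. ?f n) = (\<Sum>n\<le>s. fsg (bipair ?e (wdeg (take s w))) (frag_of (take n w, ?iw (drop n w) (s - n) a)))"
   using sa by (intro sum.cong refl) (auto simp: iword_def insert_set_def min_def drop_take)
  \<comment> \<open>The inserted letter replaces a letters, so a cut at n behind it is the cut of w
    at n + a - 1.\<close>
  also have "(\<Sum>n\<in>{Suc s..Suc (?l - a)}. ?f n) =
    (\<Sum>n\<in>{s + a..?l}. fsg (bipair ?e (wdeg (take s w))) (frag_of (?iw (take n w) s a, drop n w)))"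
  proof (rule sum.reindex_bij_witness[of _ "%n. Suc n - a" "%n. n + a - 1"])
   fix n assume n: "n \<in> {Suc s..Suc (?l - a)}"
   define k where "k = n - Suc s"
   have k: "n = Suc (s + k)" using n by (simp add: k_def)
   have l: "s + a + k \<le> ?l" using n sa by (auto simp: k insert_set_def)
   have t: "take a (drop s (take (s + a + k) w)) = take a (drop s w)" "take s (take (s + a + k) w) = take s w" by (simp_all add: drop_take min_def)
   have "take n (?iw w s a) = ?iw (take (s + a + k) w) s a" unfolding iword_def t using l by (simp add: k drop_take)
   moreover have "drop n (?iw w s a) = drop (s + a + k) w" using l by (simp add: iword_def k add.commute)
   moreover have "n + a - 1 = s + a + k" using sa by (simp add: k)
   ultimately show "fsg (bipair ?e (wdeg (take s w))) (frag_of (?iw (take (n + a - 1) w) s a, drop (n + a - 1) w)) = ?f n" by simp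
  qed (use sa in \<open>auto simp: insert_set_def\<close>)
  finally show "(\<Sum>n\<le>Suc (?l - a). ?f n) =
    (\<Sum>n\<le>s. fsg (bipair ?e (wdeg (take s w))) (frag_of (take n w, ?iw (drop n w) (s - n) a))) +
    (\<Sum>n\<in>{s + a..?l}. fsg (bipair ?e (wdeg (take s w))) (frag_of (?iw (take n w) s a, drop n w)))" .
 qed
 also have "\<dots> = (\<Sum>((s, a), n)\<in>(SIGMA x:insert_set ?l. {..fst x}).
    fsg (bipair ?e (wdeg (take s w))) (frag_of (take n w, ?iw (drop n w) (s - n) a)))
   + (\<Sum>((s, a), n)\<in>(SIGMA x:insert_set ?l. {fst x + snd x..?l}).
    fsg (bipair ?e (wdeg (take s w))) (frag_of (?iw (take n w) s a, drop n w)))"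
  by (simp add: sum.distrib case_prod_beta sum.Sigma)
 also have "(\<Sum>((s, a), n)\<in>(SIGMA x:insert_set ?l. {..fst x}).
    fsg (bipair ?e (wdeg (take s w))) (frag_of (take n w, ?iw (drop n w) (s - n) a))) =
   (\<Sum>(n, s, a)\<in>(SIGMA n:{..?l}. insert_set (?l - n)).
    fsg (bipair ?e (wdeg (take n w)) + bipair ?e (wdeg (take s (drop n w)))) (frag_of (take n w, ?iw (drop n w) s a)))"
 proof (rule sum.reindex_bij_witness[of _ "%(n, s, a). ((n + s, a), n)" "%((s, a), n). (n, s - n, a)"])
 qed (auto simp: insert_set_def shift[simplified])
 also have "(\<Sum>((s, a), n)\<in>(SIGMA x:insert_set ?l. {fst x + snd x..?l}).
    fsg (bipair ?e (wdeg (take s w))) (frag_of (?iw (take n w) s a, drop n w))) =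
   (\<Sum>(n, s, a)\<in>(SIGMA n:{..?l}. insert_set n). fsg (bipair ?e (wdeg (take s (take n w)))) (frag_of (?iw (take n w) s a, drop n w)))"
  by (rule sum.reindex_bij_witness[of _ "%(n, s, a). ((s, a), n)" "%((s, a), n). (n, s, a)"]) (auto simp: insert_set_def min_def)
 also have "(\<Sum>(n, s, a)\<in>(SIGMA n:{..?l}. insert_set (?l - n)).
    fsg (bipair ?e (wdeg (take n w)) + bipair ?e (wdeg (take s (drop n w)))) (frag_of (take n w, ?iw (drop n w) s a)))
   + (\<Sum>(n, s, a)\<in>(SIGMA n:{..?l}. insert_set n). fsg (bipair ?e (wdeg (take s (take n w)))) (frag_of (?iw (take n w) s a, drop n w)))
   = fext (%b. ften wdeg (0, 1) fid (insert_fop \<delta>) i b + ften wdeg 0 (insert_fop \<delta>) fid i b) (fdec w)"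
 proof -
  have a: "ften wdeg (0, 1) fid (insert_fop \<delta>) i (u, v) = (\<Sum>(s, a)\<in>insert_set (length v).
    fsg (bipair ?e (wdeg u) + bipair ?e (wdeg (take s v))) (frag_of (u, ?iw v s a)))" for u v
  proof -
   have "ften wdeg (0, 1) fid (insert_fop \<delta>) i (u, v) =
     (\<Sum>j\<le>i. if j = 0 then fsg (bipair ?e (wdeg u)) (fpair (frag_of u) (insert_fop \<delta> i v)) else 0)"
    unfolding ften_def prod.case by (rule sum.cong) (auto simp: fid_def)
   also have "\<dots> = fsg (bipair ?e (wdeg u)) (fpair (frag_of u) (insert_fop \<delta> i v))" by simp
   finally show ?thesis by (simp add: insert_fop_def fpair_sum fsg_sum case_prod_beta)
  qed
  have b: "ften wdeg 0 (insert_fop \<delta>) fid i (u, v) = (\<Sum>(s, a)\<in>insert_set (length u).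
    fsg (bipair ?e (wdeg (take s u))) (frag_of (?iw u s a, v)))" for u v
  proof -
   have "ften wdeg 0 (insert_fop \<delta>) fid i (u, v) = (\<Sum>j\<le>i. if j = i then fpair (insert_fop \<delta> i u) (frag_of v) else 0)"
    unfolding ften_def prod.case by (rule sum.cong) (auto simp: fid_def)
   also have "\<dots> = fpair (insert_fop \<delta> i u) (frag_of v)" by simp
   finally show ?thesis by (simp add: insert_fop_def fpair_sum case_prod_beta)
  qed
  show ?thesis unfolding fdec_def frag_extend_sum' frag_extend_of a b by (simp add: sum.Sigma sum.distrib)
 qed
 finally show "fext fdec (insert_fop \<delta> i w) =
   fext (%b. ften wdeg (0, 1) fid (insert_fop \<delta>) i b + ften wdeg 0 (insert_fop \<delta>) fid i b) (fdec w)" .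
qed


subsection \<open>Homogeneity, nonempty words and letters\<close>

lemma fsg_keys [simp]: "fkeys (fsg k x) = fkeys x" by (simp add: fsg_def)

lemma coalg_fop_keys:
 assumes "v \<in> fkeys (coalg_fop \<phi> p w)"
 obtains D where "D \<in> decs p w" "v = bword \<phi> D"
proof -
 obtain D where "D \<in> decs p w" "v \<in> fkeys (fsg (dec_sign D) (frag_of (bword \<phi> D)))"
  using subsetD[OF keys_sum assms[unfolded coalg_fop_def]] by (rule UN_E)
 then show ?thesis using that by simp
qed

lemma coder_fop_keys:
 assumes "v \<in> fkeys (coder_fop r \<phi> \<kappa> \<gamma> p w)"
 obtains D s where "D \<in> decs p w" "s < length D" "v = mword r \<phi> \<kappa> \<gamma> D s"
proof -
 obtain D where D: "D \<in> decs p w" "v \<in> fkeys (\<Sum>s<length D.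
  fsg (dec_sign D + bipair (rshift r) (wdeg (bword \<phi> (take s D)))) (frag_of (mword r \<phi> \<kappa> \<gamma> D s)))"
  using subsetD[OF keys_sum assms[unfolded coder_fop_def]] by (rule UN_E)
 obtain s where "s \<in> {..<length D}" "v \<in> fkeys
  (fsg (dec_sign D + bipair (rshift r) (wdeg (bword \<phi> (take s D)))) (frag_of (mword r \<phi> \<kappa> \<gamma> D s)))"
  using subsetD[OF keys_sum D(2)] by (rule UN_E)
 then show ?thesis using that D(1) by simp
qed

lemma insert_fop_keys:
 assumes "v \<in> fkeys (insert_fop \<delta> i w)"
 obtains s a where "(s, a) \<in> insert_set (length w)" "v = iword ((0, 1) - dsh i) (\<delta> i) w s a"
proof -
 obtain x where "x \<in> insert_set (length w)" "v \<in> fkeys (case x of (s, a) =>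
   fsg (bipair ((0, 1) - dsh i) (wdeg (take s w))) (frag_of (iword ((0, 1) - dsh i) (\<delta> i) w s a)))"
  using subsetD[OF keys_sum assms[unfolded insert_fop_def]] by (rule UN_E)
 then show ?thesis using that by (cases x) simp
qed

lemma wdeg_marked: "s < length D ==> wdeg (mword r \<phi> \<kappa> \<gamma> D s) = wdeg (concat (map snd D)) - dsh (sum_list (map fst D)) + rshift r"
proof -
 assume s: "s < length D"
 then have D: "D = take s D @ D ! s # drop (Suc s) D" by (simp add: id_take_nth_drop)
 have "concat (map snd D) = concat (map snd (take s D)) @ snd (D ! s) @ concat (map snd (drop (Suc s) D))"
  "sum_list (map fst D) = sum_list (map fst (take s D)) + (fst (D ! s) + sum_list (map fst (drop (Suc s) D)))"
  by (subst D, simp)+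
 then show ?thesis by (simp add: mword_def wdeg_bword algebra_simps)
qed

lemma coalg_fop_hom: "fhom wdeg wdeg 0 (coalg_fop \<phi>)" by (auto simp: fhom_def decs_def wdeg_bword elim!: coalg_fop_keys)

lemma coder_fop_hom: "fhom wdeg wdeg (rshift r) (coder_fop r \<phi> \<kappa> \<gamma>)"
 by (auto simp: fhom_def decs_def wdeg_marked elim!: coder_fop_keys)

lemma word_split3: "s + a \<le> length w ==> w = take s w @ take a (drop s w) @ drop (s + a) w" by (metis append_take_drop_id drop_drop add.commute)

lemma wdeg_iword: "s + a \<le> length w ==> wdeg (iword e \<delta> w s a) = wdeg w + e"
 by (subst (2) word_split3) (simp_all add: iword_def algebra_simps)

lemma insert_fop_hom: "fhom wdeg wdeg (0, 1) (insert_fop \<delta>)" by (auto simp: fhom_def insert_set_def wdeg_iword elim!: insert_fop_keys)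

lemma decs_nonempty: "D \<in> decs p w ==> w ~= [] ==> D ~= []" by (auto simp: decs_def)

lemma fne_fops: "fne (coalg_fop \<phi>)" "fne (coder_fop r \<phi> \<kappa> \<gamma>)" "fne (insert_fop \<delta>)"
proof -
 show "fne (coalg_fop \<phi>)" unfolding fne_def
 proof (intro allI impI notI)
  fix m and w :: "'a word" assume "w ~= []" "[] \<in> fkeys (coalg_fop \<phi> m w)"
  then show False by (elim coalg_fop_keys) (auto dest: decs_nonempty simp: bword_def)
 qed
 show "fne (coder_fop r \<phi> \<kappa> \<gamma>)" unfolding fne_def by (auto elim!: coder_fop_keys simp: mword_def)
 show "fne (insert_fop \<delta>)" unfolding fne_def by (auto elim!: insert_fop_keys simp: iword_def)
qed

lemma letters_fsg [simp]: "letters (fsg k x) = fsg k (letters x)" by (simp add: letters_def)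

lemma letters_linear: "letters (x + y) = letters x + letters y" "letters (x - y) = letters x - letters y"
 "letters (sum f S) = (\<Sum>s\<in>S. letters (f s))"
 by (simp_all add: letters_def frag_extend_add frag_extend_diff frag_extend_sum')

lemma letters_of: "letters (frag_of a) = (if length a = 1 then frag_of a else 0)" by (simp add: letters_def)

lemma decs_single:
 assumes "w ~= []" shows "D \<in> decs p w \<and> length D = 1 \<longleftrightarrow> D = [(p, w)]"
 using assms by (auto simp: decs_def length_Suc_conv)

lemma sum_decs_single:
 assumes "w ~= []" shows "(\<Sum>D\<in>decs p w. if length D = 1 then f D else 0) = f [(p, w)]"
proof -
 have "(\<Sum>D\<in>decs p w. if length D = 1 then f D else 0) = sum f {D \<in> decs p w. length D = 1}" by (simp add: sum.inter_filter finite_decs)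
 also have "{D \<in> decs p w. length D = 1} = {[(p, w)]}" using decs_single[OF assms] by blast
 finally show ?thesis by simp
qed

text \<open>Only the decomposition with the single block w yields one letter, and its Koszul
  exponent is 0.\<close>

lemma letters_coalg_fop:
 assumes "w ~= []" shows "letters (coalg_fop \<phi> p w) = frag_of [(wdeg w - dsh p, \<phi> p w)]"
proof -
 have "letters (coalg_fop \<phi> p w) = (\<Sum>D\<in>decs p w. if length D = 1 then fsg (dec_sign D) (frag_of (bword \<phi> D)) else 0)"
  unfolding coalg_fop_def letters_linear letters_fsg letters_of by (intro sum.cong refl) simp
 then show ?thesis using sum_decs_single[OF assms, of "%D. fsg (dec_sign D) (frag_of (bword \<phi> D))" p] by simp
qed

lemma letters_coder_fop:
 assumes "w ~= []" shows "letters (coder_fop r \<phi> \<kappa> \<gamma> p w) = frag_of [(wdeg w - dsh p + rshift r, \<kappa> p w)]"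
proof -
 let ?f = "%D. \<Sum>s<length D. fsg (dec_sign D + bipair (rshift r) (wdeg (bword \<phi> (take s D))))
   (frag_of (mword r \<phi> \<kappa> \<gamma> D s))"
 have "letters (coder_fop r \<phi> \<kappa> \<gamma> p w) = (\<Sum>D\<in>decs p w. if length D = 1 then ?f D else 0)"
  unfolding coder_fop_def letters_linear letters_fsg letters_of by (intro sum.cong refl) auto
 then show ?thesis using sum_decs_single[OF assms, of ?f p] by (simp add: mword_def)
qed

text \<open>One letter remains only if the insertion consumes the whole word, with s = 0 and a =
  \<open>length w\<close>.\<close>

lemma letters_insert_fop:
 assumes "w ~= []" shows "letters (insert_fop \<delta> i w) = frag_of [(wdeg w + ((0, 1) - dsh i), \<delta> i w)]"
proof -
 let ?f = "%(s, a). fsg (bipair ((0, 1) - dsh i) (wdeg (take s w))) (frag_of (iword ((0, 1) - dsh i) (\<delta> i) w s a))"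
 have "letters (insert_fop \<delta> i w) = (\<Sum>x\<in>insert_set (length w). if x = (0, length w) then ?f x else 0)"
  unfolding insert_fop_def letters_linear
 proof (rule sum.cong[OF refl])
  fix x assume x: "x \<in> insert_set (length w)"
  obtain s a where xs: "x = (s, a)" by (cases x)
  from x have "length (iword ((0, 1) - dsh i) (\<delta> i) w s a) = 1 \<longleftrightarrow> (s, a) = (0, length w)"
   by (auto simp: xs insert_set_def iword_def)
  then show "letters (?f x) = (if x = (0, length w) then ?f x else 0)" by (auto simp: xs letters_of)
 qed
 moreover have "(0, length w) \<in> insert_set (length w)" using assms by (cases w) (auto simp: insert_set_def)
 ultimately show ?thesis by (simp add: iword_def)
qed

section \<open>Evaluation: from formal operators to actual maps\<close>

section \<open>Evaluation of formal sums\<close>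

text \<open>Integers act through \<open>add_pow\<close>. The lemmas require \<tau> to be total with
  values in the carrier, which is why generators that are invalid or of wrong degree are sent to
  zero in all applications.\<close>

definition fev :: "('r, 'm) module => ('b => 'm) => ('b \<Rightarrow>\<^sub>0 int) => 'm" where
 "fev M \<tau> x = finsum M (%b. add_pow M (Poly_Mapping.lookup x b) (\<tau> b)) (fkeys x)"

context
 fixes R :: "'r ring" and M :: "('r, 'm) module" and \<tau> :: "'b => 'm"
 assumes M: "module R M" and \<tau>: "!!b. \<tau> b \<in> carrier M"
begin

interpretation M: module R M by (rule M)

lemma add_pow_zero: "add_pow M (0 :: int) y = (zr M)" by (simp add: add_pow_def)

lemma fev_superset:
 assumes "finite F" "fkeys x \<subseteq> F"
 shows "fev M \<tau> x = finsum M (%b. add_pow M (Poly_Mapping.lookup x b) (\<tau> b)) F"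
 unfolding fev_def by (rule M.add.finprod_mono_neutral_cong_left)
  (use assms \<tau> in \<open>auto simp: in_keys_iff M.add.int_pow_closed add_pow_zero\<close>)

lemma fev_closed: "fev M \<tau> x \<in> carrier M"
 unfolding fev_def by (rule M.finsum_closed) (use \<tau> in \<open>auto simp: M.add.int_pow_closed\<close>)

lemma fev_add: "fev M \<tau> (x + y) = fev M \<tau> x \<oplus>\<^bsub>M\<^esub> fev M \<tau> y"
proof -
 let ?F = "fkeys x \<union> fkeys y"
 have "fev M \<tau> (x + y) = finsum M (%b. add_pow M (Poly_Mapping.lookup (x + y) b) (\<tau> b)) ?F"
  by (rule fev_superset) (auto dest: subsetD[OF keys_add])
 also have "\<dots> = finsum M (%b. add_pow M (Poly_Mapping.lookup x b) (\<tau> b) \<oplus>\<^bsub>M\<^esub> add_pow M (Poly_Mapping.lookup y b) (\<tau> b)) ?F"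
  by (rule M.finsum_cong') (use \<tau> in \<open>auto simp: lookup_add M.add.int_pow_mult M.add.int_pow_closed\<close>)
 also have "\<dots> = fev M \<tau> x \<oplus>\<^bsub>M\<^esub> fev M \<tau> y" using fev_superset[of ?F x] fev_superset[of ?F y] \<tau>
  by (simp add: M.finsum_addf M.add.int_pow_closed)
 finally show ?thesis .
qed

lemma fev_0: "fev M \<tau> 0 = (zr M)" by (simp add: fev_def)

lemma fev_of: "fev M \<tau> (frag_of b) = \<tau> b" using \<tau>[of b] by (simp add: fev_def M.add.int_pow_1)

lemma fev_minus: "fev M \<tau> (- x) = \<ominus>\<^bsub>M\<^esub> fev M \<tau> x"
 using fev_add[of "- x" x] by (intro M.minus_equality[symmetric]) (simp_all add: fev_0 fev_closed)

lemma fev_fsg: "fev M \<tau> (fsg k x) = sg M k (fev M \<tau> x)" by (simp add: fsg_def sg_def fev_minus)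

lemma fev_sum: "fev M \<tau> (sum f S) = finsum M (%s. fev M \<tau> (f s)) S"
proof (induct S rule: infinite_finite_induct)
 case (infinite S)
 then show ?case by (simp add: fev_0 finsum_def finprod_def)
next
 case (insert s S)
 then show ?case by (simp add: fev_add fev_closed Pi_def)
qed (simp add: fev_0)

lemma fev_diff_eq_0: "fev M \<tau> (x - y) = (zr M) \<longleftrightarrow> fev M \<tau> x = fev M \<tau> y"
proof -
 have "fev M \<tau> x = fev M \<tau> (x - y) \<oplus>\<^bsub>M\<^esub> fev M \<tau> y" using fev_add[of "x - y" y] by simp
 moreover have "fev M \<tau> (x - y) = fev M \<tau> x \<oplus>\<^bsub>M\<^esub> \<ominus>\<^bsub>M\<^esub> fev M \<tau> y"
  using fev_add[of x "- y"] by (simp add: fev_minus)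
 ultimately show ?thesis using fev_closed by (auto simp: M.r_neg)
qed

lemma fev_cong:
 assumes "!!b. b \<in> fkeys x ==> \<tau>' b = \<tau> b"
 shows "fev M \<tau>' x = fev M \<tau> x"
 unfolding fev_def by (rule M.finsum_cong'[OF refl]) (use assms \<tau> in \<open>auto simp: M.add.int_pow_closed\<close>)

text \<open>Evaluation is a homomorphism out of a free abelian group, hence compatible with integer
  multiples and with linear extension.\<close>

lemma fev_frag_extend: "fev M \<tau> (fext X x) = fev M (%b. fev M \<tau> (X b)) x"
 unfolding frag_extend_def fev_sum fev_def[of M "%b. fev M \<tau> (X b)"]
proof (rule M.finsum_cong'[OF refl])
 have d: "fev M \<tau> (frag_cmul k y) = add_pow M k (fev M \<tau> y)" for k y
 proof -
  have "group_hom (free_Abelian_group UNIV) (add_monoid M) (fev M \<tau>)"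
   by (simp add: group_hom_def group_hom_axioms_def hom_def fev_add fev_closed M.a_group Pi_def)
  from group_hom.hom_int_pow[OF this, of y k] show ?thesis by (simp add: add_pow_def)
 qed
 show "fev M \<tau> (frag_cmul (Poly_Mapping.lookup x b) (X b)) = add_pow M (Poly_Mapping.lookup x b) (fev M \<tau> (X b))" for b by (rule d)
qed (simp add: M.add.int_pow_closed fev_closed Pi_def)

lemma fev_eq_0: "(!!b. b \<in> fkeys x ==> \<tau>' b = (zr M)) ==> fev M \<tau>' x = (zr M)"
 unfolding fev_def by (rule M.add.finprod_one_eqI) (simp add: M.add.int_pow_one)

lemma fev_lin:
 assumes N: "module R N" and f: "f \<in> lmaps R M N"
 shows "f (fev M \<tau> x) = fev N (%b. f (\<tau> b)) x"
proof -
 interpret N: module R N by (rule N)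
 have c: "add_pow N k (f y) = f (add_pow M k y)" if y: "y \<in> carrier M" for y and k :: int
 proof -
  have "f \<in> hom (add_monoid M) (add_monoid N)" using f by (auto simp: hom_def linear_maps_def)
  then have "group_hom (add_monoid M) (add_monoid N) f" by (simp add: group_hom_def group_hom_axioms_def M.a_group N.a_group)
  from group_hom.hom_int_pow[OF this, of y k] y show ?thesis by (simp add: add_pow_def)
 qed
 have "f (fev M \<tau> x) = finsum N (%b. f (add_pow M (Poly_Mapping.lookup x b) (\<tau> b))) (fkeys x)"
  unfolding fev_def by (rule lin_finsum[OF f M N]) (use \<tau> in \<open>auto simp: M.add.int_pow_closed\<close>)
 then show ?thesis by (simp add: fev_def c \<tau>)
qed

end

section \<open>Graded modules with a spanning family\<close>

text \<open>A graded module with indexed homogeneous vectors. \<open>is_based\<close> asks that they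
  span, not that they be independent, so different formal sums may have the same value.\<close>

record ('r, 'm, 'b) based = bmod :: "('r, 'm) bgmod" bgen :: "'b set" bgdeg :: "'b => bideg" bvec :: "'b => 'm"

definition gens :: "('r, 'm, 'b) based => bideg => 'b set" where "gens X d = {b \<in> bgen X. bgdeg X b = d}"

definition is_based :: "'r ring => ('r, 'm, 'b) based => bool" where
 "is_based R X \<longleftrightarrow> bgmodule R (bmod X) \<and> (\<forall>d. bvec X ` gens X d \<subseteq> carrier (bmod X d)) \<and>
  (\<forall>d. spans R (bmod X d) (bvec X ` gens X d))"

definition ev :: "('r, 'm, 'b) based => bideg => ('b \<Rightarrow>\<^sub>0 int) => 'm" where
 "ev X d = fev (bmod X d) (%b. if b \<in> gens X d then bvec X b else (zr (bmod X d)))"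

text \<open>f is one of many formal lifts of \<Phi>. The containment of keys keeps composites
  correct: \<open>ev\<close> sends generators of a wrong bidegree to zero and would otherwise lose
  terms silently.\<close>

definition realizes :: "'r ring => ('r, 'm, 'b) based => ('r, 'n, 'c) based => bideg => ('m, 'n) bgmap =>
  ('b => 'c \<Rightarrow>\<^sub>0 int) => bool" where
 "realizes R X Y e \<Phi> f \<longleftrightarrow> \<Phi> \<in> bghom R (bmod X) (bmod Y) e \<and>
  (\<forall>d. \<forall>b\<in>gens X d. fkeys (f b) \<subseteq> gens Y (d + e) \<and> bgapp \<Phi> d (bvec X b) = ev Y (d + e) (f b))"

lemma bghomD:
 assumes "f \<in> bghom R V W e"
 shows "bdeg f = e" "bgapp f d \<in> lmaps R (V d) (W (d + e))"
 using assms by (auto simp: bghom_def)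

lemma bghomI: "bdeg f = e ==> (!!d. bgapp f d \<in> lmaps R (V d) (W (d + e))) ==> f \<in> bghom R V W e" by (simp add: bghom_def)

lemma ev_total:
 assumes "is_based R X"
 shows "module R (bmod X d)" "(if b \<in> gens X d then bvec X b else (zr (bmod X d))) \<in> carrier (bmod X d)" (is ?c1)
proof -
 show m: "module R (bmod X d)" using assms by (simp add: is_based_def bgD)
 show ?c1
  using assms abelian_monoid.zero_closed[OF module_abmon[OF m]] by (auto simp: is_based_def)
qed

context
 fixes R :: "'r ring" and X :: "('r, 'm, 'b) based"
 assumes X: "is_based R X"
begin

lemma ev_closed: "ev X d x \<in> carrier (bmod X d)" unfolding ev_def by (rule fev_closed[OF ev_total[OF X]])

lemma ev_add: "ev X d (x + y) = ev X d x \<oplus>\<^bsub>bmod X d\<^esub> ev X d y" unfolding ev_def by (rule fev_add[OF ev_total[OF X]])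

lemma ev_0: "ev X d 0 = (zr (bmod X d))" unfolding ev_def by (rule fev_0[OF ev_total[OF X]])

lemma ev_fsg: "ev X d (fsg k x) = sg (bmod X d) k (ev X d x)" unfolding ev_def by (rule fev_fsg[OF ev_total[OF X]])

lemma ev_sum: "ev X d (sum f S) = finsum (bmod X d) (%s. ev X d (f s)) S" unfolding ev_def by (rule fev_sum[OF ev_total[OF X]])

lemma ev_of: "b \<in> gens X d ==> ev X d (frag_of b) = bvec X b" unfolding ev_def by (subst fev_of[OF ev_total[OF X]]) auto

lemma ev_lin:
 assumes "module R N" "f \<in> lmaps R (bmod X d) N"
 shows "f (ev X d x) = fev N (%b. f (if b \<in> gens X d then bvec X b else (zr (bmod X d)))) x"
 unfolding ev_def by (rule fev_lin[OF ev_total[OF X] assms])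

end

lemma realizesD:
 assumes "realizes R X Y e \<Phi> f"
 shows "\<Phi> \<in> bghom R (bmod X) (bmod Y) e" "b \<in> gens X d ==> fkeys (f b) \<subseteq> gens Y (d + e)"
  "b \<in> gens X d ==> bgapp \<Phi> d (bvec X b) = ev Y (d + e) (f b)"
 using assms by (auto simp: realizes_def)

lemma realizes_ev:
 assumes X: "is_based R X" and Y: "is_based R Y" and r: "realizes R X Y e \<Phi> f" and x: "fkeys x \<subseteq> gens X d"
 shows "bgapp \<Phi> d (ev X d x) = ev Y (d + e) (fext f x)" (is ?c1) "fkeys (fext f x) \<subseteq> gens Y (d + e)" (is ?c2)
proof -
 note lin = bghomD(2)[OF realizesD(1)[OF r], of d]
 show ?c1 using x
 proof (induct x rule: frag_induction)
  case zero
  show ?case by (simp add: ev_0[OF X] ev_0[OF Y] lin_zero[OF lin ev_total(1)[OF X] ev_total(1)[OF Y]])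
 next
  case (one x)
  then show ?case by (simp add: ev_of[OF X] realizesD(3)[OF r])
 next
  case (diff a b)
  interpret X: module R "bmod X d" by (rule ev_total(1)[OF X])
  have dX: "ev X d (a - b) = ev X d a \<oplus>\<^bsub>bmod X d\<^esub> \<ominus>\<^bsub>bmod X d\<^esub> ev X d b"
   using ev_add[OF X, of d a "- b"] ev_fsg[OF X, of d 1 b] by (simp add: fsg_def sg_def)
  have dY: "ev Y (d + e) (x - y) = ev Y (d + e) x \<oplus>\<^bsub>bmod Y (d + e)\<^esub> \<ominus>\<^bsub>bmod Y (d + e)\<^esub> ev Y (d + e) y" for x y
   using ev_add[OF Y, of "d + e" x "- y"] ev_fsg[OF Y, of "d + e" 1 y] by (simp add: fsg_def sg_def)
  show ?case using diff ev_closed[OF X] by (simp add: dX dY frag_extend_diff lin_add[OF lin] lin_minus[OF lin ev_total(1)[OF X] ev_total(1)[OF Y]])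
 qed
 show ?c2 using keys_frag_extend[of f x] realizesD(2)[OF r] x by blast
qed

lemma realizes_comp:
 assumes X: "is_based R X" and Y: "is_based R Y" and Z: "is_based R Z"
  and g: "realizes R Y Z e' \<Psi> g" and f: "realizes R X Y e \<Phi> f" and e: "e'' = e' + e"
 shows "realizes R X Z e'' (bgcomp \<Psi> \<Phi>) (%b. fext g (f b))"
proof -
 note F = realizesD(1)[OF f] and G = realizesD(1)[OF g]
 have deg: "d + e + e' = d + e''" for d by (simp add: e add_ac)
 show ?thesis unfolding realizes_def
 proof (intro conjI allI ballI)
  show "bgcomp \<Psi> \<Phi> \<in> bghom R (bmod X) (bmod Z) e''" using lin_comp[OF bghomD(2)[OF F] bghomD(2)[OF G]] bghomD(1)[OF F] bghomD(1)[OF G]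
   by (intro bghomI) (simp_all add: bgcomp_def deg e[symmetric])
  fix d b assume b: "b \<in> gens X d"
  show "fkeys (fext g (f b)) \<subseteq> gens Z (d + e'')" using realizes_ev(2)[OF Y Z g realizesD(2)[OF f b]] by (simp add: deg)
  show "bgapp (bgcomp \<Psi> \<Phi>) d (bvec X b) = ev Z (d + e'') (fext g (f b))"
   using realizes_ev(1)[OF Y Z g realizesD(2)[OF f b]] realizesD(3)[OF f b] bghomD(1)[OF F] by (simp add: bgcomp_def deg)
 qed
qed

lemma realizes_sum:
 assumes X: "is_based R X" and Y: "is_based R Y" and S: "finite S" and f: "!!s. s \<in> S ==> realizes R X Y e (\<Phi> s) (f s)"
 shows "realizes R X Y e (bgsum (bmod Y) e k \<Phi> S) (%b. \<Sum>s\<in>S. fsg (k s) (f s b))"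
 unfolding realizes_def
proof (intro conjI allI ballI)
 note MX = ev_total(1)[OF X] and MY = ev_total(1)[OF Y]
 show "bgsum (bmod Y) e k \<Phi> S \<in> bghom R (bmod X) (bmod Y) e" using bghomD(2)[OF realizesD(1)[OF f]]
  by (intro bghomI) (auto simp: bgsum_def intro!: lin_finsum_map lin_sg_map MX MY)
 fix d b assume b: "b \<in> gens X d"
 show "fkeys (\<Sum>s\<in>S. fsg (k s) (f s b)) \<subseteq> gens Y (d + e)"
  using keys_sum[of "%s. fsg (k s) (f s b)" S] realizesD(2)[OF f b] by fastforce
 interpret Y: module R "bmod Y (d + e)" by (rule MY)
 show "bgapp (bgsum (bmod Y) e k \<Phi> S) d (bvec X b) = ev Y (d + e) (\<Sum>s\<in>S. fsg (k s) (f s b))"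
  unfolding ev_sum[OF Y] ev_fsg[OF Y] bgsum_def unfolding bgmap.simps
  by (rule Y.finsum_cong'[OF refl]) (simp_all add: realizesD(3)[OF f b] sg_closed[OF MY] ev_closed[OF Y] Pi_def)
qed

lemma realizes_add:
 assumes X: "is_based R X" and Y: "is_based R Y" and f: "realizes R X Y e \<Phi> f" and g: "realizes R X Y e \<Psi> g"
 shows "realizes R X Y e (bgadd (bmod Y) \<Phi> \<Psi>) (%b. f b + g b)"
 unfolding realizes_def
proof (intro conjI allI ballI)
 note MX = ev_total(1)[OF X] and MY = ev_total(1)[OF Y]
 note F = realizesD(1)[OF f] and G = realizesD(1)[OF g]
 show "bgadd (bmod Y) \<Phi> \<Psi> \<in> bghom R (bmod X) (bmod Y) e" using bghomD[OF F] bghomD[OF G]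
  by (intro bghomI) (auto simp: bgadd_def intro!: lin_add_map MX MY)
 fix d b assume b: "b \<in> gens X d"
 show "fkeys (f b + g b) \<subseteq> gens Y (d + e)" using keys_add[of "f b" "g b"] realizesD(2)[OF f b] realizesD(2)[OF g b] by blast
 show "bgapp (bgadd (bmod Y) \<Phi> \<Psi>) d (bvec X b) = ev Y (d + e) (f b + g b)"
  using bghomD(1)[OF F] by (simp add: bgadd_def ev_add[OF Y] realizesD(3)[OF f b] realizesD(3)[OF g b])
qed

lemma realizes_sgn:
 assumes X: "is_based R X" and Y: "is_based R Y" and f: "realizes R X Y e \<Phi> f"
 shows "realizes R X Y e (bgsgn (bmod Y) k \<Phi>) (%b. fsg k (f b))"
 using realizesD[OF f] bghomD[OF realizesD(1)[OF f]] lin_sg_map[OF bghomD(2)[OF realizesD(1)[OF f]] ev_total(1)[OF Y]]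
 by (simp add: realizes_def bghom_def bgsgn_def ev_fsg[OF Y])

lemma realizes_zero:
 assumes Y: "is_based R Y"
 shows "realizes R X Y e (bgzero (bmod Y) e) (%b. 0)"
 by (simp add: realizes_def bghom_def bgzero_def ev_0[OF Y] lin_zero_map[OF ev_total(1)[OF Y]])

lemma realizes_eq:
 assumes X: "is_based R X" and Y: "is_based R Y" and f: "realizes R X Y e \<Phi> f" and g: "realizes R X Y e \<Psi> g"
 shows "bg_eq (bmod X) \<Phi> \<Psi> \<longleftrightarrow> (\<forall>d. \<forall>b\<in>gens X d. ev Y (d + e) (f b) = ev Y (d + e) (g b))"
proof
 have c: "bvec X b \<in> carrier (bmod X d)" if "b \<in> gens X d" for b d using X that by (auto simp: is_based_def)
 show "\<forall>d. \<forall>b\<in>gens X d. ev Y (d + e) (f b) = ev Y (d + e) (g b)" if "bg_eq (bmod X) \<Phi> \<Psi>"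
  using that realizesD(3)[OF f] realizesD(3)[OF g] c unfolding bg_eq_def by metis
 assume eq: "\<forall>d. \<forall>b\<in>gens X d. ev Y (d + e) (f b) = ev Y (d + e) (g b)"
 note F = realizesD(1)[OF f] and G = realizesD(1)[OF g]
 have "bgapp \<Phi> d x = bgapp \<Psi> d x" if x: "x \<in> carrier (bmod X d)" for d x
 proof (rule spans_lin_eq[OF _ _ ev_total(1)[OF X] ev_total(1)[OF Y] bghomD(2)[OF F] bghomD(2)[OF G] _ x])
  show "spans R (bmod X d) (bvec X ` gens X d)" "bvec X ` gens X d \<subseteq> carrier (bmod X d)" using X by (auto simp: is_based_def)
  fix y assume "y \<in> bvec X ` gens X d"
  then show "bgapp \<Phi> d y = bgapp \<Psi> d y" using eq realizesD(3)[OF f, of _ d] realizesD(3)[OF g, of _ d] by force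
 qed
 then show "bg_eq (bmod X) \<Phi> \<Psi>" using bghomD(1)[OF F] bghomD(1)[OF G] by (simp add: bg_eq_def)
qed

section \<open>Sequences of maps\<close>

definition erealizes :: "'r ring => ('r, 'm, 'b) based => ('r, 'n, 'c) based => bideg => ('m, 'n) eseq => ('b, 'c) fop => bool" where
 "erealizes R X Y e \<Phi> f \<longleftrightarrow> (\<forall>p. realizes R X Y (e - dsh p) (\<Phi> p) (f p))"

lemma erealizesD: "erealizes R X Y e \<Phi> f ==> realizes R X Y (e - dsh p) (\<Phi> p) (f p)" by (simp add: erealizes_def)

lemma erealizes_edeg: "erealizes R X Y e \<Phi> f ==> edeg \<Phi> = e"
 using bghomD(1)[OF realizesD(1)[OF erealizesD[of R X Y e \<Phi> f 0]]] by (simp add: edeg_def)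

lemma erealizes_comp:
 assumes "is_based R X" "is_based R Y" "is_based R Z" and g: "erealizes R Y Z e' \<Psi> g" and f: "erealizes R X Y e \<Phi> f"
 shows "erealizes R X Z (e' + e) (ecomp (bmod Z) \<Psi> \<Phi>) (opcomp (tdeg e) g f)"
 unfolding erealizes_def
proof
 fix m
 have "realizes R X Z (e' + e - dsh m) (bgsum (bmod Z) (e' + e - dsh m) (%i. int i * tdeg e)
   (%i. bgcomp (\<Psi> i) (\<Phi> (m - i))) {..m}) (%b. \<Sum>i\<le>m. fsg (int i * tdeg e) (fext (g i) (f (m - i) b)))"
  by (intro realizes_sum assms realizes_comp[OF assms(1-3) erealizesD[OF g] erealizesD[OF f]]) (simp_all add: dsh_diff)
 then show "realizes R X Z (e' + e - dsh m) (ecomp (bmod Z) \<Psi> \<Phi> m) (opcomp (tdeg e) g f m)"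
  by (simp add: ecomp_def erealizes_edeg[OF f] erealizes_edeg[OF g] opcomp_def[abs_def] dsh_def[symmetric])
qed

lemma erealizes_add:
 assumes "is_based R X" "is_based R Y" and f: "erealizes R X Y e \<Phi> f" and g: "erealizes R X Y e \<Psi> g"
 shows "erealizes R X Y e (eadd (bmod Y) \<Phi> \<Psi>) (%m b. f m b + g m b)"
 using realizes_add[OF assms(1,2) erealizesD[OF f] erealizesD[OF g]] by (simp add: erealizes_def eadd_def)

lemma erealizes_sgn:
 assumes "is_based R X" "is_based R Y" and f: "erealizes R X Y e \<Phi> f"
 shows "erealizes R X Y e (esgn (bmod Y) k \<Phi>) (%m b. fsg k (f m b))"
 using realizes_sgn[OF assms(1,2) erealizesD[OF f]] by (simp add: erealizes_def esgn_def)

lemma erealizes_shift: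
 assumes "is_based R Y" and f: "erealizes R X Y e \<Phi> f"
 shows "erealizes R X Y (e + dsh r) (eshift (bmod Y) r \<Phi>) (fshift r f)"
 unfolding erealizes_def
proof
 fix m
 show "realizes R X Y (e + dsh r - dsh m) (eshift (bmod Y) r \<Phi> m) (fshift r f m)"
 proof (cases "r \<le> m")
  case True
  then show ?thesis using erealizesD[OF f, of "m - r"] by (simp add: eshift_def fshift_def[abs_def] dsh_diff algebra_simps)
 next
  case False
  have "e + (int r - int m, int r - int m) = e + dsh r - dsh m" by (cases e) (simp add: dsh_def)
  then show ?thesis using False realizes_zero[OF assms(1), of X "e + dsh r - dsh m"]
   by (simp add: eshift_def fshift_def[abs_def] erealizes_edeg[OF f] add_diff_eq)
 qed
qed

definition fstrict :: "('x => 'y \<Rightarrow>\<^sub>0 int) => ('x, 'y) fop" where "fstrict f p b = (if p = 0 then f b else 0)"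

lemma erealizes_strict:
 assumes "is_based R Y" and f: "realizes R X Y e \<Phi> f"
 shows "erealizes R X Y e (strict (bmod Y) \<Phi>) (fstrict f)"
 unfolding erealizes_def
proof
 fix m
 show "realizes R X Y (e - dsh m) (strict (bmod Y) \<Phi> m) (fstrict f m)"
  using f realizes_zero[OF assms(1), of X "e - dsh m"] bghomD(1)[OF realizesD(1)[OF f]]
  by (cases "m = 0") (simp_all add: strict_def fstrict_def[abs_def] dsh_def flip: zero_prod_def)
qed

lemma opcomp_fstrict_left: "opcomp k (fstrict f) X m b = fext f (X m b)"
proof -
 have "opcomp k (fstrict f) X m b = (\<Sum>i\<le>m. if i = 0 then fext f (X m b) else 0)"
  unfolding opcomp_def fstrict_def by (rule sum.cong) auto
 then show ?thesis by simp
qed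

lemma opcomp_fstrict_right: "opcomp 0 X (fstrict f) m b = fext (X m) (f b)"
proof -
 have "opcomp 0 X (fstrict f) m b = (\<Sum>i\<le>m. if i = m then fext (X m) (f b) else 0)"
  unfolding opcomp_def fstrict_def by (rule sum.cong) auto
 then show ?thesis by simp
qed

lemma erealizes_eq:
 assumes "is_based R X" "is_based R Y" and f: "erealizes R X Y e \<Phi> f" and g: "erealizes R X Y e \<Psi> g"
 shows "eq_seq (bmod X) \<Phi> \<Psi> \<longleftrightarrow>
  (\<forall>m d. \<forall>b\<in>gens X d. ev Y (d + (e - dsh m)) (f m b) = ev Y (d + (e - dsh m)) (g m b))"
 using realizes_eq[OF assms(1,2) erealizesD[OF f] erealizesD[OF g]] by (simp add: eq_seq_def)

section \<open>The reduced tensor coalgebra\<close>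

lemma multilinear_lin:
 assumes "multilinear R V n d M \<phi>" "f \<in> lmaps R M N" "bgmodule R V"
 shows "multilinear R V n d N (%w. f (\<phi> w))"
proof (rule multilinearI)
 note m = multilinearD[OF assms(1)]
 show "w \<in> words V n d ==> f (\<phi> w) \<in> carrier N" for w using m(1) lin_closed[OF assms(2)] by blast
 fix u e a v assume w: "u @ (e, a) # v \<in> words V n d"
 show "f (\<phi> (u @ (e, a \<oplus>\<^bsub>V e\<^esub> b) # v)) = f (\<phi> (u @ (e, a) # v)) \<oplus>\<^bsub>N\<^esub> f (\<phi> (u @ (e, b) # v))"
  if b: "b \<in> carrier (V e)" for b
  unfolding m(2)[OF w b] by (rule lin_add[OF assms(2) m(1)[OF w] m(1)[OF words_replace(1)[OF assms(3) w b]]])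
 show "f (\<phi> (u @ (e, c \<odot>\<^bsub>V e\<^esub> a) # v)) = c \<odot>\<^bsub>N\<^esub> f (\<phi> (u @ (e, a) # v))" if c: "c \<in> carrier R" for c
  unfolding m(3)[OF w c] by (rule lin_smult[OF assms(2) c m(1)[OF w]])
qed

lemma multilinear_cong:
 assumes "multilinear R V n d M \<phi>" "bgmodule R V" "!!w. w \<in> words V n d ==> \<psi> w = \<phi> w"
 shows "multilinear R V n d M \<psi>"
 using assms(1) words_replace[OF assms(2)] assms(3) unfolding multilinear_def by simp

lemma multilinear_finsum:
 assumes \<phi>: "!!s. s \<in> S ==> multilinear R V n d M (\<phi> s)" and M: "module R M" and V: "bgmodule R V" and S: "finite S"
 shows "multilinear R V n d M (%w. finsum M (%s. \<phi> s w) S)"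
proof (rule multilinearI)
 interpret M: module R M by (rule M)
 have c: "\<phi> s w \<in> carrier M" if "s \<in> S" "w \<in> words V n d" for s w by (rule multilinearD(1)[OF \<phi>[OF that(1)] that(2)])
 show "w \<in> words V n d ==> finsum M (%s. \<phi> s w) S \<in> carrier M" for w using c by (intro M.finsum_closed) auto
 fix u e a v assume w: "u @ (e, a) # v \<in> words V n d"
 {
  fix b assume b: "b \<in> carrier (V e)"
  have "finsum M (%s. \<phi> s (u @ (e, a \<oplus>\<^bsub>V e\<^esub> b) # v)) S =
    finsum M (%s. \<phi> s (u @ (e, a) # v) \<oplus>\<^bsub>M\<^esub> \<phi> s (u @ (e, b) # v)) S"
   using c w words_replace[OF V w] b multilinearD(2)[OF \<phi> w b] by (intro M.finsum_cong') auto
  also have "\<dots> = finsum M (%s. \<phi> s (u @ (e, a) # v)) S \<oplus>\<^bsub>M\<^esub> finsum M (%s. \<phi> s (u @ (e, b) # v)) S"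
   using c w words_replace(1)[OF V w b] by (intro M.finsum_addf) auto
  finally show "finsum M (%s. \<phi> s (u @ (e, a \<oplus>\<^bsub>V e\<^esub> b) # v)) S = \<dots>" .
 next
  fix k assume k: "k \<in> carrier R"
  have "finsum M (%s. \<phi> s (u @ (e, k \<odot>\<^bsub>V e\<^esub> a) # v)) S = finsum M (%s. k \<odot>\<^bsub>M\<^esub> \<phi> s (u @ (e, a) # v)) S"
   using c w k multilinearD(3)[OF \<phi> w k] by (intro M.finsum_cong') auto
  also have "\<dots> = k \<odot>\<^bsub>M\<^esub> finsum M (%s. \<phi> s (u @ (e, a) # v)) S"
   using c w k S by (intro M.finsum_smult_ldistr[symmetric]) auto
  finally show "finsum M (%s. \<phi> s (u @ (e, k \<odot>\<^bsub>V e\<^esub> a) # v)) S = \<dots>" .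
 }
qed

text \<open>Evaluation in one tensor power and one bidegree; words of another length or degree, or
  with a letter outside its carrier, count as zero.\<close>

definition wev :: "'r ring => ('r, 'a) bgmod => nat => bideg => ('a word \<Rightarrow>\<^sub>0 int) => ('r, 'a) tens" where
 "wev R V l d = fev (tpow R V l d) (%w. if w \<in> words V l d then tens R V w else (zr (tpow R V l d)))"

definition Tbased :: "'r ring => ('r, 'a) bgmod => ('r, ('r, 'a) tcoalg, 'a word) based" where
 "Tbased R V = \<lparr>bmod = Tbar R V, bgen = {w. w ~= [] \<and> valid V w}, bgdeg = wdeg, bvec = Tincl R V\<rparr>"

lemma Tbased_simps [simp]: "bmod (Tbased R V) = Tbar R V" "bgdeg (Tbased R V) = wdeg" "bvec (Tbased R V) = Tincl R V"
 "bgen (Tbased R V) = {w. w ~= [] \<and> valid V w}"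
 by (simp_all add: Tbased_def)

lemma gens_Tbased: "w \<in> gens (Tbased R V) d \<longleftrightarrow> w ~= [] \<and> valid V w \<and> wdeg w = d" by (simp add: gens_def)

definition Tinj :: "'r ring => ('r, 'a) bgmod => nat => bideg => ('r, 'a) tens => ('r, 'a) tcoalg" where
 "Tinj R V n d X = (\<lambda>k\<in>{1..}. if k = n then X else (zr (tpow R V k d)))"

lemma Tincl_eq: "w \<in> words V n d ==> Tincl R V w = Tinj R V n d (tens R V w)" by (auto simp: Tincl_def Tinj_def words_iff)

context bgmods
begin

context
 fixes V :: "('r, 'a) bgmod"
 assumes V: "bgmodule R V"
begin

lemma wev_total: "module R (tpow R V l d)"
  "(if w \<in> words V l d then tens R V w else (zr (tpow R V l d))) \<in> carrier (tpow R V l d)"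
 using tpow_mod[OF V] tens_cl[OF V] abelian_monoid.zero_closed[OF module_abmon[OF tpow_mod[OF V]]] by auto

lemma wev_0: "wev R V l d 0 = (zr (tpow R V l d))" unfolding wev_def by (rule fev_0[OF wev_total])
lemma wev_fsg: "wev R V l d (fsg k x) = sg (tpow R V l d) k (wev R V l d x)" unfolding wev_def by (rule fev_fsg[OF wev_total])
lemma wev_sum: "wev R V l d (sum f S) = finsum (tpow R V l d) (%s. wev R V l d (f s)) S" unfolding wev_def by (rule fev_sum[OF wev_total])
lemma wev_diff_eq_0: "wev R V l d (x - y) = (zr (tpow R V l d)) \<longleftrightarrow> wev R V l d x = wev R V l d y"
 unfolding wev_def by (rule fev_diff_eq_0[OF wev_total])
lemma wev_of: "w \<in> words V l d ==> wev R V l d (frag_of w) = tens R V w" unfolding wev_def by (subst fev_of[OF wev_total]) auto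
lemma wev_eq_0: "(!!w. w \<in> fkeys x ==> w \<notin> words V l d) ==> wev R V l d x = (zr (tpow R V l d))"
 unfolding wev_def by (rule fev_eq_0[OF wev_total]) auto

lemma Tbar_module: "module R (Tbar R V d)" unfolding Tbar_def by (rule direct_sum_module[OF R tpow_mod[OF V]])

lemma Tbar_bgmodule: "bgmodule R (Tbar R V)" by (simp add: bgmodule_def Tbar_module)

lemma Tinj_linear:
 assumes n: "1 \<le> n"
 shows "Tinj R V n d \<in> lmaps R (tpow R V n d) (Tbar R V d)"
proof -
 have M: "module R (tpow R V k d)" for k by (rule tpow_mod[OF V])
 have z: "(zr (tpow R V k d)) \<in> carrier (tpow R V k d)" for k by (rule abelian_monoid.zero_closed[OF module_abmon[OF M]])
 have c: "Tinj R V n d X \<in> carrier (Tbar R V d)" if X: "X \<in> carrier (tpow R V n d)" for X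
 proof -
  have "{i \<in> {1..}. Tinj R V n d X i ~= (zr (tpow R V i d))} \<subseteq> {n}" by (auto simp: Tinj_def)
  then have "finite {i \<in> {1..}. Tinj R V n d X i ~= (zr (tpow R V i d))}" by (rule finite_subset) simp
  then show ?thesis unfolding Tbar_def direct_sum_iff using X z by (auto simp: Tinj_def)
 qed
 show ?thesis unfolding linear_maps_def
 proof (intro CollectI conjI ballI)
  show "Tinj R V n d \<in> carrier (tpow R V n d) \<rightarrow> carrier (Tbar R V d)" using c by blast
  show "Tinj R V n d (X \<oplus>\<^bsub>tpow R V n d\<^esub> Y) = Tinj R V n d X \<oplus>\<^bsub>Tbar R V d\<^esub> Tinj R V n d Y" for X Y
   unfolding Tbar_def by (rule extensionalityI[OF _ direct_sum_ext(1)])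
    (use abelian_monoid.l_zero[OF module_abmon[OF M] z] in \<open>simp_all add: Tinj_def direct_sum_app\<close>)
  show "Tinj R V n d (c \<odot>\<^bsub>tpow R V n d\<^esub> X) = c \<odot>\<^bsub>Tbar R V d\<^esub> Tinj R V n d X" if "c \<in> carrier R" for c X
   unfolding Tbar_def by (rule extensionalityI[OF _ direct_sum_ext(2)])
    (use module.smult_r_null[OF M that] in \<open>simp_all add: Tinj_def direct_sum_app\<close>)
 qed
qed

lemma Tincl_closed:
 assumes "w \<in> words V n d" "1 \<le> n" shows "Tincl R V w \<in> carrier (Tbar R V d)"
 unfolding Tincl_eq[OF assms(1)] by (rule lin_closed[OF Tinj_linear[OF assms(2)] tens_cl[OF V assms(1)]])

lemma Tincl_multilinear: "1 \<le> n ==> multilinear R V n d (Tbar R V d) (Tincl R V)"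
 by (rule multilinear_cong[OF multilinear_lin[OF tens_multilinear[OF V] Tinj_linear V] V Tincl_eq])

lemma Tbar_proj_linear:
 assumes "1 \<le> l" shows "(%x. x l) \<in> lmaps R (Tbar R V d) (tpow R V l d)"
 using assms by (auto simp: linear_maps_def Tbar_def direct_sum_iff direct_sum_app)

text \<open>Induction on the support in the direct sum: subtracting the component in one tensor
  power shrinks it, and each such component is generated by elementary tensors.\<close>

lemma Tbar_spans: "spans R (Tbar R V d) (Tincl R V ` {w. w ~= [] \<and> valid V w \<and> wdeg w = d})" unfolding spans_def
proof (intro allI impI)
 fix N assume N: "submodule N R (Tbar R V d)" and sub: "Tincl R V ` {w. w ~= [] \<and> valid V w \<and> wdeg w = d} \<subseteq> N"
 interpret T: module R "Tbar R V d" by (rule Tbar_module)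
 have M: "module R (tpow R V k d)" for k by (rule tpow_mod[OF V])
 have inj: "Tinj R V n d X \<in> N" if n: "1 \<le> n" and X: "X \<in> carrier (tpow R V n d)" for n X
 proof -
  have "tens R V ` words V n d \<subseteq> {x \<in> carrier (tpow R V n d). Tinj R V n d x \<in> N}"
  proof
   fix x assume "x \<in> tens R V ` words V n d"
   then obtain w where w: "w \<in> words V n d" "x = tens R V w" by blast
   have "w \<in> {w. w ~= [] \<and> valid V w \<and> wdeg w = d}" using w n by (auto simp: words_iff)
   then have "Tincl R V w \<in> N" using sub by blast
   then show "x \<in> {x \<in> carrier (tpow R V n d). Tinj R V n d x \<in> N}" using w tens_cl[OF V w(1)] Tincl_eq[OF w(1), of R] by simp
  qed
  then show ?thesis using tens_spans[OF V, of n d] lin_preimage_submodule[OF Tinj_linear[OF n] M T.module_axioms N] X unfolding spans_def by blast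
 qed
 have "\<forall>x\<in>carrier (Tbar R V d). {i \<in> {1..}. x i ~= (zr (tpow R V i d))} \<subseteq> F --> x \<in> N" if "finite F" for F
  using that
 proof (induct F)
  case empty
  have "x = (zr (Tbar R V d))" if "x \<in> carrier (Tbar R V d)" "{i \<in> {1..}. x i ~= (zr (tpow R V i d))} \<subseteq> {}" for x
   unfolding Tbar_def by (rule extensionalityI[OF _ direct_sum_ext(3)])
    (use that in \<open>auto simp: Tbar_def direct_sum_iff direct_sum_app\<close>)
  then show ?case using subgroup.one_closed[OF submodule.axioms(1)[OF N]] by auto
 next
  case (insert n F)
  show ?case
  proof (intro ballI impI)
   fix x assume x: "x \<in> carrier (Tbar R V d)" and sx: "{i \<in> {1..}. x i ~= (zr (tpow R V i d))} \<subseteq> insert n F"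
   show "x \<in> N"
   proof (cases "1 \<le> n")
    case False
    then have "{i \<in> {1..}. x i ~= (zr (tpow R V i d))} \<subseteq> F" using sx by auto
    then show ?thesis using insert x by blast
   next
    case n: True
    have xn: "x n \<in> carrier (tpow R V n d)" by (rule lin_closed[OF Tbar_proj_linear[OF n] x])
    note xi = inj[OF n xn]
    have ji: "Tinj R V n d (x n) \<in> carrier (Tbar R V d)" by (rule lin_closed[OF Tinj_linear[OF n] xn])
    let ?y = "x \<oplus>\<^bsub>Tbar R V d\<^esub> \<ominus>\<^bsub>Tbar R V d\<^esub> Tinj R V n d (x n)"
    have y: "?y \<in> carrier (Tbar R V d)" using x ji by simp
    have yi: "?y i = x i \<oplus>\<^bsub>tpow R V i d\<^esub> \<ominus>\<^bsub>tpow R V i d\<^esub> Tinj R V n d (x n) i" if "1 \<le> i" for i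
     using lin_add[OF Tbar_proj_linear[OF that] x, of "\<ominus>\<^bsub>Tbar R V d\<^esub> Tinj R V n d (x n)"] ji
      lin_minus[OF Tbar_proj_linear[OF that] T.module_axioms M ji] by simp
    have "?y i = (zr (tpow R V i d))" if "1 \<le> i" "i \<notin> F" for i
    proof (cases "i = n")
     case True
     then show ?thesis using yi[OF that(1)] xn n abelian_group.r_neg[OF module_abgrp[OF M]] by (simp add: Tinj_def)
    next
     case False
     then have "x i = (zr (tpow R V i d))" using sx that by auto
     then show ?thesis using yi[OF that(1)] False that abelian_group.r_neg[OF module_abgrp[OF M]]
       abelian_monoid.zero_closed[OF module_abmon[OF M]] by (simp add: Tinj_def)
    qed
    then have "{i \<in> {1..}. ?y i ~= (zr (tpow R V i d))} \<subseteq> F" by auto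
    then have yN: "?y \<in> N" using insert y by blast
    have "x = ?y \<oplus>\<^bsub>Tbar R V d\<^esub> Tinj R V n d (x n)" using x ji by (simp add: T.a_assoc T.l_neg)
    then show ?thesis using T.submoduleE(5)[OF N yN xi] by simp
   qed
  qed
 qed
 then show "carrier (Tbar R V d) \<subseteq> N" by (auto simp: Tbar_def direct_sum_iff)
qed

lemma Tbased_is_based: "is_based R (Tbased R V)"
proof -
 have g: "gens (Tbased R V) d = {w. w ~= [] \<and> valid V w \<and> wdeg w = d}" for d by (auto simp: gens_Tbased)
 have "Tincl R V w \<in> carrier (Tbar R V d)" if "w ~= []" "valid V w" "wdeg w = d" for w d
  using Tincl_closed[of w "length w" d] that by (cases w) (auto simp: words_iff)
 then have "Tincl R V ` gens (Tbased R V) d \<subseteq> carrier (Tbar R V d)" for d unfolding g by blast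
 then show ?thesis using Tbar_spans by (simp add: is_based_def Tbar_bgmodule g)
qed

lemma ev_Tbased:
 assumes l: "1 \<le> l"
 shows "ev (Tbased R V) d x l = wev R V l d x"
proof -
 have t: "module R (tpow R V l d)" by (rule tpow_mod[OF V])
 have "ev (Tbased R V) d x l = fev (tpow R V l d)
   (%b. (if b \<in> gens (Tbased R V) d then bvec (Tbased R V) b else (zr (bmod (Tbased R V) d))) l) x"
  by (rule ev_lin[OF Tbased_is_based t]) (simp add: Tbar_proj_linear[OF l])
 also have "\<dots> = wev R V l d x" unfolding wev_def by (rule fev_cong[OF wev_total])
   (use l in \<open>auto simp: gens_Tbased words_iff Tincl_def Tbar_def direct_sum_app\<close>)
 finally show ?thesis .
qed

lemma ev_Tbased_eq: "ev (Tbased R V) d x = ev (Tbased R V) d y \<longleftrightarrow> (\<forall>l\<ge>1. wev R V l d x = wev R V l d y)"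
proof
 assume r: "\<forall>l\<ge>1. wev R V l d x = wev R V l d y"
 show "ev (Tbased R V) d x = ev (Tbased R V) d y" by (rule extensionalityI[of _ "{1..}"])
   (use ev_closed[OF Tbased_is_based, of d] r in \<open>auto simp: Tbar_def direct_sum_iff ev_Tbased\<close>)
qed (metis ev_Tbased)

end

end

text \<open>The comultiplication takes values in the tensor square of the whole direct sum, whose
  generators are pairs of words.\<close>

definition pbased :: "'r ring => ('r, 'm, 'b) based => ('r, ('r, 'm) tens, 'b \<times> 'b) based" where
 "pbased R X = \<lparr>bmod = tpow R (bmod X) 2, bgen = bgen X \<times> bgen X, bgdeg = (%(u, v). bgdeg X u + bgdeg X v),
  bvec = (%(u, v). tens R (bmod X) [(bgdeg X u, bvec X u), (bgdeg X v, bvec X v)])\<rparr>"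

lemma pbased_simps [simp]: "bmod (pbased R X) = tpow R (bmod X) 2" "bgdeg (pbased R X) (u, v) = bgdeg X u + bgdeg X v"
 "bvec (pbased R X) (u, v) = tens R (bmod X) [(bgdeg X u, bvec X u), (bgdeg X v, bvec X v)]"
 by (simp_all add: pbased_def)

lemma gens_pbased: "(u, v) \<in> gens (pbased R X) d \<longleftrightarrow> u \<in> gens X (bgdeg X u) \<and> v \<in> gens X (bgdeg X v) \<and> bgdeg X u + bgdeg X v = d"
 by (auto simp: gens_def pbased_def)

context bgmods
begin

lemma pair_words: "[(d1, x), (d2, y)] \<in> words V 2 (d1 + d2) \<longleftrightarrow> x \<in> carrier (V d1) \<and> y \<in> carrier (V d2)"
 by (auto simp: words_iff)

lemma words_2: "w \<in> words V 2 d \<longleftrightarrow>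
 (\<exists>d1 d2 x y. w = [(d1, x), (d2, y)] \<and> d = d1 + d2 \<and> x \<in> carrier (V d1) \<and> y \<in> carrier (V d2))"
proof
 assume w: "w \<in> words V 2 d"
 then obtain a b where "w = [a, b]" by (auto simp: words_iff length_Suc_conv numeral_2_eq_2)
 then show "\<exists>d1 d2 x y. w = [(d1, x), (d2, y)] \<and> d = d1 + d2 \<and> x \<in> carrier (V d1) \<and> y \<in> carrier (V d2)"
  using w by (intro exI[of _ "fst a"] exI[of _ "fst b"] exI[of _ "snd a"] exI[of _ "snd b"]) (auto simp: words_iff)
qed (auto simp: words_iff)

lemma tens_pair_linear:
 assumes V: "bgmodule R V"
 shows "y \<in> carrier (V d2) ==> (%x. tens R V [(d1, x), (d2, y)]) \<in> lmaps R (V d1) (tpow R V 2 (d1 + d2))"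
  and "x \<in> carrier (V d1) ==> (%y. tens R V [(d1, x), (d2, y)]) \<in> lmaps R (V d2) (tpow R V 2 (d1 + d2))"
proof -
 note m = multilinearD[OF tens_multilinear[OF V, of 2 "d1 + d2"]]
 show "(%x. tens R V [(d1, x), (d2, y)]) \<in> lmaps R (V d1) (tpow R V 2 (d1 + d2))" if "y \<in> carrier (V d2)"
  using that m(1)[of "[(d1, _), (d2, y)]"] m(2,3)[of "[]" d1 _ "[(d2, y)]"] unfolding linear_maps_def by (auto simp: pair_words)
 show "(%y. tens R V [(d1, x), (d2, y)]) \<in> lmaps R (V d2) (tpow R V 2 (d1 + d2))" if "x \<in> carrier (V d1)"
  using that m(1)[of "[(d1, x), (d2, _)]"] m(2,3)[of "[(d1, x)]" d2 _ "[]"] unfolding linear_maps_def by (auto simp: pair_words)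
qed

lemma bvec_closed: "is_based R X ==> b \<in> gens X d ==> bvec X b \<in> carrier (bmod X d)" unfolding is_based_def by blast

text \<open>Spanning is obtained in one tensor factor at a time: the generators in the other factor
  are held fixed and the submodule is pulled back along the remaining linear variable.\<close>

lemma pbased_is_based:
 assumes X: "is_based R X"
 shows "is_based R (pbased R X)"
proof -
 have V: "bgmodule R (bmod X)" using X by (simp add: is_based_def)
 have T: "module R (tpow R (bmod X) 2 d)" for d by (rule tpow_mod[OF V])
 have sp: "spans R (bmod X d) (bvec X ` gens X d)" for d using X by (simp add: is_based_def)
 have "bvec (pbased R X) ` gens (pbased R X) d \<subseteq> carrier (tpow R (bmod X) 2 d)" for d
 proof
  fix z assume "z \<in> bvec (pbased R X) ` gens (pbased R X) d"
  then obtain u v where uv: "(u, v) \<in> gens (pbased R X) d" "z = bvec (pbased R X) (u, v)" by auto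
  then show "z \<in> carrier (tpow R (bmod X) 2 d)" by (auto simp: gens_pbased intro!: tens_cl[OF V] pair_words[THEN iffD2] bvec_closed[OF X])
 qed
 moreover have "spans R (tpow R (bmod X) 2 d) (bvec (pbased R X) ` gens (pbased R X) d)" for d unfolding spans_def
 proof (intro allI impI)
  fix N assume N: "submodule N R (tpow R (bmod X) 2 d)" and sub: "bvec (pbased R X) ` gens (pbased R X) d \<subseteq> N"
  have 1: "tens R (bmod X) [(d1, bvec X u), (d2, y)] \<in> N"
   if d: "d = d1 + d2" and u: "u \<in> gens X d1" and y: "y \<in> carrier (bmod X d2)" for d1 d2 u y
  proof -
   note lin = tens_pair_linear(2)[OF V bvec_closed[OF X u], of d2, folded d]
   have "bvec X ` gens X d2 \<subseteq> {y \<in> carrier (bmod X d2). tens R (bmod X) [(d1, bvec X u), (d2, y)] \<in> N}"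
   proof
    fix y assume "y \<in> bvec X ` gens X d2"
    then obtain v where v: "v \<in> gens X d2" "y = bvec X v" by blast
    have deg: "bgdeg X u = d1" "bgdeg X v = d2" using u v by (auto simp: gens_def)
    have "(u, v) \<in> gens (pbased R X) d" using u v deg d by (simp add: gens_pbased)
    then have "bvec (pbased R X) (u, v) \<in> N" using sub by blast
    then show "y \<in> {y \<in> carrier (bmod X d2). tens R (bmod X) [(d1, bvec X u), (d2, y)] \<in> N}"
     using v bvec_closed[OF X v(1)] deg by simp
   qed
   then show ?thesis using sp[of d2] lin_preimage_submodule[OF lin bgD[OF V] T N] y unfolding spans_def by blast
  qed
  have 2: "tens R (bmod X) [(d1, x), (d2, y)] \<in> N"
   if d: "d = d1 + d2" and x: "x \<in> carrier (bmod X d1)" and y: "y \<in> carrier (bmod X d2)" for d1 d2 x y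
  proof -
   note lin = tens_pair_linear(1)[OF V y, of d1, folded d]
   have "bvec X ` gens X d1 \<subseteq> {x \<in> carrier (bmod X d1). tens R (bmod X) [(d1, x), (d2, y)] \<in> N}"
    using 1[OF d _ y] bvec_closed[OF X] by blast
   then show ?thesis using sp[of d1] lin_preimage_submodule[OF lin bgD[OF V] T N] x unfolding spans_def by blast
  qed
  have "tens R (bmod X) ` words (bmod X) 2 d \<subseteq> N"
  proof (rule image_subsetI)
   fix w assume "w \<in> words (bmod X) 2 d"
   then obtain d1 d2 x y where "w = [(d1, x), (d2, y)]" "d = d1 + d2" "x \<in> carrier (bmod X d1)" "y \<in> carrier (bmod X d2)"
    unfolding words_2 by blast
   then show "tens R (bmod X) w \<in> N" using 2 by simp
  qed
  then show "carrier (tpow R (bmod X) 2 d) \<subseteq> N" using tens_spans[OF V, of 2 d] N unfolding spans_def by blast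
 qed
 ultimately show ?thesis by (simp add: is_based_def tpow_bgmodule[OF V])
qed

lemma ev_pair:
 assumes X: "is_based R X" and x: "fkeys x \<subseteq> gens X d1" and y: "fkeys y \<subseteq> gens X d2"
 shows "tens R (bmod X) [(d1, ev X d1 x), (d2, ev X d2 y)] = ev (pbased R X) (d1 + d2) (fpair x y)"
proof -
 have V: "bgmodule R (bmod X)" using X by (simp add: is_based_def)
 note P = pbased_is_based[OF X]
 have T: "module R (tpow R (bmod X) 2 (d1 + d2))" by (rule tpow_mod[OF V])
 let ?t = "%b. if b \<in> gens (pbased R X) (d1 + d2) then bvec (pbased R X) b else (zr (tpow R (bmod X) 2 (d1 + d2)))"
 note tt = ev_total[OF P, where d = "d1 + d2", unfolded pbased_simps(1)]
 have "tens R (bmod X) [(d1, ev X d1 x), (d2, ev X d2 y)] =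
   fev (tpow R (bmod X) 2 (d1 + d2)) (%u. tens R (bmod X) [(d1, if u \<in> gens X d1 then bvec X u else (zr (bmod X d1))), (d2, ev X d2 y)]) x"
  by (rule ev_lin[OF X T tens_pair_linear(1)[OF V ev_closed[OF X]]])
 also have "\<dots> = fev (tpow R (bmod X) 2 (d1 + d2)) (%u. fev (tpow R (bmod X) 2 (d1 + d2)) ?t (fext (%v. frag_of (u, v)) y)) x"
 proof (rule fev_cong[OF T])
  show "fev (tpow R (bmod X) 2 (d1 + d2)) ?t (fext (%v. frag_of (u, v)) y) \<in> carrier (tpow R (bmod X) 2 (d1 + d2))" for u
   by (rule fev_closed[OF tt])
  fix u assume "u \<in> fkeys x"
  then have u: "u \<in> gens X d1" using x by blast
  have "tens R (bmod X) [(d1, bvec X u), (d2, ev X d2 y)] =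
   fev (tpow R (bmod X) 2 (d1 + d2)) (%v. tens R (bmod X) [(d1, bvec X u), (d2, if v \<in> gens X d2 then bvec X v else (zr (bmod X d2)))]) y"
   by (rule ev_lin[OF X T tens_pair_linear(2)[OF V bvec_closed[OF X u]]])
  also have "\<dots> = fev (tpow R (bmod X) 2 (d1 + d2)) (%v. fev (tpow R (bmod X) 2 (d1 + d2)) ?t (frag_of (u, v))) y"
  proof (rule fev_cong[OF T])
   show "fev (tpow R (bmod X) 2 (d1 + d2)) ?t (frag_of (u, v)) \<in> carrier (tpow R (bmod X) 2 (d1 + d2))" for v by (rule fev_closed[OF tt])
   fix v assume "v \<in> fkeys y"
   then have v: "v \<in> gens X d2" using y by blast
   have deg: "bgdeg X u = d1" "bgdeg X v = d2" using u v by (auto simp: gens_def)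
   have "(u, v) \<in> gens (pbased R X) (d1 + d2)" using u v deg by (simp add: gens_pbased)
   then have "fev (tpow R (bmod X) 2 (d1 + d2)) ?t (frag_of (u, v)) = bvec (pbased R X) (u, v)" by (subst fev_of[OF tt]) simp
   then show "tens R (bmod X) [(d1, bvec X u), (d2, if v \<in> gens X d2 then bvec X v else (zr (bmod X d2)))] =
     fev (tpow R (bmod X) 2 (d1 + d2)) ?t (frag_of (u, v))"
    using v deg by simp
  qed
  also have "\<dots> = fev (tpow R (bmod X) 2 (d1 + d2)) ?t (fext (%v. frag_of (u, v)) y)"
   by (rule fev_frag_extend[OF tt, symmetric])
  finally show "tens R (bmod X) [(d1, if u \<in> gens X d1 then bvec X u else (zr (bmod X d1))), (d2, ev X d2 y)] =
    fev (tpow R (bmod X) 2 (d1 + d2)) ?t (fext (%v. frag_of (u, v)) y)"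
   using u by simp
 qed
 also have "\<dots> = ev (pbased R X) (d1 + d2) (fpair x y)" unfolding ev_def fpair_def pbased_simps(1) by (rule fev_frag_extend[OF tt, symmetric])
 finally show ?thesis .
qed

lemma bdeg_tmaps: "bdeg (tmaps R V W fs) = sum_list (map bdeg fs)" by (induct fs) (simp_all add: tmaps_def)

lemma tmaps_2:
 assumes V: "bgmodule R V" and W: "bgmodule R W" and f: "f \<in> bghom R V W e1" and g: "g \<in> bghom R V W e2"
 shows "tmaps R V W [f, g] \<in> bghom R (tpow R V 2) (tpow R W 2) (e1 + e2)" (is ?c1)
  and "x \<in> carrier (V d1) ==> y \<in> carrier (V d2) ==> bgapp (tmaps R V W [f, g]) (d1 + d2) (tens R V [(d1, x), (d2, y)]) =
   sg (tpow R W 2 (d1 + d2 + (e1 + e2))) (bipair e2 d1) (tens R W [(d1 + e1, bgapp f d1 x), (d2 + e2, bgapp g d2 y)])"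
proof -
 have fg: "bdeg f = e1" "bdeg g = e2" using f g by (auto simp: bghom_def)
 have u: "blin R V W 1 (unary R W f)" "blin R V W 1 (unary R W g)"
  using bghomD(2)[OF f] bghomD(2)[OF g] fg unary_blin[OF V W, of f] unary_blin[OF V W, of g] by simp_all
 let ?fs = "[(1, unary R W f), (1, unary R W g)]"
 have bl: "blin R V W q h" if "(q, h) \<in> set ?fs" for q h using u that by auto
 have sl: "sum_list (map fst ?fs) = 2" "length ?fs = 2" by simp_all
 have bd: "bdeg (btens R V W ?fs) = e1 + e2" by (simp add: fg)
 show ?c1
  using btens_linear[OF V W, where fs = ?fs, OF bl, unfolded sl bd] bd by (intro bghomI) (simp_all add: tmaps_def)
 assume x: "x \<in> carrier (V d1)" and y: "y \<in> carrier (V d2)"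
 have w: "[(d1, x), (d2, y)] \<in> words V (sum_list (map fst ?fs)) (d1 + d2)" unfolding sl using x y by (simp add: pair_words)
 have "btens_sign ?fs [(d1, x), (d2, y)] = bipair e2 d1" by (simp add: fg)
 moreover have "btens_word R V ?fs [(d1, x), (d2, y)] = [(d1 + e1, bgapp f d1 x), (d2 + e2, bgapp g d2 y)]"
  using unary_tens[OF V W, of f x d1] unary_tens[OF V W, of g y d2] bghomD(2)[OF f] bghomD(2)[OF g] x y by (simp add: fg)
 ultimately show "bgapp (tmaps R V W [f, g]) (d1 + d2) (tens R V [(d1, x), (d2, y)]) =
   sg (tpow R W 2 (d1 + d2 + (e1 + e2))) (bipair e2 d1) (tens R W [(d1 + e1, bgapp f d1 x), (d2 + e2, bgapp g d2 y)])"
  using btens_tens[OF V W, where fs = ?fs, OF bl w, unfolded sl bd] by (simp add: tmaps_def)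
qed

lemma realizes_tmaps:
 assumes X: "is_based R X" and Y: "is_based R Y" and f: "realizes R X Y e1 \<Phi> f" and g: "realizes R X Y e2 \<Psi> g" and e: "e = e1 + e2"
 shows "realizes R (pbased R X) (pbased R Y) e (tmaps R (bmod X) (bmod Y) [\<Phi>, \<Psi>])
  (%(u, v). fsg (bipair e2 (bgdeg X u)) (fpair (f u) (g v)))"
proof -
 have V: "bgmodule R (bmod X)" and W: "bgmodule R (bmod Y)" using X Y by (simp_all add: is_based_def)
 note t = tmaps_2[OF V W realizesD(1)[OF f] realizesD(1)[OF g]]
 show ?thesis unfolding realizes_def
 proof (intro conjI allI ballI)
  show "tmaps R (bmod X) (bmod Y) [\<Phi>, \<Psi>] \<in> bghom R (bmod (pbased R X)) (bmod (pbased R Y)) e" using t(1) by (simp add: e)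
  fix d b assume b: "b \<in> gens (pbased R X) d"
  obtain u v where uv: "b = (u, v)" by (cases b)
  let ?d1 = "bgdeg X u" and ?d2 = "bgdeg X v"
  have g': "u \<in> gens X ?d1" "v \<in> gens X ?d2" and d: "d = ?d1 + ?d2" using b by (auto simp: uv gens_pbased)
  have deg: "?d1 + ?d2 + (e1 + e2) = (?d1 + e1) + (?d2 + e2)" by (simp add: add_ac)
  note kf = realizesD(2)[OF f g'(1)] and kg = realizesD(2)[OF g g'(2)]
  show "fkeys (case b of (u, v) => fsg (bipair e2 (bgdeg X u)) (fpair (f u) (g v))) \<subseteq> gens (pbased R Y) (d + e)"
  proof
   fix c assume "c \<in> fkeys (case b of (u, v) => fsg (bipair e2 (bgdeg X u)) (fpair (f u) (g v)))"
   then have c: "c \<in> fkeys (fpair (f u) (g v))" by (simp add: uv)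
   obtain u' where u': "u' \<in> fkeys (f u)" "c \<in> fkeys (fext (%v. frag_of (u', v)) (g v))"
    using subsetD[OF keys_frag_extend c[unfolded fpair_def]] by (rule UN_E)
   obtain v' where v': "v' \<in> fkeys (g v)" "c \<in> fkeys (frag_of (u', v'))" using subsetD[OF keys_frag_extend u'(2)] by (rule UN_E)
   have "c = (u', v')" "u' \<in> gens Y (?d1 + e1)" "v' \<in> gens Y (?d2 + e2)" using u' v' kf kg by auto
   then show "c \<in> gens (pbased R Y) (d + e)" by (auto simp: gens_pbased gens_def pbased_def d e add_ac)
  qed
  have "bgapp (tmaps R (bmod X) (bmod Y) [\<Phi>, \<Psi>]) (?d1 + ?d2) (tens R (bmod X) [(?d1, bvec X u), (?d2, bvec X v)]) =
   sg (tpow R (bmod Y) 2 (?d1 + ?d2 + (e1 + e2))) (bipair e2 ?d1) (ev (pbased R Y) ((?d1 + e1) + (?d2 + e2)) (fpair (f u) (g v)))"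
   using t(2)[OF bvec_closed[OF X g'(1)] bvec_closed[OF X g'(2)]] ev_pair[OF Y kf kg] realizesD(3)[OF f g'(1)] realizesD(3)[OF g g'(2)] by simp
  then show "bgapp (tmaps R (bmod X) (bmod Y) [\<Phi>, \<Psi>]) d (bvec (pbased R X) b) =
    ev (pbased R Y) (d + e) (case b of (u, v) => fsg (bipair e2 (bgdeg X u)) (fpair (f u) (g v)))"
   by (simp add: uv d e ev_fsg[OF pbased_is_based[OF Y]] deg)
 qed
qed

text \<open>The index sign comes from \<open>etens\<close> and the Koszul sign from
  \<open>realizes_tmaps\<close>; together they form the exponent in \<open>ften\<close>.\<close>

lemma erealizes_tens:
 assumes X: "is_based R X" and Y: "is_based R Y" and f: "erealizes R X Y e1 \<Phi> f" and g: "erealizes R X Y e2 \<Psi> g"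
 shows "erealizes R (pbased R X) (pbased R Y) (e1 + e2) (etens R (bmod X) (bmod Y) \<Phi> \<Psi>) (ften (bgdeg X) e2 f g)"
 unfolding erealizes_def
proof
 fix m
 have "realizes R (pbased R X) (pbased R Y) (e1 + e2 - dsh m)
   (bgsum (bmod (pbased R Y)) (e1 + e2 - dsh m) (%j. int j * tdeg e2) (%j. tmaps R (bmod X) (bmod Y) [\<Phi> j, \<Psi> (m - j)]) {..m})
   (%b. \<Sum>j\<le>m. fsg (int j * tdeg e2) (case b of (u, v) => fsg (bipair (e2 - dsh (m - j)) (bgdeg X u)) (fpair (f j u) (g (m - j) v))))"
 proof (rule realizes_sum[OF pbased_is_based[OF X] pbased_is_based[OF Y]])
  fix j assume "j \<in> {..m}"
  then have "e1 + e2 - dsh m = (e1 - dsh j) + (e2 - dsh (m - j))" by (simp add: dsh_diff)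
  then show "realizes R (pbased R X) (pbased R Y) (e1 + e2 - dsh m) (tmaps R (bmod X) (bmod Y) [\<Phi> j, \<Psi> (m - j)])
    (%b. case b of (u, v) => fsg (bipair (e2 - dsh (m - j)) (bgdeg X u)) (fpair (f j u) (g (m - j) v)))"
   by (rule realizes_tmaps[OF X Y erealizesD[OF f] erealizesD[OF g]])
 qed simp
 then show "realizes R (pbased R X) (pbased R Y) (e1 + e2 - dsh m) (etens R (bmod X) (bmod Y) \<Phi> \<Psi> m) (ften (bgdeg X) e2 f g m)"
  by (simp add: etens_def erealizes_edeg[OF f] erealizes_edeg[OF g] ften_def case_prod_beta' dsh_def[symmetric])
qed

section \<open>The structure maps of the reduced tensor coalgebra\<close>

section \<open>Maps out of the tensor coalgebra\<close>

text \<open>\<open>from_T\<close> sums over the support of its argument; linearity is checked over a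
  common finite set of indices, where the additional terms vanish.\<close>

lemma from_T_realize:
 assumes V: "bgmodule R V" and W: "bgmodule R W" and \<phi>: "!!n d. 1 \<le> n ==> \<phi> n d \<in> lmaps R (tpow R V n d) (W (d + e))"
 shows "from_T R V W e \<phi> \<in> bghom R (Tbar R V) W e" (is ?c1)
  and "w \<in> words V n d ==> 1 \<le> n ==> bgapp (from_T R V W e \<phi>) d (Tincl R V w) = \<phi> n d (tens R V w)"
proof -
 let ?Z = "%n d. (zr (tpow R V n d))"
 have M: "module R (tpow R V n d)" for n d by (rule tpow_mod[OF V])
 have WM: "module R (W d)" for d by (rule bgD[OF W])
 have ext: "bgapp (from_T R V W e \<phi>) d x = finsum (W (d + e)) (%n. \<phi> n d (x n)) F"
  if x: "x \<in> carrier (Tbar R V d)" and F: "finite F" "{n. 1 \<le> n \<and> x n ~= ?Z n d} \<subseteq> F" "F \<subseteq> {1..}" for d x F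
 proof -
  interpret W: module R "W (d + e)" by (rule WM)
  have c: "\<phi> n d (x n) \<in> carrier (W (d + e))" if "1 \<le> n" for n
   by (rule lin_closed[OF \<phi>[OF that] lin_closed[OF Tbar_proj_linear[OF V that] x]])
  have z: "\<phi> n d (?Z n d) = (zr (W (d + e)))" if "1 \<le> n" for n by (rule lin_zero[OF \<phi>[OF that] M WM])
  show ?thesis unfolding from_T_def bgmap.simps by (rule W.add.finprod_mono_neutral_cong_left) (use F c z in auto)
 qed
 have fin: "finite {n. 1 \<le> n \<and> x n ~= ?Z n d}" if "x \<in> carrier (Tbar R V d)" for x d
  using that by (simp add: Tbar_def direct_sum_iff)
 show ?c1
 proof (rule bghomI)
  fix d
  interpret W: module R "W (d + e)" by (rule WM)
  interpret T: module R "Tbar R V d" by (rule Tbar_module[OF V])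
  have c: "\<phi> n d (x n) \<in> carrier (W (d + e))" if "x \<in> carrier (Tbar R V d)" "1 \<le> n" for n x
   by (rule lin_closed[OF \<phi>[OF that(2)] lin_closed[OF Tbar_proj_linear[OF V that(2)] that(1)]])
  have lin: "(%x. finsum (W (d + e)) (%n. \<phi> n d (x n)) F) \<in> lmaps R (Tbar R V d) (W (d + e))" if "F \<subseteq> {1..}" for F
   using that by (intro lin_finsum_map T.module_axioms WM lin_comp[OF Tbar_proj_linear[OF V]] \<phi>) auto
  show "bgapp (from_T R V W e \<phi>) d \<in> lmaps R (Tbar R V d) (W (d + e))" unfolding linear_maps_def
  proof (intro CollectI conjI ballI funcsetI)
   fix x assume x: "x \<in> carrier (Tbar R V d)"
   let ?S = "{n. 1 \<le> n \<and> x n ~= ?Z n d}"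
   have S: "finite ?S" "?S \<subseteq> {1..}" using fin[OF x] by auto
   show "bgapp (from_T R V W e \<phi>) d x \<in> carrier (W (d + e))"
    unfolding ext[OF x S(1) subset_refl S(2)] by (rule lin_closed[OF lin[OF S(2)] x])
   show "bgapp (from_T R V W e \<phi>) d (x \<oplus>\<^bsub>Tbar R V d\<^esub> y) =
     bgapp (from_T R V W e \<phi>) d x \<oplus>\<^bsub>W (d + e)\<^esub> bgapp (from_T R V W e \<phi>) d y" if y: "y \<in> carrier (Tbar R V d)" for y
   proof -
    let ?F = "?S \<union> {n. 1 \<le> n \<and> y n ~= ?Z n d}"
    have F: "finite ?F" "?F \<subseteq> {1..}" using fin[OF x] fin[OF y] by auto
    have "{n. 1 \<le> n \<and> (x \<oplus>\<^bsub>Tbar R V d\<^esub> y) n ~= ?Z n d} \<subseteq> ?F"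
    proof
     fix n assume n: "n \<in> {n. 1 \<le> n \<and> (x \<oplus>\<^bsub>Tbar R V d\<^esub> y) n ~= ?Z n d}"
     have "?Z n d \<oplus>\<^bsub>tpow R V n d\<^esub> ?Z n d = ?Z n d"
      by (rule abelian_monoid.l_zero[OF module_abmon[OF M] abelian_monoid.zero_closed[OF module_abmon[OF M]]])
     moreover have "(x \<oplus>\<^bsub>Tbar R V d\<^esub> y) n = x n \<oplus>\<^bsub>tpow R V n d\<^esub> y n"
      using n by (simp add: Tbar_def direct_sum_app)
     ultimately have "x n ~= ?Z n d \<or> y n ~= ?Z n d" using n by fastforce
     then show "n \<in> ?F" using n by blast
    qed
    then show ?thesis using ext[OF T.a_closed[OF x y] F(1) _ F(2)] ext[OF x F(1) _ F(2)] ext[OF y F(1) _ F(2)]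
      lin_add[OF lin[OF F(2)] x y] by auto
   qed
   show "bgapp (from_T R V W e \<phi>) d (c \<odot>\<^bsub>Tbar R V d\<^esub> x) = c \<odot>\<^bsub>W (d + e)\<^esub> bgapp (from_T R V W e \<phi>) d x"
    if c: "c \<in> carrier R" for c
   proof -
    have "{n. 1 \<le> n \<and> (c \<odot>\<^bsub>Tbar R V d\<^esub> x) n ~= ?Z n d} \<subseteq> ?S"
    proof
     fix n assume n: "n \<in> {n. 1 \<le> n \<and> (c \<odot>\<^bsub>Tbar R V d\<^esub> x) n ~= ?Z n d}"
     moreover have "c \<odot>\<^bsub>tpow R V n d\<^esub> ?Z n d = ?Z n d" by (rule module.smult_r_null[OF M c])
     moreover have "(c \<odot>\<^bsub>Tbar R V d\<^esub> x) n = c \<odot>\<^bsub>tpow R V n d\<^esub> x n"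
      using n by (simp add: Tbar_def direct_sum_app)
     ultimately show "n \<in> ?S" by fastforce
    qed
    then show ?thesis using ext[OF T.smult_closed[OF c x] S(1) _ S(2)] ext[OF x S(1) _ S(2)] lin_smult[OF lin[OF S(2)] c x] by auto
   qed
  qed
 qed (simp add: from_T_def)
 assume w: "w \<in> words V n d" and n: "1 \<le> n"
 interpret W: module R "W (d + e)" by (rule WM)
 have "bgapp (from_T R V W e \<phi>) d (Tincl R V w) = finsum (W (d + e)) (%k. \<phi> k d (Tincl R V w k)) {n}"
  using w n by (intro ext Tincl_closed[OF V w n]) (auto simp: Tincl_def words_iff)
 also have "\<dots> = \<phi> n d (tens R V w)" using w n lin_closed[OF \<phi>[OF n] tens_cl[OF V w]] by (simp add: Tincl_def words_iff)
 finally show "bgapp (from_T R V W e \<phi>) d (Tincl R V w) = \<phi> n d (tens R V w)" .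
qed

text \<open>The bound on the length of the outputs makes the components with l > q vanish, so images
  lie in the direct sum. It is the formal version of the finiteness that \<open>T_matrix\<close>
  presupposes.\<close>

lemma T_matrix_realizes:
 assumes V: "bgmodule R V" and W: "bgmodule R W"
  and lin: "!!q l d. 1 \<le> q ==> 1 \<le> l ==> bgapp (\<phi> q l) d \<in> lmaps R (tpow R V q d) (tpow R W l (d + e))"
  and app: "!!q l d w. 1 \<le> q ==> 1 \<le> l ==> w \<in> words V q d ==> bgapp (\<phi> q l) d (tens R V w) = wev R W l (d + e) (f w)"
  and keys: "!!w v. valid V w ==> w ~= [] ==> v \<in> fkeys (f w) ==>
   v ~= [] \<and> valid W v \<and> wdeg v = wdeg w + e \<and> length v \<le> length w"
 shows "realizes R (Tbased R V) (Tbased R W) e (T_matrix R V W e \<phi>) f"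
proof -
 let ?\<psi> = "%q d X. \<lambda>l\<in>{1..}. bgapp (\<phi> q l) d X"
 have M: "module R (tpow R V n d)" "module R (tpow R W n d)" for n d by (rule tpow_mod[OF V], rule tpow_mod[OF W])
 have vanish: "bgapp (\<phi> q l) d X = (zr (tpow R W l (d + e)))"
  if q: "1 \<le> q" and l: "q < l" and X: "X \<in> carrier (tpow R V q d)" for q l d X
 proof (rule tpow_lin_eq[OF V M(2) lin[OF q] lin_zero_map[OF M(2)] _ X])
  fix w assume w: "w \<in> words V q d"
  have "w ~= []" "valid V w" "length w = q" using w q by (auto simp: words_iff)
  then have "v \<notin> words W l (d + e)" if "v \<in> fkeys (f w)" for v using keys[of w v] that l by (auto simp: words_iff)
  then show "bgapp (\<phi> q l) d (tens R V w) = (zr (tpow R W l (d + e)))" using q l by (simp add: app[OF q _ w] wev_eq_0[OF W])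
 qed (use q l in auto)
 have \<psi>: "?\<psi> q d \<in> lmaps R (tpow R V q d) (Tbar R W (d + e))" if q: "1 \<le> q" for q d unfolding linear_maps_def Tbar_def
 proof (intro CollectI conjI ballI funcsetI)
  fix X assume X: "X \<in> carrier (tpow R V q d)"
  have "{l \<in> {1..}. ?\<psi> q d X l ~= (zr (tpow R W l (d + e)))} \<subseteq> {..q}"
  proof
   fix l assume l: "l \<in> {l \<in> {1..}. ?\<psi> q d X l ~= (zr (tpow R W l (d + e)))}"
   then show "l \<in> {..q}" using vanish[OF q _ X, of l] by (cases "l \<le> q") auto
  qed
  then have "finite {l \<in> {1..}. ?\<psi> q d X l ~= (zr (tpow R W l (d + e)))}" by (rule finite_subset) simp
  then show "?\<psi> q d X \<in> carrier (direct_sum {1..} (%n. tpow R W n (d + e)))"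
   unfolding direct_sum_iff using lin_closed[OF lin[OF q] X] by simp
  show "?\<psi> q d (X \<oplus>\<^bsub>tpow R V q d\<^esub> Y) = ?\<psi> q d X \<oplus>\<^bsub>direct_sum {1..} (%n. tpow R W n (d + e))\<^esub> ?\<psi> q d Y"
   if Y: "Y \<in> carrier (tpow R V q d)" for Y
   by (rule extensionalityI[OF _ direct_sum_ext(1)]) (simp_all add: direct_sum_app lin_add[OF lin[OF q] X Y])
  show "?\<psi> q d (c \<odot>\<^bsub>tpow R V q d\<^esub> X) = c \<odot>\<^bsub>direct_sum {1..} (%n. tpow R W n (d + e))\<^esub> ?\<psi> q d X"
   if c: "c \<in> carrier R" for c
   by (rule extensionalityI[OF _ direct_sum_ext(2)]) (simp_all add: direct_sum_app lin_smult[OF lin[OF q] c X])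
 qed
 have F1: "from_T R V (Tbar R W) e ?\<psi> \<in> bghom R (Tbar R V) (Tbar R W) e" by (rule from_T_realize(1)[OF V Tbar_bgmodule[OF W]]) (rule \<psi>)
 have F2: "bgapp (from_T R V (Tbar R W) e ?\<psi>) d (Tincl R V w) = ?\<psi> n d (tens R V w)" if "w \<in> words V n d" "1 \<le> n" for w n d
  by (rule from_T_realize(2)[OF V Tbar_bgmodule[OF W] _ that]) (rule \<psi>)
 show ?thesis unfolding realizes_def
 proof (intro conjI allI ballI)
  show "T_matrix R V W e \<phi> \<in> bghom R (bmod (Tbased R V)) (bmod (Tbased R W)) e" using F1 by (simp add: T_matrix_def)
  fix d w assume "w \<in> gens (Tbased R V) d"
  then have w: "w ~= []" "valid V w" "wdeg w = d" by (auto simp: gens_Tbased)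
  have ww: "w \<in> words V (length w) d" "1 \<le> length w" using w by (cases w; simp add: words_iff)+
  show "fkeys (f w) \<subseteq> gens (Tbased R W) (d + e)" using keys[OF w(2,1)] w(3) by (auto simp: gens_Tbased)
  have "?\<psi> (length w) d (tens R V w) = ev (Tbased R W) (d + e) (f w)"
  proof (rule extensionalityI[of _ "{1..}"])
   show "ev (Tbased R W) (d + e) (f w) \<in> extensional {1..}"
    using ev_closed[OF Tbased_is_based[OF W], of "d + e" "f w"] by (simp add: Tbar_def direct_sum_iff)
  qed (simp_all add: ev_Tbased[OF W] app[OF ww(2) _ ww(1)])
  then show "bgapp (T_matrix R V W e \<phi>) d (bvec (Tbased R V) w) = ev (Tbased R W) (d + e) (f w)" using F2[OF ww] by (simp add: T_matrix_def)
 qed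
qed

section \<open>Deconcatenation as a map of the tensor coalgebra\<close>

text \<open>Proper cuts only: both factors are nonempty, as the reduced coalgebra demands.\<close>

definition rdec :: "'x list => ('x list \<times> 'x list \<Rightarrow>\<^sub>0 int)" where
 "rdec w = (\<Sum>k\<in>{1..<length w}. frag_of (take k w, drop k w))"

lemma deconc_realizes:
 assumes V: "bgmodule R V"
 shows "realizes R (Tbased R V) (pbased R (Tbased R V)) 0 (deconc R V) rdec"
proof -
 note TV = Tbar_bgmodule[OF V]
 note TB = Tbased_is_based[OF V]
 have T2: "module R (tpow R (Tbar R V) 2 d)" for d by (rule tpow_mod[OF TV])
 let ?t = "%k w. tens R (Tbar R V) [(wdeg (take k w), Tincl R V (take k w)), (wdeg (drop k w), Tincl R V (drop k w))]"
 have sp: "take k w \<in> words V k (wdeg (take k w))" "drop k w \<in> words V (n - k) (wdeg (drop k w))" "wdeg (take k w) + wdeg (drop k w) = d"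
  if "w \<in> words V n d" "k < n" for w n k d
  using that wdeg_simps(3)[of "take k w" "drop k w"] by (auto simp: words_iff)
 \<comment> \<open>For a fixed cut position the varying letter lies in one of the two factors;
   linearity of the pairing in that factor gives the claim.\<close>
 have kml: "multilinear R V n d (tpow R (Tbar R V) 2 d) (?t k)" if k: "1 \<le> k" "k < n" for n d k
 proof (rule multilinearI)
  have k': "1 \<le> n - k" using k by simp
  show "?t k w \<in> carrier (tpow R (Tbar R V) 2 d)" if w: "w \<in> words V n d" for w
   using tens_cl[OF TV pair_words[THEN iffD2], OF conjI, OF Tincl_closed[OF V sp(1)[OF w k(2)] k(1)]
    Tincl_closed[OF V sp(2)[OF w k(2)] k']] sp(3)[OF w k(2)] by simp
  fix u e a v assume w: "u @ (e, a) # v \<in> words V n d"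
  note s = sp[OF w k(2)]
  note c = Tincl_closed[OF V s(1) k(1)] Tincl_closed[OF V s(2) k']
  show "?t k (u @ (e, a \<oplus>\<^bsub>V e\<^esub> b) # v) = ?t k (u @ (e, a) # v) \<oplus>\<^bsub>tpow R (Tbar R V) 2 d\<^esub> ?t k (u @ (e, b) # v)"
   if b: "b \<in> carrier (V e)" for b
  proof (cases "k \<le> length u")
   case True
   have t: "take k (u @ x # v) = take k u" "drop k (u @ x # v) = drop k u @ x # v" for x using True by simp_all
   note m = multilinearD(2)[OF Tincl_multilinear[OF V k'] s(2)[unfolded t] b]
   have cb: "Tincl R V (drop k u @ (e, b) # v) \<in> carrier (Tbar R V (wdeg (drop k u @ (e, a) # v)))"
    by (rule Tincl_closed[OF V words_replace(1)[OF V s(2)[unfolded t] b] k'])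
   show ?thesis using lin_add[OF tens_pair_linear(2)[OF TV c(1)[unfolded t]] c(2)[unfolded t] cb] s(3)[unfolded t] m unfolding t by simp
  next
   case False
   define j where "j = k - Suc (length u)"
   have kj: "k = Suc (length u + j)" using False by (simp add: j_def)
   have t: "take k (u @ x # v) = u @ x # take j v" "drop k (u @ x # v) = drop j v" for x by (simp_all add: kj)
   note m = multilinearD(2)[OF Tincl_multilinear[OF V k(1)] s(1)[unfolded t] b]
   have cb: "Tincl R V (u @ (e, b) # take j v) \<in> carrier (Tbar R V (wdeg (u @ (e, a) # take j v)))"
    by (rule Tincl_closed[OF V words_replace(1)[OF V s(1)[unfolded t] b] k(1)])
   show ?thesis using lin_add[OF tens_pair_linear(1)[OF TV c(2)[unfolded t]] c(1)[unfolded t] cb] s(3)[unfolded t] m unfolding t by simp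
  qed
  show "?t k (u @ (e, x \<odot>\<^bsub>V e\<^esub> a) # v) = x \<odot>\<^bsub>tpow R (Tbar R V) 2 d\<^esub> ?t k (u @ (e, a) # v)"
   if x: "x \<in> carrier R" for x
  proof (cases "k \<le> length u")
   case True
   have t: "take k (u @ x # v) = take k u" "drop k (u @ x # v) = drop k u @ x # v" for x using True by simp_all
   note m = multilinearD(3)[OF Tincl_multilinear[OF V k'] s(2)[unfolded t] x]
   show ?thesis using lin_smult[OF tens_pair_linear(2)[OF TV c(1)[unfolded t]] x c(2)[unfolded t]] s(3)[unfolded t] m unfolding t by simp
  next
   case False
   define j where "j = k - Suc (length u)"
   have kj: "k = Suc (length u + j)" using False by (simp add: j_def)
   have t: "take k (u @ x # v) = u @ x # take j v" "drop k (u @ x # v) = drop j v" for x by (simp_all add: kj)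
   note m = multilinearD(3)[OF Tincl_multilinear[OF V k(1)] s(1)[unfolded t] x]
   show ?thesis using lin_smult[OF tens_pair_linear(1)[OF TV c(2)[unfolded t]] x c(1)[unfolded t]] s(3)[unfolded t] m unfolding t by simp
  qed
 qed
 have ml: "multilinear R V n d (tpow R (Tbar R V) 2 d) (%w. finsum (tpow R (Tbar R V) 2 d) (%k. ?t k w) {1..<n})" for n d
  by (rule multilinear_finsum[OF kml T2 V]) auto
 let ?\<phi> = "%n d. tlift R (tpow R (Tbar R V) 2 d) (%w. finsum (tpow R (Tbar R V) 2 d) (%k. ?t k w) {1..<n})"
 have lin: "?\<phi> n d \<in> lmaps R (tpow R V n d) (tpow R (Tbar R V) 2 (d + 0))" for n d using tlift_linear[OF V T2 ml] by simp
 note F = from_T_realize[OF V tpow_bgmodule[OF TV], where \<phi> = ?\<phi> and e = 0, OF lin]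
 note P = pbased_is_based[OF TB]
 show ?thesis unfolding realizes_def
 proof (intro conjI allI ballI)
  show "deconc R V \<in> bghom R (bmod (Tbased R V)) (bmod (pbased R (Tbased R V))) 0" using F(1) by (simp add: deconc_def)
  fix d w assume "w \<in> gens (Tbased R V) d"
  then have w: "w ~= []" "valid V w" "wdeg w = d" by (auto simp: gens_Tbased)
  have ww: "w \<in> words V (length w) d" "1 \<le> length w" using w by (cases w; simp add: words_iff)+
  have kg: "(take k w, drop k w) \<in> gens (pbased R (Tbased R V)) d" if "k \<in> {1..<length w}" for k
   using that w sp(3)[OF ww(1)] by (auto simp: gens_pbased gens_Tbased)
  show "fkeys (rdec w) \<subseteq> gens (pbased R (Tbased R V)) (d + 0)"
   using keys_sum[of "%k. frag_of (take k w, drop k w)" "{1..<length w}"] kg unfolding rdec_def by fastforce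
  interpret T: module R "tpow R (Tbar R V) 2 d" by (rule T2)
  have "bgapp (deconc R V) d (Tincl R V w) = finsum (tpow R (Tbar R V) 2 d) (%k. ?t k w) {1..<length w}"
   using F(2)[OF ww] tlift_tens[OF V T2 ml ww(1)] by (simp add: deconc_def)
  also have "\<dots> = finsum (tpow R (Tbar R V) 2 d) (%k. ev (pbased R (Tbased R V)) d (frag_of (take k w, drop k w))) {1..<length w}"
   by (rule T.finsum_cong'[OF refl]) (use ev_closed[OF P, of d] in \<open>auto simp: ev_of[OF P kg]\<close>)
  finally show "bgapp (deconc R V) d (bvec (Tbased R V) w) = ev (pbased R (Tbased R V)) (d + 0) (rdec w)"
   using ev_sum[OF P, of d "%k. frag_of (take k w, drop k w)" "{1..<length w}"] by (simp add: rdec_def)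
 qed
qed

section \<open>The ideal of formal sums that evaluate to zero\<close>

text \<open>The condition ranges over all lengths and bidegrees, so x may mix both.\<close>

definition null :: "('r, 'a) bgmod => ('a word \<Rightarrow>\<^sub>0 int) => bool" where
 "null V x \<longleftrightarrow> (\<forall>l d. wev R V l d x = (zr (tpow R V l d)))"

text \<open>For valid u and v, the word u a v counts in length l and bidegree d exactly if a counts
  in the correspondingly reduced ones, and \<open>surround\<close> carries one evaluation to the
  other. Otherwise no word of the sum counts at all.\<close>

lemma null_append:
 assumes V: "bgmodule R V" and x: "null V x"
 shows "null V (fext (%a. frag_of (u @ a @ v)) x)"
 unfolding null_def
proof (intro allI)
 fix l d
 let ?x = "fext (%a. frag_of (u @ a @ v)) x"
 have k: "\<exists>a. b = u @ a @ v" if "b \<in> fkeys ?x" for b using subsetD[OF keys_frag_extend that] by (auto simp: keys_frag_of)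
 show "wev R V l d ?x = (zr (tpow R V l d))"
 proof (cases "valid V u \<and> valid V v \<and> length u + length v \<le> l")
  case False
  have "b \<notin> words V l d" if "b \<in> fkeys ?x" for b using k[OF that] False by (auto simp: words_iff)
  then show ?thesis by (rule wev_eq_0[OF V])
 next
  case True
  then have uv: "valid V u" "valid V v" by simp_all
  define n where "n = l - length u - length v"
  define d' where "d' = d - wdeg u - wdeg v"
  have l: "length u + n + length v = l" "wdeg u + d' + wdeg v = d" using True by (simp_all add: n_def d'_def)
  have w: "u @ a @ v \<in> words V l d \<longleftrightarrow> a \<in> words V n d'" for a using l uv by (auto simp: words_iff add_ac)
  note S = surround_linear[OF V V V uv, of n d', unfolded l]
  have "wev R V l d ?x = fev (tpow R V l d) (%a. wev R V l d (frag_of (u @ a @ v))) x"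
   unfolding wev_def by (rule fev_frag_extend[OF wev_total[OF V]])
  also have "\<dots> = fev (tpow R V l d) (%a. surround V u n v d' (if a \<in> words V n d' then tens R V a else (zr (tpow R V n d')))) x"
  proof (rule arg_cong[where f = "%t. fev (tpow R V l d) t x"], rule ext)
   fix a
   show "wev R V l d (frag_of (u @ a @ v)) = surround V u n v d' (if a \<in> words V n d' then tens R V a else (zr (tpow R V n d')))"
    using surround_tens[OF V V V uv, of a n d'] wev_of[OF V, of "u @ a @ v" l d] wev_eq_0[OF V, of "frag_of (u @ a @ v)" l d]
     lin_zero[OF S wev_total(1)[OF V] wev_total(1)[OF V]] by (auto simp: w)
  qed
  also have "\<dots> = surround V u n v d' (wev R V n d' x)" unfolding wev_def by (rule fev_lin[OF wev_total[OF V] wev_total(1)[OF V] S, symmetric])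
  also have "\<dots> = (zr (tpow R V l d))" using x lin_zero[OF S wev_total(1)[OF V] wev_total(1)[OF V]] by (simp add: null_def)
  finally show ?thesis .
 qed
qed

lemma null_frag_extend:
 assumes V: "bgmodule R V" and "!!b. null V (X b)"
 shows "null V (fext X x)"
 unfolding null_def wev_def
proof (intro allI)
 fix l d
 show "fev (tpow R V l d) (%w. if w \<in> words V l d then tens R V w else (zr (tpow R V l d))) (fext X x) = (zr (tpow R V l d))"
  unfolding fev_frag_extend[OF wev_total[OF V]] by (rule fev_eq_0[OF wev_total[OF V]]) (use assms(2) in \<open>simp add: null_def wev_def\<close>)
qed

lemma fcat_swap: "fcat x y = fext (%b. fext (%a. frag_of (a @ b)) x) y"
proof -
 have "fext (%a. fext (%b. frag_of (a @ b)) y) x = fext (%b. fext (%a. frag_of (a @ b)) x) y"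
  using subset_UNIV[of "fkeys y"] by (induct y rule: frag_induction) (simp_all add: frag_extend_diff frag_extend_fun_diff)
 then show ?thesis by (simp add: fcat_def)
qed

lemma null_ideal: "bgmodule R V ==> ideal (null V)" unfolding ideal_def
proof (intro conjI allI impI)
 assume V: "bgmodule R V"
 show "null V 0" by (simp add: null_def wev_0[OF V])
 show "null V (x - y)" if "null V x" "null V y" for x y using that by (simp add: null_def wev_diff_eq_0[OF V])
 show "null V (fcat x y)" if "null V x" for x y unfolding fcat_swap using null_append[OF V that, of "[]"] by - (rule null_frag_extend[OF V], simp)
 show "null V (fcat y x)" if "null V x" for x y unfolding fcat_def using null_append[OF V that, of _ "[]"] by - (rule null_frag_extend[OF V], simp)
qed

end

section \<open>Suspension, and the block formulas of F, d and K\<close>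

section \<open>Suspension\<close>

text \<open>Koszul exponent of a tensor power of \<sigma>: every later copy of \<sigma>, of bidegree
  (0,1), passes the letter and pairs with its upper degree.\<close>

fun ssign :: "'x word => int" where "ssign [] = 0"
| "ssign (x # w) = int (length w) * snd (fst x) + ssign w"

definition desusp :: "'x word => 'x word" where "desusp w = map (%(e, x). (e + (0, 1), x)) w"

lemma desusp_simps [simp]: "desusp [] = []" "desusp ((e, x) # w) = (e + (0, 1), x) # desusp w"
 "desusp (u @ v) = desusp u @ desusp v" "length (desusp w) = length w"
 "take n (desusp w) = desusp (take n w)" "drop n (desusp w) = desusp (drop n w)"
 by (auto simp: desusp_def take_map drop_map)

lemma wdeg_desusp: "wdeg (desusp w) = wdeg w + (0, int (length w))" by (induct w) (auto simp: desusp_def zero_prod_def)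

lemma valid_desusp: "valid V (desusp w) \<longleftrightarrow> valid (susp V) w" by (induct w) (auto simp: desusp_def susp_def)

lemma desusps: "w \<in> words (susp V) n d ==> desusp w \<in> words V n (d + (0, int n))" by (auto simp: words_iff wdeg_desusp valid_desusp)

lemma susp_bg: "bgmodule R V ==> bgmodule R (susp V)" by (simp add: bgmodule_def susp_def)

text \<open>Turns a family of maps into a letter function for the formal operators: the arity is
  read off from the length of the block.\<close>

definition opl :: "'r ring => ('r, 'a) bgmod => ('r, 'a, 'b) opfam => nat => 'a word => 'b" where
 "opl R V g p b = bgapp (g p (length b)) (wdeg b) (tens R V b)"

definition susp_fam :: "'r ring => ('r, 'a) bgmod => ('r, 'b) bgmod => ('r, 'a, 'b) opfam => ('r, 'a, 'b) opfam" where
 "susp_fam R A B f p q = Psi R A B q (f p q)"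

lemma linear_id: "module R M ==> (%x. x) \<in> lmaps R M M" by (auto simp: linear_maps_def)

context bgmods
begin

lemma btens_word_unary:
 assumes V: "bgmodule R V" and W: "bgmodule R W" and f: "!!d. bgapp f d \<in> lmaps R (V d) (W (d + bdeg f))"
  and x: "snd x \<in> carrier (V (fst x))"
 shows "btens_word R V ((1, unary R W f) # fs) (x # w) = (fst x + bdeg f, bgapp f (fst x) (snd x)) # btens_word R V fs w"
 using unary_tens[OF V W f x] by simp

text \<open>The only signs are the exponent b + k - 1 in \<open>Psi\<close> and the
  \<open>ssign\<close> of the tensor power of \<sigma>; on underlying elements \<sigma> and its
  inverse are the identity.\<close>

lemma Psi_props:
 assumes A: "bgmodule R A" and B: "bgmodule R B" and f: "f \<in> bghom R (tpow R A k) B (a, b)"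
 shows "Psi R A B k f \<in> bghom R (tpow R (susp A) k) (susp B) (a, b + int k - 1)" (is ?c1)
  and "w \<in> words (susp A) k d ==> bgapp (Psi R A B k f) d (tens R (susp A) w) =
   sg (susp B (d + (a, b + int k - 1))) (b + int k - 1 + ssign w) (bgapp f (d + (0, int k)) (tens R A (desusp w)))"
proof -
 note SA = susp_bg[OF A] and SB = susp_bg[OF B]
 let ?u = "(1, unary R A (desusp_map :: ('a, 'a) bgmap))"
 have dl: "bgapp (desusp_map :: ('a, 'a) bgmap) d \<in> lmaps R (susp A d) (A (d + bdeg (desusp_map :: ('a, 'a) bgmap)))" for d
  using linear_id[OF bgD[OF A]] by (simp add: desusp_map_def susp_def)
 have bl: "blin R (susp A) A q g" if "(q, g) \<in> set (replicate k ?u)" for q g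
  using that unary_blin[OF SA A dl] by (auto dest: in_set_replicate[THEN iffD1])
 have sl: "sum_list (map fst (replicate k ?u)) = k" "length (replicate k ?u) = k" for k by (induct k) simp_all
 have bd: "sum_list (map (%(q, g). bdeg g) (replicate k ?u)) = (0, int k)" for k by (induct k) (auto simp: desusp_map_def zero_prod_def)
 have word: "btens_word R (susp A) (replicate k ?u) w = desusp w" if "valid (susp A) w" "length w = k" for w k using that
 proof (induct w arbitrary: k)
  case (Cons x w)
  then obtain j where j: "k = Suc j" by (cases k) auto
  obtain e y where x: "x = (e, y)" by (cases x)
  have "btens_word R (susp A) (?u # replicate j ?u) (x # w) = (fst x + bdeg (desusp_map :: ('a, 'a) bgmap), bgapp desusp_map (fst x) (snd x)) # btens_word R (susp A) (replicate j ?u) w"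
   by (rule btens_word_unary[OF SA A dl]) (use Cons.prems in simp)
  with Cons show ?case by (simp add: j x desusp_map_def del: btens_word_Cons)
 qed simp
 have sign: "btens_sign (replicate k ?u) w = ssign w" if "length w = k" for w :: "'a word" and k using that
 proof (induct w arbitrary: k)
  case (Cons x w)
  then obtain j where j: "k = Suc j" by (cases k) auto
  have "btens_sign (?u # replicate j ?u) (x # w) = bipair (0, int j) (fst x) + btens_sign (replicate j ?u) w" using bd[of j] by simp
  with Cons show ?case by (simp add: j bipair_def)
 qed simp
 have tb: "bdeg (tmaps R (susp A) A (replicate k desusp_map)) = (0, int k)" by (simp add: tmaps_def bd[simplified])
 have tl: "bgapp (tmaps R (susp A) A (replicate k desusp_map)) d \<in> lmaps R (tpow R (susp A) k d) (tpow R A k (d + (0, int k)))" for d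
  using btens_linear[OF SA A, where fs = "replicate k ?u", OF bl, unfolded sl, of d] bd[of k] by (simp add: tmaps_def)
 have tt: "bgapp (tmaps R (susp A) A (replicate k desusp_map)) d (tens R (susp A) w) =
   sg (tpow R A k (d + (0, int k))) (ssign w) (tens R A (desusp w))" if w: "w \<in> words (susp A) k d" for d w
  using btens_tens[OF SA A, where fs = "replicate k ?u", OF bl, unfolded sl, OF _ w] bd[of k] word[of w k] sign[of w k] w
  by (simp add: tmaps_def words_iff)
 have fb: "bdeg f = (a, b)" using f by (simp add: bghom_def)
 have deg: "d + (0, int k) + (a, b) + (0, -1) = d + (a, b + int k - 1)" "d + (0, int k) + (a, b) = d + (a, b + int k - 1) + (0, 1)" for d
  by (cases d; simp)+
 have Bs: "B (d + (0, int k) + (a, b)) = susp B (d + (a, b + int k - 1))" for d by (simp add: susp_def deg)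
 have pb: "bdeg (Psi R A B k f) = (a, b + int k - 1)" by (simp add: Psi_def bgsgn_def bgcomp_def susp_map_def fb tb)
 have pa: "bgapp (Psi R A B k f) d x = sg (susp B (d + (a, b + int k - 1))) (b + int k - 1)
   (bgapp f (d + (0, int k)) (bgapp (tmaps R (susp A) A (replicate k desusp_map)) d x))" for d x
 proof -
  have "d + ((0, -1) + ((a, b) + (0, int k))) = d + (a, b + int k - 1)" by (cases d) simp
  then show ?thesis unfolding Psi_def bgsgn_def bgcomp_def susp_map_def bgmap.simps fb tb by simp
 qed
 have fl: "bgapp f (d + (0, int k)) \<in> lmaps R (tpow R A k (d + (0, int k))) (susp B (d + (a, b + int k - 1)))" for d
  using bghomD(2)[OF f, of "d + (0, int k)"] by (simp only: Bs)
 show ?c1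
  by (rule bghomI[OF pb]) (unfold pa, rule lin_sg_map[OF lin_comp[OF tl fl] bgD[OF SB]])
 assume w: "w \<in> words (susp A) k d"
 have "tens R A (desusp w) \<in> carrier (tpow R A k (d + (0, int k)))" by (rule tens_cl[OF A desusps[OF w]])
 then show "bgapp (Psi R A B k f) d (tens R (susp A) w) =
   sg (susp B (d + (a, b + int k - 1))) (b + int k - 1 + ssign w) (bgapp f (d + (0, int k)) (tens R A (desusp w)))"
  unfolding pa tt[OF w] by (simp add: lin_sg[OF fl tpow_mod[OF A] bgD[OF SB]] sg_sg[OF bgD[OF SB]] lin_closed[OF fl])
qed

section \<open>The coalgebra map of a family\<close>

lemma concat_blocks: "sum_list qs = length w ==> concat (blocks qs w) = w \<and> map length (blocks qs w) = qs"
 by (induct qs w rule: blocks.induct) auto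

lemma blocks_concat: "blocks (map length bs) (concat bs) = bs" by (induct bs) auto

lemma dec_lists_zip:
 assumes "length ps = l" "length qs = l" "sum_list ps = p" "sum_list qs = length w" "\<forall>q\<in>set qs. 1 \<le> q"
 shows "map fst (zip ps (blocks qs w)) = ps" "map (length \<circ> snd) (zip ps (blocks qs w)) = qs"
  "zip ps (blocks qs w) \<in> decs p w" "length (zip ps (blocks qs w)) = l"
proof -
 have len: "length ps = length (blocks qs w)" using assms by simp
 note c = concat_blocks[OF assms(4)]
 have m: "map fst (zip ps (blocks qs w)) = ps" "map snd (zip ps (blocks qs w)) = blocks qs w" using len by simp_all
 have "[] \<notin> set (blocks qs w)"
 proof
  assume "[] \<in> set (blocks qs w)"
  then have "0 \<in> set (map length (blocks qs w))" by force
  then show False using c assms(5) by auto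
 qed
 moreover have "snd ` set (zip ps (blocks qs w)) = set (blocks qs w)" using m(2) by (metis set_map)
 ultimately show "map fst (zip ps (blocks qs w)) = ps" "map (length \<circ> snd) (zip ps (blocks qs w)) = qs"
  "zip ps (blocks qs w) \<in> decs p w" "length (zip ps (blocks qs w)) = l"
  using c m assms by (simp_all add: decs_def flip: map_map)
qed

lemma dec_lists_unzip:
 assumes "D \<in> decs p w"
 shows "zip (map fst D) (blocks (map (length \<circ> snd) D) w) = D" (is ?c1) "sum_list (map fst D) = p"
  "sum_list (map (length \<circ> snd) D) = length w" (is ?c2) "\<forall>q\<in>set (map (length \<circ> snd) D). 1 \<le> q" (is ?c3)
proof -
 have D: "concat (map snd D) = w" "sum_list (map fst D) = p" "[] \<notin> snd ` set D" using assms by (auto simp: decs_def)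
 have ne: "\<forall>x\<in>set D. snd x ~= []" using D(3) by (metis image_eqI)
 have "blocks (map (length \<circ> snd) D) w = map snd D" using blocks_concat[of "map snd D"] D(1) by simp
 then show ?c1 by (simp add: zip_map_fst_snd)
 show ?c2 using D(1) by (metis length_concat map_map)
 show ?c3 using ne by (auto simp: Suc_le_eq)
qed (use assms in \<open>simp add: decs_def\<close>)

text \<open>The lists of indices and of positive arities correspond to decompositions of w, the
  arities being the block lengths.\<close>

lemma sum_dec_lists:
 assumes "length w = q"
 shows "(\<Sum>(ps, qs)\<in>{(ps, qs). length ps = l \<and> length qs = l \<and> sum_list ps = p \<and> sum_list qs = q \<and> (\<forall>q\<in>set qs. 1 \<le> q)}.
   T (zip ps (blocks qs w))) = (\<Sum>D\<in>{D \<in> decs p w. length D = l}. T D)"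
proof (rule sum.reindex_bij_witness[where i = "%D. (map fst D, map (length \<circ> snd) D)" and j = "%(ps, qs). zip ps (blocks qs w)"])
 let ?S = "{(ps, qs). length ps = l \<and> length qs = l \<and> sum_list ps = p \<and> sum_list qs = q \<and> (\<forall>q\<in>set qs. 1 \<le> q)}"
 fix x assume x: "x \<in> ?S"
 obtain ps qs where pq: "x = (ps, qs)" by (cases x)
 have "length ps = l" "length qs = l" "sum_list ps = p" "sum_list qs = length w" "\<forall>q\<in>set qs. 1 \<le> q"
  using x assms unfolding pq by auto
 note z = dec_lists_zip[OF this]
 show "(map fst (case x of (ps, qs) => zip ps (blocks qs w)), map (length \<circ> snd) (case x of (ps, qs) => zip ps (blocks qs w))) = x"
  unfolding pq prod.case z ..
 show "(case x of (ps, qs) => zip ps (blocks qs w)) \<in> {D \<in> decs p w. length D = l}" unfolding pq prod.case using z by blast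
 show "T (case x of (ps, qs) => zip ps (blocks qs w)) = (case x of (ps, qs) => T (zip ps (blocks qs w)))" unfolding pq prod.case ..
next
 fix D assume D: "D \<in> {D \<in> decs p w. length D = l}"
 then have D': "D \<in> decs p w" "length D = l" by auto
 note z = dec_lists_unzip[OF D'(1)]
 show "(case (map fst D, map (length \<circ> snd) D) of (ps, qs) => zip ps (blocks qs w)) = D" unfolding prod.case by (rule z(1))
 show "(map fst D, map (length \<circ> snd) D) \<in> {(ps, qs). length ps = l \<and> length qs = l \<and> sum_list ps = p \<and> sum_list qs = q \<and> (\<forall>q\<in>set qs. 1 \<le> q)}"
  unfolding mem_Collect_eq prod.case using z(2-4) D'(2) assms by (intro conjI) (simp_all only: length_map)
qed

lemma btens_decs:
 assumes g: "!!p q. 1 \<le> q ==> bdeg (g p q) = - dsh p" and "length ps = length qs" "sum_list qs = length w" "\<forall>q\<in>set qs. 1 \<le> q"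
 shows "btens_word R V (map2 (%p q. (q, g p q)) ps qs) w = bword (opl R V g) (zip ps (blocks qs w))"
  and "btens_sign (map2 (%p q. (q, g p q)) ps qs) w = dec_sign (zip ps (blocks qs w))"
  and "sum_list (map (%(q, f). bdeg f) (map2 (%p q. (q, g p q)) ps qs)) = - dsh (sum_list ps)"
  and "sum_list (map fst (map2 (%p q. (q, g p q)) ps qs)) = length w"
  and "length (map2 (%p q. (q, g p q)) ps qs) = length ps"
 using assms(2-4)
proof (induct ps qs arbitrary: w rule: list_induct2)
 case (Cons p ps q qs)
 {
  case 1
  have q: "q \<le> length w" "sum_list qs = length (drop q w)" "1 \<le> q" using 1 by auto
  show ?case using Cons(2)[OF q(2)] 1 q by (simp add: opl_def g min_def)
 next
  case 2
  have q: "q \<le> length w" "sum_list qs = length (drop q w)" "1 \<le> q" using 2 by auto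
  have m: "map fst (zip ps (blocks qs (drop q w))) = ps" using Cons(1) by simp
  show ?case using Cons(3)[OF q(2)] Cons(4)[OF q(2)] 2 q by (simp add: m)
 next
  case 3
  have q: "sum_list qs = length (drop q w)" using 3 by auto
  show ?case using Cons(4)[OF q] 3 by (simp add: g)
 next
  case 4
  have q: "sum_list qs = length (drop q w)" using 4 by auto
  show ?case using Cons(5)[OF q] 4 by simp
 next
  case 5
  show ?case using Cons(1) by simp
 }
qed simp_all

lemma finsum_sg_tens:
 assumes W: "bgmodule R W" and S: "!!s. s \<in> S ==> v s \<in> words W l d"
  and f: "!!s. s \<in> S ==> f s = sg (tpow R W l d) (k s) (tens R W (v s))"
 shows "finsum (tpow R W l d) f S = wev R W l d (\<Sum>s\<in>S. fsg (k s) (frag_of (v s)))"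
proof -
 interpret T: module R "tpow R W l d" by (rule tpow_mod[OF W])
 show ?thesis unfolding wev_sum[OF W]
  by (rule T.finsum_cong'[OF refl]) (simp_all add: f wev_fsg[OF W] wev_of[OF W S] Pi_def sg_closed[OF T.module_axioms tens_cl[OF W S]])
qed

text \<open>A formal operator mixes output lengths while a matrix entry sees one of them; evaluation
  in length l discards the other summands.\<close>

lemma wev_restrict:
 assumes W: "bgmodule R W" and "finite S" and "!!s v. s \<in> S ==> \<not> P s ==> v \<in> fkeys (X s) ==> v \<notin> words W l d"
 shows "wev R W l d (\<Sum>s\<in>S. X s) = wev R W l d (\<Sum>s\<in>{s \<in> S. P s}. X s)"
proof -
 have "(\<Sum>s\<in>S. X s) - (\<Sum>s\<in>{s \<in> S. P s}. X s) = (\<Sum>s\<in>S - {s \<in> S. P s}. X s)" using assms(2) by (subst sum_diff) auto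
 moreover have "wev R W l d (\<Sum>s\<in>S - {s \<in> S. P s}. X s) = (zr (tpow R W l d))"
 proof (rule wev_eq_0[OF W])
  fix w assume w: "w \<in> fkeys (\<Sum>s\<in>S - {s \<in> S. P s}. X s)"
  obtain s where "s \<in> S - {s \<in> S. P s}" "w \<in> fkeys (X s)" using subsetD[OF keys_sum w] by (rule UN_E)
  then show "w \<notin> words W l d" using assms(3) by blast
 qed
 ultimately show ?thesis using wev_diff_eq_0[OF W, of l d "\<Sum>s\<in>S. X s" "\<Sum>s\<in>{s \<in> S. P s}. X s"] by simp
qed

lemma length_decs: "D \<in> decs p w ==> length D \<le> length w"
proof -
 have "length D \<le> length (concat (map snd D))" if "[] \<notin> set (map snd D)" for D :: "(nat \<times> 'z list) list" using that
 proof (induct D)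
  case (Cons x D)
  then have "1 \<le> length (snd x)" by (cases "snd x") auto
  moreover have "length D \<le> length (concat (map snd D))" using Cons by simp
  ultimately show ?case by simp
 qed simp
 then show "D \<in> decs p w ==> length D \<le> length w" by (auto simp: decs_def)
qed

lemma valid_bword:
 assumes V: "bgmodule R V" and g: "!!p q. 1 \<le> q ==> g p q \<in> bghom R (tpow R V q) W (- dsh p)"
  and D: "D \<in> decs p w" and w: "valid V w"
 shows "valid W (bword (opl R V g) D)"
proof -
 have "valid W (bword (opl R V g) D)" if "valid V (concat (map snd D))" "[] \<notin> set (map snd D)" for D using that
 proof (induct D)
  case (Cons x D)
  obtain p b where x: "x = (p, b)" by (cases x)
  have b: "valid V b" "1 \<le> length b" using Cons.prems by (cases b; simp add: x)+
  have "tens R V b \<in> carrier (tpow R V (length b) (wdeg b))" by (rule tens_cl[OF V]) (simp add: words_iff b)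
  then have "opl R V g p b \<in> carrier (W (wdeg b + - dsh p))" unfolding opl_def using lin_closed[OF bghomD(2)[OF g[OF b(2)]]] by blast
  then show ?case using Cons by (simp add: x)
 qed simp
 then show ?thesis using D w by (auto simp: decs_def)
qed

lemma coalg_realizes:
 assumes V: "bgmodule R V" and W: "bgmodule R W" and g: "!!p q. 1 \<le> q ==> g p q \<in> bghom R (tpow R V q) W (- dsh p)"
 shows "realizes R (Tbased R V) (Tbased R W) (- dsh p) (T_matrix R V W (- int p, - int p)
  (%q l. bgsum (tpow R W l) (- int p, - int p) (%_. 0) (%(ps, qs). btens R V W (map2 (%p q. (q, g p q)) ps qs))
    {(ps, qs). length ps = l \<and> length qs = l \<and> sum_list ps = p \<and> sum_list qs = q \<and> (\<forall>q\<in>set qs. 1 \<le> q)}))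
  (coalg_fop (opl R V g) p)"
proof -
 have e: "(- int p, - int p) = - dsh p" by (simp add: dsh_def)
 let ?S = "%q l. {(ps :: nat list, qs :: nat list). length ps = l \<and> length qs = l \<and> sum_list ps = p \<and> sum_list qs = q \<and> (\<forall>q\<in>set qs. 1 \<le> q)}"
 let ?fs = "%ps qs. map2 (%p q. (q, g p q)) ps qs"
 have gd: "bdeg (g p q) = - dsh p" if "1 \<le> q" for p q using bghomD(1)[OF g[OF that]] .
 have bl: "blin R V W q f" if "(ps, qs) \<in> ?S q' l" "(q, f) \<in> set (?fs ps qs)" for ps qs q f q' l
 proof -
  have "q \<in> set qs" "\<exists>p. f = g p q" using that(2) by (auto dest: set_zip_rightD)
  then show ?thesis using that(1) bghom_blin[OF g] by auto
 qed
 have pq: "length ps = length qs" "sum_list qs = length w" "\<forall>q\<in>set qs. 1 \<le> q" "length ps = l" "sum_list ps = p"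
  if "(ps, qs) \<in> ?S (length w) l" for ps qs l and w :: "'b word"
  using that by auto
 have sums: "sum_list (map (%(q, f). bdeg f) (?fs ps qs)) = - dsh p" "sum_list (map fst (?fs ps qs)) = q" "length (?fs ps qs) = l"
  if "(ps, qs) \<in> ?S q l" for ps qs q l
  using btens_decs(3,4,5)[where g = g and ps = ps and qs = qs and w = "replicate q undefined", OF gd] that by auto
 have btl: "bgapp (btens R V W (?fs ps qs)) d \<in> lmaps R (tpow R V q d) (tpow R W l (d + - dsh p))"
  if "(ps, qs) \<in> ?S q l" for ps qs q l d
  using btens_linear[OF V W, where fs = "?fs ps qs" and d = d, OF bl[OF that]] by (simp add: sums[OF that] del: length_map map_map)
 have M: "module R (tpow R V n d)" "module R (tpow R W n d)" for n d by (rule tpow_mod[OF V], rule tpow_mod[OF W])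
 show ?thesis unfolding e
 proof (rule T_matrix_realizes[OF V W])
  fix q l :: nat and d assume q: "1 \<le> q" and l: "1 \<le> l"
  show "bgapp (bgsum (tpow R W l) (- dsh p) (%_. 0) (%(ps, qs). btens R V W (?fs ps qs)) (?S q l)) d
    \<in> lmaps R (tpow R V q d) (tpow R W l (d + - dsh p))"
   unfolding bgsum_def bgmap.simps
  proof (intro lin_finsum_map M lin_sg_map)
   fix s assume "s \<in> ?S q l"
   moreover obtain ps qs where ps: "s = (ps, qs)" by (cases s)
   ultimately show "bgapp (case s of (ps, qs) => btens R V W (?fs ps qs)) d \<in> lmaps R (tpow R V q d) (tpow R W l (d + - dsh p))"
    unfolding ps prod.case by (intro btl)
  qed
  fix w assume w: "w \<in> words V q d"
  have lw: "length w = q" "valid V w" using w by (auto simp: words_iff)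
  have bt: "bgapp (btens R V W (?fs ps qs)) d (tens R V w) = sg (tpow R W l (d + - dsh p)) (dec_sign (zip ps (blocks qs w)))
    (tens R W (bword (opl R V g) (zip ps (blocks qs w))))
    \<and> bword (opl R V g) (zip ps (blocks qs w)) \<in> words W l (d + - dsh p)"
   if pqs: "(ps, qs) \<in> ?S q l" for ps qs
  proof -
   note s = sums[OF pqs]
   have *: "length ps = length qs" "sum_list qs = length w" "\<forall>q\<in>set qs. 1 \<le> q" using pqs lw by auto
   have bd: "btens_word R V (?fs ps qs) w = bword (opl R V g) (zip ps (blocks qs w))" "btens_sign (?fs ps qs) w = dec_sign (zip ps (blocks qs w))"
    by (rule btens_decs(1)[where g = g, OF gd *], assumption) (rule btens_decs(2)[where g = g, OF gd *], assumption)
   have ww: "w \<in> words V (sum_list (map fst (?fs ps qs))) d" unfolding s by (rule w)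
   show ?thesis using btens_tens[OF V W, where fs = "?fs ps qs" and w = w and d = d, OF bl[OF pqs] ww]
     btens_word_words[OF V, where fs = "?fs ps qs" and w = w and d = d and W = W, OF bl[OF pqs] ww]
    unfolding bdeg_btens s bd by simp
  qed
  have "bgapp (bgsum (tpow R W l) (- dsh p) (%_. 0) (%(ps, qs). btens R V W (?fs ps qs)) (?S q l)) d (tens R V w) =
    wev R W l (d + - dsh p) (\<Sum>s\<in>?S q l. fsg (case s of (ps, qs) => dec_sign (zip ps (blocks qs w)))
     (frag_of (case s of (ps, qs) => bword (opl R V g) (zip ps (blocks qs w)))))"
   unfolding bgsum_def bgmap.simps by (rule finsum_sg_tens[OF W]) (use bt sg_sg[OF M(2)] in \<open>auto simp: sg_def\<close>)
  also have "(\<Sum>s\<in>?S q l. fsg (case s of (ps, qs) => dec_sign (zip ps (blocks qs w)))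
     (frag_of (case s of (ps, qs) => bword (opl R V g) (zip ps (blocks qs w))))) =
    (\<Sum>D\<in>{D \<in> decs p w. length D = l}. fsg (dec_sign D) (frag_of (bword (opl R V g) D)))"
   using sum_dec_lists[OF lw(1), where T = "%D. fsg (dec_sign D) (frag_of (bword (opl R V g) D))"] by (simp add: case_prod_beta)
  also have "wev R W l (d + - dsh p) \<dots> = wev R W l (d + - dsh p) (coalg_fop (opl R V g) p w)" unfolding coalg_fop_def
   by (rule wev_restrict[OF W finite_decs, symmetric]) (auto simp: words_iff)
  finally show "bgapp (bgsum (tpow R W l) (- dsh p) (%_. 0) (%(ps, qs). btens R V W (?fs ps qs)) (?S q l)) d (tens R V w) =
    wev R W l (d + - dsh p) (coalg_fop (opl R V g) p w)" .
 next
  fix w v assume w: "valid V w" "w ~= []" and v: "v \<in> fkeys (coalg_fop (opl R V g) p w)"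
  obtain D where D: "D \<in> decs p w" "v = bword (opl R V g) D" using v by (rule coalg_fop_keys)
  have "length v = length D" by (simp add: D(2))
  then have "v ~= []" using decs_nonempty[OF D(1) w(2)] by auto
  then show "v ~= [] \<and> valid W v \<and> wdeg v = wdeg w + - dsh p \<and> length v \<le> length w"
   using valid_bword[OF V g D(1) w(1)] D(1) decs_nonempty[OF D(1) w(2)] length_decs[OF D(1)] by (auto simp: D(2) wdeg_bword decs_def)
 qed
qed

end

definition letter_map :: "('a, 'b) bgmap => 'a word => 'b word" where "letter_map f = map (%(e, x). (e, bgapp f e x))"

lemma letter_map_simps [simp]: "letter_map f [] = []" "letter_map f ((e, x) # w) = (e, bgapp f e x) # letter_map f w"
 "length (letter_map f w) = length w" "wdeg (letter_map f w) = wdeg w"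
 by (auto simp: letter_map_def wdeg_def comp_def case_prod_beta)

lemma letter_map_bgid [simp]: "letter_map bgid w = w" by (induct w) (auto simp: letter_map_def bgid_def)

text \<open>The common shape of three operators: one map f with copies of u1 before and of u2 behind
  it, both of bidegree 0. Insertions take the identity for u1 and u2; pi and the middle part of t_n
  take the two end projections, suspended in the case of pi.\<close>

definition sandw :: "'r ring => ('r, 'b) bgmod => ('a, 'b) bgmap => nat => nat => (('r, 'a) tens, 'b) bgmap =>
  ('a, 'b) bgmap => nat => (nat \<times> (('r, 'a) tens, 'b) bgmap) list" where
 "sandw R W u1 s j f u2 t = replicate s (1, unary R W u1) @ (j, f) # replicate t (1, unary R W u2)"

definition sandw_word :: "'r ring => ('r, 'a) bgmod => ('a, 'b) bgmap => nat => nat => (('r, 'a) tens, 'b) bgmap =>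
  ('a, 'b) bgmap => 'a word => 'b word" where
 "sandw_word R V u1 s j f u2 w = letter_map u1 (take s w)
  @ (wdeg (take j (drop s w)) + bdeg f, bgapp f (wdeg (take j (drop s w))) (tens R V (take j (drop s w))))
  # letter_map u2 (drop (s + j) w)"

context bgmods
begin

context
 fixes V :: "('r, 'a) bgmod" and W :: "('r, 'b) bgmod"
 assumes V: "bgmodule R V" and W: "bgmodule R W"
begin

lemma btens_replicate:
 assumes u: "!!d. bgapp f d \<in> lmaps R (V d) (W d)" and f0: "bdeg f = 0" and w: "valid V w" "length w = s"
 shows "btens_word R V (replicate s (1, unary R W f) @ fs) (w @ w') = letter_map f w @ btens_word R V fs w'"
  and "btens_sign (replicate s (1, unary R W f) @ fs) (w @ w') = bipair (sum_list (map (%(q, f). bdeg f) fs)) (wdeg w) + btens_sign fs w'"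
  and "sum_list (map (%(q, f). bdeg f) (replicate s (1, unary R W f))) = 0"
 using w
proof (induct w arbitrary: s)
 case (Cons x w)
 have u': "bgapp f d \<in> lmaps R (V d) (W (d + bdeg f))" for d using u by (simp add: f0)
 {
  case 1
  then obtain k where k: "s = Suc k" "length w = k" by (cases s) auto
  obtain e y where x: "x = (e, y)" by (cases x)
  have "btens_word R V ((1, unary R W f) # replicate k (1, unary R W f) @ fs) (x # w @ w') =
    (fst x + bdeg f, bgapp f (fst x) (snd x)) # btens_word R V (replicate k (1, unary R W f) @ fs) (w @ w')"
   by (rule btens_word_unary[OF V W u']) (use 1 in simp)
  then show ?case using Cons(1)[of k] 1 k by (simp add: f0 x del: btens_word_Cons)
 next
  case 2
  then obtain k where k: "s = Suc k" "length w = k" by (cases s) auto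
  show ?case using Cons(2)[of k] Cons(3)[of k] 2 k by simp
 next
  case 3
  then obtain k where k: "s = Suc k" "length w = k" by (cases s) auto
  show ?case using Cons(3)[of k] 3 k by (simp add: f0)
 }
qed simp_all

lemma sum_bdeg_unary: "bdeg u = 0 ==> sum_list (map (%(q, f). bdeg f) (replicate s (1, unary R W u))) = 0" by (induct s) auto

context
 fixes u1 u2 :: "('a, 'b) bgmap" and f :: "(('r, 'a) tens, 'b) bgmap" and s j t :: nat and e
 assumes u1: "!!d. bgapp u1 d \<in> lmaps R (V d) (W d)" "bdeg u1 = 0"
  and u2: "!!d. bgapp u2 d \<in> lmaps R (V d) (W d)" "bdeg u2 = 0"
  and f: "f \<in> bghom R (tpow R V j) W e"
begin

abbreviation (input) "sw \<equiv> sandw R W u1 s j f u2 t"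

lemma sandw_blin: "(q, g) \<in> set sw ==> blin R V W q g"
proof -
 have "blin R V W 1 (unary R W u1)" by (rule unary_blin[OF V W]) (simp add: u1)
 moreover have "blin R V W 1 (unary R W u2)" by (rule unary_blin[OF V W]) (simp add: u2)
 ultimately show "(q, g) \<in> set sw ==> blin R V W q g" using bghom_blin[OF f] by (auto simp: sandw_def)
qed

lemma sandw_props: "sum_list (map fst sw) = s + j + t" "length sw = s + 1 + t" "sum_list (map (%(q, f). bdeg f) sw) = e"
 using sum_bdeg_unary[OF u1(2), of s] sum_bdeg_unary[OF u2(2), of t] bghomD(1)[OF f] by (simp_all add: sandw_def sum_list_replicate)

lemma sandw_linear: "bgapp (btens R V W sw) d \<in> lmaps R (tpow R V (s + j + t) d) (tpow R W (s + 1 + t) (d + e))"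
 using btens_linear[OF V W, where fs = sw and d = d, OF sandw_blin] unfolding bdeg_btens sandw_props by simp

lemma sandw_tens:
 assumes w: "w \<in> words V (s + j + t) d"
 shows "bgapp (btens R V W sw) d (tens R V w) = sg (tpow R W (s + 1 + t) (d + e)) (bipair e (wdeg (take s w)))
   (tens R W (sandw_word R V u1 s j f u2 w))" (is ?c1)
  and "sandw_word R V u1 s j f u2 w \<in> words W (s + 1 + t) (d + e)" (is ?c2)
proof -
 have v: "valid V (take s w)" "length (take s w) = s" "valid V (drop (s + j) w)" "length (drop (s + j) w) = t" using w by (auto simp: words_iff)
 have dd: "drop j (drop s w) = drop (s + j) w" by (simp add: add.commute)
 have word: "btens_word R V sw w = sandw_word R V u1 s j f u2 w"
  using btens_replicate(1)[OF u1 v(1,2), of "(j, f) # replicate t (1, unary R W u2)" "drop s w"] btens_replicate(1)[OF u2 v(3,4), of "[]" "[]"]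
  by (simp add: sandw_def sandw_word_def add.commute[of j s])
 have sign: "btens_sign sw w = bipair e (wdeg (take s w))"
  using btens_replicate(2)[OF u1 v(1,2), of "(j, f) # replicate t (1, unary R W u2)" "drop s w"]
   btens_replicate(2)[OF u2 v(3,4), of "[]" "[]"] sum_bdeg_unary[OF u2(2), of t] bghomD(1)[OF f]
  by (simp add: sandw_def add.commute[of j s])
 have w': "w \<in> words V (sum_list (map fst sw)) d" unfolding sandw_props by (rule w)
 show ?c1
  using btens_tens[OF V W, where fs = sw and w = w and d = d, OF sandw_blin w'] unfolding bdeg_btens sandw_props word sign .
 show ?c2
  using btens_word_words[OF V, where fs = sw and w = w and d = d and W = W, OF sandw_blin w'] unfolding sandw_props word .
qed

end

end

lemma bgid_linear: "bgmodule R V ==> bgapp bgid d \<in> lmaps R (V d) (V d)" using linear_id[OF bgD] by (simp add: bgid_def)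

lemma bdeg_bgid: "bdeg bgid = 0" by (simp add: bgid_def)

lemma insert_op_sandw: "insert_op R V s q f t = btens R V V (sandw R V bgid s q f bgid t)" by (simp add: insert_op_def sandw_def)

lemma insert_realizes:
 assumes V: "bgmodule R V" and g: "!!j. 1 \<le> j ==> g i j \<in> bghom R (tpow R V j) V ((0, 1) - dsh i)"
 shows "realizes R (Tbased R V) (Tbased R V) ((0, 1) - dsh i) (T_matrix R V V (- int i, 1 - int i)
  (%q l. bgsum (tpow R V l) (- int i, 1 - int i) (%_. 0)
    (%(s, j, t). insert_op R V s j (g i j) t) {(s, j, t). s + 1 + t = l \<and> s + j + t = q \<and> 1 \<le> j}))
  (insert_fop (opl R V g) i)"
proof -
 let ?e = "(0, 1) - dsh i"
 have e: "(- int i, 1 - int i) = ?e" by (simp add: dsh_def)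
 let ?S = "%q l. {(s :: nat, j :: nat, t :: nat). s + 1 + t = l \<and> s + j + t = q \<and> 1 \<le> j}"
 have M: "module R (tpow R V n d)" for n d by (rule tpow_mod[OF V])
 note sl = sandw_linear[OF V V bgid_linear[OF V] bdeg_bgid bgid_linear[OF V] bdeg_bgid g]
 note st = sandw_tens[OF V V bgid_linear[OF V] bdeg_bgid bgid_linear[OF V] bdeg_bgid g]
 have iw: "sandw_word R V bgid s j (g i j) bgid w = iword ?e (opl R V g i) w s j" if "1 \<le> j" "s + j \<le> length w" for s j w
 proof -
  have l: "length (take j (drop s w)) = j" using that by simp
  show ?thesis unfolding sandw_word_def iword_def opl_def l letter_map_bgid bghomD(1)[OF g[OF that(1)]] ..
 qed
 show ?thesis unfolding e
 proof (rule T_matrix_realizes[OF V V])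
  fix q l :: nat and d assume q: "1 \<le> q" and l: "1 \<le> l"
  show "bgapp (bgsum (tpow R V l) ?e (%_. 0) (%(s, j, t). insert_op R V s j (g i j) t) (?S q l)) d
    \<in> lmaps R (tpow R V q d) (tpow R V l (d + ?e))"
   unfolding bgsum_def bgmap.simps
  proof (intro lin_finsum_map M lin_sg_map)
   fix x assume x: "x \<in> ?S q l"
   obtain s j t where s: "x = (s, j, t)" by (cases x)
   then have "s + 1 + t = l" "s + j + t = q" "1 \<le> j" using x by auto
   then show "bgapp (case x of (s, j, t) => insert_op R V s j (g i j) t) d \<in> lmaps R (tpow R V q d) (tpow R V l (d + ?e))"
    unfolding s prod.case insert_op_sandw using sl[of j s t d] by simp
  qed
  fix w assume w: "w \<in> words V q d"
  have lw: "length w = q" "valid V w" using w by (auto simp: words_iff)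
  let ?k = "%(s, j, t). bipair ?e (wdeg (take s w))"
  let ?v = "%(s, j, t). iword ?e (opl R V g i) w s j"
  have app: "bgapp (case x of (s, j, t) => insert_op R V s j (g i j) t) d (tens R V w) = sg (tpow R V l (d + ?e)) (?k x) (tens R V (?v x))
    \<and> ?v x \<in> words V l (d + ?e)" if x: "x \<in> ?S q l" for x
  proof -
   obtain s j t where s: "x = (s, j, t)" by (cases x)
   then have "s + 1 + t = l" "s + j + t = q" "1 \<le> j" using x by auto
   then show ?thesis unfolding s prod.case insert_op_sandw using st[of j w s t d] w iw[of j s w] lw by simp
  qed
  have "bgapp (bgsum (tpow R V l) ?e (%_. 0) (%(s, j, t). insert_op R V s j (g i j) t) (?S q l)) d (tens R V w) =
    wev R V l (d + ?e) (\<Sum>x\<in>?S q l. fsg (?k x) (frag_of (?v x)))"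
   unfolding bgsum_def bgmap.simps by (rule finsum_sg_tens[OF V]) (use app in \<open>simp_all add: sg_def[where k = 0]\<close>)
  also have "(\<Sum>x\<in>?S q l. fsg (?k x) (frag_of (?v x))) =
    (\<Sum>x\<in>{x \<in> insert_set q. Suc q = l + snd x}. (%(s, j). fsg (bipair ?e (wdeg (take s w))) (frag_of (iword ?e (opl R V g i) w s j))) x)"
   by (rule sum.reindex_bij_witness[where i = "%(s, j). (s, j, q - s - j)" and j = "%(s, j, t). (s, j)"])
    (auto simp: insert_set_def)
  also have "wev R V l (d + ?e) \<dots> = wev R V l (d + ?e) (insert_fop (opl R V g) i w)" unfolding insert_fop_def lw(1)
   by (rule wev_restrict[OF V finite_insert_set, symmetric]) (auto simp: words_iff iword_def insert_set_def lw)
  finally show "bgapp (bgsum (tpow R V l) ?e (%_. 0) (%(s, j, t). insert_op R V s j (g i j) t) (?S q l)) d (tens R V w) =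
    wev R V l (d + ?e) (insert_fop (opl R V g) i w)" .
 next
  fix w v assume w: "valid V w" "w ~= []" and v: "v \<in> fkeys (insert_fop (opl R V g) i w)"
  obtain s a where sa: "(s, a) \<in> insert_set (length w)" "v = iword ?e (opl R V g i) w s a" using v by (rule insert_fop_keys)
  have a: "1 \<le> a" "s + a \<le> length w" using sa(1) by (auto simp: insert_set_def)
  have "w \<in> words V (s + a + (length w - s - a)) (wdeg w)" using a w by (simp add: words_iff)
  then have "v \<in> words V (s + 1 + (length w - s - a)) (wdeg w + ?e)" using st(2)[OF a(1)] iw[OF a] sa(2) by metis
  then show "v ~= [] \<and> valid V v \<and> wdeg v = wdeg w + ?e \<and> length v \<le> length w" using a by (auto simp: words_iff)
 qed
qed

section \<open>The path object\<close>

lemma triple_sum_simps: "carrier (triple_sum L M N) = carrier L \<times> carrier M \<times> carrier N"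
 "(zr (triple_sum L M N)) = ((zr L), (zr M), (zr N))"
 "(x, y, z) \<oplus>\<^bsub>triple_sum L M N\<^esub> (x', y', z') = (x \<oplus>\<^bsub>L\<^esub> x', y \<oplus>\<^bsub>M\<^esub> y', z \<oplus>\<^bsub>N\<^esub> z')"
 "c \<odot>\<^bsub>triple_sum L M N\<^esub> (x, y, z) = (c \<odot>\<^bsub>L\<^esub> x, c \<odot>\<^bsub>M\<^esub> y, c \<odot>\<^bsub>N\<^esub> z)"
 by (simp_all add: triple_sum_def)

lemma triple_sum_module:
 assumes L: "module R L" and M: "module R M" and N: "module R N"
 shows "module R (triple_sum L M N)"
proof (rule moduleI[OF R])
 interpret L: module R L by (rule L)
 interpret M: module R M by (rule M)
 interpret N: module R N by (rule N)
 show "abelian_group (triple_sum L M N)"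
 proof (rule abelian_groupI)
  fix x assume x: "x \<in> carrier (triple_sum L M N)"
  obtain a b c where "x = (a, b, c)" by (cases x)
  then show "\<exists>y\<in>carrier (triple_sum L M N). y \<oplus>\<^bsub>triple_sum L M N\<^esub> x = (zr (triple_sum L M N))"
   using x by (intro bexI[of _ "(\<ominus>\<^bsub>L\<^esub> a, \<ominus>\<^bsub>M\<^esub> b, \<ominus>\<^bsub>N\<^esub> c)"]) (auto simp: triple_sum_simps L.l_neg M.l_neg N.l_neg)
 qed (auto simp: triple_sum_simps L.a_assoc M.a_assoc N.a_assoc intro: L.a_comm M.a_comm N.a_comm)
qed (auto simp: triple_sum_simps module.smult_l_distr[OF L] module.smult_l_distr[OF M] module.smult_l_distr[OF N]
  module.smult_r_distr[OF L] module.smult_r_distr[OF M] module.smult_r_distr[OF N]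
  module.smult_assoc1[OF L] module.smult_assoc1[OF M] module.smult_assoc1[OF N]
  module.smult_closed[OF L] module.smult_closed[OF M] module.smult_closed[OF N]
  module.smult_one[OF L] module.smult_one[OF M] module.smult_one[OF N])

lemma path_bg: "bgmodule R B ==> bgmodule R (path r B)" by (simp add: bgmodule_def path_def triple_sum_module)

lemma triple_proj_linear: "fst \<in> lmaps R (triple_sum L M N) L" "(%x. fst (snd x)) \<in> lmaps R (triple_sum L M N) M"
 "(%x. snd (snd x)) \<in> lmaps R (triple_sum L M N) N"
 by (auto simp: linear_maps_def triple_sum_simps)

lemma susp_path: "susp (path r B) d = triple_sum (susp B d) (susp B (d + rshift r)) (susp B d)" by (simp add: susp_def path_def add_ac)

text \<open>The factor (-1)^(r-1) of pi_M is stored in the marked letter, so the exponent in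
  \<open>pi_fop\<close> is the Koszul sign alone.\<close>

definition pi_word :: "nat => ('r, 'b) bgmod => ('b \<times> 'b \<times> 'b) word => nat => 'b word" where
 "pi_word r W w s = map (%(e, x, y, z). (e, x)) (take s w)
  @ (case w ! s of (e, x, y, z) => (e + rshift r, sg (W (e + rshift r)) (int r - 1) y))
  # map (%(e, x, y, z). (e, z)) (drop (Suc s) w)"

definition pi_fop :: "nat => ('r, 'b) bgmod => ('b \<times> 'b \<times> 'b) word => ('b word \<Rightarrow>\<^sub>0 int)" where
 "pi_fop r W w = (\<Sum>s<length w. fsg (bipair (rshift r) (wdeg (take s w))) (frag_of (pi_word r W w s)))"

lemma pi_realizes:
 fixes B :: "('r, 'b) bgmod"
 assumes B: "bgmodule R B"
 shows "realizes R (Tbased R (susp (path r B))) (Tbased R (susp B)) (rshift r) (T_matrix R (susp (path r B)) (susp B) (rshift r)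
     (%q l. bgsum (tpow R (susp B) l) (rshift r) (%_. 0) (%(s, t). tmaps R (susp (path r B)) (susp B)
        (replicate s (bgcomp susp_map (bgcomp end_minus desusp_map))
        @ bgsgn (susp B) (int r - 1) (bgcomp susp_map (bgcomp (end_zero r) desusp_map))
        # replicate t (bgcomp susp_map (bgcomp end_plus desusp_map))))
      {(s, t). s + 1 + t = l \<and> l = q}))
  (pi_fop r (susp B))"
proof -
 define pL :: "('b \<times> 'b \<times> 'b, 'b) bgmap" where "pL = bgcomp susp_map (bgcomp end_minus desusp_map)"
 define pM :: "('b \<times> 'b \<times> 'b, 'b) bgmap" where "pM = bgsgn (susp B) (int r - 1) (bgcomp susp_map (bgcomp (end_zero r) desusp_map))"
 define pR :: "('b \<times> 'b \<times> 'b, 'b) bgmap" where "pR = bgcomp susp_map (bgcomp end_plus desusp_map)"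
 let ?V = "susp (path r B)" and ?W = "susp B" and ?e = "rshift r"
 have V: "bgmodule R ?V" and W: "bgmodule R ?W" using B by (simp_all add: susp_bg path_bg)
 have M: "module R (tpow R ?W n d)" for n d by (rule tpow_mod[OF W])
 have Lapp: "bgapp pL d x = fst x" and L0: "bdeg pL = 0" for d x
  by (simp_all add: pL_def bgcomp_def susp_map_def end_minus_def desusp_map_def case_prod_beta zero_prod_def)
 have Rapp: "bgapp pR d x = snd (snd x)" and R0: "bdeg pR = 0" for d x
  by (simp_all add: pR_def bgcomp_def susp_map_def end_plus_def desusp_map_def case_prod_beta zero_prod_def)
 have Me: "bdeg pM = ?e" by (simp add: pM_def bgcomp_def susp_map_def end_zero_def desusp_map_def bgsgn_def rshift_def)
 have sh: "(0, -1) + (rshift r + (0, 1)) = rshift r" by (simp add: rshift_def)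
 have Mapp: "bgapp pM d x = sg (?W (d + ?e)) (int r - 1) (fst (snd x))" for d x
  unfolding pM_def bgcomp_def susp_map_def end_zero_def desusp_map_def bgsgn_def bgmap.simps sh by (simp add: case_prod_beta)
 have Ll: "bgapp pL d \<in> lmaps R (?V d) (?W d)" for d
 proof -
  have "bgapp pL d = fst" using Lapp by blast
  then show ?thesis unfolding susp_path by (simp add: triple_proj_linear(1))
 qed
 have Rl: "bgapp pR d \<in> lmaps R (?V d) (?W d)" for d
 proof -
  have "bgapp pR d = (%x. snd (snd x))" using Rapp by blast
  then show ?thesis unfolding susp_path by (simp add: triple_proj_linear(3))
 qed
 have Ml: "bgapp pM d \<in> lmaps R (?V d) (?W (d + bdeg pM))" for d
 proof -
  have "bgapp pM d = (%x. sg (?W (d + ?e)) (int r - 1) (fst (snd x)))" using Mapp by blast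
  then show ?thesis unfolding susp_path Me by (simp add: lin_sg_map triple_proj_linear(2) bgD[OF W])
 qed
 have Mh: "unary R ?W pM \<in> bghom R (tpow R ?V 1) ?W ?e" using unary_blin[OF V W Ml] Me by (intro bghomI) (simp_all add: blin_def)
 have tm: "tmaps R ?V ?W (replicate s pL @ pM # replicate t pR) = btens R ?V ?W (sandw R ?W pL s 1 (unary R ?W pM) pR t)" for s t
  by (simp add: tmaps_def sandw_def map_replicate_const)
 note sl = sandw_linear[OF V W Ll L0 Rl R0 Mh]
 note st = sandw_tens[OF V W Ll L0 Rl R0 Mh]
 have pw: "sandw_word R ?V pL s 1 (unary R ?W pM) pR w = pi_word r ?W w s" if w: "valid ?V w" "s < length w" for s w
 proof -
  have t: "take 1 (drop s w) = [w ! s]" using that by (simp add: take_Suc_conv_app_nth hd_drop_conv_nth take_Suc)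
  obtain e x where x: "w ! s = (e, x)" by (cases "w ! s")
  have "w ! s \<in> set w" using that by simp
  then have xc: "x \<in> carrier (?V e)" using that by (auto simp: valid_def x)
  obtain a b c where abc: "x = (a, b, c)" by (cases x)
  have lm: "letter_map pL u = map (%(e, x, y, z). (e, x)) u" "letter_map pR u = map (%(e, x, y, z). (e, z)) u" for u
   by (auto simp: letter_map_def Lapp Rapp)
  show ?thesis using unary_tens[OF V W Ml xc] Mapp[of e x] by (simp add: sandw_word_def pi_word_def t[simplified] x lm Me abc)
 qed
 have main: "realizes R (Tbased R ?V) (Tbased R ?W) ?e (T_matrix R ?V ?W ?e
   (%q l. bgsum (tpow R ?W l) ?e (%_. 0) (%(s, t). tmaps R ?V ?W (replicate s pL @ pM # replicate t pR))
    {(s, t). s + 1 + t = l \<and> l = q})) (pi_fop r ?W)"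
 proof (rule T_matrix_realizes[OF V W])
  let ?S = "%q l. {(s :: nat, t :: nat). s + 1 + t = l \<and> l = q}"
  fix q l :: nat and d assume q: "1 \<le> q" and l: "1 \<le> l"
  show "bgapp (bgsum (tpow R ?W l) ?e (%_. 0) (%(s, t). tmaps R ?V ?W (replicate s pL @ pM # replicate t pR)) (?S q l)) d
    \<in> lmaps R (tpow R ?V q d) (tpow R ?W l (d + ?e))"
   unfolding bgsum_def bgmap.simps
  proof (intro lin_finsum_map tpow_mod V W lin_sg_map)
   fix x assume x: "x \<in> ?S q l"
   obtain s t where s: "x = (s, t)" by (cases x)
   then have "s + 1 + t = l" "l = q" using x by auto
   then show "bgapp (case x of (s, t) => tmaps R ?V ?W (replicate s pL @ pM # replicate t pR)) d
     \<in> lmaps R (tpow R ?V q d) (tpow R ?W l (d + ?e))"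
    unfolding s prod.case tm using sl[of s t d] by simp
  qed
  fix w assume w: "w \<in> words ?V q d"
  have lw: "length w = q" "valid ?V w" using w by (auto simp: words_iff)
  let ?k = "%(s, t). bipair ?e (wdeg (take s w))"
  let ?v = "%(s, t). pi_word r ?W w s"
  have app: "bgapp (case x of (s, t) => tmaps R ?V ?W (replicate s pL @ pM # replicate t pR)) d (tens R ?V w) =
    sg (tpow R ?W l (d + ?e)) (?k x) (tens R ?W (?v x)) \<and> ?v x \<in> words ?W l (d + ?e)" if x: "x \<in> ?S q l" for x
  proof -
   obtain s t where s: "x = (s, t)" by (cases x)
   then have "s + 1 + t = l" "l = q" using x by auto
   then show ?thesis unfolding s prod.case tm using st[of w s t d] w pw[of w s] lw by simp
  qed
  have "bgapp (bgsum (tpow R ?W l) ?e (%_. 0) (%(s, t). tmaps R ?V ?W (replicate s pL @ pM # replicate t pR)) (?S q l)) d (tens R ?V w) =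
    wev R ?W l (d + ?e) (\<Sum>x\<in>?S q l. fsg (?k x) (frag_of (?v x)))"
   unfolding bgsum_def bgmap.simps by (rule finsum_sg_tens[OF W]) (use app in \<open>simp_all add: sg_def[where k = 0]\<close>)
  also have "(\<Sum>x\<in>?S q l. fsg (?k x) (frag_of (?v x))) =
    (\<Sum>s\<in>{s \<in> {..<q}. l = q}. fsg (bipair ?e (wdeg (take s w))) (frag_of (pi_word r ?W w s)))"
   by (rule sum.reindex_bij_witness[where i = "%s. (s, q - Suc s)" and j = "%(s, t). s"]) auto
  also have "wev R ?W l (d + ?e) \<dots> = wev R ?W l (d + ?e) (pi_fop r ?W w)" unfolding pi_fop_def lw(1)
   by (rule wev_restrict[OF W finite_lessThan, symmetric]) (auto simp: words_iff pi_word_def lw)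
  finally show "bgapp (bgsum (tpow R ?W l) ?e (%_. 0) (%(s, t). tmaps R ?V ?W (replicate s pL @ pM # replicate t pR)) (?S q l)) d (tens R ?V w) =
    wev R ?W l (d + ?e) (pi_fop r ?W w)" .
 next
  fix w v assume w: "valid ?V w" "w ~= []" and v: "v \<in> fkeys (pi_fop r ?W w)"
  obtain s where s: "s \<in> {..<length w}" "v \<in> fkeys (fsg (bipair ?e (wdeg (take s w))) (frag_of (pi_word r ?W w s)))"
   using subsetD[OF keys_sum v[unfolded pi_fop_def]] by (rule UN_E)
  have "w \<in> words ?V (s + 1 + (length w - s - 1)) (wdeg w)" using s w by (simp add: words_iff)
  from st(2)[OF this] have "v \<in> words ?W (s + 1 + (length w - s - 1)) (wdeg w + ?e)" using pw[OF w(1), of s] s by simp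
  then show "v ~= [] \<and> valid ?W v \<and> wdeg v = wdeg w + ?e \<and> length v \<le> length w" using s by (auto simp: words_iff)
 qed
 then show ?thesis by (simp only: pL_def pM_def pR_def)
qed

lemma pi_bword:
 assumes "s < length D"
 shows "pi_word r W (bword \<chi> D) s = mword r (%p b. fst (\<chi> p b))
  (%p b. sg (W (wdeg b - dsh p + rshift r)) (int r - 1) (fst (snd (\<chi> p b)))) (%p b. snd (snd (\<chi> p b))) D s"
 using assms by (simp add: pi_word_def mword_def bword_def take_map drop_map case_prod_beta comp_def)

text \<open>The source of the block form of K: the letters of H are triples, pi reads their first
  components left of the marked letter and their last components right of it, and projecting to an
  end does not change the degrees that the Koszul sign sees.\<close>

lemma pi_coalg_fop: "fext (pi_fop r W) (coalg_fop \<chi> p w) = coder_fop r (%p b. fst (\<chi> p b))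
  (%p b. sg (W (wdeg b - dsh p + rshift r)) (int r - 1) (fst (snd (\<chi> p b)))) (%p b. snd (snd (\<chi> p b))) p w"
 unfolding coalg_fop_def frag_extend_sum' coder_fop_def
proof (intro sum.cong refl)
 fix D assume "D \<in> decs p w"
 have "wdeg (bword \<chi> (take s D)) = wdeg (bword (%p b. fst (\<chi> p b)) (take s D))" for s by (simp add: wdeg_bword)
 then show "fext (pi_fop r W) (fsg (dec_sign D) (frag_of (bword \<chi> D))) =
   (\<Sum>s<length D. fsg (dec_sign D + bipair (rshift r) (wdeg (bword (%p b. fst (\<chi> p b)) (take s D))))
    (frag_of (mword r (%p b. fst (\<chi> p b)) (%p b. sg (W (wdeg b - dsh p + rshift r)) (int r - 1) (fst (snd (\<chi> p b))))
      (%p b. snd (snd (\<chi> p b))) D s)))"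
  by (simp add: pi_fop_def fsg_sum pi_bword)
qed

end

section \<open>Signs of suspended against unsuspended equations\<close>

section \<open>Signs\<close>

text \<open>The second word arises from the first by signs on single letters with exponents adding
  up to k; multilinearity extracts them as one sign.\<close>

inductive sgw :: "('r, 'a) bgmod => int => 'a word => 'a word => bool" for V where sgw_Nil: "sgw V 0 [] []"
| sgw_Cons: "sgw V k w w' ==> y = sg (V e) l x ==> sgw V (l + k) ((e, x) # w) ((e, y) # w')"

lemma sgw_refl: "sgw V 0 w w"
proof (induct w)
 case (Cons x w)
 have "sgw V (0 + 0) ((fst x, snd x) # w) ((fst x, snd x) # w)" by (rule sgw_Cons[OF Cons]) (simp add: sg_def)
 then show ?case by simp
qed (rule sgw_Nil)

lemma sgw_append: "sgw V k u u' ==> sgw V l v v' ==> sgw V (k + l) (u @ v) (u' @ v')"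
proof (induct rule: sgw.induct)
 case (sgw_Cons k w w' y e j x)
 then have "sgw V (j + (k + l)) ((e, x) # w @ v) ((e, y) # w' @ v')" by (intro sgw.sgw_Cons) auto
 then show ?case by (simp add: add.assoc)
qed simp

lemma ssign_append: "ssign (u @ v) = ssign u + ssign v + int (length v) * snd (wdeg u)" by (induct u) (auto simp: algebra_simps snd_zero)

text \<open>X and Y are the lower and upper degree of the prefix of length s, Yb the upper degree of
  the consumed block of length q; eu, eb, ev are \<open>ssign\<close> of prefix, block and suffix
  (of length t), ew and ei those of the word before and after the insertion.\<close>

lemma insertion_sign:
 fixes s q t i p :: nat and X Y Yb ew ei eb eu ev :: int
 assumes "ei = eu + (int t * (Yb + (1 - int p)) + ev) + (1 + int t) * Y" and "ew = eu + (eb + ev + int t * Yb) + (int q + int t) * Y"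
 shows "even ((int i + ((- int p) * X + (1 - int p) * Y)) + (k0 + int i + ei + (1 - int p + eb))
  - ((k0 + 1 + ew) + (int (s * q + t + p * (1 + s + t)) + ((- int p) * X + (2 - int p - int q) * (Y + int s)))))"
 unfolding assms by (simp add: algebra_simps)

text \<open>c is the deviation from the bidegree of a morphism component: 0 for morphisms, (0,1) for
  the operations, (r, r-1) for the middle component of h.\<close>

definition family :: "'r ring => ('r, 'a) bgmod => ('r, 'b) bgmod => bideg => ('r, 'a, 'b) opfam => bool" where
 "family R A B c f \<longleftrightarrow> (\<forall>i j. 1 \<le> j --> f i j \<in> bghom R (tpow R A j) B ((- int i, 1 - int i - int j) + c))"

lemma familyD: "family R A B c f ==> 1 \<le> j ==> f i j \<in> bghom R (tpow R A j) B ((- int i, 1 - int i - int j) + c)" by (simp add: family_def)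

text \<open>The exponent sq + t + pj with p = u - i, t = v - s - q and j = v + 1 - q, plus the
  Koszul sign of the inserted operation passing s letters.\<close>

definition ins_sign :: "nat => nat => 'x word => nat \<times> nat \<times> nat => int" where
 "ins_sign u v w = (%(i, s, q). int (s * q + (v - s - q) + (u - i) * (v + 1 - q))
  + bipair (- int (u - i), 2 - int (u - i) - int q) (wdeg (take s w)))"

definition ins_word :: "'r ring => ('r, 'a) bgmod => ('r, 'a, 'a) opfam => nat => 'a word => nat \<times> nat \<times> nat => 'a word" where
 "ins_word R A m u w = (%(i, s, q). iword (- int (u - i), 2 - int (u - i) - int q) (opl R A m (u - i)) w s q)"


context bgmods
begin

lemma letter_linear:
 assumes V: "bgmodule R V" and w: "u @ (e, x) # v \<in> words V n d"
 shows "(%y. tens R V (u @ (e, y) # v)) \<in> lmaps R (V e) (tpow R V n d)"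
proof -
 note m = multilinearD[OF tens_multilinear[OF V]] and r = words_replace[OF V]
 show ?thesis unfolding linear_maps_def
 proof (intro CollectI conjI ballI funcsetI)
  fix y assume y: "y \<in> carrier (V e)"
  note wy = r(1)[OF w y]
  show "tens R V (u @ (e, y) # v) \<in> carrier (tpow R V n d)" by (rule m(1)[OF wy])
  show "tens R V (u @ (e, y \<oplus>\<^bsub>V e\<^esub> z) # v) = tens R V (u @ (e, y) # v) \<oplus>\<^bsub>tpow R V n d\<^esub> tens R V (u @ (e, z) # v)"
   if z: "z \<in> carrier (V e)" for z by (rule m(2)[OF wy z])
  show "tens R V (u @ (e, c \<odot>\<^bsub>V e\<^esub> y) # v) = c \<odot>\<^bsub>tpow R V n d\<^esub> tens R V (u @ (e, y) # v)"
   if c: "c \<in> carrier R" for c by (rule m(3)[OF wy c])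
 qed
qed

lemma tens_sgw:
 assumes V: "bgmodule R V" and s: "sgw V k w w'"
 shows "u @ w \<in> words V n d ==> tens R V (u @ w') = sg (tpow R V n d) k (tens R V (u @ w)) \<and> u @ w' \<in> words V n d"
 using s
proof (induct arbitrary: u rule: sgw.induct)
 case sgw_Nil
 then show ?case by (simp add: sg_def)
next
 case (sgw_Cons k w w' y e l x)
 have M: "module R (tpow R V n d)" by (rule tpow_mod[OF V])
 have x: "x \<in> carrier (V e)" using sgw_Cons.prems by (simp add: words_iff)
 have y: "y \<in> carrier (V e)" unfolding sgw_Cons(3) by (rule sg_closed[OF bgD[OF V] x])
 have w1: "(u @ [(e, y)]) @ w \<in> words V n d" using words_replace(1)[OF V sgw_Cons.prems y] by simp
 from sgw_Cons(2)[OF w1] have "tens R V (u @ (e, y) # w') = sg (tpow R V n d) k (tens R V (u @ (e, y) # w)) \<and> u @ (e, y) # w' \<in> words V n d"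
  by simp
 moreover have "tens R V (u @ (e, y) # w) = sg (tpow R V n d) l (tens R V (u @ (e, x) # w))"
  unfolding sgw_Cons(3) by (rule lin_sg[OF letter_linear[OF V sgw_Cons.prems] bgD[OF V] M x])
 ultimately show ?case using sg_sg[OF M tens_cl[OF V sgw_Cons.prems]] by (simp add: add.commute)
qed

lemma opl_sgw:
 assumes V: "bgmodule R V" and W: "bgmodule R W" and g: "g p (length w) \<in> bghom R (tpow R V (length w)) W e"
  and s: "sgw V k w w'" and w: "valid V w"
 shows "opl R V g p w' = sg (W (wdeg w + e)) k (opl R V g p w)" (is ?c1) "length w' = length w" "wdeg w' = wdeg w"
proof -
 have w1: "[] @ w \<in> words V (length w) (wdeg w)" using w by (simp add: words_iff)
 note t = tens_sgw[OF V s w1, simplified]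
 show l: "length w' = length w" "wdeg w' = wdeg w" using t by (auto simp: words_iff)
 show ?c1 unfolding opl_def l
  using t lin_sg[OF bghomD(2)[OF g] tpow_mod[OF V] bgD[OF W] tens_cl[OF V w1[simplified]]] by simp
qed

lemma opl_closed:
 assumes V: "bgmodule R V" and g: "g p (length w) \<in> bghom R (tpow R V (length w)) W e" and w: "valid V w"
 shows "opl R V g p w \<in> carrier (W (wdeg w + e))"
 unfolding opl_def by (rule lin_closed[OF bghomD(2)[OF g] tens_cl[OF V]]) (simp add: words_iff w)

text \<open>With k the length of b, the upper degree is snd c + 1 - p - k, so in the exponent of
  \<open>Psi\<close> the arity cancels and snd c - p remains.\<close>

lemma susp_letter:
 assumes A: "bgmodule R A" and B: "bgmodule R B"
  and f: "f p (length b) \<in> bghom R (tpow R A (length b)) B ((- int p, 1 - int p - int (length b)) + c)"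
  and b: "valid (susp A) b"
 shows "opl R (susp A) (susp_fam R A B f) p b = sg (susp B (wdeg b - dsh p + c)) (snd c - int p + ssign b) (opl R A f p (desusp b))" (is ?c1)
  and "opl R A f p (desusp b) \<in> carrier (susp B (wdeg b - dsh p + c))" (is ?c2)
  and "susp_fam R A B f p (length b) \<in> bghom R (tpow R (susp A) (length b)) (susp B) (c - dsh p)" (is ?c3)
proof -
 have f': "f p (length b) \<in> bghom R (tpow R A (length b)) B (fst c - int p, snd c + 1 - int p - int (length b))"
  using f by (cases c) (simp add: algebra_simps)
 have e: "(fst c - int p, snd c + 1 - int p - int (length b) + int (length b) - 1) = c - dsh p" by (cases c) (simp add: dsh_def)
 have w: "b \<in> words (susp A) (length b) (wdeg b)" using b by (simp add: words_iff)
 have g: "wdeg b + (c - dsh p) = wdeg b - dsh p + c" by simp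
 show ?c1
  using Psi_props(2)[OF A B f' w] unfolding e g by (simp add: opl_def susp_fam_def wdeg_desusp algebra_simps)
 show ?c3
  using Psi_props(1)[OF A B f'] unfolding e by (simp add: susp_fam_def)
 have "opl R A f p (desusp b) \<in> carrier (B (wdeg (desusp b) + ((- int p, 1 - int p - int (length b)) + c)))"
  using f b by (intro opl_closed[OF A]) (simp_all add: valid_desusp)
 moreover have "wdeg (desusp b) + ((- int p, 1 - int p - int (length b)) + c) = wdeg b - dsh p + c + (0, 1)"
  by (cases "wdeg b"; cases c) (simp add: wdeg_desusp dsh_def)
 ultimately show ?c2 by (simp add: susp_def)
qed

text \<open>Of the six summation parameters only i, s and q are free, and the sum is reindexed by
  these.\<close>

lemma insertion_eval:
 assumes A: "bgmodule R A" and B: "bgmodule R B" and mf: "family R A A (0, 1) m" and ff: "family R A B c f"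
  and w: "w \<in> words A v d" and v: "1 \<le> v" and e: "e = (- int u, 2 - int u - int v) + c"
  and x: "x \<in> (SIGMA i:{..u}. insert_set v)"
 shows "opl R A f (fst x) (ins_word R A m u w x) \<in> carrier (B (d + e))" (is ?c1)
  and "ins_word R A m u w x \<in> words A (v + 1 - snd (snd x)) (d + (- int (u - fst x), 2 - int (u - fst x) - int (snd (snd x))))"
  and "bgapp (insertion_sum R A B e f m u v) d (tens R A w) = finsum (B (d + e))
   (%x. sg (B (d + e)) (ins_sign u v w x) (opl R A f (fst x) (ins_word R A m u w x)))
   (SIGMA i:{..u}. insert_set v)"
proof -
 have m: "m p q \<in> bghom R (tpow R A q) A (- int p, 2 - int p - int q)" if "1 \<le> q" for p q
  using familyD[OF mf that, of p] by (simp add: algebra_simps)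
 note f = familyD[OF ff]
 let ?S = "SIGMA i:{..u}. insert_set v"
 let ?e = "%i q. (- int (u - i), 2 - int (u - i) - int q)"
 interpret B: module R "B (d + e)" by (rule bgD[OF B])
 have iw: "ins_word R A m u w (i, s, q) \<in> words A (v + 1 - q) (d + ?e i q)" "bgapp (insert_op R A s q (m (u - i) q) (v - s - q)) d (tens R A w) =
    sg (tpow R A (v + 1 - q) (d + ?e i q)) (bipair (?e i q) (wdeg (take s w))) (tens R A (ins_word R A m u w (i, s, q)))"
  if "(i, s, q) \<in> ?S" for i s q
 proof -
  have q: "1 \<le> q" "s + q \<le> v" "i \<le> u" using that by (auto simp: insert_set_def)
  have n: "s + 1 + (v - s - q) = v + 1 - q" "s + q + (v - s - q) = v" using q by auto
  have l: "length (take q (drop s w)) = q" using q w by (simp add: words_iff)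
  have sw: "sandw_word R A bgid s q (m (u - i) q) bgid w = ins_word R A m u w (i, s, q)"
   unfolding sandw_word_def ins_word_def iword_def opl_def prod.case l letter_map_bgid bghomD(1)[OF m[OF q(1)]] ..
  note st = sandw_tens[OF A A bgid_linear[OF A] bdeg_bgid bgid_linear[OF A] bdeg_bgid m[OF q(1), of "u - i"],
    where s = s and t = "v - s - q", unfolded n, OF w, unfolded sw]
  show "ins_word R A m u w (i, s, q) \<in> words A (v + 1 - q) (d + ?e i q)" by (rule st(2))
  show "bgapp (insert_op R A s q (m (u - i) q) (v - s - q)) d (tens R A w) =
    sg (tpow R A (v + 1 - q) (d + ?e i q)) (bipair (?e i q) (wdeg (take s w))) (tens R A (ins_word R A m u w (i, s, q)))"
   unfolding insert_op_sandw by (rule st(1))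
 qed
 have deg: "d + ?e i q + ((- int i, 1 - int i - int (v + 1 - q)) + c) = d + e" if "(i, s, q) \<in> ?S" for i s q
  using that unfolding e by (cases d; cases c) (auto simp: insert_set_def of_nat_diff)
 have lin: "bgapp (f i (v + 1 - q)) (d + ?e i q) \<in> lmaps R (tpow R A (v + 1 - q) (d + ?e i q)) (B (d + e))"
  if "(i, s, q) \<in> ?S" for i s q
  using bghomD(2)[OF f[of "v + 1 - q" i], of "d + ?e i q"] that unfolding deg[OF that] by (auto simp: insert_set_def)
 have ol: "opl R A f i (ins_word R A m u w (i, s, q)) = bgapp (f i (v + 1 - q)) (d + ?e i q) (tens R A (ins_word R A m u w (i, s, q)))"
  if "(i, s, q) \<in> ?S" for i s q
  using iw(1)[OF that] by (simp add: opl_def words_iff)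
 have cl: "opl R A f i (ins_word R A m u w (i, s, q)) \<in> carrier (B (d + e))" if "(i, s, q) \<in> ?S" for i s q
  unfolding ol[OF that] by (rule lin_closed[OF lin[OF that] tens_cl[OF A iw(1)[OF that]]])
 show ?c1
  "ins_word R A m u w x \<in> words A (v + 1 - snd (snd x)) (d + ?e (fst x) (snd (snd x)))"
  using cl[of "fst x" "fst (snd x)" "snd (snd x)"] iw(1)[of "fst x" "fst (snd x)" "snd (snd x)"] x by simp_all
 let ?h = "%(i, s, q). (i, u - i, v + 1 - q, q, s, v - s - q)"
 let ?k = "%(i, p, j, q, s, t). int (s * q + t + p * j)"
 let ?g = "%(i, p, j, q, s, t). bgcomp (f i j) (insert_op R A s q (m p q) t)"
 let ?T = "{(i, p, j, q, s, t). u = i + p \<and> v + 1 = j + q \<and> j = 1 + s + t \<and> 1 \<le> q}"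
 have T: "?T = ?h ` ?S"
 proof
  show "?T \<subseteq> ?h ` ?S"
  proof
   fix y assume y: "y \<in> ?T"
   obtain i p j q s t where yy: "y = (i, p, j, q, s, t)" by (cases y)
   have "y = ?h (i, s, q)" "(i, s, q) \<in> ?S" using y by (auto simp: yy insert_set_def)
   then show "y \<in> ?h ` ?S" by blast
  qed
  show "?h ` ?S \<subseteq> ?T" by (auto simp: insert_set_def)
 qed
 have inj: "inj_on ?h ?S" by (auto simp: inj_on_def)
 have bi: "bdeg (insert_op R A s q (m (u - i) q) t) = ?e i q" if "1 \<le> q" for i s q t
  using bghomD(1)[OF m[OF that]] sum_bdeg_unary[OF A A bdeg_bgid, of s] sum_bdeg_unary[OF A A bdeg_bgid, of t] by (simp add: insert_op_def)
 have val: "sg (B (d + e)) (?k (?h y)) (bgapp (?g (?h y)) d (tens R A w)) =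
   sg (B (d + e)) (ins_sign u v w y) (opl R A f (fst y) (ins_word R A m u w y))" if y: "y \<in> ?S" for y
 proof -
  obtain i s q where yy: "y = (i, s, q)" by (cases y)
  note y' = y[unfolded yy]
  have q: "1 \<le> q" using y' by (auto simp: insert_set_def)
  have "bgapp (bgcomp (f i (v + 1 - q)) (insert_op R A s q (m (u - i) q) (v - s - q))) d (tens R A w) =
    sg (B (d + e)) (bipair (?e i q) (wdeg (take s w))) (opl R A f i (ins_word R A m u w (i, s, q)))"
   unfolding bgcomp_def bgmap.simps bi[OF q] iw(2)[OF y'] ol[OF y']
   by (rule lin_sg[OF lin[OF y'] tpow_mod[OF A] bgD[OF B] tens_cl[OF A iw(1)[OF y']]])
  then show ?thesis using sg_sg[OF B.module_axioms cl[OF y']] by (simp add: yy ins_sign_def)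
 qed
 have "bgapp (insertion_sum R A B e f m u v) d (tens R A w) = finsum (B (d + e)) (%y. sg (B (d + e)) (?k y) (bgapp (?g y) d (tens R A w))) (?h ` ?S)"
  unfolding insertion_sum_def bgsum_def bgmap.simps T ..
 also have "\<dots> = finsum (B (d + e)) (%y. sg (B (d + e)) (?k (?h y)) (bgapp (?g (?h y)) d (tens R A w))) ?S"
 proof (rule B.finsum_reindex[OF _ inj], rule funcsetI)
  fix y assume "y \<in> ?h ` ?S"
  then obtain z where z: "z \<in> ?S" "y = ?h z" by blast
  show "sg (B (d + e)) (?k y) (bgapp (?g y) d (tens R A w)) \<in> carrier (B (d + e))"
   unfolding z(2) val[OF z(1)] using cl[of "fst z" "fst (snd z)" "snd (snd z)"] z(1) by (intro sg_closed[OF B.module_axioms]) simp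
 qed
 also have "\<dots> = finsum (B (d + e)) (%x. sg (B (d + e)) (ins_sign u v w x) (opl R A f (fst x) (ins_word R A m u w x))) ?S"
 proof (rule B.finsum_cong'[OF refl])
  show "(%x. sg (B (d + e)) (ins_sign u v w x) (opl R A f (fst x) (ins_word R A m u w x))) \<in> ?S \<rightarrow> carrier (B (d + e))"
  proof (rule funcsetI)
   fix z assume "z \<in> ?S"
   then show "sg (B (d + e)) (ins_sign u v w z) (opl R A f (fst z) (ins_word R A m u w z)) \<in> carrier (B (d + e))"
    using cl[of "fst z" "fst (snd z)" "snd (snd z)"] by (intro sg_closed[OF B.module_axioms]) simp
  qed
 qed (rule val)
 finally show "bgapp (insertion_sum R A B e f m u v) d (tens R A w) = finsum (B (d + e))
   (%x. sg (B (d + e)) (ins_sign u v w x) (opl R A f (fst x) (ins_word R A m u w x))) ?S" .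
qed

text \<open>Suspension changes all summands by the same exponent k0 + 1 + \<open>ssign w\<close>.
  The parameter k0 leaves room for the factor (-1)^(r-1) on the middle letters; it is 0 for an
  ordinary morphism family.\<close>

lemma insertion_susp:
 assumes A: "bgmodule R A" and B: "bgmodule R B" and mf: "family R A A (0, 1) m" and ff: "family R A B c f"
  and w: "w \<in> words (susp A) v d" and v: "1 \<le> v" and D0: "D0 = d + (0, 1) - dsh u + c"
  and \<phi>: "!!i b. valid (susp A) b ==> b ~= [] ==>
   \<phi> i b = sg (susp B (wdeg b - dsh i + c)) (k0 + int i + ssign b) (opl R A f i (desusp b))"
 shows "finsum (susp B D0) (%(i, s, q). sg (susp B D0) (int i + bipair ((0, 1) - dsh (u - i)) (wdeg (take s w)))
   (\<phi> i (iword ((0, 1) - dsh (u - i)) (opl R (susp A) (susp_fam R A A m) (u - i)) w s q))) (SIGMA i:{..u}. insert_set v)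
  = sg (susp B D0) (k0 + 1 + ssign w) (bgapp (insertion_sum R A B ((- int u, 2 - int u - int v) + c) f m u v)
    (d + (0, int v)) (tens R A (desusp w)))"
  and "(i, s, q) \<in> (SIGMA i:{..u}. insert_set v) ==>
   \<phi> i (iword ((0, 1) - dsh (u - i)) (opl R (susp A) (susp_fam R A A m) (u - i)) w s q) \<in> carrier (susp B D0)"
proof -
 have m: "m p q \<in> bghom R (tpow R A q) A (- int p, 2 - int p - int q)" if "1 \<le> q" for p q
  using familyD[OF mf that, of p] by (simp add: algebra_simps)
 note f = familyD[OF ff]
 let ?S = "SIGMA i:{..u}. insert_set v"
 let ?e = "(- int u, 2 - int u - int v) + c"
 let ?iw = "%i s q. iword ((0, 1) - dsh (u - i)) (opl R (susp A) (susp_fam R A A m) (u - i)) w s q"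
 have lw: "length w = v" "valid (susp A) w" "wdeg w = d" using w by (auto simp: words_iff)
 have BD: "susp B D0 = B (d + (0, int v) + ?e)"
 proof -
  have "D0 + (0, 1) = d + (0, int v) + ?e" unfolding D0 by (cases d; cases c) (simp add: dsh_def)
  then show ?thesis by (simp add: susp_def)
 qed
 interpret B: module R "susp B D0" by (rule bgD[OF susp_bg[OF B]])
 note dw = desusps[OF w]
 note ie = insertion_eval[where f = f and m = m and u = u, OF A B mf ff dw v refl, folded BD]
 have key: "\<phi> i (?iw i s q) = sg (susp B D0) (k0 + int i + ssign (?iw i s q) + (1 - int (u - i) + ssign (take q (drop s w))))
   (opl R A f i (ins_word R A m u (desusp w) (i, s, q)))"
  if x: "(i, s, q) \<in> ?S" for i s q
 proof -
  have q: "1 \<le> q" "s + q \<le> v" "i \<le> u" using x by (auto simp: insert_set_def)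
  let ?b = "take q (drop s w)" and ?p = "u - i"
  have b: "valid (susp A) ?b" "length ?b = q" using lw q by simp_all
  have mc: "m ?p (length ?b) \<in> bghom R (tpow R A (length ?b)) A ((- int ?p, 1 - int ?p - int (length ?b)) + (0, 1))"
   using m[OF q(1), of ?p] unfolding b(2) by (simp add: algebra_simps)
  note sl = susp_letter[where f = m and p = ?p and c = "(0, 1)", OF A A mc b(1)]
  have iwv: "ins_word R A m u (desusp w) (i, s, q) = desusp (take s w)
    @ (wdeg ?b + ((0, 1) - dsh ?p) + (0, 1), opl R A m ?p (desusp ?b)) # desusp (drop (s + q) w)"
  proof -
   have "wdeg (desusp ?b) + (- int ?p, 2 - int ?p - int q) = wdeg ?b + ((0, 1) - dsh ?p) + (0, 1)"
    by (cases "wdeg ?b") (simp add: wdeg_desusp b(2)[simplified] dsh_def b del: length_take length_drop)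
   then show ?thesis by (simp add: ins_word_def iword_def)
  qed
  \<comment> \<open>Old and new word agree except for the inserted letter, which suspension
    multiplies by the sign of the inserted operation.\<close>
  have "sgw A (1 - int ?p + ssign ?b) (ins_word R A m u (desusp w) (i, s, q)) (desusp (?iw i s q))"
  proof -
   have "sgw A (0 + ((1 - int ?p + ssign ?b) + 0)) (ins_word R A m u (desusp w) (i, s, q)) (desusp (?iw i s q))"
    unfolding iwv iword_def desusp_simps
   proof (intro sgw_append sgw_refl sgw_Cons)
    show "opl R (susp A) (susp_fam R A A m) (u - i) ?b = sg (A (wdeg ?b + ((0, 1) - dsh ?p) + (0, 1)))
      (1 - int ?p + ssign ?b) (opl R A m ?p (desusp ?b))"
     using sl(1) by (simp add: susp_def algebra_simps)
   qed
   then show ?thesis by simp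
  qed
  note sgw = this
  have iwlen: "ins_word R A m u (desusp w) (i, s, q) \<in> words A (v + 1 - q) (d + (0, int v) + (- int (u - i), 2 - int (u - i) - int q))"
   using ie(2)[OF x] by simp
  let ?ow = "ins_word R A m u (desusp w) (i, s, q)"
  have ol: "length ?ow = v + 1 - q" "valid A ?ow" using iwlen by (auto simp: words_iff)
  have "1 \<le> v + 1 - q" using q by simp
  then have fo: "f i (length ?ow) \<in> bghom R (tpow R A (length ?ow)) B ((- int i, 1 - int i - int (length ?ow)) + c)" unfolding ol(1) by (rule f)
  note os = opl_sgw[where g = f and p = i, OF A B fo sgw ol(2)]
  have oc: "opl R A f i ?ow \<in> carrier (susp B D0)" using ie(1)[OF x] by simp
  have degs: "B (wdeg ?ow + ((- int i, 1 - int i - int (length ?ow)) + c)) = susp B D0"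
  proof -
   have "wdeg ?ow + ((- int i, 1 - int i - int (length ?ow)) + c) = d + (0, int v) + ?e"
    using iwlen q unfolding ol(1) by (cases d; cases c) (auto simp: words_iff of_nat_diff)
   then show ?thesis by (simp only: BD)
  qed
  have sv: "susp_fam R A A m ?p q \<in> bghom R (tpow R (susp A) q) (susp A) ((0, 1) - dsh ?p)" using sl(3) by (simp only: b(2))
  have "opl R (susp A) (susp_fam R A A m) ?p ?b \<in> carrier (susp A (wdeg ?b + ((0, 1) - dsh ?p)))"
   using sv b by (intro opl_closed susp_bg[OF A]) (simp_all only: b)
  then have v2: "valid (susp A) (?iw i s q)" "?iw i s q ~= []" using lw by (simp_all add: iword_def)
  have wd: "wdeg (?iw i s q) - dsh i + c = D0" using q lw wdeg_iword[of s q w "(0, 1) - dsh ?p" "opl R (susp A) (susp_fam R A A m) ?p"]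
   by (simp add: D0 dsh_diff algebra_simps)
  show ?thesis unfolding \<phi>[OF v2] wd os(1) degs by (rule sg_sg[OF B.module_axioms oc])
 qed
 have par: "even ((int i + bipair ((0, 1) - dsh (u - i)) (wdeg (take s w))) + (k0 + int i + ssign (?iw i s q) + (1 - int (u - i) + ssign (take q (drop s w))))
   - ((k0 + 1 + ssign w) + ins_sign u v (desusp w) (i, s, q)))" if x: "(i, s, q) \<in> ?S" for i s q
 proof -
  have q: "1 \<le> q" "s + q \<le> v" "i \<le> u" using x by (auto simp: insert_set_def)
  let ?u = "take s w" and ?b = "take q (drop s w)" and ?v = "drop (s + q) w"
  have l: "length ?u = s" "length ?b = q" "length ?v = v - s - q" using lw q by simp_all
  have w3: "w = ?u @ ?b @ ?v" by (rule word_split3) (use lw q in simp)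
  have ew: "ssign w = ssign ?u + (ssign ?b + ssign ?v + int (v - s - q) * snd (wdeg ?b)) + (int q + int (v - s - q)) * snd (wdeg ?u)"
   by (subst w3) (simp only: ssign_append l length_append of_nat_add add.assoc)
  have ei: "ssign (?iw i s q) = ssign ?u + (int (v - s - q) * (snd (wdeg ?b) + (1 - int (u - i))) + ssign ?v) + (1 + int (v - s - q)) * snd (wdeg ?u)"
   unfolding iword_def ssign_append ssign.simps list.size l by (simp add: dsh_def)
  have v1: "v + 1 - q = 1 + s + (v - s - q)" using q by simp
  have op: "ins_sign u v (desusp w) (i, s, q) = int (s * q + (v - s - q) + (u - i) * (1 + s + (v - s - q))) +
    ((- int (u - i)) * fst (wdeg ?u) + (2 - int (u - i) - int q) * (snd (wdeg ?u) + int s))"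
   using l(1) lw unfolding ins_sign_def prod.case v1 by (simp add: wdeg_desusp bipair_def)
  have bp: "bipair ((0, 1) - dsh (u - i)) (wdeg ?u) = (- int (u - i)) * fst (wdeg ?u) + (1 - int (u - i)) * snd (wdeg ?u)"
   by (simp add: bipair_def dsh_def algebra_simps)
  show ?thesis unfolding op bp by (rule insertion_sign[OF ei ew])
 qed
 have cl: "opl R A f i (ins_word R A m u (desusp w) (i, s, q)) \<in> carrier (susp B D0)" if "(i, s, q) \<in> ?S" for i s q
  using ie(1)[OF that] by simp
 show mem: "\<phi> i (?iw i s q) \<in> carrier (susp B D0)" if "(i, s, q) \<in> ?S" for i s q
  unfolding key[OF that] by (rule sg_closed[OF B.module_axioms cl[OF that]])
 \<comment> \<open>A witness for the index premise of \<open>insertion_eval\<close>: arity 1 at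
   position 0, available because v is at least 1.\<close>
 have x0: "(0, 0, 1) \<in> ?S" using v by (auto simp: insert_set_def)
 let ?R = "%x. sg (susp B D0) (ins_sign u v (desusp w) x) (opl R A f (fst x) (ins_word R A m u (desusp w) x))"
 have Rc: "?R \<in> ?S \<rightarrow> carrier (susp B D0)" using cl by (intro funcsetI sg_closed[OF B.module_axioms]) auto
 have "finsum (susp B D0) (%(i, s, q). sg (susp B D0) (int i + bipair ((0, 1) - dsh (u - i)) (wdeg (take s w))) (\<phi> i (?iw i s q))) ?S =
   finsum (susp B D0) (%x. sg (susp B D0) (k0 + 1 + ssign w) (?R x)) ?S"
 proof (rule B.finsum_cong'[OF refl])
  show "(%x. sg (susp B D0) (k0 + 1 + ssign w) (?R x)) \<in> ?S \<rightarrow> carrier (susp B D0)"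
   by (intro funcsetI sg_closed[OF B.module_axioms] funcset_mem[OF Rc])
  fix x assume x: "x \<in> ?S"
  obtain i s q where xx: "x = (i, s, q)" by (cases x)
  note x' = x[unfolded xx]
  show "(case x of (i, s, q) => sg (susp B D0) (int i + bipair ((0, 1) - dsh (u - i)) (wdeg (take s w))) (\<phi> i (?iw i s q))) =
    sg (susp B D0) (k0 + 1 + ssign w) (?R x)"
   unfolding xx prod.case key[OF x'] fst_conv sg_sg[OF B.module_axioms cl[OF x']] by (rule sg_cong[OF par[OF x']])
 qed
 also have "\<dots> = sg (susp B D0) (k0 + 1 + ssign w) (finsum (susp B D0) ?R ?S)"
  by (rule lin_finsum[OF lin_sg_map[OF lin_id B.module_axioms] B.module_axioms B.module_axioms Rc, symmetric])
 also have "finsum (susp B D0) ?R ?S = bgapp (insertion_sum R A B ?e f m u v) (d + (0, int v)) (tens R A (desusp w))"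
  by (rule ie(3)[OF x0, symmetric])
 finally show "finsum (susp B D0) (%(i, s, q). sg (susp B D0) (int i + bipair ((0, 1) - dsh (u - i)) (wdeg (take s w))) (\<phi> i (?iw i s q))) ?S =
   sg (susp B D0) (k0 + 1 + ssign w) (bgapp (insertion_sum R A B ?e f m u v) (d + (0, int v)) (tens R A (desusp w)))" .
qed

end

section \<open>Blocks without suspension\<close>

text \<open>The exponent of the morphism equation without its summand u, rewritten modulo 2 as a
  recursion over the blocks.\<close>

fun block_msign :: "(nat \<times> 'x word) list => int" where "block_msign [] = 0"
| "block_msign ((p, b) # D) = int ((p + length b) * length D + length b * (sum_list (map fst D) + length (concat (map snd D)))) + block_msign D"

text \<open>Koszul exponent of the tensor product of the unsuspended f_{p_k q_k}: the first argument
  is the total bidegree of the later maps, and desuspension raises the upper degree of the block by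
  its length.\<close>

fun block_ksign :: "(nat \<times> 'x word) list => int" where "block_ksign [] = 0"
| "block_ksign ((p, b) # D) = bipair (- int (sum_list (map fst D)), int (length D) - int (sum_list (map fst D)) - int (length (concat (map snd D))))
  (wdeg b + (0, int (length b))) + block_ksign D"

text \<open>Collects the signs by which suspended letters differ from unsuspended ones.\<close>

fun block_ssign :: "(nat \<times> 'x word) list => int" where "block_ssign [] = 0"
| "block_ssign ((p, b) # D) = int p + ssign b + block_ssign D"

definition block_sign :: "nat => (nat \<times> 'x word) list => int" where "block_sign u D = int u + block_msign D + block_ksign D"

definition opd :: "'r ring => ('r, 'a) bgmod => ('r, 'a, 'b) opfam => nat => 'a word => 'b" where "opd R A f p b = opl R A f p (desusp b)"

text \<open>Removing the first pair lowers both j and t in the later factors j + t, an even change.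
  The first pair has the factor j + 1, which is the number of remaining pairs plus 2.\<close>

lemma morphism_sign_Cons:
 assumes "length qs = length ps"
 shows "even (int (morphism_sign u (length (p # ps)) (p # ps) (q # qs)) -
  (int ((p + q) * length ps + q * (sum_list ps + sum_list qs)) + int (morphism_sign u (length ps) ps qs)))"
proof -
 let ?l = "length ps"
 let ?a = "%t. ps ! (t - 1) + qs ! (t - 1)" and ?a' = "%t. (p # ps) ! (t - 1) + (q # qs) ! (t - 1)"
 let ?T = "%t. ?a t * (?l + t) + qs ! (t - 1) * (\<Sum>w=t+1..?l. ?a w)"
 let ?T' = "%t. ?a' t * (Suc ?l + t) + (q # qs) ! (t - 1) * (\<Sum>w=t+1..Suc ?l. ?a' w)"
 have shift: "(\<Sum>w=Suc t..Suc ?l. F w) = (\<Sum>w=t..?l. F (Suc w))" for F :: "nat => nat" and t by (rule sum.shift_bounds_cl_Suc_ivl)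
 have tot: "(\<Sum>w=1..?l. ?a w) = sum_list ps + sum_list qs"
 proof -
  have "(\<Sum>w=1..?l. ?a w) = (\<Sum>k<?l. ps ! k + qs ! k)" by (rule sum.reindex_bij_witness[where i = Suc and j = "%w. w - 1"]) auto
  then show ?thesis using assms by (simp add: sum.distrib sum_list_sum_nth atLeast0LessThan)
 qed
 have T: "?T' (Suc t) = ?T t + 2 * ?a t" if t: "1 \<le> t" for t
 proof -
  obtain k where k: "t = Suc k" using t by (cases t) auto
  have "(\<Sum>w=Suc t+1..Suc ?l. ?a' w) = (\<Sum>w=t+1..?l. ?a w)"
   unfolding add.commute[of _ 1] plus_1_eq_Suc shift by (intro sum.cong refl) (auto simp: nth_Cons')
  then show ?thesis by (simp add: k algebra_simps)
 qed
 have T1: "?T' 1 = (p + q) * ?l + q * (sum_list ps + sum_list qs) + 2 * (p + q)"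
 proof -
  have "(\<Sum>w=1+1..Suc ?l. ?a' w) = (\<Sum>w=1..?l. ?a w)" unfolding plus_1_eq_Suc shift by (intro sum.cong refl) (auto simp: nth_Cons')
  then show ?thesis unfolding tot by (simp add: algebra_simps)
 qed
 have "(\<Sum>t=1..Suc ?l. ?T' t) = ?T' 1 + (\<Sum>t=Suc 1..Suc ?l. ?T' t)" by (rule sum.atLeast_Suc_atMost) simp
 also have "(\<Sum>t=Suc 1..Suc ?l. ?T' t) = (\<Sum>t=1..?l. ?T' (Suc t))" by (rule shift)
 also have "\<dots> = (\<Sum>t=1..?l. ?T t + 2 * ?a t)" by (intro sum.cong refl T) simp
 also have "\<dots> = (\<Sum>t=1..?l. ?T t) + 2 * (\<Sum>t=1..?l. ?a t)" by (simp add: sum.distrib sum_distrib_left)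
 finally have "morphism_sign u (length (p # ps)) (p # ps) (q # qs) =
   (p + q) * ?l + q * (sum_list ps + sum_list qs) + morphism_sign u ?l ps qs + 2 * ((p + q) + (\<Sum>t=1..?l. ?a t))"
  unfolding T1 morphism_sign_def by simp
 then show ?thesis by simp
qed

lemma morphism_sign_blocks: "even (int (morphism_sign u (length D) (map fst D) (map (length \<circ> snd) D)) - (int u + block_msign D))"
proof (induct D)
 case Nil
 then show ?case by (simp add: morphism_sign_def)
next
 case (Cons x D)
 obtain p b where x: "x = (p, b)" by (cases x)
 have l: "sum_list (map (length \<circ> snd) D) = length (concat (map snd D))" by (induct D) auto
 have "even (int (morphism_sign u (length (x # D)) (map fst (x # D)) (map (length \<circ> snd) (x # D))) -
   (int ((p + length b) * length D + length b * (sum_list (map fst D) + length (concat (map snd D)))) +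
   int (morphism_sign u (length D) (map fst D) (map (length \<circ> snd) D))))"
  using morphism_sign_Cons[where ps = "map fst D" and qs = "map (length \<circ> snd) D" and p = p and q = "length b" and u = u]
  unfolding l by (simp add: x)
 from dvd_add[OF this Cons] show ?case by (simp add: x algebra_simps comp_def)
qed

text \<open>The comparison of the suspended with the unsuspended block sum, by induction on the
  blocks: the first group holds the Koszul exponent, \<open>ssign\<close> of the output and the
  letter signs, the second one \<open>ssign\<close> of the input and the unsuspended exponents. The
  sum of the weights will be u - i.\<close>

lemma block_signs: "even (dec_sign D + ssign (bword \<phi> D) + block_ssign D
  - (ssign (concat (map snd D)) + block_msign D + block_ksign D + int (sum_list (map fst D))))"
proof (induct D)
 case (Cons x D)
 obtain p b where x: "x = (p, b)" by (cases x)
 obtain X Y where b: "wdeg b = (X, Y)" by (cases "wdeg b")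
 define P Q l where "P = int (sum_list (map fst D))" and "Q = int (length (concat (map snd D)))" and "l = int (length D)"
 have e: "even ((bipair (- dsh (sum_list (map fst D))) (wdeg b) + l * (Y - int p) + (int p + ssign b))
  - ((ssign b + Q * Y) + ((int p + int (length b)) * l + int (length b) * (P + Q))
   + bipair (- P, l - P - Q) (wdeg b + (0, int (length b))) + int p))"
  unfolding b by (simp add: bipair_def dsh_def P_def[symmetric] algebra_simps)
 have "dec_sign (x # D) + ssign (bword \<phi> (x # D)) + block_ssign (x # D)
  - (ssign (concat (map snd (x # D))) + block_msign (x # D) + block_ksign (x # D) + int (sum_list (map fst (x # D))))
  = (dec_sign D + ssign (bword \<phi> D) + block_ssign D
  - (ssign (concat (map snd D)) + block_msign D + block_ksign D + int (sum_list (map fst D))))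
  + ((bipair (- dsh (sum_list (map fst D))) (wdeg b) + l * (Y - int p) + (int p + ssign b))
  - ((ssign b + Q * Y) + ((int p + int (length b)) * l + int (length b) * (P + Q))
   + bipair (- P, l - P - Q) (wdeg b + (0, int (length b))) + int p))"
  by (simp add: x ssign_append P_def Q_def l_def b dsh_def del: bipair_simps) (simp add: algebra_simps)?
 then show ?case using dvd_add[OF Cons e] by (simp only:)
qed simp

lemma block_term_sign:
 assumes "u = i + P" "even (dec + sb + bs - (sw + ms + ks + int P))"
 shows "even (dec + (1 - int i + sb + bs) - (1 + sw + (int u + ms + ks)))"
proof -
 have "dec + (1 - int i + sb + bs) - (1 + sw + (int u + ms + ks)) = (dec + sb + bs - (sw + ms + ks + int P)) - 2 * int i" unfolding assms(1) by simp
 then show ?thesis using dvd_diff[OF assms(2) dvd_triv_left, of "int i"] by (simp only:)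
qed

text \<open>The marked letter has its degree raised by (r, r-1). This adds (l-1-s)(r-1) to
  \<open>ssign\<close> of the output, r - 1 to the letter signs and (r-1)s to the Koszul exponent on
  desuspended letters. Up to even numbers rl + i + l is left, the sign of M_{il} on middle
  components.\<close>

lemma marked_term_sign:
 fixes r i l s P :: nat
 assumes "u = i + P" "even (dec + sb + bs - (sw + ms + ks + int P))"
 shows "even ((int r - int i + dec + bp) + (1 - int i + (sb + (int l - 1 - int s) * (int r - 1)) + (bs + (int r - 1)))
  - (1 + int r + sw + (int u + ms + ks) + (int (r * l + i + l) + (bp + (int r - 1) * int s))))"
proof -
 have "(int r - int i + dec + bp) + (1 - int i + (sb + (int l - 1 - int s) * (int r - 1)) + (bs + (int r - 1)))
  - (1 + int r + sw + (int u + ms + ks) + (int (r * l + i + l) + (bp + (int r - 1) * int s)))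
  = (dec + sb + bs - (sw + ms + ks + int P)) - 2 * (2 * int i + int l + int s * int r - int s)"
  unfolding assms(1) by (simp add: algebra_simps)
 then show ?thesis using dvd_diff[OF assms(2) dvd_triv_left, of "2 * int i + int l + int s * int r - int s"] by (simp only:)
qed

lemma sgw_props: "sgw V k w w' ==> wdeg w' = wdeg w \<and> length w' = length w \<and> ssign w' = ssign w" by (induct rule: sgw.induct) auto

lemma sgw_desusp: "sgw (susp V) k w w' ==> sgw V k (desusp w) (desusp w')"
proof (induct rule: sgw.induct)
 case (sgw_Cons k w w' y e l x)
 then show ?case unfolding desusp_simps by (intro sgw.sgw_Cons) (simp_all add: susp_def)
qed (simp add: sgw_Nil)

lemma sgw_blocks:
 assumes "!!p b. valid V b ==> b ~= [] ==> \<phi> p b = sg (W (wdeg b - dsh p)) (int p + ssign b) (\<psi> p b)"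
 shows "[] \<notin> set (map snd D) ==> valid V (concat (map snd D)) ==> sgw W (block_ssign D) (bword \<psi> D) (bword \<phi> D)"
proof (induct D)
 case Nil
 then show ?case by (simp add: sgw_Nil)
next
 case (Cons x D)
 obtain p b where x: "x = (p, b)" by (cases x)
 have "sgw W ((int p + ssign b) + block_ssign D) ((wdeg b - dsh p, \<psi> p b) # bword \<psi> D) ((wdeg b - dsh p, \<phi> p b) # bword \<phi> D)"
  using Cons by (intro sgw_Cons assms) (auto simp: x)
 then show ?case by (simp add: x)
qed

lemma valid_blocks:
 assumes "!!p b. valid V b ==> b ~= [] ==> \<phi> p b \<in> carrier (W (wdeg b - dsh p))"
 shows "[] \<notin> set (map snd D) ==> valid V (concat (map snd D)) ==> valid W (bword \<phi> D)"
proof (induct D)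
 case (Cons x D)
 obtain p b where x: "x = (p, b)" by (cases x)
 have "valid V b" "b ~= []" using Cons.prems by (auto simp: x)
 with assms Cons show ?case by (simp add: x)
qed simp

lemma block_ssign_append: "block_ssign (D @ E) = block_ssign D + block_ssign E" by (induct D rule: block_ssign.induct) auto

lemma ssign_blocks: "ssign (bword \<phi> E) = ssign (bword \<theta> E)"
proof (induct E)
 case (Cons x E)
 obtain p b where "x = (p, b)" by (cases x)
 with Cons show ?case by simp
qed simp

lemma ssign_marked:
 assumes s: "s < length D"
 shows "ssign (mword r \<phi> \<kappa> \<gamma> D s) = ssign (bword \<theta> D) + (int (length D) - 1 - int s) * (int r - 1)"
proof -
 have D: "D = take s D @ D ! s # drop (Suc s) D" using s by (simp add: id_take_nth_drop)
 obtain p b where x: "D ! s = (p, b)" by (cases "D ! s")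
 have l: "int (length (drop (Suc s) D)) = int (length D) - 1 - int s" using s by auto
 have "ssign (bword \<theta> D) = ssign (bword \<theta> (take s D) @ (wdeg b - dsh p, \<theta> p b) # bword \<theta> (drop (Suc s) D))"
  by (subst D) (simp add: x)
 then show ?thesis unfolding mword_def ssign_append ssign.simps x
  using ssign_blocks[of \<phi> "take s D" \<theta>] ssign_blocks[of \<gamma> "drop (Suc s) D" \<theta>]
  by (simp add: l[simplified] wdeg_bword rshift_def algebra_simps)
qed

context bgmods
begin

lemma op_susp_sgw:
 assumes B: "bgmodule R B" and mf: "family R B B (0, 1) m" and v: "valid (susp B) v" "v ~= []"
  and s: "sgw (susp B) k v v'" and D0: "D0 = wdeg v + (0, 1) - dsh i"
 shows "opl R (susp B) (susp_fam R B B m) i v' = sg (susp B D0) (1 - int i + ssign v + k) (opl R B m i (desusp v))" (is ?c1)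
  and "opl R B m i (desusp v) \<in> carrier (susp B D0)" (is ?c2)
proof -
 have SB: "bgmodule R (susp B)" by (rule susp_bg[OF B])
 have v1: "[] @ v \<in> words (susp B) (length v) (wdeg v)" using v by (simp add: words_iff)
 have v': "valid (susp B) v'" using tens_sgw[OF SB s v1] by (simp add: words_iff)
 note p = sgw_props[OF s]
 have D0': "D0 = wdeg v - dsh i + (0, 1)" by (simp add: D0)
 have l: "1 \<le> length v" using v(2) by (cases v) auto
 then have mv: "m i (length v') \<in> bghom R (tpow R B (length v')) B ((- int i, 1 - int i - int (length v')) + (0, 1))"
  using familyD[OF mf, of "length v'" i] p by simp
 note sl = susp_letter[where f = m and p = i and c = "(0, 1)", OF B B mv v']
 have vd: "valid B (desusp v)" using v by (simp add: valid_desusp)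
 have md: "m i (length (desusp v)) \<in> bghom R (tpow R B (length (desusp v))) B ((- int i, 1 - int i - int (length v)) + (0, 1))"
  using familyD[OF mf l, of i] by simp
 have deg: "wdeg (desusp v) + ((- int i, 1 - int i - int (length v)) + (0, 1)) = D0 + (0, 1)"
  unfolding D0' by (cases "wdeg v") (simp add: wdeg_desusp dsh_def)
 note os = opl_sgw[where g = m and p = i, OF B B md sgw_desusp[OF s] vd, unfolded deg]
 have BD: "B (D0 + (0, 1)) = susp B D0" by (simp add: susp_def)
 show cl: ?c2 using opl_closed[where g = m and p = i, OF B md vd] unfolding deg BD .
 have "opl R (susp B) (susp_fam R B B m) i v' = sg (susp B D0) (1 - int i + ssign v) (opl R B m i (desusp v'))" using sl(1) p by (simp add: D0')
 also have "\<dots> = sg (susp B D0) (1 - int i + ssign v + k) (opl R B m i (desusp v))" unfolding os(1) BD by (rule sg_sg[OF bgD[OF SB] cl])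
 finally show ?c1 .
qed

text \<open>One summand on suspended words against the same summand of the unsuspended block sum.
  The part 1 + \<open>ssign w\<close> of the sign is common to all summands and can be pulled
  out.\<close>

lemma block_term:
 assumes B: "bgmodule R B" and mf: "family R B B (0, 1) m" and w: "valid V w" "w ~= []"
  and i: "i \<le> u" and D: "D \<in> decs (u - i) w" and D0: "D0 = wdeg w + (0, 1) - dsh u"
  and \<psi>: "!!p b. valid V b ==> b ~= [] ==> \<psi> p b \<in> carrier (susp B (wdeg b - dsh p))"
  and \<phi>: "!!p b. valid V b ==> b ~= [] ==> \<phi> p b = sg (susp B (wdeg b - dsh p)) (int p + ssign b) (\<psi> p b)"
 shows "sg (susp B D0) (dec_sign D) (opl R (susp B) (susp_fam R B B m) i (bword \<phi> D)) =
   sg (susp B D0) (1 + ssign w + block_sign u D) (opl R B m i (desusp (bword \<psi> D)))" (is ?c1)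
  and "opl R B m i (desusp (bword \<psi> D)) \<in> carrier (susp B D0)" (is ?c2)
  and "opl R (susp B) (susp_fam R B B m) i (bword \<phi> D) \<in> carrier (susp B D0)" (is ?c3)
proof -
 have d: "concat (map snd D) = w" "sum_list (map fst D) = u - i" "[] \<notin> set (map snd D)" using D by (auto simp: decs_def)
 have dw: "valid V (concat (map snd D))" unfolding d(1) by (rule w(1))
 have ne: "bword \<psi> D ~= []" using decs_nonempty[OF D w(2)] by (auto simp: bword_def)
 have v: "valid (susp B) (bword \<psi> D)" by (rule valid_blocks[where W = "susp B", OF \<psi> d(3) dw])
 have s: "sgw (susp B) (block_ssign D) (bword \<psi> D) (bword \<phi> D)" by (rule sgw_blocks[where W = "susp B", OF \<phi> d(3) dw])
 have D0': "D0 = wdeg (bword \<psi> D) + (0, 1) - dsh i" using i unfolding D0 wdeg_bword d by (simp add: dsh_diff)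
 note o = op_susp_sgw[OF B mf v ne s D0']
 have M: "module R (susp B D0)" by (rule bgD[OF susp_bg[OF B]])
 show ?c2 by (rule o(2))
 show ?c3 unfolding o(1) by (rule sg_closed[OF M o(2)])
 have u: "u = i + sum_list (map fst D)" using i d by simp
 show ?c1
  unfolding o(1) sg_sg[OF M o(2)] block_sign_def by (rule sg_cong, rule block_term_sign[OF u]) (use block_signs[of D \<psi>] d in simp)
qed

text \<open>The exponent r - i on the suspended side belongs to (-1)^r c(d^B, K): r is the external
  factor, and -i comes from the total degree -1 of K.\<close>

lemma marked_term:
 assumes B: "bgmodule R B" and mf: "family R B B (0, 1) m" and w: "valid V w" "w ~= []"
  and i: "i \<le> u" and D: "D \<in> decs (u - i) w" and s: "s < length D" and D0: "D0 = wdeg w + (0, 1) - dsh u + rshift r"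
  and x: "!!p b. valid V b ==> b ~= [] ==> x p b \<in> carrier (susp B (wdeg b - dsh p))"
  and y: "!!p b. valid V b ==> b ~= [] ==> y p b \<in> carrier (susp B (wdeg b - dsh p + rshift r))"
  and z: "!!p b. valid V b ==> b ~= [] ==> z p b \<in> carrier (susp B (wdeg b - dsh p))"
  and \<phi>: "!!p b. valid V b ==> b ~= [] ==> \<phi> p b = sg (susp B (wdeg b - dsh p)) (int p + ssign b) (x p b)"
  and \<kappa>: "!!p b. valid V b ==> b ~= [] ==> \<kappa> p b = sg (susp B (wdeg b - dsh p + rshift r)) (int r - 1 + (int p + ssign b)) (y p b)"
  and \<gamma>: "!!p b. valid V b ==> b ~= [] ==> \<gamma> p b = sg (susp B (wdeg b - dsh p)) (int p + ssign b) (z p b)"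
 shows "sg (susp B D0) (int r - int i + dec_sign D + bipair (rshift r) (wdeg (bword \<phi> (take s D))))
   (opl R (susp B) (susp_fam R B B m) i (mword r \<phi> \<kappa> \<gamma> D s)) =
   sg (susp B D0) (1 + int r + ssign w + block_sign u D + (int (r * length D + i + length D)
    + bipair (rshift r) (wdeg (desusp (bword x (take s D))))))
   (opl R B m i (desusp (mword r x y z D s)))"
  and "opl R B m i (desusp (mword r x y z D s)) \<in> carrier (susp B D0)"
  and "opl R (susp B) (susp_fam R B B m) i (mword r \<phi> \<kappa> \<gamma> D s) \<in> carrier (susp B D0)" (is ?c1)
proof -
 have d: "concat (map snd D) = w" "sum_list (map fst D) = u - i" "[] \<notin> set (map snd D)" using D by (auto simp: decs_def)
 have Ds: "D = take s D @ D ! s # drop (Suc s) D" using s by (simp add: id_take_nth_drop)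
 obtain p b where pb: "D ! s = (p, b)" by (cases "D ! s")
 have "concat (map snd D) = concat (map snd (take s D)) @ b @ concat (map snd (drop (Suc s) D))" by (subst Ds) (simp add: pb)
 then have val: "valid V (concat (map snd (take s D)))" "valid V b" "valid V (concat (map snd (drop (Suc s) D)))" using w(1) unfolding d by simp_all
 have "set (map snd D) = set (map snd (take s D)) \<union> {b} \<union> set (map snd (drop (Suc s) D))" by (subst Ds) (simp add: pb)
 then have ne: "[] \<notin> set (map snd (take s D))" "b ~= []" "[] \<notin> set (map snd (drop (Suc s) D))" using d(3) by auto
 let ?v = "mword r x y z D s"
 have v: "valid (susp B) ?v" "?v ~= []"
  using valid_blocks[where W = "susp B", OF x ne(1) val(1)] valid_blocks[where W = "susp B", OF z ne(3) val(3)] y[OF val(2) ne(2)]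
  by (simp_all add: mword_def pb)
 have "sgw (susp B) (block_ssign (take s D) + ((int r - 1 + (int p + ssign b)) + block_ssign (drop (Suc s) D)))
   ?v (mword r \<phi> \<kappa> \<gamma> D s)"
  unfolding mword_def pb fst_conv snd_conv
  by (intro sgw_append sgw_Cons sgw_blocks[where W = "susp B", OF \<phi> ne(1) val(1)] sgw_blocks[where W = "susp B", OF \<gamma> ne(3) val(3)] \<kappa>[OF val(2) ne(2)])
 moreover have "block_ssign D = block_ssign (take s D) + (int p + ssign b + block_ssign (drop (Suc s) D))"
  by (subst Ds) (simp add: block_ssign_append pb)
 ultimately have sgw: "sgw (susp B) (block_ssign D + (int r - 1)) ?v (mword r \<phi> \<kappa> \<gamma> D s)" by (simp add: algebra_simps)
 have D0': "D0 = wdeg ?v + (0, 1) - dsh i" using i unfolding D0 wdeg_marked[OF s] d by (simp add: dsh_diff)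
 note o = op_susp_sgw[OF B mf v sgw D0']
 have M: "module R (susp B D0)" by (rule bgD[OF susp_bg[OF B]])
 show "opl R B m i (desusp ?v) \<in> carrier (susp B D0)" by (rule o(2))
 show ?c1
  unfolding o(1) by (rule sg_closed[OF M o(2)])
 have u: "u = i + sum_list (map fst D)" using i d by simp
 have bp: "bipair (rshift r) (wdeg (desusp (bword x (take s D)))) = bipair (rshift r) (wdeg (bword \<phi> (take s D))) + (int r - 1) * int s"
  using s by (simp add: wdeg_desusp wdeg_bword) (simp add: bipair_def rshift_def)
 show "sg (susp B D0) (int r - int i + dec_sign D + bipair (rshift r) (wdeg (bword \<phi> (take s D))))
   (opl R (susp B) (susp_fam R B B m) i (mword r \<phi> \<kappa> \<gamma> D s)) =
   sg (susp B D0) (1 + int r + ssign w + block_sign u D + (int (r * length D + i + length D)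
    + bipair (rshift r) (wdeg (desusp (bword x (take s D))))))
   (opl R B m i (desusp ?v))"
  unfolding o(1) sg_sg[OF M o(2)] block_sign_def bp ssign_marked[OF s, where \<theta> = x]
  by (rule sg_cong, rule marked_term_sign[OF u]) (use block_signs[of D x] d in simp)
qed

lemma btens_desusp:
 assumes f: "\<forall>p q. 1 \<le> q --> bdeg (f p q) = (- int p, 1 - int p - int q)"
  and "length ps = length qs" "sum_list qs = length w" "\<forall>q\<in>set qs. 1 \<le> q"
 shows "btens_word R V (map2 (%p q. (q, f p q)) ps qs) (desusp w) = desusp (bword (opd R V f) (zip ps (blocks qs w)))"
  and "btens_sign (map2 (%p q. (q, f p q)) ps qs) (desusp w) = block_ksign (zip ps (blocks qs w))"
  and "sum_list (map (%(q, f). bdeg f) (map2 (%p q. (q, f p q)) ps qs)) = (- int (sum_list ps), int (length ps) - int (sum_list ps) - int (length w))"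
  and "sum_list (map fst (map2 (%p q. (q, f p q)) ps qs)) = length w"
  and "length (map2 (%p q. (q, f p q)) ps qs) = length ps"
 using assms(2-4)
proof (induct ps qs arbitrary: w rule: list_induct2)
 case (Cons p ps q qs)
 {
  case 1
  have q: "q \<le> length w" "sum_list qs = length (drop q w)" "1 \<le> q" using 1 by auto
  have l: "length (take q w) = q" using q by simp
  have e: "wdeg (take q w) + (0, int q) + (- int p, 1 - int p - int q) = wdeg (take q w) - dsh p + (0, 1)"
   by (cases "wdeg (take q w)") (simp add: dsh_def)
  show ?case using Cons(2)[OF q(2)] 1 q l e by (simp add: opd_def opl_def f wdeg_desusp min_def)
 next
  case 2
  have q: "q \<le> length w" "sum_list qs = length (drop q w)" "1 \<le> q" using 2 by auto
  have m: "map fst (zip ps (blocks qs (drop q w))) = ps" using Cons(1) by simp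
  have c: "length (concat (blocks qs (drop q w))) = length w - q" using concat_blocks[OF q(2)] by simp
  have l: "length (zip ps (blocks qs (drop q w))) = length ps" using Cons(1) by simp
  have t: "length (take q w) = q" using q by simp
  show ?case using Cons(3)[OF q(2)] Cons(4)[OF q(2)] 2 q
   by (simp add: m c wdeg_desusp min_absorb2 Cons(1) of_nat_diff del: bipair_simps length_concat)
 next
  case 3
  have q: "sum_list qs = length (drop q w)" "q \<le> length w" using 3 by auto
  show ?case using Cons(4)[OF q(1)] 3 q(2) by (simp add: f of_nat_diff)
 next
  case 4
  have q: "sum_list qs = length (drop q w)" using 4 by auto
  show ?case using Cons(5)[OF q] 4 by simp
 next
  case 5
  show ?case using Cons(1) by simp
 }
qed (simp_all add: zero_prod_def)

lemma opd_closed: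
 assumes A: "bgmodule R A" and B: "bgmodule R B" and ff: "family R A B c f" and b: "valid (susp A) b" "b ~= []"
 shows "opd R A f p b \<in> carrier (susp B (wdeg b - dsh p + c))" (is ?c1)
  and "opl R (susp A) (susp_fam R A B f) p b = sg (susp B (wdeg b - dsh p + c)) (snd c - int p + ssign b) (opd R A f p b)"
proof -
 have l: "1 \<le> length b" using b(2) by (cases b) auto
 note sl = susp_letter[where f = f and p = p and c = c, OF A B familyD[OF ff l] b(1)]
 show ?c1
  and "opl R (susp A) (susp_fam R A B f) p b = sg (susp B (wdeg b - dsh p + c)) (snd c - int p + ssign b) (opd R A f p b)"
  unfolding opd_def by (rule sl(2), rule sl(1))
qed

text \<open>The quadruples of summation parameters are replaced by an index i and a decomposition of
  w, the form in which the formal operators are summed.\<close>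

lemma block_eval:
 assumes A: "bgmodule R A" and B: "bgmodule R B" and mf: "family R B B (0, 1) m" and ff: "family R A B 0 f"
  and w: "w \<in> words (susp A) v d" and v: "1 \<le> v" and D0: "D0 = d + (0, 1) - dsh u"
 shows "bgapp (block_sum R A B (- int u, 2 - int u - int v) m f u v) (d + (0, int v)) (tens R A (desusp w)) =
  finsum (susp B D0) (%x. sg (susp B D0) (block_sign u (snd x)) (opl R B m (fst x) (desusp (bword (opd R A f) (snd x)))))
   (SIGMA i:{..u}. decs (u - i) w)"
proof -
 let ?S = "SIGMA i:{..u}. decs (u - i) w" and ?\<psi> = "opd R A f" and ?d = "d + (0, int v)" and ?e = "(- int u, 2 - int u - int v)"
 have lw: "length w = v" "valid (susp A) w" "wdeg w = d" using w by (auto simp: words_iff)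
 have wne: "w ~= []" using lw v by auto
 have BD: "B (?d + ?e) = susp B D0"
 proof -
  have "?d + ?e = D0 + (0, 1)" unfolding D0 by (cases d) (simp add: dsh_def)
  then show ?thesis by (simp add: susp_def)
 qed
 interpret B: module R "susp B D0" by (rule bgD[OF susp_bg[OF B]])
 have f: "f i j \<in> bghom R (tpow R A j) B (- int i, 1 - int i - int j)" if "1 \<le> j" for i j using familyD[OF ff that, of i] by simp
 have m: "m i j \<in> bghom R (tpow R B j) B (- int i, 2 - int i - int j)" if "1 \<le> j" for i j
  using familyD[OF mf that, of i] by (simp add: algebra_simps)
 have \<psi>: "?\<psi> p b \<in> carrier (susp B (wdeg b - dsh p))" if "valid (susp A) b" "b ~= []" for p b
  using opd_closed(1)[OF A B ff that] by simp
 let ?v = "%D. desusp (bword ?\<psi> D)"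
 have cl: "opl R B m i (?v D) \<in> carrier (susp B D0)" if "(i, D) \<in> ?S" for i D
  using that lw D0 wne by (intro block_term(2)[OF B mf lw(2) wne, of i u D D0 ?\<psi> "%p b. sg (susp B (wdeg b - dsh p)) (int p + ssign b) (?\<psi> p b)"])
   (auto intro: \<psi>)
 let ?h = "%(i, D). (i, length D, map fst D, map (length \<circ> snd) D)"
 let ?k = "%(i, j, ps, qs). int (morphism_sign u j ps qs)"
 let ?g = "%(i, j, ps, qs). bgcomp (m i j) (btens R A B (map2 (%p q. (q, f p q)) ps qs))"
 let ?T = "{(i, j, ps, qs). 1 \<le> j \<and> length ps = j \<and> length qs = j \<and> (\<forall>q\<in>set qs. 1 \<le> q) \<and> u = i + sum_list ps \<and> v = sum_list qs}"
 have T: "?T = ?h ` ?S"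
 proof
  show "?T \<subseteq> ?h ` ?S"
  proof
   fix y assume y: "y \<in> ?T"
   obtain i j ps qs where yy: "y = (i, j, ps, qs)" by (cases y)
   have c: "length ps = j" "length qs = j" "sum_list ps = u - i" "sum_list qs = length w" "\<forall>q\<in>set qs. 1 \<le> q" "i \<le> u"
    using y lw unfolding yy by auto
   note z = dec_lists_zip[OF c(1-5)]
   have "y = ?h (i, zip ps (blocks qs w))" "(i, zip ps (blocks qs w)) \<in> ?S" using z c(6) by (simp_all add: yy)
   then show "y \<in> ?h ` ?S" by blast
  qed
  show "?h ` ?S \<subseteq> ?T"
  proof (rule image_subsetI)
   fix y assume y: "y \<in> ?S"
   obtain i D where yy: "y = (i, D)" by (cases y)
   have D: "i \<le> u" "D \<in> decs (u - i) w" using y by (auto simp: yy)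
   note z = dec_lists_unzip[OF D(2)]
   have "1 \<le> length D" using decs_nonempty[OF D(2) wne] by (cases D) auto
   then show "?h y \<in> ?T"
    unfolding yy prod.case mem_Collect_eq using z(2-4) D(1) lw by (intro conjI) (simp_all only: length_map le_add_diff_inverse)
  qed
 qed
 have inj: "inj_on ?h ?S"
 proof (rule inj_onI)
  fix y y' assume y: "y \<in> ?S" "y' \<in> ?S" "?h y = ?h y'"
  obtain i D i' D' where yy: "y = (i, D)" "y' = (i', D')" by (cases y; cases y')
  have D: "D \<in> decs (u - i) w" "D' \<in> decs (u - i') w" using y by (auto simp: yy)
  have e: "i = i'" "map fst D = map fst D'" "map (length \<circ> snd) D = map (length \<circ> snd) D'"
   using y(3) unfolding yy prod.case prod.inject by blast+
  have "D = zip (map fst D') (blocks (map (length \<circ> snd) D') w)" using dec_lists_unzip(1)[OF D(1)] unfolding e by (rule sym)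
  also have "\<dots> = D'" by (rule dec_lists_unzip(1)[OF D(2)])
  finally show "y = y'" unfolding yy e by (rule arg_cong)
 qed
 have val: "sg (susp B D0) (?k (?h y)) (bgapp (?g (?h y)) ?d (tens R A (desusp w))) =
   sg (susp B D0) (block_sign u (snd y)) (opl R B m (fst y) (?v (snd y)))" if y: "y \<in> ?S" for y
 proof -
  obtain i D where yy: "y = (i, D)" by (cases y)
  have D: "i \<le> u" "D \<in> decs (u - i) w" using y by (auto simp: yy)
  note z = dec_lists_unzip[OF D(2)]
  let ?ps = "map fst D" and ?qs = "map (length \<circ> snd) D"
  let ?fs = "map2 (%p q. (q, f p q)) ?ps ?qs"
  have l: "1 \<le> length D" using decs_nonempty[OF D(2) wne] by (cases D) auto
  have fd: "\<forall>p q. 1 \<le> q --> bdeg (f p q) = (- int p, 1 - int p - int q)" using bghomD(1)[OF f] by blast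
  have pl: "length ?ps = length ?qs" by simp
  note bd1 = btens_desusp(1)[where f = f and ps = ?ps and qs = ?qs and w = w and V = A, OF fd pl z(3,4), unfolded z(1,2) length_map]
  note bd = btens_desusp(2-5)[where f = f and ps = ?ps and qs = ?qs and w = w, OF fd pl z(3,4), unfolded z(1,2) length_map]
  have bl: "blin R A B q f'" if "(q, f') \<in> set ?fs" for q f'
  proof -
   have "q \<in> set ?qs" "\<exists>p. f' = f p q" using that by (auto dest: set_zip_rightD)
   then show ?thesis using z(4) bghom_blin[OF f] by blast
  qed
  let ?D = "?d + (- int (u - i), int (length D) - int (u - i) - int (length w))"
  have ww: "desusp w \<in> words A (sum_list (map fst ?fs)) ?d" using desusps[OF w] unfolding bd(3) lw .
  have bt: "bgapp (btens R A B ?fs) ?d (tens R A (desusp w)) = sg (tpow R B (length D) ?D) (block_ksign D) (tens R B (?v D))"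
   using btens_tens[OF A B, where fs = ?fs and w = "desusp w" and d = ?d, OF bl ww] unfolding bdeg_btens bd1 bd by simp
  have vw: "?v D \<in> words B (length D) ?D"
   using btens_word_words[OF A, where fs = ?fs and w = "desusp w" and d = ?d and W = B, OF bl ww] unfolding bd1 bd by simp
  have deg: "?D + (- int i, 2 - int i - int (length D)) = ?d + ?e" using D(1) lw(1) by (cases d) (simp add: of_nat_diff)
  have lin: "bgapp (m i (length D)) ?D \<in> lmaps R (tpow R B (length D) ?D) (susp B D0)"
   using bghomD(2)[OF m[OF l, of i], of ?D] unfolding deg BD .
  have ol: "bgapp (m i (length D)) ?D (tens R B (?v D)) = opl R B m i (?v D)" using vw by (simp add: opl_def words_iff)
  have bdg: "bdeg (btens R A B ?fs) = (- int (u - i), int (length D) - int (u - i) - int (length w))" unfolding bdeg_btens bd(2) ..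
  have "bgapp (?g (?h y)) ?d (tens R A (desusp w)) = sg (susp B D0) (block_ksign D) (opl R B m i (?v D))"
   unfolding yy prod.case bgcomp_def bgmap.simps bdg bt lin_sg[OF lin tpow_mod[OF B] B.module_axioms tens_cl[OF B vw]] ol ..
  moreover have cl': "opl R B m i (?v D) \<in> carrier (susp B D0)" using cl y yy by blast
  moreover have "even (int (morphism_sign u (length D) (map fst D) (map (length \<circ> snd) D)) + block_ksign D - block_sign u D)"
   using morphism_sign_blocks[of u D] by (simp add: block_sign_def)
  note sg_cong[OF this]
  ultimately show ?thesis by (simp add: yy sg_sg[OF B.module_axioms cl'])
 qed
 have "bgapp (block_sum R A B ?e m f u v) ?d (tens R A (desusp w)) =
   finsum (susp B D0) (%y. sg (susp B D0) (?k y) (bgapp (?g y) ?d (tens R A (desusp w)))) (?h ` ?S)"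
  unfolding block_sum_def bgsum_def bgmap.simps T BD ..
 also have "\<dots> = finsum (susp B D0) (%y. sg (susp B D0) (?k (?h y)) (bgapp (?g (?h y)) ?d (tens R A (desusp w)))) ?S"
 proof (rule B.finsum_reindex[OF _ inj], rule funcsetI)
  fix y assume "y \<in> ?h ` ?S"
  then obtain z where z: "z \<in> ?S" "y = ?h z" by blast
  show "sg (susp B D0) (?k y) (bgapp (?g y) ?d (tens R A (desusp w))) \<in> carrier (susp B D0)"
   unfolding z(2) val[OF z(1)] using cl[of "fst z" "snd z"] z(1) by (intro sg_closed[OF B.module_axioms]) simp
 qed
 also have "\<dots> = finsum (susp B D0) (%x. sg (susp B D0) (block_sign u (snd x)) (opl R B m (fst x) (?v (snd x)))) ?S"
 proof (rule B.finsum_cong'[OF refl])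
  show "(%x. sg (susp B D0) (block_sign u (snd x)) (opl R B m (fst x) (?v (snd x)))) \<in> ?S \<rightarrow> carrier (susp B D0)"
  proof (rule funcsetI)
   fix z assume "z \<in> ?S"
   then show "sg (susp B D0) (block_sign u (snd z)) (opl R B m (fst z) (?v (snd z))) \<in> carrier (susp B D0)"
    using cl[of "fst z" "snd z"] by (intro sg_closed[OF B.module_axioms]) simp
  qed
 qed (rule val)
 finally show ?thesis .
qed

end

section \<open>The operations of the path object on words\<close>

section \<open>The operations of the path object\<close>

definition path_fst :: "('b \<times> 'b \<times> 'b) word => 'b word" where "path_fst w = map (%(e, x, y, z). (e, x)) w"

definition path_last :: "('b \<times> 'b \<times> 'b) word => 'b word" where "path_last w = map (%(e, x, y, z). (e, z)) w"

text \<open>The middle words of t_n without the signs indicated by bars.\<close>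

definition path_mid :: "nat => ('b \<times> 'b \<times> 'b) word => nat => 'b word" where
 "path_mid r w s = path_fst (take s w) @ (case w ! s of (e, x, y, z) => (e + rshift r, y)) # path_last (drop (Suc s) w)"

lemma path_fst_blocks: "path_fst (desusp (bword \<psi> D)) = desusp (bword (%p b. fst (\<psi> p b)) D)"
 and path_last_blocks: "path_last (desusp (bword \<psi> D)) = desusp (bword (%p b. snd (snd (\<psi> p b))) D)"
 by (simp_all add: path_fst_def path_last_def desusp_def bword_def case_prod_beta comp_def)

lemma path_mid_blocks:
 assumes "s < length D"
 shows "path_mid r (desusp (bword \<psi> D)) s = desusp (mword r (%p b. fst (\<psi> p b))
  (%p b. fst (snd (\<psi> p b))) (%p b. snd (snd (\<psi> p b))) D s)"
proof -
 have n: "desusp (bword \<psi> D) ! s = (wdeg (snd (D ! s)) - dsh (fst (D ! s)) + (0, 1), \<psi> (fst (D ! s)) (snd (D ! s)))"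
  using assms by (simp add: desusp_def bword_def case_prod_beta)
 have e: "x + (0, 1) + rshift r = x + rshift r + (0, 1)" for x by (simp add: add_ac)
 show ?thesis unfolding path_mid_def n desusp_simps bword_simps path_fst_blocks path_last_blocks mword_def by (simp add: case_prod_beta e)
qed

lemma path_word_props: "length (path_fst w) = length w" "length (path_last w) = length w" "wdeg (path_fst w) = wdeg w" "wdeg (path_last w) = wdeg w"
 by (simp_all add: path_fst_def path_last_def wdeg_def comp_def case_prod_beta)

lemma path_fst_letter_map: "path_fst w = letter_map end_minus w" "path_last w = letter_map end_plus w"
 by (simp_all add: path_fst_def path_last_def letter_map_def end_minus_def end_plus_def case_prod_beta)

context bgmods
begin

lemma lin_triple:
 assumes "f \<in> lmaps R P L" "g \<in> lmaps R P M" "h \<in> lmaps R P N"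
 shows "(%x. (f x, g x, h x)) \<in> lmaps R P (triple_sum L M N)"
 using assms by (auto simp: linear_maps_def triple_sum_simps)

lemma multilinear_triple:
 assumes "multilinear R V n d L f" "multilinear R V n d M g" "multilinear R V n d N h"
 shows "multilinear R V n d (triple_sum L M N) (%w. (f w, g w, h w))"
 using assms unfolding multilinear_def by (simp add: triple_sum_simps)

lemma multilinear_letter_map:
 assumes V: "bgmodule R V" and W: "bgmodule R W" and u: "!!d. bgapp f d \<in> lmaps R (V d) (W d)"
 shows "multilinear R V n d (tpow R W n d) (%w. tens R W (letter_map f w))" (is ?c1) and "w \<in> words V n d ==> letter_map f w \<in> words W n d"
proof -
 have val: "valid W (letter_map f w)" if "valid V w" for w using that
 proof (induct w)
  case (Cons x w)
  then show ?case by (cases x) (simp add: lin_closed[OF u])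
 qed simp
 show lw: "letter_map f w \<in> words W n d" if "w \<in> words V n d" for w using that val by (simp add: words_iff)
 have app: "letter_map f (p @ (e, a) # q) = letter_map f p @ (e, bgapp f e a) # letter_map f q" for p e a q by (simp add: letter_map_def)
 note m = multilinearD[OF tens_multilinear[OF W]]
 show ?c1
 proof (rule multilinearI)
  show "w \<in> words V n d ==> tens R W (letter_map f w) \<in> carrier (tpow R W n d)" for w by (rule m(1)[OF lw])
  fix p e a q assume w: "p @ (e, a) # q \<in> words V n d"
  have a: "a \<in> carrier (V e)" using w by (simp add: words_iff)
  note lw[OF w, unfolded app] 
  note m' = m(2)[OF this] m(3)[OF this]
  show "tens R W (letter_map f (p @ (e, a \<oplus>\<^bsub>V e\<^esub> b) # q)) =
    tens R W (letter_map f (p @ (e, a) # q)) \<oplus>\<^bsub>tpow R W n d\<^esub> tens R W (letter_map f (p @ (e, b) # q))"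
   if b: "b \<in> carrier (V e)" for b
   unfolding app lin_add[OF u a b] by (rule m'(1)[OF lin_closed[OF u b]])
  show "tens R W (letter_map f (p @ (e, c \<odot>\<^bsub>V e\<^esub> a) # q)) = c \<odot>\<^bsub>tpow R W n d\<^esub> tens R W (letter_map f (p @ (e, a) # q))"
   if c: "c \<in> carrier R" for c
   unfolding app lin_smult[OF u c a] by (rule m'(2)[OF c])
 qed
qed

lemma end_linear:
 fixes B :: "('r, 'b) bgmod"
 shows "bgapp end_minus d \<in> lmaps R (path r B d) (B d)" "bgapp end_plus d \<in> lmaps R (path r B d) (B d)"
  "bgapp (end_zero r) d \<in> lmaps R (path r B d) (B (d + rshift r))"
  "bdeg (end_minus :: ('b \<times> 'b \<times> 'b, 'b) bgmap) = 0" "bdeg (end_plus :: ('b \<times> 'b \<times> 'b, 'b) bgmap) = 0"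
  "bdeg (end_zero r :: ('b \<times> 'b \<times> 'b, 'b) bgmap) = rshift r"
 by (auto simp: end_minus_def end_plus_def end_zero_def path_def linear_maps_def triple_sum_simps)

text \<open>The signed middle word is the value of a tensor product of projections, with the middle
  one at position s, so multilinearity is inherited from there.\<close>

lemma path_mid_multilinear:
 assumes B: "bgmodule R B" and s: "s < n"
 shows "multilinear R (path r B) n d (tpow R B n (d + rshift r)) (%w. sg (tpow R B n (d + rshift r)) (bipair (rshift r) (wdeg (take s w)))
   (tens R B (path_mid r w s)))" (is ?c1)
  and "w \<in> words (path r B) n d ==> path_mid r w s \<in> words B n (d + rshift r)"
proof -
 note P = path_bg[OF B, of r]
 have el: "bgapp (end_zero r) d \<in> lmaps R (path r B d) (B (d + bdeg (end_zero r :: ('b \<times> 'b \<times> 'b, 'b) bgmap)))" for d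
  unfolding end_linear(6) by (rule end_linear(3))
 have h: "unary R B (end_zero r) \<in> bghom R (tpow R (path r B) 1) B (rshift r)"
  using unary_blin[OF P B el] by (intro bghomI) (simp_all add: blin_def end_linear)
 have n: "s + 1 + (n - s - 1) = n" using s by simp
 note sl = sandw_linear[OF P B end_linear(1,4,2,5) h, where s = s and t = "n - s - 1", unfolded n]
 note st = sandw_tens[OF P B end_linear(1,4,2,5) h, where s = s and t = "n - s - 1", unfolded n]
 have sw: "sandw_word R (path r B) end_minus s 1 (unary R B (end_zero r)) end_plus w = path_mid r w s" if w: "w \<in> words (path r B) n d" for w
 proof -
  have l: "length w = n" "valid (path r B) w" using w by (auto simp: words_iff)
  have t: "take 1 (drop s w) = [w ! s]" using l s by (simp add: take_Suc_conv_app_nth hd_drop_conv_nth take_Suc)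
  obtain e x where x: "w ! s = (e, x)" by (cases "w ! s")
  have "w ! s \<in> set w" using l s by simp
  then have xc: "x \<in> carrier (path r B e)" using l by (auto simp: valid_def x)
  show ?thesis using unary_tens[OF P B el xc]
   by (simp add: sandw_word_def path_mid_def t[simplified] x path_fst_letter_map end_linear(6)) (simp add: end_zero_def case_prod_beta)
 qed
 show "w \<in> words (path r B) n d ==> path_mid r w s \<in> words B n (d + rshift r)" using st(2) sw by fastforce
 show ?c1
  by (rule multilinear_cong[OF multilinear_lin[OF tens_multilinear[OF P] sl P] P]) (simp only: st(1) sw)
qed

text \<open>The bars in t_n are a Koszul sign in disguise: (1-r) and (r-1) have the same parity, so
  the barred prefix carries the sign for moving a map of bidegree (r, r-1) past it.\<close>

lemma path_bar_sgw:
 "\<exists>k. sgw B k (path_fst w) (map (%(e, x, y, z). (e, sg (B e) (int r * fst e + (1 - int r) * snd e) x)) w) \<and> even (k - bipair (rshift r) (wdeg w))"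
proof (induct w)
 case Nil
 show ?case by (intro exI[of _ 0]) (simp add: path_fst_def sgw_Nil)
next
 case (Cons a w)
 obtain e x y z where a: "a = (e, x, y, z)" by (cases a)
 obtain k where k: "sgw B k (path_fst w) (map (%(e, x, y, z). (e, sg (B e) (int r * fst e + (1 - int r) * snd e) x)) w)"
   "even (k - bipair (rshift r) (wdeg w))" using Cons by blast
 have "even (int r * fst e + (1 - int r) * snd e + k - bipair (rshift r) (wdeg (a # w)))"
 proof -
  have "int r * fst e + (1 - int r) * snd e + k - bipair (rshift r) (wdeg (a # w)) = (k - bipair (rshift r) (wdeg w)) + 2 * ((1 - int r) * snd e)"
   by (simp add: a bipair_def rshift_def algebra_simps)
  then show ?thesis using dvd_add[OF k(2) dvd_triv_left] by (simp only:)
 qed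
 moreover have "sgw B (int r * fst e + (1 - int r) * snd e + k) (path_fst (a # w))
   (map (%(e, x, y, z). (e, sg (B e) (int r * fst e + (1 - int r) * snd e) x)) (a # w))"
  using sgw_Cons[OF k(1) refl, where e = e and x = x and l = "int r * fst e + (1 - int r) * snd e"] by (simp add: a path_fst_def)
 ultimately show ?case by blast
qed

lemma path_t_props:
 fixes B :: "('r, 'b) bgmod"
 assumes B: "bgmodule R B"
 shows "bgapp (path_t R r B n) d \<in> lmaps R (tpow R (path r B) n d) (path r (tpow R B n) d)" (is ?c1)
  and "w \<in> words (path r B) n d ==> bgapp (path_t R r B n) d (tens R (path r B) w) =
   (tens R B (path_fst w), finsum (tpow R B n (d + rshift r)) (%s. sg (tpow R B n (d + rshift r)) (bipair (rshift r) (wdeg (take s w)))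
    (tens R B (path_mid r w s))) {..<n}, tens R B (path_last w))"
proof -
 note P = path_bg[OF B, of r]
 have M: "module R (tpow R B n d)" for d by (rule tpow_mod[OF B])
 have PM: "module R (path r (tpow R B n) d)" unfolding path_def by (intro triple_sum_module M)
 let ?E = "d + rshift r"
 let ?\<Phi> = "%w. (tens R B (map (%(e, x, y, z). (e, x)) w), finsum (tpow R B n ?E) (%j. tens R B
        (map (%(e, x, y, z). (e, sg (B e) (int r * fst e + (1 - int r) * snd e) x)) (take j w)
        @ (case w ! j of (e, x, y, z) => (e + rshift r, y))
        # map (%(e, x, y, z). (e, z)) (drop (Suc j) w)))
      {..<n},
     tens R B (map (%(e, x, y, z). (e, z)) w))"
 let ?\<Psi> = "%w. (tens R B (path_fst w), finsum (tpow R B n ?E) (%s. sg (tpow R B n ?E) (bipair (rshift r) (wdeg (take s w)))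
    (tens R B (path_mid r w s))) {..<n}, tens R B (path_last w))"
 have eq: "?\<Phi> w = ?\<Psi> w" if w: "w \<in> words (path r B) n d" for w
 proof -
  have "tens R B (map (%(e, x, y, z). (e, sg (B e) (int r * fst e + (1 - int r) * snd e) x)) (take j w)
        @ (case w ! j of (e, x, y, z) => (e + rshift r, y))
        # map (%(e, x, y, z). (e, z)) (drop (Suc j) w)) =
    sg (tpow R B n ?E) (bipair (rshift r) (wdeg (take j w))) (tens R B (path_mid r w j))" if j: "j < n" for j
  proof -
   obtain k where k: "sgw B k (path_fst (take j w)) (map (%(e, x, y, z). (e, sg (B e) (int r * fst e + (1 - int r) * snd e) x)) (take j w))"
    "even (k - bipair (rshift r) (wdeg (take j w)))" using path_bar_sgw by blast
   have pm: "[] @ path_mid r w j \<in> words B n ?E" using path_mid_multilinear(2)[OF B j w] by simp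
   have "sgw B (k + 0) (path_mid r w j) (map (%(e, x, y, z). (e, sg (B e) (int r * fst e + (1 - int r) * snd e) x)) (take j w)
        @ (case w ! j of (e, x, y, z) => (e + rshift r, y)) # path_last (drop (Suc j) w))"
    unfolding path_mid_def by (intro sgw_append k(1) sgw_refl)
   from tens_sgw[OF B this pm] show ?thesis using sg_cong[OF k(2)] by (simp add: path_last_def)
  qed
  then have "finsum (tpow R B n ?E) (%j. tens R B (map (%(e, x, y, z). (e, sg (B e) (int r * fst e + (1 - int r) * snd e) x)) (take j w)
        @ (case w ! j of (e, x, y, z) => (e + rshift r, y))
        # map (%(e, x, y, z). (e, z)) (drop (Suc j) w))) {..<n} =
    finsum (tpow R B n ?E) (%s. sg (tpow R B n ?E) (bipair (rshift r) (wdeg (take s w))) (tens R B (path_mid r w s))) {..<n}"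
   using multilinearD(1)[OF path_mid_multilinear(1)[OF B] w] M[of ?E, THEN module_abmon] by (intro abelian_monoid.finsum_cong') auto
  then show ?thesis by (simp add: path_fst_def path_last_def)
 qed
 have ml: "multilinear R (path r B) n d (path r (tpow R B n) d) ?\<Psi>" unfolding path_def[of r "tpow R B n"]
  by (intro multilinear_triple multilinear_finsum path_mid_multilinear(1) B M P finite_lessThan)
   (simp_all add: path_fst_letter_map multilinear_letter_map(1)[OF P B] end_linear path_mid_multilinear(1)[OF B])
 have ml': "multilinear R (path r B) n d (path r (tpow R B n) d) ?\<Phi>" by (rule multilinear_cong[OF ml P eq])
 have app: "bgapp (path_t R r B n) d = tlift R (path r (tpow R B n) d) ?\<Phi>" by (simp add: path_t_def)
 show ?c1
  unfolding app by (rule tlift_linear[OF P PM ml'])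
 show "bgapp (path_t R r B n) d (tens R (path r B) w) = ?\<Psi> w" if w: "w \<in> words (path r B) n d"
  unfolding app tlift_tens[OF P PM ml' w] by (rule eq[OF w])
qed

lemma unary_op_linear:
 assumes B: "bgmodule R B" and m: "m \<in> bghom R (tpow R B 1) B e"
 shows "(%x. bgapp m d (tens R B [(d, x)])) \<in> lmaps R (B d) (B (d + e))"
proof -
 have "(%y. tens R B ([] @ (d, y) # [])) \<in> lmaps R (B d) (tpow R B 1 d)"
  by (rule letter_linear[OF B, where x = "zr (B d)"])
   (simp add: words_iff abelian_monoid.zero_closed[OF module_abmon[OF bgD[OF B]]])
 from lin_comp[OF this bghomD(2)[OF m]] show ?thesis by simp
qed

lemma path_op1_linear:
 fixes B :: "('r, 'b) bgmod"
 assumes B: "bgmodule R B" and m: "m i 1 \<in> bghom R (tpow R B 1) B (- int i, 1 - int i)"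
 shows "bgapp (path_op1 R r B m i) d \<in> lmaps R (path r B d) (path r B (d + (- int i, 1 - int i)))"
proof -
 let ?e = "(- int i, 1 - int i)"
 let ?m = "%d x. bgapp (m i 1) d (tens R B [(d, x)])"
 have ml: "?m d \<in> lmaps R (B d) (B (d + ?e))" for d by (rule unary_op_linear[OF B m])
 note BM = bgD[OF B]
 have x: "(%x. ?m d (fst x)) \<in> lmaps R (path r B d) (B (d + ?e))" "(%x. ?m d (snd (snd x))) \<in> lmaps R (path r B d) (B (d + ?e))"
  unfolding path_def by (rule lin_comp[OF triple_proj_linear(1) ml], rule lin_comp[OF triple_proj_linear(3) ml])
 have y: "(%x. ?m (d + rshift r) (fst (snd x))) \<in> lmaps R (path r B d) (B (d + rshift r + ?e))"
  unfolding path_def by (rule lin_comp[OF triple_proj_linear(2) ml])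
 have com: "d + ?e + rshift r = d + rshift r + ?e" by (simp add: add_ac)
 have mid: "(%x. if i = r then (\<ominus>\<^bsub>B d\<^esub> fst x \<ominus>\<^bsub>B d\<^esub> ?m (d + rshift r) (fst (snd x))) \<oplus>\<^bsub>B d\<^esub> snd (snd x)
    else sg (B (d + rshift r + ?e)) (int (i + r + 1)) (?m (d + rshift r) (fst (snd x)))) \<in> lmaps R (path r B d) (B (d + rshift r + ?e))"
 proof (cases "i = r")
  case True
  have e: "d + rshift r + ?e = d" unfolding True rshift_def by (cases d) simp
  have neg: "\<ominus>\<^bsub>B d\<^esub> a = sg (B d) 1 a" for a by (simp add: sg_def)
  have p: "fst \<in> lmaps R (path r B d) (B d)" "(%x. snd (snd x)) \<in> lmaps R (path r B d) (B d)"
   unfolding path_def by (rule triple_proj_linear(1), rule triple_proj_linear(3))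
  have "(%x. (\<ominus>\<^bsub>B d\<^esub> fst x \<ominus>\<^bsub>B d\<^esub> ?m (d + rshift r) (fst (snd x))) \<oplus>\<^bsub>B d\<^esub> snd (snd x)) \<in> lmaps R (path r B d) (B d)"
   unfolding a_minus_def neg by (intro lin_add_map lin_sg_map BM p y[unfolded e])
  then show ?thesis unfolding e using True by simp
 next
  case False
  then show ?thesis using lin_sg_map[OF y BM] by simp
 qed
 have "bgapp (path_op1 R r B m i) d = (%x. (?m d (fst x), if i = r then (\<ominus>\<^bsub>B d\<^esub> fst x \<ominus>\<^bsub>B d\<^esub> ?m (d + rshift r) (fst (snd x))) \<oplus>\<^bsub>B d\<^esub> snd (snd x)
    else sg (B (d + rshift r + ?e)) (int (i + r + 1)) (?m (d + rshift r) (fst (snd x))), ?m d (snd (snd x))))"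
  by (simp add: path_op1_def Let_def case_prod_beta fun_eq_iff)
 moreover have "path r B (d + ?e) = triple_sum (B (d + ?e)) (B (d + rshift r + ?e)) (B (d + ?e))" by (simp add: path_def com)
 ultimately show ?thesis using lin_triple[OF x(1) mid x(2)] by simp
qed

text \<open>One formula for all arities: for j = 1 the exponent rj + i + j is r + i + 1, which for i
  = r gives the minus sign in front of m_{r1} y. Only the summand z - x is peculiar to i = r and j =
  1.\<close>

lemma path_op_props:
 fixes B :: "('r, 'b) bgmod"
 assumes B: "bgmodule R B" and mf: "family R B B (0, 1) m"
 shows "family R (path r B) (path r B) (0, 1) (path_op R r B m)" (is ?c1)
  and "valid (path r B) v ==> v ~= [] ==> E = wdeg v + (- int i, 2 - int i - int (length v)) ==>
   opl R (path r B) (path_op R r B m) i v = (opl R B m i (path_fst v),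
    finsum (B (E + rshift r)) (%s. sg (B (E + rshift r)) (int (r * length v + i + length v) + bipair (rshift r) (wdeg (take s v)))
     (opl R B m i (path_mid r v s))) {..<length v}
     \<oplus>\<^bsub>B (E + rshift r)\<^esub> (if length v = 1 \<and> i = r then snd (snd (snd (hd v))) \<ominus>\<^bsub>B (E + rshift r)\<^esub> fst (snd (hd v)) else (zr (B (E + rshift r)))),
    opl R B m i (path_last v))"
  and "valid (path r B) v ==> v ~= [] ==> E = wdeg v + (- int i, 2 - int i - int (length v)) ==> s < length v ==>
   opl R B m i (path_mid r v s) \<in> carrier (B (E + rshift r))"
proof -
 note P = path_bg[OF B, of r] and BM = bgD[OF B]
 have m: "m i j \<in> bghom R (tpow R B j) B (- int i, 2 - int i - int j)" if "1 \<le> j" for i j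
  using familyD[OF mf that, of i] by (simp add: algebra_simps)
 have m1: "m i 1 \<in> bghom R (tpow R B 1) B (- int i, 1 - int i)" for i using m[of 1 i] by simp
 have d1: "bdeg (path_op1 R r B m i) = (- int i, 1 - int i)" for i by (simp add: path_op1_def Let_def)
 have l1: "bgapp (path_op1 R r B m i) d \<in> lmaps R (path r B d) (path r B (d + bdeg (path_op1 R r B m i)))" for i d
  unfolding d1 by (rule path_op1_linear[where m = m and i = i, OF B m1])
 let ?D = "%i j. path_diag r (m i j) (bgsgn B (int (r * j + i + j)) (m i j)) (m i j)"
 have bs: "bgapp (bgsgn B k (m i j)) d x = sg (B (d + (- int i, 2 - int i - int j))) k (bgapp (m i j) d x)" if "1 \<le> j" for i j k d x
  using bghomD(1)[OF m[OF that, of i]] by (simp add: bgsgn_def)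
 have bt: "bdeg (path_t R r B j) = 0" for j by (simp add: path_t_def)
 have appD: "bgapp (bgcomp (?D i j) (path_t R r B j)) d x = (case bgapp (path_t R r B j) d x of (a, b, c) =>
   (bgapp (m i j) d a, sg (B (d + rshift r + (- int i, 2 - int i - int j))) (int (r * j + i + j)) (bgapp (m i j) (d + rshift r) b), bgapp (m i j) d c))"
  if "1 \<le> j" for i j d x
  by (simp add: bgcomp_def path_diag_def bt bs[OF that])
 have com: "d + e + rshift r = d + rshift r + e" for d e by (simp add: add_ac)
 have ph: "path_op R r B m i j \<in> bghom R (tpow R (path r B) j) (path r B) (- int i, 2 - int i - int j)" if j: "1 \<le> j" for i j
 proof (cases "j = 1")
  case True
  have "unary R (path r B) (path_op1 R r B m i) \<in> bghom R (tpow R (path r B) 1) (path r B) (- int i, 1 - int i)"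
   using unary_blin[OF P P l1] by (intro bghomI) (simp_all add: blin_def d1)
  then show ?thesis using True by (simp add: path_op_def)
 next
  case False
  have dg: "bdeg (bgcomp (?D i j) (path_t R r B j)) = (- int i, 2 - int i - int j)"
   using bghomD(1)[OF m[OF j, of i]] by (simp add: bgcomp_def path_diag_def bt)
  have "bgcomp (?D i j) (path_t R r B j) \<in> bghom R (tpow R (path r B) j) (path r B) (- int i, 2 - int i - int j)"
  proof (rule bghomI[OF dg])
   fix d
   let ?e = "(- int i, 2 - int i - int j)"
   note pt = path_t_props(1)[OF B, of r j d]
   have pr: "(%x. fst (bgapp (path_t R r B j) d x)) \<in> lmaps R (tpow R (path r B) j d) (tpow R B j d)"
    "(%x. fst (snd (bgapp (path_t R r B j) d x))) \<in> lmaps R (tpow R (path r B) j d) (tpow R B j (d + rshift r))"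
    "(%x. snd (snd (bgapp (path_t R r B j) d x))) \<in> lmaps R (tpow R (path r B) j d) (tpow R B j d)"
    using lin_comp[OF pt[unfolded path_def[of r "tpow R B j"]] triple_proj_linear(1)]
     lin_comp[OF pt[unfolded path_def[of r "tpow R B j"]] triple_proj_linear(2)]
     lin_comp[OF pt[unfolded path_def[of r "tpow R B j"]] triple_proj_linear(3)] by auto
   note mh = bghomD(2)[OF m[OF j, of i]]
   have tgt: "path r B (d + ?e) = triple_sum (B (d + ?e)) (B (d + rshift r + ?e)) (B (d + ?e))" by (simp add: path_def com)
   have fe: "bgapp (bgcomp (?D i j) (path_t R r B j)) d = (%x. (bgapp (m i j) d (fst (bgapp (path_t R r B j) d x)),
     sg (B (d + rshift r + ?e)) (int (r * j + i + j)) (bgapp (m i j) (d + rshift r) (fst (snd (bgapp (path_t R r B j) d x)))),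
     bgapp (m i j) d (snd (snd (bgapp (path_t R r B j) d x)))))"
    by (rule ext) (unfold appD[OF j] case_prod_beta, rule refl)
   have "(%x. (bgapp (m i j) d (fst (bgapp (path_t R r B j) d x)),
     sg (B (d + rshift r + ?e)) (int (r * j + i + j)) (bgapp (m i j) (d + rshift r) (fst (snd (bgapp (path_t R r B j) d x)))),
     bgapp (m i j) d (snd (snd (bgapp (path_t R r B j) d x)))))
    \<in> lmaps R (tpow R (path r B) j d) (path r B (d + ?e))"
    unfolding tgt by (rule lin_triple[OF lin_comp[OF pr(1) mh] lin_sg_map[OF lin_comp[OF pr(2) mh] BM] lin_comp[OF pr(3) mh]])
   then show "bgapp (bgcomp (?D i j) (path_t R r B j)) d \<in> lmaps R (tpow R (path r B) j d) (path r B (d + ?e))" unfolding fe .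
  qed
  then show ?thesis using False by (simp add: path_op_def)
 qed
 show ?c1 unfolding family_def
 proof (intro allI impI)
  fix i j :: nat assume j: "1 \<le> j"
  have e: "(- int i, 1 - int i - int j) + (0, 1) = (- int i, 2 - int i - int j)" by simp
  show "path_op R r B m i j \<in> bghom R (tpow R (path r B) j) (path r B) ((- int i, 1 - int i - int j) + (0, 1))" unfolding e by (rule ph[OF j])
 qed
 assume v: "valid (path r B) v" "v ~= []" and E: "E = wdeg v + (- int i, 2 - int i - int (length v))"
 let ?n = "length v" and ?d = "wdeg v"
 have n: "1 \<le> ?n" using v(2) by (cases v) auto
 have w: "v \<in> words (path r B) ?n ?d" using v by (simp add: words_iff)
 let ?E = "E + rshift r"
 have deg: "?d + rshift r + (- int i, 2 - int i - int ?n) = ?E" unfolding E by (simp add: add_ac)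
 have lin: "bgapp (m i ?n) (?d + rshift r) \<in> lmaps R (tpow R B ?n (?d + rshift r)) (B ?E)"
  using bghomD(2)[OF m[OF n, of i], of "?d + rshift r"] unfolding deg .
 have pm: "path_mid r v s \<in> words B ?n (?d + rshift r)" if "s < ?n" for s by (rule path_mid_multilinear(2)[OF B that w])
 have ol: "opl R B m i (path_mid r v s) = bgapp (m i ?n) (?d + rshift r) (tens R B (path_mid r v s))" if "s < ?n" for s
  using pm[OF that] by (simp add: opl_def words_iff)
 show cl: "opl R B m i (path_mid r v s) \<in> carrier (B ?E)" if "s < ?n" for s
  unfolding ol[OF that] by (rule lin_closed[OF lin tens_cl[OF B pm[OF that]]])
 have olf: "opl R B m i (path_fst v) = bgapp (m i ?n) ?d (tens R B (path_fst v))"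
  "opl R B m i (path_last v) = bgapp (m i ?n) ?d (tens R B (path_last v))"
  by (simp_all add: opl_def path_word_props)
 interpret BE: module R "B ?E" by (rule BM)
 show "opl R (path r B) (path_op R r B m) i v = (opl R B m i (path_fst v),
    finsum (B ?E) (%s. sg (B ?E) (int (r * ?n + i + ?n) + bipair (rshift r) (wdeg (take s v))) (opl R B m i (path_mid r v s))) {..<?n}
     \<oplus>\<^bsub>B ?E\<^esub> (if ?n = 1 \<and> i = r then snd (snd (snd (hd v))) \<ominus>\<^bsub>B ?E\<^esub> fst (snd (hd v)) else (zr (B ?E))),
    opl R B m i (path_last v))"
 proof (cases "?n = 1")
  case False
  let ?T = "tpow R B ?n (?d + rshift r)"
  have T: "module R ?T" by (rule tpow_mod[OF B])
  have tc: "sg ?T k (tens R B (path_mid r v s)) \<in> carrier ?T" if "s < ?n" for s k by (rule sg_closed[OF T tens_cl[OF B pm[OF that]]])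
  have "sg (B ?E) k (bgapp (m i ?n) (?d + rshift r) (finsum ?T (%s. sg ?T (b s) (tens R B (path_mid r v s))) {..<?n})) =
    finsum (B ?E) (%s. sg (B ?E) (k + b s) (opl R B m i (path_mid r v s))) {..<?n}" for k b
  proof -
   have "bgapp (m i ?n) (?d + rshift r) (finsum ?T (%s. sg ?T (b s) (tens R B (path_mid r v s))) {..<?n}) =
     finsum (B ?E) (%s. bgapp (m i ?n) (?d + rshift r) (sg ?T (b s) (tens R B (path_mid r v s)))) {..<?n}"
    by (rule lin_finsum[OF lin T BM]) (use tc in auto)
   also have "\<dots> = finsum (B ?E) (%s. sg (B ?E) (b s) (opl R B m i (path_mid r v s))) {..<?n}" by (rule BE.finsum_cong'[OF refl])
     (auto simp: ol lin_sg[OF lin T BM tens_cl[OF B pm]] intro!: sg_closed[OF BM] lin_closed[OF lin] tens_cl[OF B pm])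
   finally have *: "bgapp (m i ?n) (?d + rshift r) (finsum ?T (%s. sg ?T (b s) (tens R B (path_mid r v s))) {..<?n}) =
     finsum (B ?E) (%s. sg (B ?E) (b s) (opl R B m i (path_mid r v s))) {..<?n}" .
   have "sg (B ?E) k (finsum (B ?E) (%s. sg (B ?E) (b s) (opl R B m i (path_mid r v s))) {..<?n}) =
     finsum (B ?E) (%s. sg (B ?E) k (sg (B ?E) (b s) (opl R B m i (path_mid r v s)))) {..<?n}"
    by (rule lin_finsum[OF lin_sg_map[OF lin_id BM] BM BM]) (auto intro!: sg_closed[OF BM] cl)
   also have "\<dots> = finsum (B ?E) (%s. sg (B ?E) (k + b s) (opl R B m i (path_mid r v s))) {..<?n}"
    by (rule BE.finsum_cong'[OF refl]) (auto simp: sg_sg[OF BM cl] intro!: sg_closed[OF BM] cl)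
   finally show ?thesis unfolding * .
  qed
  note mid = this
  have fc: "finsum (B ?E) (%s. sg (B ?E) (k + b s) (opl R B m i (path_mid r v s))) {..<?n} \<in> carrier (B ?E)" for k b
   by (rule BE.finsum_closed) (auto intro!: sg_closed[OF BM] cl)
  have "opl R (path r B) (path_op R r B m) i v = bgapp (bgcomp (?D i ?n) (path_t R r B ?n)) ?d (tens R (path r B) v)"
   using False by (simp add: opl_def path_op_def)
  also have "\<dots> = (opl R B m i (path_fst v),
    finsum (B ?E) (%s. sg (B ?E) (int (r * ?n + i + ?n) + bipair (rshift r) (wdeg (take s v))) (opl R B m i (path_mid r v s))) {..<?n},
    opl R B m i (path_last v))"
   unfolding appD[OF n] path_t_props(2)[OF B w] prod.case deg mid olf ..
  finally show ?thesis using False BE.r_zero[OF fc] by simp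
 next
  case True
  obtain e x y z where ve: "v = [(e, x, y, z)]" using True by (cases v; cases "hd v") auto
  have c: "(x, y, z) \<in> carrier (path r B e)" using v by (simp add: ve)
  then have xyz: "x \<in> carrier (B e)" "y \<in> carrier (B (e + rshift r))" "z \<in> carrier (B e)" by (auto simp: path_def triple_sum_simps)
  have Ee: "E = e + (- int i, 1 - int i)" unfolding E by (simp add: ve)
  have pmv: "path_mid r v 0 = [(e + rshift r, y)]" by (simp add: path_mid_def ve path_fst_def path_last_def)
  have my: "bgapp (m i 1) (e + rshift r) (tens R B [(e + rshift r, y)]) = opl R B m i (path_mid r v 0)" by (simp add: pmv opl_def)
  have yc: "opl R B m i (path_mid r v 0) \<in> carrier (B ?E)" by (rule cl) (simp add: True)
  have op: "opl R (path r B) (path_op R r B m) i v = bgapp (path_op1 R r B m i) e (x, y, z)"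
   using unary_tens[OF P P l1 c] by (simp add: ve opl_def path_op_def)
  have s0: "finsum (B ?E) F {..<?n} = F 0" if "F 0 \<in> carrier (B ?E)" for F using that by (simp add: True lessThan_Suc)
  have sum: "finsum (B ?E) (%s. sg (B ?E) (int (r * ?n + i + ?n) + bipair (rshift r) (wdeg (take s v))) (opl R B m i (path_mid r v s))) {..<?n} =
    sg (B ?E) (int (i + r + 1)) (opl R B m i (path_mid r v 0))"
   by (subst s0) (simp_all add: True sg_closed[OF BM yc] add_ac)
  have dE: "e + rshift r + (- int i, 1 - int i) = ?E" unfolding Ee by (simp add: add_ac)
  have mid: "(if i = r then (\<ominus>\<^bsub>B e\<^esub> x \<ominus>\<^bsub>B e\<^esub> opl R B m i (path_mid r v 0)) \<oplus>\<^bsub>B e\<^esub> z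
    else sg (B ?E) (int (i + r + 1)) (opl R B m i (path_mid r v 0))) =
    sg (B ?E) (int (i + r + 1)) (opl R B m i (path_mid r v 0)) \<oplus>\<^bsub>B ?E\<^esub> (if ?n = 1 \<and> i = r then z \<ominus>\<^bsub>B ?E\<^esub> x else (zr (B ?E)))"
  proof (cases "i = r")
   case ir: True
   have Ei: "?E = e" unfolding Ee ir rshift_def by (cases e) simp
   let ?y = "opl R B m i (path_mid r v 0)"
   interpret Be: module R "B e" by (rule BM)
   have yc': "?y \<in> carrier (B e)" using yc unfolding Ei .
   have "(\<ominus>\<^bsub>B e\<^esub> x \<ominus>\<^bsub>B e\<^esub> ?y) \<oplus>\<^bsub>B e\<^esub> z = \<ominus>\<^bsub>B e\<^esub> ?y \<oplus>\<^bsub>B e\<^esub> (z \<ominus>\<^bsub>B e\<^esub> x)"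
    using xyz yc' by (simp add: a_minus_def Be.a_ac)
   then show ?thesis unfolding Ei using ir True by (simp add: sg_def)
  next
   case False
   then show ?thesis using BE.r_zero[OF sg_closed[OF BM yc]] by simp
  qed
  have o1: "opl R B m i (path_fst v) = bgapp (m i 1) e (tens R B [(e, x)])" "opl R B m i (path_last v) = bgapp (m i 1) e (tens R B [(e, z)])"
   by (simp_all add: opl_def path_fst_def path_last_def ve)
  have "bgapp (path_op1 R r B m i) e (x, y, z) = (opl R B m i (path_fst v),
    if i = r then (\<ominus>\<^bsub>B e\<^esub> x \<ominus>\<^bsub>B e\<^esub> opl R B m i (path_mid r v 0)) \<oplus>\<^bsub>B e\<^esub> z
    else sg (B ?E) (int (i + r + 1)) (opl R B m i (path_mid r v 0)), opl R B m i (path_last v))"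
   unfolding path_op1_def Let_def bgmap.simps prod.case my dE o1 ..
  then show ?thesis unfolding op sum mid by (simp add: ve)
 qed
qed

end

section \<open>Morphism equations as one-letter components\<close>

section \<open>Morphism equations and one-letter components\<close>

text \<open>One-letter words evaluated in V itself, where the morphism equations take place, instead
  of in the first tensor power.\<close>

definition lev :: "('r, 'a) bgmod => bideg => ('a word \<Rightarrow>\<^sub>0 int) => 'a" where
 "lev V d = fev (V d) (%w. if w \<in> words V 1 d then snd (hd w) else (zr (V d)))"

definition homog :: "bideg => ('a word \<Rightarrow>\<^sub>0 int) => bool" where
 "homog D x \<longleftrightarrow> (\<forall>w\<in>fkeys x. length w = 1 \<and> wdeg w = D)"

lemma homog_fsg: "homog D x ==> homog D (fsg k x)" by (simp add: homog_def)

lemma homog_sum: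
 assumes "!!s. s \<in> S ==> homog D (f s)" shows "homog D (sum f S)"
 unfolding homog_def
proof
 fix w assume w: "w \<in> fkeys (sum f S)"
 obtain s where "s \<in> S" "w \<in> fkeys (f s)" using subsetD[OF keys_sum w] by (rule UN_E)
 then show "length w = 1 \<and> wdeg w = D" using assms by (auto simp: homog_def)
qed

lemma homog_add: "homog D x ==> homog D y ==> homog D (x + y)" unfolding homog_def by (intro ballI) (drule subsetD[OF keys_add], auto)

lemma homog_diff: "homog D x ==> homog D y ==> homog D (x - y)" unfolding homog_def by (intro ballI) (drule subsetD[OF keys_diff], auto)

lemma homog_of: "homog D (frag_of [(D, y)])" by (simp add: homog_def)

lemma sum_Sigma_decs: "(\<Sum>i\<le>u. \<Sum>D\<in>decs (u - i) w. h i D) = (\<Sum>x\<in>(SIGMA i:{..u}. decs (u - i) w). h (fst x) (snd x))"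
 by (simp add: sum.Sigma finite_decs case_prod_beta)

lemma letters_opcomp_blocks:
 assumes w: "w ~= []" and D0: "D0 = wdeg w + (0, 1) - dsh u"
 shows "letters (opcomp k (insert_fop \<delta>) (coalg_fop \<phi>) u w) = (\<Sum>x\<in>(SIGMA i:{..u}. decs (u - i) w).
  fsg (int (fst x) * k + dec_sign (snd x)) (frag_of [(D0, \<delta> (fst x) (bword \<phi> (snd x)))]))"
proof -
 have t: "letters (fext (insert_fop \<delta> i) (frag_of (bword \<phi> D))) = frag_of [(D0, \<delta> i (bword \<phi> D))]"
  if "i \<le> u" "D \<in> decs (u - i) w" for i D
 proof -
  have "bword \<phi> D ~= []" using decs_nonempty[OF that(2) w] by (auto simp: bword_def)
  moreover have "wdeg (bword \<phi> D) + ((0, 1) - dsh i) = D0" using that by (simp add: D0 wdeg_bword decs_def dsh_diff)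
  ultimately show ?thesis by (simp add: letters_insert_fop)
 qed
 have "letters (opcomp k (insert_fop \<delta>) (coalg_fop \<phi>) u w) = (\<Sum>i\<le>u. \<Sum>D\<in>decs (u - i) w.
   fsg (int i * k) (fsg (dec_sign D) (letters (fext (insert_fop \<delta> i) (frag_of (bword \<phi> D))))))"
  by (simp add: opcomp_def coalg_fop_def letters_linear frag_extend_sum' fsg_sum)
 also have "\<dots> = (\<Sum>i\<le>u. \<Sum>D\<in>decs (u - i) w. fsg (int i * k + dec_sign D) (frag_of [(D0, \<delta> i (bword \<phi> D))]))"
  by (intro sum.cong refl) (simp only: t atMost_iff fsg_fsg)
 also have "\<dots> = (\<Sum>x\<in>(SIGMA i:{..u}. decs (u - i) w).
   fsg (int (fst x) * k + dec_sign (snd x)) (frag_of [(D0, \<delta> (fst x) (bword \<phi> (snd x)))]))"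
  by (simp add: sum.Sigma finite_decs case_prod_beta)
 finally show ?thesis .
qed

lemma letters_opcomp_marked:
 assumes w: "w ~= []" and D0: "D0 = wdeg w + (0, 1) - dsh u + rshift r"
 shows "letters (opcomp k (insert_fop \<delta>) (coder_fop r \<phi> \<kappa> \<gamma>) u w) = (\<Sum>x\<in>(SIGMA i:{..u}. decs (u - i) w). \<Sum>s<length (snd x).
  fsg (int (fst x) * k + (dec_sign (snd x) + bipair (rshift r) (wdeg (bword \<phi> (take s (snd x))))))
   (frag_of [(D0, \<delta> (fst x) (mword r \<phi> \<kappa> \<gamma> (snd x) s))]))"
proof -
 have t: "letters (fext (insert_fop \<delta> i) (frag_of (mword r \<phi> \<kappa> \<gamma> D s))) = frag_of [(D0, \<delta> i (mword r \<phi> \<kappa> \<gamma> D s))]"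
  if "i \<le> u" "D \<in> decs (u - i) w" "s < length D" for i D s
 proof -
  have "mword r \<phi> \<kappa> \<gamma> D s ~= []" by (simp add: mword_def)
  moreover have "wdeg (mword r \<phi> \<kappa> \<gamma> D s) + ((0, 1) - dsh i) = D0" using that by (simp add: D0 wdeg_marked decs_def dsh_diff)
  ultimately show ?thesis by (simp add: letters_insert_fop)
 qed
 have "letters (opcomp k (insert_fop \<delta>) (coder_fop r \<phi> \<kappa> \<gamma>) u w) = (\<Sum>i\<le>u. \<Sum>D\<in>decs (u - i) w. \<Sum>s<length D.
   fsg (int i * k) (fsg (dec_sign D + bipair (rshift r) (wdeg (bword \<phi> (take s D))))
    (letters (fext (insert_fop \<delta> i) (frag_of (mword r \<phi> \<kappa> \<gamma> D s))))))"
  by (simp add: opcomp_def coder_fop_def letters_linear frag_extend_sum' fsg_sum)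
 also have "\<dots> = (\<Sum>i\<le>u. \<Sum>D\<in>decs (u - i) w. \<Sum>s<length D.
   fsg (int i * k + (dec_sign D + bipair (rshift r) (wdeg (bword \<phi> (take s D))))) (frag_of [(D0, \<delta> i (mword r \<phi> \<kappa> \<gamma> D s))]))"
  by (intro sum.cong refl) (simp only: t atMost_iff lessThan_iff fsg_fsg)
 also have "\<dots> = (\<Sum>x\<in>(SIGMA i:{..u}. decs (u - i) w). \<Sum>s<length (snd x).
  fsg (int (fst x) * k + (dec_sign (snd x) + bipair (rshift r) (wdeg (bword \<phi> (take s (snd x))))))
   (frag_of [(D0, \<delta> (fst x) (mword r \<phi> \<kappa> \<gamma> (snd x) s))]))"
  by (rule sum_Sigma_decs)
 finally show ?thesis .
qed

lemma letters_opcomp_insert: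
 assumes w: "w ~= []" and D0: "D0 = wdeg w + (0, 1) - dsh u + c"
  and X: "!!i b. b ~= [] ==> letters (X i b) = frag_of [(wdeg b - dsh i + c, \<phi> i b)]"
 shows "letters (opcomp 1 X (insert_fop \<delta>) u w) = (\<Sum>x\<in>(SIGMA i:{..u}. insert_set (length w)).
  fsg (int (fst x) + bipair ((0, 1) - dsh (u - fst x)) (wdeg (take (fst (snd x)) w)))
   (frag_of [(D0, \<phi> (fst x) (iword ((0, 1) - dsh (u - fst x)) (\<delta> (u - fst x)) w (fst (snd x)) (snd (snd x))))]))"
proof -
 let ?iw = "%i y. iword ((0, 1) - dsh (u - i)) (\<delta> (u - i)) w (fst y) (snd y)"
 have t: "letters (fext (X i) (frag_of (?iw i y))) = frag_of [(D0, \<phi> i (?iw i y))]"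
  if "i \<le> u" "y \<in> insert_set (length w)" for i y
 proof -
  have "?iw i y ~= []" by (simp add: iword_def)
  moreover have "wdeg (?iw i y) - dsh i + c = D0" using that wdeg_iword[of "fst y" "snd y" w "(0, 1) - dsh (u - i)" "\<delta> (u - i)"]
   by (simp add: D0 insert_set_def dsh_diff case_prod_beta)
  ultimately show ?thesis by (simp add: X)
 qed
 have "letters (opcomp 1 X (insert_fop \<delta>) u w) = (\<Sum>i\<le>u. \<Sum>y\<in>insert_set (length w).
   fsg (int i) (fsg (bipair ((0, 1) - dsh (u - i)) (wdeg (take (fst y) w))) (letters (fext (X i) (frag_of (?iw i y))))))"
  by (simp add: opcomp_def insert_fop_def letters_linear frag_extend_sum' fsg_sum case_prod_beta del: bipair_simps)
 also have "\<dots> = (\<Sum>i\<le>u. \<Sum>y\<in>insert_set (length w).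
   fsg (int i + bipair ((0, 1) - dsh (u - i)) (wdeg (take (fst y) w))) (frag_of [(D0, \<phi> i (?iw i y))]))"
  by (intro sum.cong refl) (simp only: t atMost_iff fsg_fsg)
 also have "\<dots> = (\<Sum>x\<in>(SIGMA i:{..u}. insert_set (length w)).
  fsg (int (fst x) + bipair ((0, 1) - dsh (u - fst x)) (wdeg (take (fst (snd x)) w)))
   (frag_of [(D0, \<phi> (fst x) (iword ((0, 1) - dsh (u - fst x)) (\<delta> (u - fst x)) w (fst (snd x)) (snd (snd x))))]))"
  by (simp add: sum.Sigma case_prod_beta del: bipair_simps)
 finally show ?thesis .
qed

context bgmods
begin

context
 fixes V :: "('r, 'a) bgmod"
 assumes V: "bgmodule R V"
begin

lemma lev_total: "module R (V d)" "(if w \<in> words V 1 d then snd (hd w) else (zr (V d))) \<in> carrier (V d)"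
proof -
 show m: "module R (V d)" by (rule bgD[OF V])
 note z = abelian_monoid.zero_closed[OF module_abmon[OF m]]
 show "(if w \<in> words V 1 d then snd (hd w) else (zr (V d))) \<in> carrier (V d)"
 proof (cases "w \<in> words V 1 d")
  case True
  then obtain x where "w = [x]" by (auto simp: words_iff length_Suc_conv)
  with True show ?thesis by (simp add: words_iff z)
 qed (simp add: z)
qed

lemma lev_closed: "lev V d x \<in> carrier (V d)" unfolding lev_def by (rule fev_closed[OF lev_total])

lemma lev_add: "lev V d (x + y) = lev V d x \<oplus>\<^bsub>V d\<^esub> lev V d y" unfolding lev_def by (rule fev_add[OF lev_total])

lemma lev_0: "lev V d 0 = (zr (V d))" unfolding lev_def by (rule fev_0[OF lev_total])

lemma lev_fsg: "lev V d (fsg k x) = sg (V d) k (lev V d x)" unfolding lev_def by (rule fev_fsg[OF lev_total])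

lemma lev_sum: "lev V d (sum f S) = finsum (V d) (%s. lev V d (f s)) S" unfolding lev_def by (rule fev_sum[OF lev_total])

lemma lev_diff_eq_0: "lev V d (x - y) = (zr (V d)) \<longleftrightarrow> lev V d x = lev V d y"
 unfolding lev_def by (rule fev_diff_eq_0[OF lev_total])

lemma lev_of: "y \<in> carrier (V d) ==> lev V d (frag_of [(d, y)]) = y" unfolding lev_def by (subst fev_of[OF lev_total]) (simp add: words_iff)

lemma lev_sum_of:
 assumes "!!s. s \<in> S ==> y s \<in> carrier (V d)"
 shows "lev V d (\<Sum>s\<in>S. fsg (k s) (frag_of [(d, y s)])) = finsum (V d) (%s. sg (V d) (k s) (y s)) S"
 unfolding lev_sum lev_fsg by (rule abelian_monoid.finsum_cong'[OF module_abmon[OF bgD[OF V]] refl])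
  (use assms in \<open>auto simp: lev_of intro: sg_closed[OF bgD[OF V]]\<close>)

text \<open>V and its first tensor power are exchanged by x \<mapsto>
  \<open>tens R V [(D, x)]\<close> and the map that the identity induces back; all other lengths and
  bidegrees contribute zero.\<close>

lemma null_homog:
 assumes x: "homog D x"
 shows "null V x \<longleftrightarrow> lev V D x = (zr (V D))"
proof -
 let ?t = "%w. if w \<in> words V 1 D then tens R V w else (zr (tpow R V 1 D))"
 let ?s = "%w. if w \<in> words V 1 D then snd (hd w) else (zr (V D))"
 have T: "module R (tpow R V 1 D)" by (rule tpow_mod[OF V])
 have M: "module R (V D)" by (rule bgD[OF V])
 have one: "\<exists>y\<in>carrier (V D). w = [(D, y)]" if "w \<in> words V 1 D" for w using that by (cases w) (auto simp: words_iff)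
 have il: "(%y. tens R V [(D, y)]) \<in> lmaps R (V D) (tpow R V 1 D)"
  using letter_linear[OF V, where u = "[]" and v = "[]" and e = D and x = "zr (V D)" and n = 1 and d = D]
  by (simp add: words_iff abelian_monoid.zero_closed[OF module_abmon[OF M]])
 have bi: "bgapp bgid d \<in> lmaps R (V d) (V (d + bdeg (bgid :: ('a, 'a) bgmap)))" for d using bgid_linear[OF V] by (simp add: bdeg_bgid)
 have pl: "bgapp (unary R V bgid) D \<in> lmaps R (tpow R V 1 D) (V D)" using blinD[OF unary_blin[OF V V bi], of D] by (simp add: bdeg_bgid)
 have pt: "bgapp (unary R V bgid) D (tens R V [(D, y)]) = y" if "y \<in> carrier (V D)" for y
  using unary_tens[OF V V bi that] by (simp add: bgid_def)
 have i: "tens R V [(D, lev V D x)] = wev R V 1 D x"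
 proof -
  have "tens R V [(D, lev V D x)] = fev (tpow R V 1 D) (%w. tens R V [(D, ?s w)]) x" unfolding lev_def by (rule fev_lin[OF lev_total T il])
  also have "(%w. tens R V [(D, ?s w)]) = ?t"
  proof
   fix w
   show "tens R V [(D, ?s w)] = ?t w" using one[of w] lin_zero[OF il M T] by (cases "w \<in> words V 1 D") auto
  qed
  finally show ?thesis unfolding wev_def .
 qed
 have p: "bgapp (unary R V bgid) D (wev R V 1 D x) = lev V D x"
 proof -
  have "bgapp (unary R V bgid) D (wev R V 1 D x) = fev (V D) (%w. bgapp (unary R V bgid) D (?t w)) x"
   unfolding wev_def by (rule fev_lin[OF wev_total[OF V] M pl])
  also have "(%w. bgapp (unary R V bgid) D (?t w)) = ?s"
  proof
   fix w
   show "bgapp (unary R V bgid) D (?t w) = ?s w" using one[of w] lin_zero[OF pl T M] pt by (cases "w \<in> words V 1 D") auto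
  qed
  finally show ?thesis unfolding lev_def .
 qed
 have other: "wev R V l d x = (zr (tpow R V l d))" if "l ~= 1 \<or> d ~= D" for l d
  by (rule wev_eq_0[OF V]) (use that x in \<open>auto simp: homog_def words_iff\<close>)
 show ?thesis
 proof
  show "lev V D x = (zr (V D))" if "null V x" using p that lin_zero[OF pl T M] by (simp add: null_def)
  show "null V x" if "lev V D x = (zr (V D))" unfolding null_def
  proof (intro allI)
   fix l d
   have "wev R V 1 D x = (zr (tpow R V 1 D))" using i lin_zero[OF il M T] that by simp
   then show "wev R V l d x = (zr (tpow R V l d))" using other by (cases "l ~= 1 \<or> d ~= D") auto
  qed
 qed
qed

end

lemma opd_zero:
 assumes A: "bgmodule R A" and B: "bgmodule R B" and ff: "family R A B 0 f" and b: "valid (susp A) b" "b ~= []"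
 shows "opd R A f p b \<in> carrier (susp B (wdeg b - dsh p))" (is ?c1)
  and "opl R (susp A) (susp_fam R A B f) p b = sg (susp B (wdeg b - dsh p)) (int p + ssign b) (opd R A f p b)" (is ?c2)
proof -
 have e: "wdeg b - dsh p + 0 = wdeg b - dsh p" by simp
 note o = opd_closed[where f = f and p = p, OF A B ff b, unfolded e]
 show ?c1 by (rule o(1))
 show ?c2
  unfolding o(2) by (rule sg_cong) (simp add: snd_zero)
qed

lemma insertion_sum_linear:
 assumes A: "bgmodule R A" and B: "bgmodule R B" and mf: "family R A A (0, 1) m" and ff: "family R A B c f"
  and v: "1 \<le> v" and e: "e = (- int u, 2 - int u - int v) + c"
 shows "bgapp (insertion_sum R A B e f m u v) d \<in> lmaps R (tpow R A v d) (B (d + e))"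
 unfolding insertion_sum_def bgsum_def bgmap.simps
proof (intro lin_finsum_map lin_sg_map tpow_mod A bgD[OF B])
 fix x :: "nat \<times> nat \<times> nat \<times> nat \<times> nat \<times> nat"
 assume x: "x \<in> {(i, p, j, q, s, t). u = i + p \<and> v + 1 = j + q \<and> j = 1 + s + t \<and> 1 \<le> q}"
 obtain i p j q s t where xx: "x = (i, p, j, q, s, t)" by (cases x)
 have c: "u = i + p" "v + 1 = j + q" "j = 1 + s + t" "1 \<le> q" using x by (auto simp: xx)
 have n: "s + q + t = v" "s + 1 + t = j" "1 \<le> j" using c by auto
 have m: "m p q \<in> bghom R (tpow R A q) A (- int p, 2 - int p - int q)" using familyD[OF mf c(4), of p] by (simp add: algebra_simps)
 have bi: "bdeg (insert_op R A s q (m p q) t) = (- int p, 2 - int p - int q)"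
  using bghomD(1)[OF m] sum_bdeg_unary[OF A A bdeg_bgid, of s] sum_bdeg_unary[OF A A bdeg_bgid, of t] by (simp add: insert_op_def)
 have sl: "bgapp (insert_op R A s q (m p q) t) d \<in> lmaps R (tpow R A v d) (tpow R A j (d + (- int p, 2 - int p - int q)))"
  using sandw_linear[OF A A bgid_linear[OF A] bdeg_bgid bgid_linear[OF A] bdeg_bgid m, where s = s and t = t and d = d]
  unfolding n insert_op_sandw .
 have deg: "d + (- int p, 2 - int p - int q) + ((- int i, 1 - int i - int j) + c) = d + e" using c(2) unfolding e c(1) by (cases d; cases c) simp
 note lc = lin_comp[OF sl bghomD(2)[OF familyD[OF ff n(3), of i]], unfolded deg]
 show "bgapp (case x of (i, p, j, q, s, t) => bgcomp (f i j) (insert_op R A s q (m p q) t)) d \<in> lmaps R (tpow R A v d) (B (d + e))"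
  unfolding xx prod.case bgcomp_def bgmap.simps bi by (rule lc)
qed

lemma block_sum_linear:
 fixes A :: "('r, 'a) bgmod"
 assumes A: "bgmodule R A" and B: "bgmodule R B" and mf: "family R B B (0, 1) m" and ff: "family R A B 0 f" and e: "e = (- int u, 2 - int u - int v)"
 shows "bgapp (block_sum R A B e m f u v) d \<in> lmaps R (tpow R A v d) (B (d + e))"
 unfolding block_sum_def bgsum_def bgmap.simps
proof (intro lin_finsum_map lin_sg_map tpow_mod A bgD[OF B])
 fix x :: "nat \<times> nat \<times> nat list \<times> nat list"
 assume x: "x \<in> {(i, j, ps, qs). 1 \<le> j \<and> length ps = j \<and> length qs = j \<and> (\<forall>q\<in>set qs. 1 \<le> q) \<and> u = i + sum_list ps \<and> v = sum_list qs}"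
 obtain i j ps qs where xx: "x = (i, j, ps, qs)" by (cases x)
 have c: "1 \<le> j" "length ps = j" "length qs = j" "\<forall>q\<in>set qs. 1 \<le> q" "u = i + sum_list ps" "v = sum_list qs" using x by (auto simp: xx)
 have f: "f i j \<in> bghom R (tpow R A j) B (- int i, 1 - int i - int j)" if "1 \<le> j" for i j using familyD[OF ff that, of i] by simp
 have m: "m i j \<in> bghom R (tpow R B j) B (- int i, 2 - int i - int j)" using familyD[OF mf c(1), of i] by (simp add: algebra_simps)
 let ?fs = "map2 (%p q. (q, f p q)) ps qs"
 have fd: "\<forall>p q. 1 \<le> q --> bdeg (f p q) = (- int p, 1 - int p - int q)" using bghomD(1)[OF f] by blast
 have l: "length ps = length qs" "sum_list qs = length (replicate v (undefined :: bideg \<times> 'a))" using c by simp_all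
 note bd = btens_desusp(3-5)[where f = f and ps = ps and qs = qs, OF fd l c(4), unfolded c(2) length_replicate]
 have bl: "blin R A B q f'" if "(q, f') \<in> set ?fs" for q f'
 proof -
  have "q \<in> set qs" "\<exists>p. f' = f p q" using that by (auto dest: set_zip_rightD)
  then show ?thesis using c(4) bghom_blin[OF f] by blast
 qed
 have deg: "d + (- int (sum_list ps), int j - int (sum_list ps) - int v) + (- int i, 2 - int i - int j) = d + e" unfolding e c(5) by (cases d) simp
 note bt = btens_linear[OF A B, where fs = ?fs and d = d, OF bl, unfolded bdeg_btens bd]
 note lc = lin_comp[OF bt bghomD(2)[OF m], unfolded deg]
 show "bgapp (case x of (i, j, ps, qs) => bgcomp (m i j) (btens R A B (map2 (%p q. (q, f p q)) ps qs))) d \<in> lmaps R (tpow R A v d) (B (d + e))"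
  unfolding xx prod.case bgcomp_def bgmap.simps bdeg_btens bd by (rule lc)
qed

text \<open>Both sides are linear on the tensor power, so elementary tensors suffice, and every word
  in A is the desuspension of a word in its suspension.\<close>

lemma morphism_iff:
 assumes A: "bgmodule R A" and B: "bgmodule R B" and mA: "family R A A (0, 1) mA" and mB: "family R B B (0, 1) mB" and ff: "family R A B 0 f"
 shows "dAinf_morphism R A mA B mB f \<longleftrightarrow> (\<forall>u w. valid (susp A) w --> w ~= [] -->
  bgapp (insertion_sum R A B (- int u, 2 - int u - int (length w)) f mA u (length w)) (wdeg w + (0, int (length w))) (tens R A (desusp w)) =
  bgapp (block_sum R A B (- int u, 2 - int u - int (length w)) mB f u (length w)) (wdeg w + (0, int (length w))) (tens R A (desusp w)))"
  (is "_ \<longleftrightarrow> ?R")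
proof
 assume m: "dAinf_morphism R A mA B mB f"
 show ?R
 proof (intro allI impI)
  fix u :: nat and w assume w: "valid (susp A) w" "w ~= []"
  have l: "1 \<le> length w" using w(2) by (cases w) auto
  have "w \<in> words (susp A) (length w) (wdeg w)" using w by (simp add: words_iff)
  note tens_cl[OF A desusps[OF this]]
  then show "bgapp (insertion_sum R A B (- int u, 2 - int u - int (length w)) f mA u (length w)) (wdeg w + (0, int (length w))) (tens R A (desusp w)) =
    bgapp (block_sum R A B (- int u, 2 - int u - int (length w)) mB f u (length w)) (wdeg w + (0, int (length w))) (tens R A (desusp w))"
   using m l unfolding dAinf_morphism_def bg_eq_def by blast
 qed
next
 assume r: ?R
 show "dAinf_morphism R A mA B mB f" unfolding dAinf_morphism_def
 proof (intro conjI allI impI)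
  show "map_family R A B f" unfolding map_family_def
  proof (intro allI impI)
   fix i j :: nat assume j: "1 \<le> j"
   show "f i j \<in> bghom R (tpow R A j) B (- int i, 1 - int i - int j)" using familyD[OF ff j, of i] by simp
  qed
  fix u v :: nat assume v: "1 \<le> v"
  let ?e = "(- int u, 2 - int u - int v)"
  have e0: "?e = ?e + 0" by simp
  have main: "bgapp (insertion_sum R A B ?e f mA u v) d x = bgapp (block_sum R A B ?e mB f u v) d x" if x: "x \<in> carrier (tpow R A v d)" for d x
  proof (rule tpow_lin_eq[OF A bgD[OF B] insertion_sum_linear[OF A B mA ff v e0] block_sum_linear[OF A B mB ff refl] _ x])
   fix w assume w: "w \<in> words A v d"
   \<comment> \<open>The word of the suspension whose desuspension is w: the labels are lowered by
     (0,1).\<close>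
   let ?w = "map (%(e, x). (e - (0, 1), x)) w"
   have dw: "desusp ?w = w" by (induct w) (auto simp: desusp_def)
   have vw: "valid (susp A) ?w" "length ?w = v" using w valid_desusp[of A ?w] unfolding dw by (simp_all add: words_iff)
   have ne: "?w ~= []" using vw(2) v by auto
   have dg: "wdeg ?w + (0, int v) = d" proof -
    have "wdeg w = d" using w by (simp add: words_iff)
    then show ?thesis using wdeg_desusp[of ?w] unfolding dw vw(2) by (simp only:)
   qed
   show "bgapp (insertion_sum R A B ?e f mA u v) d (tens R A w) = bgapp (block_sum R A B ?e mB f u v) d (tens R A w)"
    using r[rule_format, OF vw(1) ne, of u] unfolding vw(2) dg dw .
  qed
  have dg: "bdeg (insertion_sum R A B ?e f mA u v) = bdeg (block_sum R A B ?e mB f u v)"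
   unfolding insertion_sum_def block_sum_def bgsum_def bgmap.simps ..
  show "bg_eq (tpow R A v) (insertion_sum R A B ?e f mA u v) (block_sum R A B ?e mB f u v)"
   unfolding bg_eq_def by (rule conjI[OF dg], rule allI, rule ballI, rule main)
 qed
qed

text \<open>Insertions take place in A, so a map out of the target passes through the sum. It is
  applied to the end projections with c = 0 and to the middle one with c = (r, r-1).\<close>

lemma insertion_sum_post:
 assumes A: "bgmodule R A" and B: "bgmodule R B" and B': "bgmodule R B'" and mf: "family R A A (0, 1) m" and ff: "family R A B 0 f"
  and p: "p \<in> bghom R B B' c" and eq: "!!i j. 1 \<le> j ==> bg_eq (tpow R A j) (bgcomp p (f i j)) (f' i j)"
  and v: "1 \<le> v" and e: "e = (- int u, 2 - int u - int v)" and x: "x \<in> carrier (tpow R A v d)"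
 shows "bgapp p (d + e) (bgapp (insertion_sum R A B e f m u v) d x) = bgapp (insertion_sum R A B' (e + c) f' m u v) d x"
proof -
 let ?S = "{(i, p, j, q, s, t). u = i + p \<and> v + 1 = j + q \<and> j = 1 + s + t \<and> (1 :: nat) \<le> q}"
 let ?g = "%f (i, p, j, q, s, t). bgcomp (f i j) (insert_op R A s q (m p q) t)"
 let ?k = "%(i, p, j, q, s, t). int (s * q + t + p * j)"
 have M: "module R (B (d + e))" "module R (B' (d + (e + c)))" by (rule bgD[OF B], rule bgD[OF B'])
 have pl: "bgapp p (d + e) \<in> lmaps R (B (d + e)) (B' (d + (e + c)))" using bghomD(2)[OF p, of "d + e"] by (simp add: add.assoc)
 have main: "bgapp (?g f y) d x \<in> carrier (B (d + e)) \<and> bgapp p (d + e) (bgapp (?g f y) d x) = bgapp (?g f' y) d x" if y: "y \<in> ?S" for y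
 proof -
  obtain i a j q s t where xx: "y = (i, a, j, q, s, t)" by (cases y)
  have c: "u = i + a" "v + 1 = j + q" "j = 1 + s + t" "1 \<le> q" using y by (auto simp: xx)
  have n: "s + q + t = v" "s + 1 + t = j" "1 \<le> j" using c by auto
  let ?e = "(- int a, 2 - int a - int q)"
  have m: "m a q \<in> bghom R (tpow R A q) A ?e" using familyD[OF mf c(4), of a] by (simp add: algebra_simps)
  have bi: "bdeg (insert_op R A s q (m a q) t) = ?e"
   using bghomD(1)[OF m] sum_bdeg_unary[OF A A bdeg_bgid, of s] sum_bdeg_unary[OF A A bdeg_bgid, of t] by (simp add: insert_op_def)
  have sl: "bgapp (insert_op R A s q (m a q) t) d \<in> lmaps R (tpow R A v d) (tpow R A j (d + ?e))"
   using sandw_linear[OF A A bgid_linear[OF A] bdeg_bgid bgid_linear[OF A] bdeg_bgid m, where s = s and t = t and d = d]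
   unfolding n insert_op_sandw .
  have fh: "f i j \<in> bghom R (tpow R A j) B (- int i, 1 - int i - int j)" using familyD[OF ff n(3), of i] by simp
  have deg: "d + ?e + (- int i, 1 - int i - int j) = d + e" using c(2) unfolding e c(1) by (cases d) simp
  let ?y = "bgapp (insert_op R A s q (m a q) t) d x"
  have yc: "?y \<in> carrier (tpow R A j (d + ?e))" by (rule lin_closed[OF sl x])
  have "bgapp (f i j) (d + ?e) ?y \<in> carrier (B (d + e))" using lin_closed[OF bghomD(2)[OF fh] yc] unfolding deg .
  moreover have "bgapp (bgcomp p (f i j)) (d + ?e) ?y = bgapp (f' i j) (d + ?e) ?y" using eq[OF n(3), of i] yc unfolding bg_eq_def by blast
  then have "bgapp p (d + e) (bgapp (f i j) (d + ?e) ?y) = bgapp (f' i j) (d + ?e) ?y" unfolding bgcomp_def bgmap.simps bghomD(1)[OF fh] deg .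
  ultimately show ?thesis unfolding xx prod.case bgcomp_def bgmap.simps bi by blast
 qed
 have "bgapp p (d + e) (bgapp (insertion_sum R A B e f m u v) d x) =
   finsum (B' (d + (e + c))) (%y. bgapp p (d + e) (sg (B (d + e)) (?k y) (bgapp (?g f y) d x))) ?S"
  unfolding insertion_sum_def bgsum_def bgmap.simps by (rule lin_finsum[OF pl M]) (rule funcsetI, rule sg_closed[OF M(1)], use main in blast)
 also have "\<dots> = finsum (B' (d + (e + c))) (%y. sg (B' (d + (e + c))) (?k y) (bgapp (?g f' y) d x)) ?S"
 proof (rule abelian_monoid.finsum_cong'[OF module_abmon[OF M(2)] refl])
  fix y assume y: "y \<in> ?S"
  show "bgapp p (d + e) (sg (B (d + e)) (?k y) (bgapp (?g f y) d x)) = sg (B' (d + (e + c))) (?k y) (bgapp (?g f' y) d x)"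
   unfolding lin_sg[OF pl M conjunct1[OF main[OF y]]] conjunct2[OF main[OF y]] ..
 next
  show "(%y. sg (B' (d + (e + c))) (?k y) (bgapp (?g f' y) d x)) \<in> ?S \<rightarrow> carrier (B' (d + (e + c)))"
  proof (rule funcsetI, rule sg_closed[OF M(2)])
   fix y assume "y \<in> ?S"
   note y = main[OF this]
   show "bgapp (?g f' y) d x \<in> carrier (B' (d + (e + c)))" using lin_closed[OF pl conjunct1[OF y]] unfolding conjunct2[OF y] .
  qed
 qed
 also have "\<dots> = bgapp (insertion_sum R A B' (e + c) f' m u v) d x" unfolding insertion_sum_def bgsum_def bgmap.simps ..
 finally show ?thesis .
qed

text \<open>The parts coming from d^B F and from F d^A are the two sides of the morphism equation
  with the same sign 1 + \<open>ssign w\<close>, so their difference vanishes exactly if the sides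
  agree.\<close>

lemma commut_null:
 assumes A: "bgmodule R A" and B: "bgmodule R B" and mA: "family R A A (0, 1) mA" and mB: "family R B B (0, 1) mB" and ff: "family R A B 0 f"
  and w: "valid (susp A) w" "w ~= []"
  and \<phi>: "!!p b. valid (susp A) b ==> b ~= [] ==> \<phi> p b = sg (susp B (wdeg b - dsh p)) (int p + ssign b) (opd R A f p b)"
 shows "null (susp B) (letters (commut (insert_fop (opl R (susp A) (susp_fam R A A mA)))
   (insert_fop (opl R (susp B) (susp_fam R B B mB))) (coalg_fop \<phi>) u w)) \<longleftrightarrow>
  bgapp (insertion_sum R A B (- int u, 2 - int u - int (length w)) f mA u (length w)) (wdeg w + (0, int (length w))) (tens R A (desusp w)) =
  bgapp (block_sum R A B (- int u, 2 - int u - int (length w)) mB f u (length w)) (wdeg w + (0, int (length w))) (tens R A (desusp w))"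
proof -
 let ?v = "length w" and ?\<delta>A = "opl R (susp A) (susp_fam R A A mA)" and ?\<delta>B = "opl R (susp B) (susp_fam R B B mB)"
 define D0 where "D0 = wdeg w + (0, 1) - dsh u"
 let ?W = "susp B D0"
 have SB: "bgmodule R (susp B)" by (rule susp_bg[OF B])
 have M: "module R ?W" by (rule bgD[OF SB])
 have ww: "w \<in> words (susp A) ?v (wdeg w)" using w by (simp add: words_iff)
 have v: "1 \<le> ?v" using w(2) by (cases w) auto
 note \<psi> = opd_zero(1)[OF A B ff]
 have D00: "D0 = wdeg w + (0, 1) - dsh u + 0" by (simp add: D0_def)
 have e0: "(- int u, 2 - int u - int ?v) + 0 = (- int u, 2 - int u - int ?v)" by simp
 define Ins where "Ins = bgapp (insertion_sum R A B (- int u, 2 - int u - int ?v) f mA u ?v) (wdeg w + (0, int ?v)) (tens R A (desusp w))"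
 define Blk where "Blk = bgapp (block_sum R A B (- int u, 2 - int u - int ?v) mB f u ?v) (wdeg w + (0, int ?v)) (tens R A (desusp w))"
 define P where "P = (\<Sum>x\<in>(SIGMA i:{..u}. decs (u - i) w).
  fsg (int (fst x) * 0 + dec_sign (snd x)) (frag_of [(D0, ?\<delta>B (fst x) (bword \<phi> (snd x)))]))"
 define Q where "Q = (\<Sum>x\<in>(SIGMA i:{..u}. insert_set ?v). fsg (int (fst x) + bipair ((0, 1) - dsh (u - fst x)) (wdeg (take (fst (snd x)) w)))
   (frag_of [(D0, \<phi> (fst x) (iword ((0, 1) - dsh (u - fst x)) (?\<delta>A (u - fst x)) w (fst (snd x)) (snd (snd x))))]))"
 have lt: "letters (commut (insert_fop ?\<delta>A) (insert_fop ?\<delta>B) (coalg_fop \<phi>) u w) = P - Q"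
  unfolding commut_def letters_linear P_def Q_def letters_opcomp_blocks[OF w(2) D0_def]
  by (subst letters_opcomp_insert[OF w(2) D00, of _ \<phi>]) (simp_all add: letters_coalg_fop)
 have hom: "homog D0 (P - Q)" unfolding P_def Q_def by (intro homog_diff homog_sum homog_fsg homog_of)
 have \<phi>': "\<phi> i b = sg (susp B (wdeg b - dsh i + 0)) (0 + int i + ssign b) (opl R A f i (desusp b))"
  if "valid (susp A) b" "b ~= []" for i b
  using \<phi>[OF that] by (simp add: opd_def)
 note ins = insertion_susp[OF A B mA ff ww v D00 \<phi>', unfolded e0]
 have lQ: "lev (susp B) D0 Q = sg ?W (1 + ssign w) Ins"
 proof -
  have "lev (susp B) D0 Q = finsum ?W (%x. sg ?W (int (fst x) + bipair ((0, 1) - dsh (u - fst x)) (wdeg (take (fst (snd x)) w)))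
   (\<phi> (fst x) (iword ((0, 1) - dsh (u - fst x)) (?\<delta>A (u - fst x)) w (fst (snd x)) (snd (snd x))))) (SIGMA i:{..u}. insert_set ?v)"
   unfolding Q_def
  proof (rule lev_sum_of[OF SB])
   fix x assume "x \<in> (SIGMA i:{..u}. insert_set ?v)"
   then show "\<phi> (fst x) (iword ((0, 1) - dsh (u - fst x)) (?\<delta>A (u - fst x)) w (fst (snd x)) (snd (snd x))) \<in> carrier ?W"
    by (intro ins(2)) simp_all
  qed
  then show ?thesis using ins(1) unfolding Ins_def by (simp add: case_prod_unfold del: bipair_simps)
 qed
 note bt = block_term[OF B mB w _ _ D0_def \<psi> \<phi>]
 have bc: "opl R B mB (fst x) (desusp (bword (opd R A f) (snd x))) \<in> carrier ?W" "?\<delta>B (fst x) (bword \<phi> (snd x)) \<in> carrier ?W"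
   "sg ?W (dec_sign (snd x)) (?\<delta>B (fst x) (bword \<phi> (snd x))) =
    sg ?W (1 + ssign w) (sg ?W (block_sign u (snd x)) (opl R B mB (fst x) (desusp (bword (opd R A f) (snd x)))))"
  if x: "x \<in> (SIGMA i:{..u}. decs (u - i) w)" for x
 proof -
  have x': "fst x \<le> u" "snd x \<in> decs (u - fst x) w" using x by auto
  show c: "opl R B mB (fst x) (desusp (bword (opd R A f) (snd x))) \<in> carrier ?W" by (rule bt(2)[OF x'])
  show "?\<delta>B (fst x) (bword \<phi> (snd x)) \<in> carrier ?W" by (rule bt(3)[OF x'])
  have "sg ?W (dec_sign (snd x)) (?\<delta>B (fst x) (bword \<phi> (snd x))) =
    sg ?W (1 + ssign w + block_sign u (snd x)) (opl R B mB (fst x) (desusp (bword (opd R A f) (snd x))))"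
   by (rule bt(1)[OF x'])
  then show "sg ?W (dec_sign (snd x)) (?\<delta>B (fst x) (bword \<phi> (snd x))) =
    sg ?W (1 + ssign w) (sg ?W (block_sign u (snd x)) (opl R B mB (fst x) (desusp (bword (opd R A f) (snd x)))))"
   unfolding sg_sg[OF M c] .
 qed
 have lP: "lev (susp B) D0 P = sg ?W (1 + ssign w) Blk"
 proof -
  let ?S = "SIGMA i:{..u}. decs (u - i) w"
  let ?h = "%x. sg ?W (block_sign u (snd x)) (opl R B mB (fst x) (desusp (bword (opd R A f) (snd x))))"
  have hc: "?h \<in> ?S \<rightarrow> carrier ?W" by (rule funcsetI, rule sg_closed[OF M bc(1)])
  have "lev (susp B) D0 P = finsum ?W (%x. sg ?W (dec_sign (snd x)) (?\<delta>B (fst x) (bword \<phi> (snd x)))) ?S"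
   unfolding P_def using lev_sum_of[OF SB bc(2), where k = "%x. int (fst x) * 0 + dec_sign (snd x)"] by simp
  also have "\<dots> = finsum ?W (%x. sg ?W (1 + ssign w) (?h x)) ?S" by (rule abelian_monoid.finsum_cong'[OF module_abmon[OF M] refl])
    (rule funcsetI, rule sg_closed[OF M], rule funcset_mem[OF hc], assumption, rule bc(3))
  also have "\<dots> = sg ?W (1 + ssign w) (finsum ?W ?h ?S)" by (rule lin_finsum[OF lin_sg_map[OF lin_id M] M M hc, symmetric])
  finally show ?thesis unfolding Blk_def block_eval[OF A B mB ff ww v D0_def] .
 qed
 have cl: "Ins \<in> carrier ?W" "Blk \<in> carrier ?W"
 proof -
  have d: "D0 + (0, 1) = wdeg w + (0, int ?v) + (- int u, 2 - int u - int ?v)" unfolding D0_def by (cases "wdeg w") (simp add: dsh_def)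
  have t: "tens R A (desusp w) \<in> carrier (tpow R A ?v (wdeg w + (0, int ?v)))" by (rule tens_cl[OF A desusps[OF ww]])
  have W: "?W = B (wdeg w + (0, int ?v) + (- int u, 2 - int u - int ?v))" unfolding susp_def d ..
  show "Ins \<in> carrier ?W" unfolding Ins_def W by (rule lin_closed[OF insertion_sum_linear[OF A B mA ff v e0[symmetric]] t])
  show "Blk \<in> carrier ?W" unfolding Blk_def W by (rule lin_closed[OF block_sum_linear[OF A B mB ff refl] t])
 qed
 have "null (susp B) (P - Q) \<longleftrightarrow> sg ?W (1 + ssign w) Blk = sg ?W (1 + ssign w) Ins"
  unfolding null_homog[OF SB hom] lev_diff_eq_0[OF SB] lP lQ ..
 also have "\<dots> \<longleftrightarrow> Ins = Blk"
 proof
  assume "sg ?W (1 + ssign w) Blk = sg ?W (1 + ssign w) Ins"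
  then have "sg ?W (1 + ssign w) (sg ?W (1 + ssign w) Blk) = sg ?W (1 + ssign w) (sg ?W (1 + ssign w) Ins)" by simp
  then show "Ins = Blk" unfolding sg_sg[OF M cl(1)] sg_sg[OF M cl(2)] by (simp add: sg_def)
 qed simp
 finally show ?thesis unfolding lt Ins_def Blk_def .
qed

end

section \<open>The middle component of the equation for h\<close>

section \<open>The middle component of the morphism equation\<close>

lemma bword_cong:
 assumes "!!p b. valid V b ==> b ~= [] ==> \<phi> p b = \<phi>' p b"
 shows "[] \<notin> set (map snd D) ==> valid V (concat (map snd D)) ==> bword \<phi> D = bword \<phi>' D"
proof (induct D)
 case (Cons x D)
 obtain p b where x: "x = (p, b)" by (cases x)
 have "valid V b" "b ~= []" using Cons.prems by (auto simp: x)
 with Cons assms show ?case by (simp add: x)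
qed simp

context bgmods
begin

lemma lev_minus: "bgmodule R V ==> lev V d (- x) = \<ominus>\<^bsub>V d\<^esub> lev V d x" unfolding lev_def by (rule fev_minus[OF lev_total])

lemma lev_diff: "bgmodule R V ==> lev V d (x - y) = lev V d x \<ominus>\<^bsub>V d\<^esub> lev V d y"
 using lev_add[of V d x "- y"] lev_minus[of V d y] by (simp add: a_minus_def)

lemma lev_sum_cong:
 assumes V: "bgmodule R V" and "!!s. s \<in> S ==> lev V d (f s) = lev V d (g s)"
 shows "lev V d (sum f S) = lev V d (sum g S)"
 unfolding lev_sum[OF V] by (rule abelian_monoid.finsum_cong'[OF module_abmon[OF bgD[OF V]] refl]) (simp_all add: assms lev_closed[OF V])

lemma letters_fshift_coalg:
 assumes "w ~= []"
 shows "letters (fshift r (coalg_fop \<phi>) u w) = (if r \<le> u then frag_of [(wdeg w - dsh (u - r), \<phi> (u - r) w)] else 0)"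
 using assms by (simp add: fshift_def letters_coalg_fop)

context
 fixes A :: "('r, 'a) bgmod" and B :: "('r, 'b) bgmod" and mA mB r and h :: "('r, 'a, 'b \<times> 'b \<times> 'b) opfam"
 assumes A: "bgmodule R A" and B: "bgmodule R B" and mA: "family R A A (0, 1) mA" and mB: "family R B B (0, 1) mB"
  and hf: "family R A (path r B) 0 h"
begin

text \<open>\<open>px\<close>, \<open>py\<close>, \<open>pz\<close> are the components of h on a
  desuspended block; \<open>fx\<close>, \<open>fy\<close>, \<open>fz\<close> are the letters that pi
  reads off from the suspended family, the middle one with its factor (-1)^(r-1).\<close>

abbreviation (input) "px p b \<equiv> fst (opd R A h p b)"
abbreviation (input) "py p b \<equiv> fst (snd (opd R A h p b))"
abbreviation (input) "pz p b \<equiv> snd (snd (opd R A h p b))"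
abbreviation (input) "fx p b \<equiv> fst (opl R (susp A) (susp_fam R A (path r B) h) p b)"
abbreviation (input) "fy p b \<equiv> sg (susp B (wdeg b - dsh p + rshift r)) (int r - 1) (fst (snd (opl R (susp A) (susp_fam R A (path r B) h) p b)))"
abbreviation (input) "fz p b \<equiv> snd (snd (opl R (susp A) (susp_fam R A (path r B) h) p b))"

lemma path_letters:
 assumes b: "valid (susp A) b" "b ~= []"
 shows "px p b \<in> carrier (susp B (wdeg b - dsh p))" "py p b \<in> carrier (susp B (wdeg b - dsh p + rshift r))"
  "pz p b \<in> carrier (susp B (wdeg b - dsh p))"
  and "fx p b = sg (susp B (wdeg b - dsh p)) (int p + ssign b) (px p b)"
  and "fy p b = sg (susp B (wdeg b - dsh p + rshift r)) (int r - 1 + (int p + ssign b)) (py p b)"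
  and "fz p b = sg (susp B (wdeg b - dsh p)) (int p + ssign b) (pz p b)"
proof -
 let ?d = "wdeg b - dsh p"
 note o = opd_zero[OF A path_bg[OF B] hf b, of p, unfolded susp_path]
 note M = bgD[OF susp_bg[OF B]]
 note T = triple_sum_module[OF M M M, of ?d "?d + rshift r" ?d]
 note pl = triple_proj_linear[of "susp B ?d" "susp B (?d + rshift r)" "susp B ?d"]
 show "px p b \<in> carrier (susp B ?d)" by (rule lin_closed[OF pl(1) o(1)])
 show y: "py p b \<in> carrier (susp B (?d + rshift r))" by (rule lin_closed[OF pl(2) o(1)])
 show "pz p b \<in> carrier (susp B ?d)" by (rule lin_closed[OF pl(3) o(1)])
 show "fx p b = sg (susp B ?d) (int p + ssign b) (px p b)" unfolding o(2) by (rule lin_sg[OF pl(1) T M o(1)])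
 have "fst (snd (opl R (susp A) (susp_fam R A (path r B) h) p b)) = sg (susp B (?d + rshift r)) (int p + ssign b) (py p b)"
  unfolding o(2) by (rule lin_sg[OF pl(2) T M o(1)])
 then show "fy p b = sg (susp B (?d + rshift r)) (int r - 1 + (int p + ssign b)) (py p b)" by (simp only: sg_sg[OF M y])
 show "fz p b = sg (susp B ?d) (int p + ssign b) (pz p b)" unfolding o(2) by (rule lin_sg[OF pl(3) T M o(1)])
qed

context
 fixes u :: nat and w :: "'a word"
 assumes w: "valid (susp A) w" "w ~= []"
begin

text \<open>\<open>dw\<close> and \<open>ew\<close> are the degree of the desuspended word and the
  bidegree of the equation for h; \<open>Dm\<close> is the bidegree of the one-letter component of
  the defect.\<close>

abbreviation (input) "dw \<equiv> wdeg w + (0, int (length w))"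
abbreviation (input) "ew \<equiv> (- int u, 2 - int u - int (length w))"
abbreviation (input) "hins \<equiv> bgapp (insertion_sum R A (path r B) ew h mA u (length w)) dw (tens R A (desusp w))"
abbreviation (input) "hblk \<equiv> bgapp (block_sum R A (path r B) ew (path_op R r B mB) h u (length w)) dw (tens R A (desusp w))"
abbreviation (input) "SD \<equiv> SIGMA i:{..u}. decs (u - i) w"
abbreviation (input) "Dm \<equiv> wdeg w + (0, 1) - dsh u + rshift r"

lemma w_words: "w \<in> words (susp A) (length w) (wdeg w)" "1 \<le> length w" using w by (cases w; simp add: words_iff)+

lemma desusp_tens_cl: "tens R A (desusp w) \<in> carrier (tpow R A (length w) dw)" by (rule tens_cl[OF A desusps[OF w_words(1)]])

lemma path_block_word:
 assumes x: "x \<in> SD"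
 defines "v \<equiv> desusp (bword (opd R A h) (snd x))"
 shows "valid (path r B) v" "v ~= []" "wdeg w + (0, 1) - dsh u + (0, 1) = wdeg v + (- int (fst x), 2 - int (fst x) - int (length v))" (is ?c1)
  "length v = length (snd x)"
proof -
 have D: "fst x \<le> u" "snd x \<in> decs (u - fst x) w" using x by auto
 then have d: "concat (map snd (snd x)) = w" "sum_list (map fst (snd x)) = u - fst x" "[] \<notin> set (map snd (snd x))" by (auto simp: decs_def)
 have dv: "valid (susp A) (concat (map snd (snd x)))" unfolding d by (rule w(1))
 show "valid (path r B) v"
  unfolding v_def valid_desusp by (rule valid_blocks[where W = "susp (path r B)", OF opd_zero(1)[OF A path_bg[OF B] hf] d(3) dv])
 show l: "length v = length (snd x)" by (simp add: v_def)
 have "snd x ~= []" by (rule decs_nonempty[OF D(2) w(2)])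
 then show "v ~= []" using l by auto
 show ?c1
  using D(1) unfolding v_def wdeg_desusp wdeg_bword d by (cases "wdeg w") (simp add: dsh_def of_nat_diff)
qed

lemma hblk_proj:
 assumes p: "\<pi> \<in> lmaps R (susp (path r B) (wdeg w + (0, 1) - dsh u)) N" and N: "module R N"
 shows "\<pi> hblk = finsum N (%x. sg N (block_sign u (snd x)) (\<pi> (opl R (path r B) (path_op R r B mB) (fst x)
   (desusp (bword (opd R A h) (snd x)))))) SD"
proof -
 let ?D0 = "wdeg w + (0, 1) - dsh u"
 note P = path_bg[OF B, of r]
 note fam = path_op_props(1)[OF B mB, of r]
 have M: "module R (susp (path r B) ?D0)" by (rule bgD[OF susp_bg[OF P]])
 have c: "opl R (path r B) (path_op R r B mB) (fst x) (desusp (bword (opd R A h) (snd x))) \<in> carrier (susp (path r B) ?D0)"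
  if x: "x \<in> SD" for x
 proof -
  have x': "fst x \<le> u" "snd x \<in> decs (u - fst x) w" using x by auto
  show ?thesis by (rule block_term(2)[where \<phi> = "%p b. sg (susp (path r B) (wdeg b - dsh p)) (int p + ssign b) (opd R A h p b)",
     OF P fam w x' refl opd_zero(1)[OF A P hf]]) simp_all
 qed
 have "\<pi> hblk = finsum N (%x. \<pi> (sg (susp (path r B) ?D0) (block_sign u (snd x)) (opl R (path r B) (path_op R r B mB) (fst x)
   (desusp (bword (opd R A h) (snd x)))))) SD"
  unfolding block_eval[OF A P fam hf w_words refl] by (rule lin_finsum[OF p M N]) (rule funcsetI, rule sg_closed[OF M c])
 also have "\<dots> = finsum N (%x. sg N (block_sign u (snd x)) (\<pi> (opl R (path r B) (path_op R r B mB) (fst x)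
   (desusp (bword (opd R A h) (snd x)))))) SD"
  by (rule abelian_monoid.finsum_cong'[OF module_abmon[OF N] refl])
   (rule funcsetI, rule sg_closed[OF N lin_closed[OF p c]], assumption, rule lin_sg[OF p M N c])
 finally show ?thesis .
qed

text \<open>The outer components of each operation on the path object are m_ij applied to the outer
  components, so an end projection carries the block side for h to the block side for f or
  g.\<close>

lemma endpoint_block:
 assumes f: "family R A B 0 f" and \<pi>: "\<pi> = fst \<or> \<pi> = (%x. snd (snd x))"
  and eq: "!!p b. valid (susp A) b ==> b ~= [] ==> \<pi> (opd R A h p b) = opd R A f p b"
 shows "\<pi> hblk = bgapp (block_sum R A B ew mB f u (length w)) dw (tens R A (desusp w))"
proof -
 let ?D0 = "wdeg w + (0, 1) - dsh u"
 have lin: "\<pi> \<in> lmaps R (susp (path r B) ?D0) (susp B ?D0)" using \<pi> triple_proj_linear unfolding susp_path by blast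
 have N: "module R (susp B ?D0)" by (rule bgD[OF susp_bg[OF B]])
 show ?thesis unfolding hblk_proj[OF lin N] block_eval[OF A B mB f w_words refl]
 proof (rule abelian_monoid.finsum_cong'[OF module_abmon[OF N] refl])
  have eqx: "\<pi> (opl R (path r B) (path_op R r B mB) (fst x) (desusp (bword (opd R A h) (snd x)))) =
    opl R B mB (fst x) (desusp (bword (opd R A f) (snd x)))" if x: "x \<in> SD" for x
  proof -
   note v = path_block_word[OF x]
   have d: "concat (map snd (snd x)) = w" "[] \<notin> set (map snd (snd x))" using x by (auto simp: decs_def)
   have dv: "valid (susp A) (concat (map snd (snd x)))" unfolding d by (rule w(1))
   show ?thesis
    using \<pi> bword_cong[where \<phi> = "%p b. \<pi> (opd R A h p b)", OF eq d(2) dv] by (auto simp: path_op_props(2)[OF B mB v(1-3)] path_fst_blocks path_last_blocks)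
  qed
  show "sg (susp B ?D0) (block_sign u (snd x)) (\<pi> (opl R (path r B) (path_op R r B mB) (fst x) (desusp (bword (opd R A h) (snd x))))) =
    sg (susp B ?D0) (block_sign u (snd x)) (opl R B mB (fst x) (desusp (bword (opd R A f) (snd x))))"
   if "x \<in> SD" for x unfolding eqx[OF that] ..
  show "(%x. sg (susp B ?D0) (block_sign u (snd x)) (opl R B mB (fst x) (desusp (bword (opd R A f) (snd x))))) \<in> SD \<rightarrow> carrier (susp B ?D0)"
  proof (rule funcsetI, rule sg_closed[OF N])
   fix x assume x: "x \<in> SD"
   then have x': "fst x \<le> u" "snd x \<in> decs (u - fst x) w" by auto
   show "opl R B mB (fst x) (desusp (bword (opd R A f) (snd x))) \<in> carrier (susp B ?D0)"
    by (rule block_term(2)[where \<phi> = "%p b. sg (susp B (wdeg b - dsh p)) (int p + ssign b) (opd R A f p b)",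
     OF B mB w x' refl opd_zero(1)[OF A B f]]) simp_all
  qed
 qed
qed

text \<open>The middle component of the block side without the summand z - x of M_r1.\<close>

definition mid_formal :: "('b word \<Rightarrow>\<^sub>0 int)" where
 "mid_formal = (\<Sum>x\<in>SD. fsg (block_sign u (snd x)) (\<Sum>s<length (snd x).
  fsg (int (r * length (snd x) + fst x + length (snd x)) + bipair (rshift r) (wdeg (desusp (bword px (take s (snd x))))))
   (frag_of [(Dm, opl R B mB (fst x) (desusp (mword r px py pz (snd x) s)))])))"

text \<open>The contribution of the summand z - x of M_r1. The inner maps then have total index u -
  r, whence the condition on u; this is what becomes the shifted difference of G and F.\<close>

definition mid_ends :: "('b word \<Rightarrow>\<^sub>0 int)" where
 "mid_ends = (if r \<le> u then frag_of [(Dm, pz (u - r) w)] - frag_of [(Dm, px (u - r) w)] else 0)"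

lemma marked:
 assumes x: "x \<in> SD" and s: "s < length (snd x)"
 shows "sg (susp B Dm) (int r - int (fst x) + dec_sign (snd x) + bipair (rshift r) (wdeg (bword fx (take s (snd x)))))
   (opl R (susp B) (susp_fam R B B mB) (fst x) (mword r fx fy fz (snd x) s)) =
   sg (susp B Dm) (1 + int r + ssign w + block_sign u (snd x) + (int (r * length (snd x) + fst x + length (snd x))
    + bipair (rshift r) (wdeg (desusp (bword px (take s (snd x)))))))
   (opl R B mB (fst x) (desusp (mword r px py pz (snd x) s)))" (is ?c1)
  and "opl R B mB (fst x) (desusp (mword r px py pz (snd x) s)) \<in> carrier (susp B Dm)" (is ?c2)
  and "opl R (susp B) (susp_fam R B B mB) (fst x) (mword r fx fy fz (snd x) s) \<in> carrier (susp B Dm)" (is ?c3)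
proof -
 have x': "fst x \<le> u" "snd x \<in> decs (u - fst x) w" using x by auto
 note mt = marked_term[where x = px and y = py and z = pz and \<phi> = fx and \<kappa> = fy and \<gamma> = fz, OF B mB w x' s refl path_letters(1-6)]
 show ?c1
  by (rule mt(1))
 show ?c2 by (rule mt(2))
 show ?c3 by (rule mt(3))
qed

text \<open>The degrees match because (r, r-1) + (0,1) = (r, r), the shift of the sequence by
  r.\<close>

lemma Dm_ends: "r \<le> u ==> wdeg w - dsh (u - r) = Dm" using rshift_add(1)[of r] by (cases "wdeg w") (simp add: dsh_diff dsh_def rshift_def)

lemma mid_block: "fst (snd hblk) = lev (susp B) Dm (mid_formal + fsg (int u) mid_ends)"
proof -
 let ?D0 = "wdeg w + (0, 1) - dsh u"
 have SB: "bgmodule R (susp B)" by (rule susp_bg[OF B])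
 have N: "module R (susp B Dm)" by (rule bgD[OF SB])
 have lin: "(%x. fst (snd x)) \<in> lmaps R (susp (path r B) ?D0) (susp B Dm)" using triple_proj_linear(2) unfolding susp_path .
 let ?k = "%x s. int (r * length (snd x) + fst x + length (snd x)) + bipair (rshift r) (wdeg (desusp (bword px (take s (snd x)))))"
 let ?M = "%x s. opl R B mB (fst x) (desusp (mword r px py pz (snd x) s))"
 let ?S = "%x. \<Sum>s<length (snd x). fsg (?k x s) (frag_of [(Dm, ?M x s)])"
 \<comment> \<open>The only index at which the operation M_r1 is applied: i = r and one
   block.\<close>
 let ?x0 = "(r, [(u - r, w)])"
 let ?ext = "%x. if x = ?x0 then mid_ends else 0"
 have ends: "lev (susp B) Dm mid_ends = pz (u - r) w \<ominus>\<^bsub>susp B Dm\<^esub> px (u - r) w" if "r \<le> u"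
  using that path_letters(1,3)[OF w, of "u - r"] unfolding Dm_ends[OF that] by (simp add: mid_ends_def lev_diff[OF SB] lev_of[OF SB])
 have trm: "fst (snd (opl R (path r B) (path_op R r B mB) (fst x) (desusp (bword (opd R A h) (snd x))))) =
   lev (susp B) Dm (?S x + ?ext x)" if x: "x \<in> SD" for x
 proof -
  let ?v = "desusp (bword (opd R A h) (snd x))"
  note v = path_block_word[OF x]
  have BE: "B (?D0 + (0, 1) + rshift r) = susp B Dm" by (simp add: susp_def add_ac)
  have s: "path_mid r ?v s = desusp (mword r px py pz (snd x) s)"
    "wdeg (take s ?v) = wdeg (desusp (bword px (take s (snd x))))" if "s < length (snd x)" for s
   using path_mid_blocks[OF that, of r "opd R A h"] by (simp_all add: wdeg_desusp wdeg_bword)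
  have one: "(length (snd x) = 1 \<and> fst x = r) \<longleftrightarrow> x = ?x0"
  proof
   assume l: "length (snd x) = 1 \<and> fst x = r"
   have "snd x \<in> decs (u - fst x) w" using x by auto
   with decs_single[OF w(2), of "snd x" "u - fst x"] l have "snd x = [(u - r, w)]" by simp
   with l show "x = ?x0" by (simp add: prod_eq_iff)
  qed simp
  have ext: "(if length ?v = 1 \<and> fst x = r then snd (snd (snd (hd ?v))) \<ominus>\<^bsub>susp B Dm\<^esub> fst (snd (hd ?v)) else (zr (susp B Dm))) = lev (susp B) Dm (?ext x)"
  proof (cases "x = ?x0")
   case True
   then have "r \<le> u" using x by auto
   from ends[OF this] show ?thesis using True by simp
  next
   case False
   then have "\<not> (length ?v = 1 \<and> fst x = r)" unfolding v(4) using one by blast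
   from if_not_P[OF this] show ?thesis using False by (simp only: if_False lev_0[OF SB])
  qed
  have "finsum (susp B Dm) (%s. sg (susp B Dm) (int (r * length ?v + fst x + length ?v) + bipair (rshift r) (wdeg (take s ?v)))
     (opl R B mB (fst x) (path_mid r ?v s))) {..<length ?v} = finsum (susp B Dm) (%s. sg (susp B Dm) (?k x s) (?M x s)) {..<length (snd x)}"
   unfolding v(4) by (rule abelian_monoid.finsum_cong'[OF module_abmon[OF N] refl])
    (rule funcsetI, rule sg_closed[OF N], rule marked(2)[OF x], simp, simp only: s lessThan_iff)
  also have "\<dots> = lev (susp B) Dm (?S x)" by (rule lev_sum_of[OF SB, symmetric]) (rule marked(2)[OF x], simp)
  finally show ?thesis unfolding path_op_props(2)[OF B mB v(1-3)] BE ext by (simp add: lev_add[OF SB])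
 qed
 have "fst (snd hblk) = finsum (susp B Dm) (%x. sg (susp B Dm) (block_sign u (snd x)) (lev (susp B) Dm (?S x + ?ext x))) SD"
  unfolding hblk_proj[OF lin N] by (rule abelian_monoid.finsum_cong'[OF module_abmon[OF N] refl])
   (rule funcsetI, rule sg_closed[OF N lev_closed[OF SB]], simp only: trm)
 also have "\<dots> = lev (susp B) Dm (\<Sum>x\<in>SD. fsg (block_sign u (snd x)) (?S x + ?ext x))" unfolding lev_sum[OF SB] lev_fsg[OF SB] ..
 also have "(\<Sum>x\<in>SD. fsg (block_sign u (snd x)) (?S x + ?ext x)) = mid_formal + (\<Sum>x\<in>SD. fsg (block_sign u (snd x)) (?ext x))"
  by (simp add: fsg_add sum.distrib mid_formal_def)
 \<comment> \<open>For a single block \<open>block_msign\<close> and \<open>block_ksign\<close>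
   vanish, so u alone is left of its sign.\<close>
 also have "(\<Sum>x\<in>SD. fsg (block_sign u (snd x)) (?ext x)) = fsg (int u) mid_ends"
 proof -
  have "(\<Sum>x\<in>SD. fsg (block_sign u (snd x)) (?ext x)) = (\<Sum>x\<in>SD. if x = ?x0 then fsg (block_sign u [(u - r, w)]) mid_ends else 0)"
   by (rule sum.cong) auto
  also have "\<dots> = (if ?x0 \<in> SD then fsg (block_sign u [(u - r, w)]) mid_ends else 0)" by (rule sum.delta) (simp add: finite_decs)
  also have "\<dots> = fsg (int u) mid_ends"
  proof (cases "r \<le> u")
   case True
   have "[(u - r, w)] \<in> decs (u - r) w" using decs_single[OF w(2), of "[(u - r, w)]" "u - r"] by simp
   moreover have "block_sign u [(u - r, w)] = int u" by (simp add: block_sign_def bipair_def)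
   ultimately show ?thesis using True by simp
  next
   case False
   then show ?thesis by (simp add: mid_ends_def)
  qed
  finally show ?thesis .
 qed
 finally show ?thesis .
qed

text \<open>Up to the common sign r + \<open>ssign w\<close>, the three parts of the defect are the
  insertion side of the middle equation, minus the regular part of its block side, and minus the
  part with z - x. The last one matches since u - r and u + r have the same parity.\<close>

lemma defect_null: "null (susp B) (letters (hdefect r (insert_fop (opl R (susp A) (susp_fam R A A mA)))
   (insert_fop (opl R (susp B) (susp_fam R B B mB))) (coalg_fop fx) (coalg_fop fz) (coder_fop r fx fy fz) u w)) \<longleftrightarrow>
  fst (snd hins) = fst (snd hblk)"
proof -
 let ?\<delta>A = "opl R (susp A) (susp_fam R A A mA)" and ?\<delta>B = "opl R (susp B) (susp_fam R B B mB)"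
 let ?hm = "%i j. bgcomp (end_zero r) (h i j)"
 note P = path_bg[OF B, of r]
 have SB: "bgmodule R (susp B)" by (rule susp_bg[OF B])
 have N: "module R (susp B Dm)" by (rule bgD[OF SB])
 have eh: "end_zero r \<in> bghom R (path r B) B (rshift r)" by (intro bghomI end_linear)
 have hm: "family R A B (rshift r) ?hm" unfolding family_def
 proof (intro allI impI)
  fix i j :: nat assume j: "1 \<le> j"
  let ?e = "(- int i, 1 - int i - int j)"
  have hh: "h i j \<in> bghom R (tpow R A j) (path r B) ?e" using familyD[OF hf j, of i] by simp
  show "?hm i j \<in> bghom R (tpow R A j) B (?e + rshift r)"
  proof (rule bghomI)
   show "bdeg (?hm i j) = ?e + rshift r" using bghomD(1)[OF hh] end_linear(6)[of r] by (simp add: bgcomp_def add.commute)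
   show "bgapp (?hm i j) d \<in> lmaps R (tpow R A j d) (B (d + (?e + rshift r)))" for d
    using lin_comp[OF bghomD(2)[OF hh] end_linear(3)] unfolding bgcomp_def bgmap.simps bghomD(1)[OF hh] by (simp add: add.assoc)
  qed
 qed
 have mid: "fst (snd hins) = bgapp (insertion_sum R A B (ew + rshift r) ?hm mA u (length w)) dw (tens R A (desusp w))"
 proof -
  have "bgapp (end_zero r) (dw + ew) hins = bgapp (insertion_sum R A B (ew + rshift r) ?hm mA u (length w)) dw (tens R A (desusp w))"
   by (rule insertion_sum_post[OF A P B mA hf eh _ w_words(2) refl desusp_tens_cl]) (simp add: bg_eq_def)
  then show ?thesis by (simp add: end_zero_def case_prod_beta)
 qed
 have od: "py p b = opl R A ?hm p (desusp b)" for p b by (simp add: opd_def opl_def bgcomp_def end_zero_def case_prod_beta)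
 have \<kappa>: "fy p b = sg (susp B (wdeg b - dsh p + rshift r)) (int r - 1 + int p + ssign b) (opl R A ?hm p (desusp b))"
  if "valid (susp A) b" "b ~= []" for p b
  unfolding path_letters(5)[OF that] od by (simp add: add.assoc)
 note ins = insertion_susp[where \<phi> = fy, OF A B mA hm w_words refl \<kappa>]
 let ?I = "frag_of [(Dm, fst (snd hins))]"
 have Ic: "fst (snd hins) \<in> carrier (susp B Dm)"
 proof -
  have d: "dw + (ew + rshift r) = Dm + (0, 1)" by (cases "wdeg w") (simp add: dsh_def rshift_def)
  have "bgapp (insertion_sum R A B (ew + rshift r) ?hm mA u (length w)) dw (tens R A (desusp w)) \<in> carrier (B (dw + (ew + rshift r)))"
   by (rule lin_closed[OF insertion_sum_linear[OF A B mA hm w_words(2) refl] desusp_tens_cl])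
  then show ?thesis unfolding mid d by (simp add: susp_def)
 qed
 define Pf where "Pf = (\<Sum>x\<in>SD. \<Sum>s<length (snd x).
  fsg (int (fst x) * (- 1) + (dec_sign (snd x) + bipair (rshift r) (wdeg (bword fx (take s (snd x))))))
   (frag_of [(Dm, ?\<delta>B (fst x) (mword r fx fy fz (snd x) s))]))"
 define Qf where "Qf = (\<Sum>x\<in>(SIGMA i:{..u}. insert_set (length w)).
  fsg (int (fst x) + bipair ((0, 1) - dsh (u - fst x)) (wdeg (take (fst (snd x)) w)))
   (frag_of [(Dm, fy (fst x) (iword ((0, 1) - dsh (u - fst x)) (?\<delta>A (u - fst x)) w (fst (snd x)) (snd (snd x))))]))"
 define Ef where "Ef = (if r \<le> u then frag_of [(Dm, fz (u - r) w)] - frag_of [(Dm, fx (u - r) w)] else 0)"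
 have lt: "letters (hdefect r (insert_fop ?\<delta>A) (insert_fop ?\<delta>B) (coalg_fop fx) (coalg_fop fz) (coder_fop r fx fy fz) u w) =
   fsg (int r) Pf + Qf - Ef"
 proof -
  have 1: "letters (opcomp (- 1) (insert_fop ?\<delta>B) (coder_fop r fx fy fz) u w) = Pf"
   unfolding Pf_def by (rule letters_opcomp_marked[OF w(2) refl])
  have 2: "letters (opcomp 1 (coder_fop r fx fy fz) (insert_fop ?\<delta>A) u w) = Qf"
   unfolding Qf_def by (rule letters_opcomp_insert[OF w(2) refl letters_coder_fop])
  show ?thesis unfolding hdefect_def letters_linear letters_fsg 1 2 letters_fshift_coalg[OF w(2)] Ef_def by (simp add: Dm_ends)
 qed
 have hom: "homog Dm (fsg (int r) Pf + Qf - Ef)" unfolding Pf_def Qf_def Ef_def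
  by (intro homog_diff homog_add homog_sum homog_fsg homog_of) (simp add: homog_diff homog_of homog_def[of _ 0])
 have lP: "lev (susp B) Dm (fsg (int r) Pf) = lev (susp B) Dm (fsg (1 + int r + ssign w) mid_formal)" unfolding Pf_def mid_formal_def fsg_sum
 proof (intro lev_sum_cong[OF SB])
  fix x s assume x: "x \<in> SD" and "s \<in> {..<length (snd x)}"
  then have s: "s < length (snd x)" by simp
  note m = marked[OF x s]
  have 1: "int r + (int (fst x) * (- 1) + (dec_sign (snd x) + bipair (rshift r) (wdeg (bword fx (take s (snd x)))))) =
    int r - int (fst x) + dec_sign (snd x) + bipair (rshift r) (wdeg (bword fx (take s (snd x))))" by simp
  show "lev (susp B) Dm (fsg (int r) (fsg (int (fst x) * (- 1) + (dec_sign (snd x) + bipair (rshift r) (wdeg (bword fx (take s (snd x))))))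
     (frag_of [(Dm, ?\<delta>B (fst x) (mword r fx fy fz (snd x) s))]))) =
   lev (susp B) Dm (fsg (1 + int r + ssign w) (fsg (block_sign u (snd x)) (fsg (int (r * length (snd x) + fst x + length (snd x))
     + bipair (rshift r) (wdeg (desusp (bword px (take s (snd x))))))
    (frag_of [(Dm, opl R B mB (fst x) (desusp (mword r px py pz (snd x) s)))]))))"
   unfolding fsg_fsg 1 lev_fsg[OF SB] lev_of[OF SB m(2)] lev_of[OF SB m(3)] m(1) by (simp only: add.assoc)
 qed
 have lQ: "lev (susp B) Dm Qf = lev (susp B) Dm (fsg (int r + ssign w) ?I)"
 proof -
  have "lev (susp B) Dm Qf = finsum (susp B Dm) (%x. sg (susp B Dm) (int (fst x) + bipair ((0, 1) - dsh (u - fst x)) (wdeg (take (fst (snd x)) w)))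
   (fy (fst x) (iword ((0, 1) - dsh (u - fst x)) (?\<delta>A (u - fst x)) w (fst (snd x)) (snd (snd x))))) (SIGMA i:{..u}. insert_set (length w))"
   unfolding Qf_def
  proof (rule lev_sum_of[OF SB])
   fix x assume x: "x \<in> (SIGMA i:{..u}. insert_set (length w))"
   show "fy (fst x) (iword ((0, 1) - dsh (u - fst x)) (?\<delta>A (u - fst x)) w (fst (snd x)) (snd (snd x))) \<in> carrier (susp B Dm)"
    by (rule ins(2)) (use x in simp_all)
  qed
  also have "\<dots> = finsum (susp B Dm) (%(i, s, q). sg (susp B Dm) (int i + bipair ((0, 1) - dsh (u - i)) (wdeg (take s w)))
   (fy i (iword ((0, 1) - dsh (u - i)) (?\<delta>A (u - i)) w s q))) (SIGMA i:{..u}. insert_set (length w))"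
   unfolding case_prod_unfold ..
  also have "\<dots> = sg (susp B Dm) (int r - 1 + 1 + ssign w) (bgapp (insertion_sum R A B (ew + rshift r) ?hm mA u (length w)) dw (tens R A (desusp w)))"
   by (rule ins(1))
  finally show ?thesis unfolding lev_fsg[OF SB] lev_of[OF SB Ic] unfolding mid by simp
 qed
 have lE: "lev (susp B) Dm Ef = lev (susp B) Dm (fsg (int r + ssign w + int u) mid_ends)"
 proof (cases "r \<le> u")
  case True
  note pl = path_letters[OF w, of "u - r", unfolded Dm_ends[OF True]]
  have par: "even (int (u - r) + ssign w - (int r + ssign w + int u))" using True by simp
  have fc: "fz (u - r) w \<in> carrier (susp B Dm)" "fx (u - r) w \<in> carrier (susp B Dm)" unfolding pl(4,6) by (intro sg_closed[OF N] pl)+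
  have "lev (susp B) Dm Ef = fz (u - r) w \<ominus>\<^bsub>susp B Dm\<^esub> fx (u - r) w"
   using True by (simp add: Ef_def lev_diff[OF SB] lev_of[OF SB fc(1)] lev_of[OF SB fc(2)])
  also have "\<dots> = lev (susp B) Dm (fsg (int (u - r) + ssign w) (frag_of [(Dm, pz (u - r) w)]) - fsg (int (u - r) + ssign w) (frag_of [(Dm, px (u - r) w)]))"
   unfolding pl(4,6) lev_diff[OF SB] lev_fsg[OF SB] lev_of[OF SB pl(1)] lev_of[OF SB pl(3)] ..
  also have "fsg (int (u - r) + ssign w) (frag_of [(Dm, pz (u - r) w)]) - fsg (int (u - r) + ssign w) (frag_of [(Dm, px (u - r) w)]) =
    fsg (int r + ssign w + int u) mid_ends"
   using True par by (auto simp: mid_ends_def fsg_def)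
  finally show ?thesis .
 next
  case False
  then show ?thesis by (simp add: Ef_def mid_ends_def)
 qed
 have "lev (susp B) Dm (fsg (int r) Pf + Qf - Ef) =
   lev (susp B) Dm (fsg (1 + int r + ssign w) mid_formal + fsg (int r + ssign w) ?I - fsg (int r + ssign w + int u) mid_ends)"
  unfolding lev_diff[OF SB] lev_add[OF SB] lP lQ lE ..
 also have "fsg (1 + int r + ssign w) mid_formal + fsg (int r + ssign w) ?I - fsg (int r + ssign w + int u) mid_ends =
   fsg (int r + ssign w) (?I - (mid_formal + fsg (int u) mid_ends))"
  by (auto simp: fsg_def)
 finally have total: "lev (susp B) Dm (fsg (int r) Pf + Qf - Ef) = sg (susp B Dm) (int r + ssign w) (lev (susp B) Dm (?I - (mid_formal + fsg (int u) mid_ends)))"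
  unfolding lev_fsg[OF SB] .
 have z: "sg (susp B Dm) k y = (zr (susp B Dm)) \<longleftrightarrow> y = (zr (susp B Dm))" if y: "y \<in> carrier (susp B Dm)" for k y
 proof
  assume "sg (susp B Dm) k y = (zr (susp B Dm))"
  then have "sg (susp B Dm) k (sg (susp B Dm) k y) = (zr (susp B Dm))" by (simp add: sg_zero[OF N])
  then show "y = (zr (susp B Dm))" unfolding sg_sg[OF N y] by (simp add: sg_def)
 qed (simp add: sg_zero[OF N])
 show ?thesis unfolding lt null_homog[OF SB hom] total z[OF lev_closed[OF SB]] lev_diff_eq_0[OF SB] lev_of[OF SB Ic] mid_block ..
qed

end

end

end

section \<open>Assembly of the equivalence\<close>

section \<open>Homotopies and coderivations\<close>

lemma erealizes_cong:
 assumes "erealizes R X Y e \<Phi> f" "!!p d b. b \<in> gens X d ==> f p b = f' p b"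
 shows "erealizes R X Y e \<Phi> f'"
 using assms unfolding erealizes_def realizes_def by simp

lemma erealizes_ehom:
 assumes "erealizes R X Y (u, v) \<Phi> f" shows "\<Phi> \<in> ehom R (bmod X) (bmod Y) u v"
 using realizesD(1)[OF erealizesD[OF assms]] by (simp add: ehom_def dsh_def)

lemma coalg_fop_cong:
 assumes "!!p b. valid V b ==> b ~= [] ==> \<phi> p b = \<phi>' p b" "valid V w"
 shows "coalg_fop \<phi> p w = coalg_fop \<phi>' p w"
 unfolding coalg_fop_def
proof (rule sum.cong[OF refl])
 fix D assume "D \<in> decs p w"
 then have d: "[] \<notin> set (map snd D)" "valid V (concat (map snd D))" using assms(2) by (auto simp: decs_def)
 have "bword \<phi> D = bword \<phi>' D" by (rule bword_cong[OF assms(1) d])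
 then show "fsg (dec_sign D) (frag_of (bword \<phi> D)) = fsg (dec_sign D) (frag_of (bword \<phi>' D))" by simp
qed

context bgmods
begin

lemma fdec_rdec: "w ~= [] ==> fdec w = rdec w + frag_of ([], w) + frag_of (w, [])"
proof -
 assume "w ~= []"
 then have "{..length w} = insert 0 (insert (length w) {1..<length w})" by (cases w) auto
 then show ?thesis using \<open>w ~= []\<close> by (simp add: fdec_def rdec_def add_ac)
qed

text \<open>Passage from all cuts to proper ones. The coalgebra morphisms fix the empty word and K
  kills it, so on ([], w) and (w, []) only K on w survives; these terms occur on both sides and
  cancel.\<close>

lemma coder_fop_rdec:
 assumes w: "w ~= []"
 shows "fext (%b. ften wdeg (rshift r) (coalg_fop \<phi>) (coder_fop r \<phi> \<kappa> \<gamma>) m b + ften wdeg 0 (coder_fop r \<phi> \<kappa> \<gamma>) (coalg_fop \<gamma>) m b) (rdec w)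
  = fext rdec (coder_fop r \<phi> \<kappa> \<gamma> m w)"
proof -
 let ?F = "coalg_fop \<phi>" and ?G = "coalg_fop \<gamma>" and ?K = "coder_fop r \<phi> \<kappa> \<gamma>"
 let ?T = "%b. ften wdeg (rshift r) ?F ?K m b + ften wdeg 0 ?K ?G m b"
 have l: "?T ([], w) = fext (%v. frag_of ([], v)) (?K m w)"
 proof -
  have "ften wdeg (rshift r) ?F ?K m ([], w) = (\<Sum>j\<le>m. if j = 0 then fpair (frag_of []) (?K m w) else 0)"
   unfolding ften_def prod.case by (intro sum.cong refl) (simp add: fid_def)
  moreover have "ften wdeg 0 ?K ?G m ([], w) = 0" by (simp add: ften_def)
  ultimately show ?thesis by (simp add: fpair_def)
 qed
 have r: "?T (w, []) = fext (%u. frag_of (u, [])) (?K m w)"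
 proof -
  have "ften wdeg 0 ?K ?G m (w, []) = (\<Sum>j\<le>m. if j = m then fpair (?K m w) (frag_of []) else 0)"
   unfolding ften_def prod.case by (intro sum.cong refl) (simp add: fid_def)
  moreover have "ften wdeg (rshift r) ?F ?K m (w, []) = 0" by (simp add: ften_def)
  ultimately show ?thesis by (simp add: fpair_def)
 qed
 have "fext fdec (?K m w) = fext (%v. rdec v + frag_of ([], v) + frag_of (v, [])) (?K m w)"
 proof (rule frag_extend_eq)
  fix v assume "v \<in> fkeys (?K m w)"
  then have "v ~= []" using fne_fops(2) w unfolding fne_def by blast
  then show "fdec v = rdec v + frag_of ([], v) + frag_of (v, [])" by (rule fdec_rdec)
 qed
 also have "\<dots> = fext rdec (?K m w) + fext (%v. frag_of ([], v)) (?K m w) + fext (%v. frag_of (v, [])) (?K m w)"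
  by (simp only: frag_extend_fun_add)
 finally have 1: "fext fdec (?K m w) = fext rdec (?K m w) + ?T ([], w) + ?T (w, [])" unfolding l r .
 have "fext ?T (fdec w) = fext ?T (rdec w) + ?T ([], w) + ?T (w, [])"
  unfolding fdec_rdec[OF w] by (simp only: frag_extend_add frag_extend_of)
 moreover have "fext fdec (?K m w) = fext ?T (fdec w)"
  using coder_fop_coder[of r \<phi> \<gamma> \<kappa>] unfolding coder_op_def dcompat_def by blast
 ultimately show ?thesis using 1 by simp
qed

text \<open>Evaluation in length 1 sees precisely the one-letter words, and in all other lengths
  they count as zero. This is the converse of the letter criterion.\<close>

lemma null_letters:
 assumes V: "bgmodule R V" and x: "null V x"
 shows "null V (letters x)"
 unfolding null_def
proof (intro allI)
 fix l d
 let ?t = "%w. if w \<in> words V l d then tens R V w else (zr (tpow R V l d))"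
 have e: "wev R V l d (letters x) = fev (tpow R V l d) (%b. fev (tpow R V l d) ?t (if length b = 1 then frag_of b else 0)) x"
  unfolding wev_def letters_def by (rule fev_frag_extend[OF wev_total[OF V]])
 have b: "fev (tpow R V l d) ?t (if length b = 1 then frag_of b else 0) = (if length b = 1 then ?t b else (zr (tpow R V l d)))" for b
  by (simp add: fev_of[OF wev_total[OF V]] fev_0[OF wev_total[OF V]])
 show "wev R V l d (letters x) = (zr (tpow R V l d))"
 proof (cases "l = 1")
  case True
  then have "(%b. if length b = 1 then ?t b else (zr (tpow R V l d))) = ?t" by (auto simp: words_iff fun_eq_iff)
  then have "wev R V l d (letters x) = wev R V l d x" unfolding e b by (simp only: wev_def)
  then show ?thesis using x by (simp add: null_def)
 next
  case False
  show ?thesis unfolding e b by (rule fev_eq_0[OF wev_total[OF V]]) (use False in \<open>auto simp: words_iff\<close>)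
 qed
qed

text \<open>x and y are homogeneous of bidegree D and contain no empty word, so the other lengths
  and bidegrees in \<open>null\<close> vanish by themselves.\<close>

lemma null_ev:
 assumes V: "bgmodule R V" and x: "fkeys x \<subseteq> gens (Tbased R V) D" and y: "fkeys y \<subseteq> gens (Tbased R V) D"
 shows "ev (Tbased R V) D x = ev (Tbased R V) D y \<longleftrightarrow> null V (x - y)"
proof -
 have z: "wev R V l d (x - y) = (zr (tpow R V l d))" if "\<not> (1 \<le> l \<and> d = D)" for l d
 proof (rule wev_eq_0[OF V])
  fix w assume w: "w \<in> fkeys (x - y)"
  have "w \<in> gens (Tbased R V) D" using subsetD[OF keys_diff w] x y by blast
  then have "w ~= []" "wdeg w = D" by (simp_all add: gens_Tbased)
  then show "w \<notin> words V l d" using that by (cases w) (auto simp: words_iff)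
 qed
 have "null V (x - y) \<longleftrightarrow> (\<forall>l\<ge>1. wev R V l D (x - y) = (zr (tpow R V l D)))"
 proof
  assume r: "\<forall>l\<ge>1. wev R V l D (x - y) = (zr (tpow R V l D))"
  show "null V (x - y)" unfolding null_def
  proof (intro allI)
   fix l d
   show "wev R V l d (x - y) = (zr (tpow R V l d))" using r z[of l d] by (cases "1 \<le> l \<and> d = D") simp_all
  qed
 qed (simp add: null_def)
 then show ?thesis unfolding ev_Tbased_eq[OF V] wev_diff_eq_0[OF V] by (rule sym)
qed

lemma susp_fam_hom:
 assumes A: "bgmodule R A" and B: "bgmodule R B" and f: "family R A B c f" and q: "1 \<le> q"
 shows "susp_fam R A B f p q \<in> bghom R (tpow R (susp A) q) (susp B) (c - dsh p)"
proof -
 have "f p q \<in> bghom R (tpow R A q) B (fst c - int p, snd c + 1 - int p - int q)"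
  using familyD[OF f q, of p] by (cases c) (simp add: algebra_simps)
 from Psi_props(1)[OF A B this] show ?thesis by (cases c) (simp add: susp_fam_def dsh_def)
qed

lemma coalg_map_realizes:
 assumes A: "bgmodule R A" and B: "bgmodule R B" and f: "family R A B 0 f"
 shows "erealizes R (Tbased R (susp A)) (Tbased R (susp B)) 0 (coalg_map R A B f) (coalg_fop (opl R (susp A) (susp_fam R A B f)))"
 unfolding erealizes_def
proof
 fix p
 have g: "susp_fam R A B f p q \<in> bghom R (tpow R (susp A) q) (susp B) (- dsh p)" if "1 \<le> q" for p q
  using susp_fam_hom[OF A B f that, of p] by simp
 have "realizes R (Tbased R (susp A)) (Tbased R (susp B)) (- dsh p) (coalg_map R A B f p) (coalg_fop (opl R (susp A) (susp_fam R A B f)) p)"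
  using coalg_realizes[where g = "susp_fam R A B f" and p = p, OF susp_bg[OF A] susp_bg[OF B] g] unfolding coalg_map_def susp_fam_def .
 then show "realizes R (Tbased R (susp A)) (Tbased R (susp B)) (0 - dsh p) (coalg_map R A B f p) (coalg_fop (opl R (susp A) (susp_fam R A B f)) p)"
  by simp
qed

lemma codiff_realizes:
 assumes A: "bgmodule R A" and m: "family R A A (0, 1) m"
 shows "erealizes R (Tbased R (susp A)) (Tbased R (susp A)) (0, 1) (codiff R A m) (insert_fop (opl R (susp A) (susp_fam R A A m)))"
 unfolding erealizes_def
proof
 fix i
 show "realizes R (Tbased R (susp A)) (Tbased R (susp A)) ((0, 1) - dsh i) (codiff R A m i) (insert_fop (opl R (susp A) (susp_fam R A A m)) i)"
  using insert_realizes[where g = "susp_fam R A A m" and i = i, OF susp_bg[OF A] susp_fam_hom[OF A A m]] unfolding codiff_def susp_fam_def .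
qed

lemma path_pi_realizes:
 assumes B: "bgmodule R B"
 shows "erealizes R (Tbased R (susp (path r B))) (Tbased R (susp B)) (rshift r) (path_pi R r B) (fstrict (pi_fop r (susp B)))"
 using erealizes_strict[OF Tbased_is_based[OF susp_bg[OF B]] pi_realizes[OF B, of r]] unfolding path_pi_def Let_def by (simp add: Tbased_def)

lemma coder_realizes:
 assumes A: "bgmodule R A" and B: "bgmodule R B" and h: "family R A (path r B) 0 h"
 shows "erealizes R (Tbased R (susp A)) (Tbased R (susp B)) (rshift r) (ecomp (Tbar R (susp B)) (path_pi R r B) (coalg_map R A (path r B) h))
  (coder_fop r (%p b. fst (opl R (susp A) (susp_fam R A (path r B) h) p b))
   (%p b. sg (susp B (wdeg b - dsh p + rshift r)) (int r - 1) (fst (snd (opl R (susp A) (susp_fam R A (path r B) h) p b))))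
   (%p b. snd (snd (opl R (susp A) (susp_fam R A (path r B) h) p b))))"
proof -
 note P = path_bg[OF B, of r]
 note b = Tbased_is_based[OF susp_bg[OF A]] Tbased_is_based[OF susp_bg[OF P]] Tbased_is_based[OF susp_bg[OF B]]
 have "erealizes R (Tbased R (susp A)) (Tbased R (susp B)) (rshift r + 0)
   (ecomp (bmod (Tbased R (susp B))) (path_pi R r B) (coalg_map R A (path r B) h))
   (opcomp (tdeg 0) (fstrict (pi_fop r (susp B))) (coalg_fop (opl R (susp A) (susp_fam R A (path r B) h))))"
  by (rule erealizes_comp[OF b path_pi_realizes[OF B] coalg_map_realizes[OF A P h]])
 moreover have "opcomp (tdeg 0) (fstrict (pi_fop r (susp B))) (coalg_fop (opl R (susp A) (susp_fam R A (path r B) h))) =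
  coder_fop r (%p b. fst (opl R (susp A) (susp_fam R A (path r B) h) p b))
   (%p b. sg (susp B (wdeg b - dsh p + rshift r)) (int r - 1) (fst (snd (opl R (susp A) (susp_fam R A (path r B) h) p b))))
   (%p b. snd (snd (opl R (susp A) (susp_fam R A (path r B) h) p b)))"
  by (rule ext, rule ext) (unfold opcomp_fstrict_left pi_coalg_fop, rule refl)
 ultimately show ?thesis by (simp add: Tbased_def)
qed

text \<open>The formal operators on both sides coincide on every nonempty word, so no evaluation has
  to be compared.\<close>

lemma coder_coderivation:
 assumes V: "bgmodule R V" and W: "bgmodule R W"
  and X: "erealizes R (Tbased R V) (Tbased R W) 0 X (coalg_fop \<phi>)" and Y: "erealizes R (Tbased R V) (Tbased R W) 0 Y (coalg_fop \<gamma>)"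
  and K: "erealizes R (Tbased R V) (Tbased R W) (rshift r) K (coder_fop r \<phi> \<kappa> \<gamma>)"
 shows "coderivation R V W X Y (int r) (int r - 1) K"
proof -
 let ?TV = "Tbased R V" and ?TW = "Tbased R W"
 let ?F = "coalg_fop \<phi>" and ?G = "coalg_fop \<gamma>" and ?K = "coder_fop r \<phi> \<kappa> \<gamma>"
 note b = Tbased_is_based[OF V] Tbased_is_based[OF W]
 note pb = pbased_is_based[OF b(1)] pbased_is_based[OF b(2)]
 have bm: "bmod (Tbased R V) = Tbar R V" "bmod (Tbased R W) = Tbar R W" "bgdeg ?TV = wdeg" by (simp_all add: Tbased_def)
 have XK: "erealizes R (pbased R ?TV) (pbased R ?TW) (rshift r) (etens R (Tbar R V) (Tbar R W) X K) (ften wdeg (rshift r) ?F ?K)"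
  using erealizes_tens[OF b X K] unfolding bm by simp
 have KY: "erealizes R (pbased R ?TV) (pbased R ?TW) (rshift r) (etens R (Tbar R V) (Tbar R W) K Y) (ften wdeg 0 ?K ?G)"
  using erealizes_tens[OF b K Y] unfolding bm by simp
 have dV: "erealizes R ?TV (pbased R ?TV) 0 (strict (tpow R (Tbar R V) 2) (deconc R V)) (fstrict rdec)"
  using erealizes_strict[OF pb(1) deconc_realizes[OF V]] by (simp add: bm)
 have dW: "erealizes R ?TW (pbased R ?TW) 0 (strict (tpow R (Tbar R W) 2) (deconc R W)) (fstrict rdec)"
  using erealizes_strict[OF pb(2) deconc_realizes[OF W]] by (simp add: bm)
 let ?L = "ecomp (tpow R (Tbar R W) 2) (eadd (tpow R (Tbar R W) 2) (etens R (Tbar R V) (Tbar R W) X K) (etens R (Tbar R V) (Tbar R W) K Y))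
   (strict (tpow R (Tbar R V) 2) (deconc R V))"
 let ?S = "ecomp (tpow R (Tbar R W) 2) (strict (tpow R (Tbar R W) 2) (deconc R W)) K"
 have L: "erealizes R ?TV (pbased R ?TW) (rshift r) ?L (opcomp 0 (%m b. ften wdeg (rshift r) ?F ?K m b + ften wdeg 0 ?K ?G m b) (fstrict rdec))"
  using erealizes_comp[OF b(1) pb erealizes_add[OF pb XK KY] dV] by (simp add: bm)
 have S: "erealizes R ?TV (pbased R ?TW) (rshift r) ?S (opcomp (- 1) (fstrict rdec) ?K)"
  using erealizes_comp[OF b(1) b(2) pb(2) dW K] by (simp add: bm)
 have "eq_seq (Tbar R V) ?L ?S"
 proof -
  have "opcomp 0 (%m b. ften wdeg (rshift r) ?F ?K m b + ften wdeg 0 ?K ?G m b) (fstrict rdec) m w = opcomp (- 1) (fstrict rdec) ?K m w"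
   if "w \<in> gens ?TV d" for m d w
  proof -
   have "w ~= []" using that by (simp add: gens_Tbased)
   then show ?thesis unfolding opcomp_fstrict_right opcomp_fstrict_left by (rule coder_fop_rdec)
  qed
  then show ?thesis using erealizes_eq[OF b(1) pb(2) L S] unfolding bm by simp
 qed
 moreover have "K \<in> ehom R (Tbar R V) (Tbar R W) (int r) (int r - 1)" using erealizes_ehom[OF K[unfolded rshift_def]] by (simp add: bm)
 ultimately show ?thesis unfolding coderivation_def Let_def by blast
qed

lemma defect_realizes:
 assumes V: "bgmodule R V" and W: "bgmodule R W"
  and dV: "erealizes R (Tbased R V) (Tbased R V) (0, 1) dV fV" and dW: "erealizes R (Tbased R W) (Tbased R W) (0, 1) dW fW"
  and X: "erealizes R (Tbased R V) (Tbased R W) 0 X F" and Y: "erealizes R (Tbased R V) (Tbased R W) 0 Y G"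
  and K: "erealizes R (Tbased R V) (Tbased R W) (rshift r) K k"
 shows "eq_seq (Tbar R V) (eadd (Tbar R W) (esgn (Tbar R W) (int r) (ecomp (Tbar R W) dW K)) (ecomp (Tbar R W) K dV))
   (eshift (Tbar R W) r (eadd (Tbar R W) Y (esgn (Tbar R W) 1 X))) \<longleftrightarrow>
  (\<forall>m w. valid V w --> w ~= [] --> null W (hdefect r fV fW F G k m w))"
proof -
 let ?TV = "Tbased R V" and ?TW = "Tbased R W"
 note b = Tbased_is_based[OF V] Tbased_is_based[OF W]
 have bm: "bmod ?TV = Tbar R V" "bmod ?TW = Tbar R W" by (simp_all add: Tbased_def)
 let ?l = "%m w. fsg (int r) (opcomp (- 1) fW k m w) + opcomp 1 k fV m w"
 let ?s = "fshift r (%m w. G m w + fsg 1 (F m w))"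
 have 1: "erealizes R ?TV ?TW (dsh r) (ecomp (Tbar R W) dW K) (opcomp (- 1) fW k)"
  using erealizes_comp[OF b(1) b(2) b(2) dW K] unfolding bm rshift_add by simp
 have 2: "erealizes R ?TV ?TW (dsh r) (ecomp (Tbar R W) K dV) (opcomp 1 k fV)"
  using erealizes_comp[OF b(1) b(1) b(2) K dV] unfolding bm rshift_add by simp
 note L = erealizes_add[OF b erealizes_sgn[OF b 1, where k = "int r"] 2, unfolded bm]
 have S: "erealizes R ?TV ?TW (dsh r) (eshift (Tbar R W) r (eadd (Tbar R W) Y (esgn (Tbar R W) 1 X))) ?s"
  using erealizes_shift[OF b(2) erealizes_add[OF b Y erealizes_sgn[OF b X, where k = 1]], where r = r] unfolding bm by simp
 have hd: "?l m w - ?s m w = hdefect r fV fW F G k m w" for m w by (simp add: hdefect_def fshift_def fsg_def)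
 have eqv: "ev ?TW (d + (dsh r - dsh m)) (?l m w) = ev ?TW (d + (dsh r - dsh m)) (?s m w) \<longleftrightarrow> null W (hdefect r fV fW F G k m w)"
  if w: "w \<in> gens ?TV d" for m d w
  unfolding hd[symmetric] by (rule null_ev[OF W realizesD(2)[OF erealizesD[OF L] w] realizesD(2)[OF erealizesD[OF S] w]])
 let ?Q = "%m w. null W (hdefect r fV fW F G k m w)"
 have "eq_seq (Tbar R V) (eadd (Tbar R W) (esgn (Tbar R W) (int r) (ecomp (Tbar R W) dW K)) (ecomp (Tbar R W) K dV))
   (eshift (Tbar R W) r (eadd (Tbar R W) Y (esgn (Tbar R W) 1 X))) \<longleftrightarrow> (\<forall>m d. \<forall>w\<in>gens ?TV d. ?Q m w)"
  unfolding erealizes_eq[OF b L S, unfolded bm] by (simp only: eqv cong: ball_cong)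
 also have "\<dots> \<longleftrightarrow> (\<forall>m w. valid V w --> w ~= [] --> ?Q m w)"
 proof
  assume q: "\<forall>m d. \<forall>w\<in>gens ?TV d. ?Q m w"
  show "\<forall>m w. valid V w --> w ~= [] --> ?Q m w"
  proof (intro allI impI)
   fix m w assume "valid V w" "w ~= []"
   then have "w \<in> gens ?TV (wdeg w)" by (simp add: gens_Tbased)
   then show "?Q m w" by (rule bspec[OF spec[OF spec[OF q, of m], of "wdeg w"]])
  qed
 qed (simp add: gens_Tbased)
 finally show ?thesis .
qed

end

lemma family_iff: "family R A B 0 f \<longleftrightarrow> map_family R A B f" by (simp add: family_def map_family_def)

lemma family_op_iff: "family R A A (0, 1) m \<longleftrightarrow> (\<forall>i j. 1 \<le> j --> m i j \<in> bghom R (tpow R A j) A (- int i, 2 - int i - int j))"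
proof -
 have e: "(- int i, 1 - int i - int j) + (0, 1) = (- int i, 2 - int i - int j)" for i j by simp
 show ?thesis unfolding family_def e ..
qed

text \<open>In \<open>coderivation\<close> F is the left and G the right factor:
  \<open>path_pi\<close> has \<open>end_minus\<close> in front of the marked letter and
  \<open>end_plus\<close> behind it, and these ends of h are f and g. The informal statement writes
  the two in the opposite order.\<close>

theorem theorem5p31:
  fixes R :: "'r ring" and r :: nat
    and A :: "('r, 'a) bgmod" and mA :: "('r, 'a, 'a) opfam"
    and B :: "('r, 'b) bgmod" and mB :: "('r, 'b, 'b) opfam"
    and f g :: "('r, 'a, 'b) opfam"
    and h :: "('r, 'a, 'b \<times> 'b \<times> 'b) opfam"
    and F G K :: "(('r, 'a) tcoalg, ('r, 'b) tcoalg) eseq"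
    and H :: "(('r, 'a) tcoalg, ('r, 'b \<times> 'b \<times> 'b) tcoalg) eseq"
    and dA :: "(('r, 'a) tcoalg, ('r, 'a) tcoalg) eseq"
    and dB :: "(('r, 'b) tcoalg, ('r, 'b) tcoalg) eseq"
  assumes "cring R"
    and "derived_Ainf R A mA" and "derived_Ainf R B mB"
    and "dAinf_morphism R A mA B mB f" and "dAinf_morphism R A mA B mB g"
    and "map_family R A (path r B) h" and "has_endpoints R A f g h"
    and "dA = codiff R A mA" and "dB = codiff R B mB"
    and "F = coalg_map R A B f" and "G = coalg_map R A B g"
    and "H = coalg_map R A (path r B) h"
    and "K = ecomp (Tbar R (susp B)) (path_pi R r B) H"
  shows "r_homotopy R r A mA B mB f g h \<longleftrightarrow>
    coderivation R (susp A) (susp B) F G (int r) (int r - 1) K \<and>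
    eq_seq (Tbar R (susp A))
      (eadd (Tbar R (susp B))
        (esgn (Tbar R (susp B)) (int r) (ecomp (Tbar R (susp B)) dB K))
        (ecomp (Tbar R (susp B)) K dA))
      (eshift (Tbar R (susp B)) r
        (eadd (Tbar R (susp B)) G (esgn (Tbar R (susp B)) 1 F)))"
proof -
 interpret bgmods R by (rule bgmods.intro) fact
 have A: "bgmodule R A" and B: "bgmodule R B" using assms(2,3) by (simp_all add: derived_Ainf_def)
 have mA: "family R A A (0, 1) mA" and mB: "family R B B (0, 1) mB" using assms(2,3) unfolding derived_Ainf_def family_op_iff by blast+
 have ff: "family R A B 0 f" and gf: "family R A B 0 g" and hf: "family R A (path r B) 0 h"
  using assms(4-6) by (simp_all add: family_iff dAinf_morphism_def)
 note P = path_bg[OF B, of r] and SA = susp_bg[OF A] and SB = susp_bg[OF B]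
 define \<delta>A where "\<delta>A = opl R (susp A) (susp_fam R A A mA)"
 define \<delta>B where "\<delta>B = opl R (susp B) (susp_fam R B B mB)"
 define \<phi> where "\<phi> = (%p b. fst (opl R (susp A) (susp_fam R A (path r B) h) p b))"
 define \<kappa> where "\<kappa> = (%p b. sg (susp B (wdeg b - dsh p + rshift r)) (int r - 1) (fst (snd (opl R (susp A) (susp_fam R A (path r B) h) p b))))"
 define \<gamma> where "\<gamma> = (%p b. snd (snd (opl R (susp A) (susp_fam R A (path r B) h) p b)))"
 have em: "bg_eq (tpow R A j) (bgcomp end_minus (h i j)) (f i j)" and ep: "bg_eq (tpow R A j) (bgcomp end_plus (h i j)) (g i j)"
  if "1 \<le> j" for i j
  using assms(7) that by (simp_all add: has_endpoints_def)
 have ends: "fst (opd R A h p b) = opd R A f p b" "snd (snd (opd R A h p b)) = opd R A g p b" if b: "valid (susp A) b" "b ~= []" for p b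
 proof -
  have l: "1 \<le> length b" using b by (cases b) auto
  have "tens R A (desusp b) \<in> carrier (tpow R A (length b) (wdeg (desusp b)))"
   using b by (intro tens_cl[OF A]) (simp add: words_iff valid_desusp)
  then have "bgapp (bgcomp end_minus (h p (length b))) (wdeg (desusp b)) (tens R A (desusp b)) = bgapp (f p (length b)) (wdeg (desusp b)) (tens R A (desusp b))"
   "bgapp (bgcomp end_plus (h p (length b))) (wdeg (desusp b)) (tens R A (desusp b)) = bgapp (g p (length b)) (wdeg (desusp b)) (tens R A (desusp b))"
   using em[OF l, of p] ep[OF l, of p] unfolding bg_eq_def by blast+
  then show "fst (opd R A h p b) = opd R A f p b" "snd (snd (opd R A h p b)) = opd R A g p b"
   by (simp_all add: opd_def opl_def bgcomp_def end_minus_def end_plus_def case_prod_beta)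
 qed
 have \<phi>f: "\<phi> p b = sg (susp B (wdeg b - dsh p)) (int p + ssign b) (opd R A f p b)"
  and \<gamma>g: "\<gamma> p b = sg (susp B (wdeg b - dsh p)) (int p + ssign b) (opd R A g p b)"
  if b: "valid (susp A) b" "b ~= []" for p b
  using path_letters(4,6)[OF A B mA mB hf b, of p] unfolding \<phi>_def \<gamma>_def ends[OF b] by simp_all
 \<comment> \<open>On valid blocks the letters of f are the first components of the letters of h;
   using the latter expresses F, G and K through the same letter functions.\<close>
 have F: "erealizes R (Tbased R (susp A)) (Tbased R (susp B)) 0 F (coalg_fop \<phi>)" unfolding assms(10)
 proof (rule erealizes_cong[OF coalg_map_realizes[OF A B ff]])
  fix p d w assume "w \<in> gens (Tbased R (susp A)) d"
  then show "coalg_fop (opl R (susp A) (susp_fam R A B f)) p w = coalg_fop \<phi> p w"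
   by (intro coalg_fop_cong[where V = "susp A"]) (simp_all add: gens_Tbased \<phi>f opd_zero(2)[OF A B ff])
 qed
 have G: "erealizes R (Tbased R (susp A)) (Tbased R (susp B)) 0 G (coalg_fop \<gamma>)" unfolding assms(11)
 proof (rule erealizes_cong[OF coalg_map_realizes[OF A B gf]])
  fix p d w assume "w \<in> gens (Tbased R (susp A)) d"
  then show "coalg_fop (opl R (susp A) (susp_fam R A B g)) p w = coalg_fop \<gamma> p w"
   by (intro coalg_fop_cong[where V = "susp A"]) (simp_all add: gens_Tbased \<gamma>g opd_zero(2)[OF A B gf])
 qed
 have K: "erealizes R (Tbased R (susp A)) (Tbased R (susp B)) (rshift r) K (coder_fop r \<phi> \<kappa> \<gamma>)"
  unfolding assms(12,13) \<phi>_def \<kappa>_def \<gamma>_def by (rule coder_realizes[OF A B hf])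
 have dA: "erealizes R (Tbased R (susp A)) (Tbased R (susp A)) (0, 1) dA (insert_fop \<delta>A)"
  unfolding assms(8) \<delta>A_def by (rule codiff_realizes[OF A mA])
 have dB: "erealizes R (Tbased R (susp B)) (Tbased R (susp B)) (0, 1) dB (insert_fop \<delta>B)"
  unfolding assms(9) \<delta>B_def by (rule codiff_realizes[OF B mB])
 let ?hd = "hdefect r (insert_fop \<delta>A) (insert_fop \<delta>B) (coalg_fop \<phi>) (coalg_fop \<gamma>) (coder_fop r \<phi> \<kappa> \<gamma>)"
 note fm = assms(4)[unfolded morphism_iff[OF A B mA mB ff], rule_format] and gm = assms(5)[unfolded morphism_iff[OF A B mA mB gf], rule_format]
 have cF: "null (susp B) (letters (commut (insert_fop \<delta>A) (insert_fop \<delta>B) (coalg_fop \<phi>) m w))"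
  if "valid (susp A) w" "w ~= []" for m w
  unfolding \<delta>A_def \<delta>B_def by (rule iffD2[OF commut_null[where f = f, OF A B mA mB ff that \<phi>f] fm[OF that]])
 have cG: "null (susp B) (letters (commut (insert_fop \<delta>A) (insert_fop \<delta>B) (coalg_fop \<gamma>) m w))"
  if "valid (susp A) w" "w ~= []" for m w
  unfolding \<delta>A_def \<delta>B_def by (rule iffD2[OF commut_null[where f = g, OF A B mA mB gf that \<gamma>g] gm[OF that]])
 \<comment> \<open>Both outer components agree because f and g are morphisms, so equality of the
   triples is equality of their middle components.\<close>
 have step: "bgapp (insertion_sum R A (path r B) (- int u, 2 - int u - int (length w)) h mA u (length w)) (wdeg w + (0, int (length w))) (tens R A (desusp w)) =
   bgapp (block_sum R A (path r B) (- int u, 2 - int u - int (length w)) (path_op R r B mB) h u (length w)) (wdeg w + (0, int (length w))) (tens R A (desusp w))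
   \<longleftrightarrow> null (susp B) (letters (?hd u w))" (is "?hi = ?hb \<longleftrightarrow> _")
  if w: "valid (susp A) w" "w ~= []" for u w
 proof -
  let ?d = "wdeg w + (0, int (length w))" and ?e = "(- int u, 2 - int u - int (length w))"
  have em0: "end_minus \<in> bghom R (path r B) B 0" and ep0: "end_plus \<in> bghom R (path r B) B 0" by (rule bghomI, simp_all add: end_linear)+
  note tc = desusp_tens_cl[OF A B mA mB hf w] and lw = w_words(2)[OF A B mA mB hf w]
  have "bgapp end_minus (?d + ?e) ?hi = bgapp (insertion_sum R A B (?e + 0) f mA u (length w)) ?d (tens R A (desusp w))"
   by (rule insertion_sum_post[OF A P B mA hf em0 em lw refl tc])
  then have i1: "fst ?hi = bgapp (insertion_sum R A B ?e f mA u (length w)) ?d (tens R A (desusp w))" by (simp add: end_minus_def case_prod_beta)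
  have "bgapp end_plus (?d + ?e) ?hi = bgapp (insertion_sum R A B (?e + 0) g mA u (length w)) ?d (tens R A (desusp w))"
   by (rule insertion_sum_post[OF A P B mA hf ep0 ep lw refl tc])
  then have i2: "snd (snd ?hi) = bgapp (insertion_sum R A B ?e g mA u (length w)) ?d (tens R A (desusp w))"
   by (simp add: end_plus_def case_prod_beta)
  have b1: "fst ?hb = bgapp (block_sum R A B ?e mB f u (length w)) ?d (tens R A (desusp w))"
   by (rule endpoint_block[OF A B mA mB hf w ff disjI1[OF refl] ends(1)])
  have b2: "snd (snd ?hb) = bgapp (block_sum R A B ?e mB g u (length w)) ?d (tens R A (desusp w))"
   by (rule endpoint_block[where \<pi> = "%x. snd (snd x)", OF A B mA mB hf w gf disjI2[OF refl] ends(2)])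
  have "?hi = ?hb \<longleftrightarrow> fst (snd ?hi) = fst (snd ?hb)" unfolding prod_eq_iff i1 i2 b1 b2 fm[OF w, of u] gm[OF w, of u] by blast
  also have "\<dots> \<longleftrightarrow> null (susp B) (letters (?hd u w))"
   unfolding \<delta>A_def \<delta>B_def \<phi>_def \<kappa>_def \<gamma>_def by (rule defect_null[OF A B mA mB hf w, symmetric])
  finally show ?thesis .
 qed
 have "r_homotopy R r A mA B mB f g h \<longleftrightarrow> dAinf_morphism R A mA (path r B) (path_op R r B mB) h"
  using assms(7) by (simp add: r_homotopy_def)
 also have "\<dots> \<longleftrightarrow> (\<forall>u w. valid (susp A) w --> w ~= [] --> null (susp B) (letters (?hd u w)))"
  unfolding morphism_iff[OF A P mA path_op_props(1)[OF B mB] hf] by (intro iff_allI imp_cong refl step)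
 also have "\<dots> \<longleftrightarrow> (\<forall>u w. valid (susp A) w --> w ~= [] --> null (susp B) (?hd u w))"
 proof
  assume L: "\<forall>u w. valid (susp A) w --> w ~= [] --> null (susp B) (letters (?hd u w))"
  \<comment> \<open>The set of words is closed under prefixes and suffixes, as the induction
    requires, and so contains the empty word, on which the defect is zero.\<close>
  have "null (susp B) (?hd m w)" if "w \<in> {w. valid (susp A) w}" for m w
   by (rule hdefect_null[where S = "{w. valid (susp A) w}" and dgA = wdeg and dgB = wdeg, OF null_ideal[OF SB] _
     insert_fop_coder insert_fop_coder insert_fop_hom coalg_fop_coalg coalg_fop_hom coalg_fop_coalg coalg_fop_hom
     coder_fop_coder coder_fop_hom fne_fops(3) fne_fops(3) fne_fops(1) fne_fops(1) fne_fops(2) _ _ _ _ _ _ _ _ that])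
    (use cF cG L in simp_all)
  then show "\<forall>u w. valid (susp A) w --> w ~= [] --> null (susp B) (?hd u w)" by simp
 next
  assume "\<forall>u w. valid (susp A) w --> w ~= [] --> null (susp B) (?hd u w)"
  then show "\<forall>u w. valid (susp A) w --> w ~= [] --> null (susp B) (letters (?hd u w))" using null_letters[OF SB] by blast
 qed
 also have "\<dots> \<longleftrightarrow> eq_seq (Tbar R (susp A))
   (eadd (Tbar R (susp B)) (esgn (Tbar R (susp B)) (int r) (ecomp (Tbar R (susp B)) dB K)) (ecomp (Tbar R (susp B)) K dA))
   (eshift (Tbar R (susp B)) r (eadd (Tbar R (susp B)) G (esgn (Tbar R (susp B)) 1 F)))"
  by (rule defect_realizes[OF SA SB dA dB F G K, symmetric])
 finally show ?thesis using coder_coderivation[OF SA SB F G K] by blast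
qed

end
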